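(* Let $r,q\in\mathbb{N}$ with $r\ge2$ and $q\geq 2$, let $Y_1,\dots,Y_r$ be the GIT quotients defined in the context, and let $Y_0=\{pt\}$. Then for $1\leq k\leq r$ there are morphisms $\phi_{k}:Y_{k}\longrightarrow Y_{k-1}$ such that $$Y_{r}\xrightarrow{\phi_{r}}Y_{r-1}\xrightarrow{\phi_{r-1}}\cdots \to Y_{2}\xrightarrow{\phi_{2}}Y_{1}\xrightarrow{\phi_{1}}Y_{0}=\{pt\}$$ is a generalized Bott tower with $r$ stages.
   Context: All varieties are over $\mathbb{C}$. For $k\ge 1$ put $n_k=kq+1$ and $G_k=PSL(n_k,\mathbb{C})$. Let $T_k\subset B_k\subset G_k$ be a maximal torus and a Borel subgroup (say, images of the diagonal and of the upper triangular matrices), with simple roots $\alpha_{1(k)},\dots,\alpha_{n_k-1(k)}$, simple reflections $s_{\alpha_{i(k)}}$, fundamental weights $\omega_{i(k)}$, and one-parameter subgroups $\lambda_{i(k)}$ of $T_k$ dual to the simple roots, i.e. $\langle\alpha_{i(k)},\lambda_{j(k)}\rangle=\delta_{i,j}$ (so $\lambda_{j(k)}(t)$ is the class of $\mathrm{diag}(t,\dots,t,1,\dots,1)$ with $j$ entries $t$). Let $Q_k$ be the standard maximal parabolic subgroup of $G_k$ corresponding to $\alpha_{k(k)}$, so $G_k/Q_k$ is the Grassmannian $G_{k,n_k}$. $\mathcal{L}(n_k\omega_{k(k)})$ is the line bundle on $G_{k,n_k}$ associated to the character $n_k\omega_{k(k)}$ of $T_k$, i.e. the restriction of $\mathcal{O}(n_k)$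 for the Plücker embedding with its natural $G_k$-linearization. $X(w)=\overline{B_kwQ_k/Q_k}$ denotes a Schubert variety. Set $$w_{k,n_k}=(s_{\alpha_{q(k)}}\cdots s_{\alpha_{1(k)}})(s_{\alpha_{2q(k)}}\cdots s_{\alpha_{2(k)}})\cdots(s_{\alpha_{kq(k)}}\cdots s_{\alpha_{k(k)}}),$$ in one-line notation $(q+1,2q+1,\dots,kq+1)$; $X(w_{k,n_k})$ is the unique minimal dimensional Schubert variety in $G_{k,n_k}$ admitting semistable points for the $T_k$-linearized bundle $\mathcal{L}(n_k\omega_{k(k)})$. Let $T_{J_k}\subseteq T_k$ be the subtorus generated by $\lambda_{jq(k)}(\mathbb{G}_m)$, $1\le j\le k$. For a reductive group $H$ acting on a projective variety $X$ with $H$-linearized ample line bundle $\mathcal{L}$, $X^{ss}_H(\mathcal{L})$ is the set of $x\in X$ for which some $s\in H^0(X,\mathcal{L}^{\otimes m})^H$, $m\geq 1$, satisfies $s(x)\ne0$. The GIT quotient is the quotient of $X^{ss}_H(\mathcal{L})$ by $H$. $Y_k:=T_{J_k}\backslash\backslash X(w_{k,n_k})^{ss}_{T_{J_k}}(\mathcal{L}(n_k\omega_{k(k)}))$ for $1\le k\le r$. A generalized Bott tower with $m$ stages is a sequence $X_m\xrightarrow{\pi_m}X_{m-1}\to\cdots\xrightarrow{\pi_1}X_0=\{pt\}$ such that for every $1\le i\le m$ there is $n_i\in\mathbb{N}$ and line bundles $\mathcal{L}_{i,0},\dots,\mathcal{L}_{i,n_i}$ on $X_{i-1}$, with $\mathcal{L}_{i,0}$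 trivial, such that $\pi_i:X_i\to X_{i-1}$ is isomorphic over $X_{i-1}$ to the projective space bundle $\mathbb{P}(\mathcal{L}_{i,0}\oplus\mathcal{L}_{i,1}\oplus\cdots\oplus\mathcal{L}_{i,n_i})$. Here $\mathbb{P}(\mathcal{E})$, for a vector bundle $\mathcal{E}$ with transition functions $g_{ij}:U_i\cap U_j\to GL(m,\mathbb{C})$, is obtained by gluing the $U_i\times\mathbb{P}^{m-1}$ via $(x,[v])\mapsto(x,[g_{ij}(x)v])$. *)

theory Defs
  imports
    "HOL-Analysis.Abstract_Topology"
    "HOL-Analysis.Sum_Topology"
    "HOL-Algebra.Generated_Groups"
    "Jordan_Normal_Form.Determinant"
    "Jordan_Normal_Form.DL_Submatrix"
begin

section \<open>Varieties as spaces with functions\<close>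

text \<open>A variety over the complex numbers is represented by its set of closed points with the
  Zariski topology and its sheaf of regular functions: \<open>regf X U\<close> is the set of functions that are
  regular on the open set \<open>U\<close>. HOL functions are total, so membership in \<open>regf X U\<close> only
  constrains the values on \<open>U\<close>.\<close>

record 'a fspace =
  ftop :: "'a topology"
  regf :: "'a set \<Rightarrow> ('a \<Rightarrow> complex) set"

abbreviation pts :: "'a fspace \<Rightarrow> 'a set" where
  "pts X \<equiv> topspace (ftop X)"

definition fmorphism :: "'a fspace \<Rightarrow> 'b fspace \<Rightarrow> ('a \<Rightarrow> 'b) \<Rightarrow> bool" where
  "fmorphism X Y f \<longleftrightarrow> continuous_map (ftop X) (ftop Y) f \<and>
     (\<forall>V g. openin (ftop Y) V \<longrightarrow> g \<in> regf Y V \<longrightarrow> g \<circ> f \<in> regf X {x \<in> pts X. f x \<in> V})"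

definition fisomorphism :: "'a fspace \<Rightarrow> 'b fspace \<Rightarrow> ('a \<Rightarrow> 'b) \<Rightarrow> bool" where
  "fisomorphism X Y f \<longleftrightarrow> fmorphism X Y f \<and>
     (\<exists>g. fmorphism Y X g \<and> (\<forall>x\<in>pts X. g (f x) = x) \<and> (\<forall>y\<in>pts Y. f (g y) = y))"

definition point_fspace :: "'a \<Rightarrow> 'a fspace" where
  "point_fspace p = \<lparr>ftop = discrete_topology {p}, regf = (\<lambda>_. UNIV)\<rparr>"

text \<open>The induced structure on a locally closed subset: functions that are locally restrictions of
  regular functions of the ambient space.\<close>

definition sub_fspace :: "'a fspace \<Rightarrow> 'a set \<Rightarrow> 'a fspace" where
  "sub_fspace X A = \<lparr>ftop = subtopology (ftop X) A,
     regf = (\<lambda>W. {f. \<forall>x\<in>W. \<exists>U g. openin (ftop X) U \<and> x \<in> U \<and> g \<in> regf X U \<and>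
                       (\<forall>y \<in> U \<inter> W. f y = g y)})\<rparr>"

definition sum_fspace :: "'i set \<Rightarrow> ('i \<Rightarrow> 'a fspace) \<Rightarrow> ('i \<times> 'a) fspace" where
  "sum_fspace I X = \<lparr>ftop = sum_topology (\<lambda>i. ftop (X i)) I,
     regf = (\<lambda>W. {f. \<forall>i\<in>I. (\<lambda>x. f (i, x)) \<in> regf (X i) {x. (i, x) \<in> W}})\<rparr>"

text \<open>The product of varieties does not carry the product topology. Its basic open sets are the
  nonvanishing loci in \<open>U \<times> V\<close> of elements of the image of
  \<open>\<O>(U) \<otimes> \<O>(V)\<close>, and its regular functions are locally quotients of such elements.\<close>

definition tensor_funs :: "'a fspace \<Rightarrow> 'b fspace \<Rightarrow> 'a set \<Rightarrow> 'b set \<Rightarrow> ('a \<times> 'b \<Rightarrow> complex) set" where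
  "tensor_funs X Y U V = {h. \<exists>(N::nat) a b. (\<forall>i<N. a i \<in> regf X U \<and> b i \<in> regf Y V) \<and>
     h = (\<lambda>(x, y). \<Sum>i<N. a i x * b i y)}"

definition prod_fspace :: "'a fspace \<Rightarrow> 'b fspace \<Rightarrow> ('a \<times> 'b) fspace" where
  "prod_fspace X Y = \<lparr>
     ftop = topology_generated_by
       {{z \<in> U \<times> V. h z \<noteq> 0} | U V h.
          openin (ftop X) U \<and> openin (ftop Y) V \<and> h \<in> tensor_funs X Y U V},
     regf = (\<lambda>W. {f. \<forall>w\<in>W. \<exists>U V g h. openin (ftop X) U \<and> openin (ftop Y) V \<and> w \<in> U \<times> V \<and>
       g \<in> tensor_funs X Y U V \<and> h \<in> tensor_funs X Y U V \<and> h w \<noteq> 0 \<and>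
       (\<forall>z \<in> W \<inter> U \<times> V. h z \<noteq> 0 \<longrightarrow> f z = g z / h z)})\<rparr>"

definition final_topology :: "'a topology \<Rightarrow> ('a \<Rightarrow> 'b) \<Rightarrow> 'b topology" where
  "final_topology T p =
     topology (\<lambda>W. W \<subseteq> p ` topspace T \<and> openin T {x \<in> topspace T. p x \<in> W})"

lemma istopology_final:
  "istopology (\<lambda>W. W \<subseteq> p ` topspace T \<and> openin T {x \<in> topspace T. p x \<in> W})"
proof -
  have 1: "{x \<in> topspace T. p x \<in> A \<inter> B} =
      {x \<in> topspace T. p x \<in> A} \<inter> {x \<in> topspace T. p x \<in> B}" for A B
    by auto
  have 2: "{x \<in> topspace T. p x \<in> \<Union>\<K>} = (\<Union>K\<in>\<K>. {x \<in> topspace T. p x \<in> K})" for \<K>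
    by auto
  show ?thesis
    unfolding istopology_def 1 2 by (blast intro: openin_Int openin_Union)
qed

lemma openin_final_topology:
  "openin (final_topology T p) W \<longleftrightarrow>
     W \<subseteq> p ` topspace T \<and> openin T {x \<in> topspace T. p x \<in> W}"
  unfolding final_topology_def topology_inverse'[OF istopology_final] ..

text \<open>The quotient of \<open>X\<close> by the fibres of \<open>p\<close>: final topology, and the functions whose pullback
  along \<open>p\<close> is regular.\<close>

definition quotient_fspace :: "'a fspace \<Rightarrow> ('a \<Rightarrow> 'b) \<Rightarrow> 'b fspace" where
  "quotient_fspace X p = \<lparr>ftop = final_topology (ftop X) p,
     regf = (\<lambda>W. {f. f \<circ> p \<in> regf X {x \<in> pts X. p x \<in> W}})\<rparr>"


section \<open>Projective space\<close>

text \<open>For a finite index set \<open>S\<close>, the vector space \<open>\<complex>\<close>-to-the-\<open>S\<close> consists of the functions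
  vanishing outside \<open>S\<close>. A point of \<open>\<P>(S)\<close> is a line without the origin.\<close>

definition cvecs :: "'b set \<Rightarrow> ('b \<Rightarrow> complex) set" where
  "cvecs S = {v. \<forall>b. b \<notin> S \<longrightarrow> v b = 0}"

definition pt_class :: "('b \<Rightarrow> complex) \<Rightarrow> ('b \<Rightarrow> complex) set" where
  "pt_class v = {(\<lambda>b. c * v b) | c. c \<noteq> 0}"

definition proj_pts :: "'b set \<Rightarrow> ('b \<Rightarrow> complex) set set" where
  "proj_pts S = pt_class ` {v \<in> cvecs S. v \<noteq> (\<lambda>_. 0)}"

definition hom_polys :: "'b set \<Rightarrow> nat \<Rightarrow> (('b \<Rightarrow> complex) \<Rightarrow> complex) set" where
  "hom_polys S d = {F. \<exists>(M :: ('b \<Rightarrow> nat) set) c. finite M \<and> (\<forall>\<alpha>\<in>M. (\<Sum>b\<in>S. \<alpha> b) = d) \<and>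
     F = (\<lambda>v. \<Sum>\<alpha>\<in>M. c \<alpha> * (\<Prod>b\<in>S. v b ^ \<alpha> b))}"

definition proj_space :: "'b set \<Rightarrow> (('b \<Rightarrow> complex) set) fspace" where
  "proj_space S = \<lparr>
     ftop = topology_generated_by {{x \<in> proj_pts S. \<forall>v\<in>x. F v \<noteq> 0} | d F. F \<in> hom_polys S d},
     regf = (\<lambda>W. {f. \<forall>x\<in>W. \<exists>d. \<exists>F\<in>hom_polys S d. \<exists>G\<in>hom_polys S d. (\<forall>v\<in>x. G v \<noteq> 0) \<and>
       (\<forall>y\<in>W. \<forall>v\<in>y. G v \<noteq> 0 \<longrightarrow> f y = F v / G v)})\<rparr>"

text \<open>The global sections of \<open>\<O>(d)\<close> on a subvariety \<open>X\<close> of \<open>\<P>(S)\<close>, as functions on the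
  punctured affine cone \<open>\<Union>X\<close> that are locally quotients \<open>F / G\<close> of forms with
  \<open>deg F - deg G = d\<close>. They need not extend to forms on \<open>\<P>(S)\<close>.\<close>

definition sections :: "'b set \<Rightarrow> ('b \<Rightarrow> complex) set set \<Rightarrow> nat \<Rightarrow> (('b \<Rightarrow> complex) \<Rightarrow> complex) set" where
  "sections S X d = {s. \<forall>x\<in>X. \<exists>e. \<exists>F\<in>hom_polys S (d + e). \<exists>G\<in>hom_polys S e. (\<forall>v\<in>x. G v \<noteq> 0) \<and>
     (\<forall>y\<in>X. \<forall>v\<in>y. G v \<noteq> 0 \<longrightarrow> s v = F v / G v)}"


section \<open>GIT quotients\<close>

text \<open>\<open>X\<close> is a closed subvariety of \<open>\<P>(S)\<close> and \<open>H\<close> a set of linear automorphisms of the ambient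
  vector space through which the group acts on \<open>X\<close> and on the sections of the powers of
  \<open>\<L> = \<O>(d)\<close>. If the group itself does not act linearly, but a finite cover of it does with kernel
  acting trivially on forms of degree \<open>d\<close>, then \<open>H\<close> contains all the lifts.\<close>

definition semistable ::
  "'b set \<Rightarrow> ('b \<Rightarrow> complex) set set \<Rightarrow> (('b \<Rightarrow> complex) \<Rightarrow> 'b \<Rightarrow> complex) set \<Rightarrow> nat \<Rightarrow>
     ('b \<Rightarrow> complex) set set" where
  "semistable S X H d = {x \<in> X. \<exists>m\<ge>1. \<exists>s \<in> sections S X (d * m).
     (\<forall>h\<in>H. \<forall>v\<in>\<Union>X. s (h v) = s v) \<and> (\<forall>v\<in>x. s v \<noteq> 0)}"

definition semistable_fspace where
  "semistable_fspace S X H d = sub_fspace (proj_space S) (semistable S X H d)"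

text \<open>The points of the good quotient are the classes of semistable points under the relation
  ``the orbit closures in the semistable locus meet''.\<close>

definition git_class where
  "git_class S X H d x = {y \<in> semistable S X H d.
     ftop (semistable_fspace S X H d) closure_of {h ` x | h. h \<in> H} \<inter>
     ftop (semistable_fspace S X H d) closure_of {h ` y | h. h \<in> H} \<noteq> {}}"

text \<open>A function on the quotient is regular iff its pullback, which is an invariant function, is.\<close>

definition git_quotient ::
  "'b set \<Rightarrow> ('b \<Rightarrow> complex) set set \<Rightarrow> (('b \<Rightarrow> complex) \<Rightarrow> 'b \<Rightarrow> complex) set \<Rightarrow> nat \<Rightarrow>
     ('b \<Rightarrow> complex) set set fspace" where
  "git_quotient S X H d = quotient_fspace (semistable_fspace S X H d) (git_class S X H d)"


section \<open>The group PSL(n) and Schubert varieties in Grassmannians\<close>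

text \<open>Matrix rows and columns are numbered from \<open>0\<close>, so the basis vector \<open>e\<^sub>i\<close> of the literature has
  number \<open>i - 1\<close>. Simple roots, simple reflections and the dual one-parameter subgroups keep their
  numbers \<open>1, \<dots>, n - 1\<close>.\<close>

definition SL :: "nat \<Rightarrow> complex mat monoid" where
  "SL n = \<lparr>carrier = {A \<in> carrier_mat n n. det A = 1}, monoid.mult = (*), one = 1\<^sub>m n\<rparr>"

definition SL_center :: "nat \<Rightarrow> complex mat set" where
  "SL_center n = {A \<in> carrier (SL n). \<exists>c. A = c \<cdot>\<^sub>m 1\<^sub>m n}"

definition PSL :: "nat \<Rightarrow> complex mat set monoid" where
  "PSL n = SL n Mod SL_center n"

text \<open>The element of \<open>PSL(n) = PGL(n)\<close> given by an arbitrary invertible matrix, as a coset of the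
  center of \<open>SL(n)\<close>.\<close>

definition mat_class :: "nat \<Rightarrow> complex mat \<Rightarrow> complex mat set" where
  "mat_class n M = {A \<in> carrier (SL n). \<exists>c. A = c \<cdot>\<^sub>m M}"

definition borel_subgroup :: "nat \<Rightarrow> complex mat set set" where
  "borel_subgroup n = {mat_class n A | A. A \<in> carrier (SL n) \<and> upper_triangular A}"

definition one_param :: "nat \<Rightarrow> nat \<Rightarrow> complex \<Rightarrow> complex mat set" where
  "one_param n j t = mat_class n (mat_diag n (\<lambda>i. if i < j then t else 1))"

definition simple_reflection :: "nat \<Rightarrow> nat \<Rightarrow> nat" where
  "simple_reflection i = Transposition.transpose (i - 1) i"

definition weyl_class :: "nat \<Rightarrow> (nat \<Rightarrow> nat) \<Rightarrow> complex mat set" where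
  "weyl_class n w = mat_class n (mat n n (\<lambda>(i, j). if i = w j then 1 else 0))"

definition ksubsets :: "nat \<Rightarrow> nat \<Rightarrow> nat set set" where
  "ksubsets k n = {I. I \<subseteq> {..<n} \<and> card I = k}"

text \<open>The \<open>k\<close>-th exterior power of a matrix, acting on Pluecker coordinates.\<close>

definition ext_power :: "nat \<Rightarrow> nat \<Rightarrow> complex mat \<Rightarrow> (nat set \<Rightarrow> complex) \<Rightarrow> nat set \<Rightarrow> complex" where
  "ext_power k n A v = (\<lambda>I. if I \<in> ksubsets k n
     then \<Sum>J\<in>ksubsets k n. det (submatrix A I J) * v J else 0)"

text \<open>An element \<open>g\<close> of \<open>PSL(n)\<close> is the set of its lifts to \<open>SL(n)\<close>, and a point of projective space
  the set of its representatives.\<close>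

definition psl_act :: "nat \<Rightarrow> nat \<Rightarrow> complex mat set \<Rightarrow> (nat set \<Rightarrow> complex) set \<Rightarrow> (nat set \<Rightarrow> complex) set" where
  "psl_act k n g x = {ext_power k n A v | A v. A \<in> g \<and> v \<in> x}"

definition base_point :: "nat \<Rightarrow> (nat set \<Rightarrow> complex) set" where
  "base_point k = pt_class (\<lambda>I. if I = {..<k} then 1 else 0)"

text \<open>The stabilizer of the line spanned by \<open>e\<^sub>1 \<and> \<dots> \<and> e\<^sub>k\<close> is the maximal parabolic
  \<open>Q\<close> attached to the \<open>k\<close>-th simple root, so its orbit is \<open>G/Q\<close>, Pluecker embedded.\<close>

definition grassmannian :: "nat \<Rightarrow> nat \<Rightarrow> (nat set \<Rightarrow> complex) set set" where
  "grassmannian k n = {psl_act k n g (base_point k) | g. g \<in> carrier (PSL n)}"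

definition schubert :: "nat \<Rightarrow> nat \<Rightarrow> (nat \<Rightarrow> nat) \<Rightarrow> (nat set \<Rightarrow> complex) set set" where
  "schubert k n w = subtopology (ftop (proj_space (ksubsets k n))) (grassmannian k n) closure_of
     {psl_act k n (b \<otimes>\<^bsub>PSL n\<^esub> weyl_class n w) (base_point k) | b. b \<in> borel_subgroup n}"


section \<open>The quotients \<open>Y\<^sub>k\<close>\<close>

text \<open>The word \<open>(s\<^sub>q \<dots> s\<^sub>1) (s\<^sub>2\<^sub>q \<dots> s\<^sub>2) \<dots> (s\<^sub>k\<^sub>q \<dots> s\<^sub>k)\<close>, a product of permutations acting from
  the right-hand end.\<close>

definition w_min :: "nat \<Rightarrow> nat \<Rightarrow> nat \<Rightarrow> nat" where
  "w_min q k = foldr (\<circ>)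
     (map simple_reflection (concat (map (\<lambda>m. rev [m..<Suc (m * q)]) [1..<Suc k]))) id"

definition nk :: "nat \<Rightarrow> nat \<Rightarrow> nat" where
  "nk q k = k * q + 1"

definition T_J :: "nat \<Rightarrow> nat \<Rightarrow> complex mat set set" where
  "T_J q k = generate (PSL (nk q k)) {one_param (nk q k) (j * q) t | j t. 1 \<le> j \<and> j \<le> k \<and> t \<noteq> 0}"

text \<open>\<open>\<L>(n\<^sub>k \<omega>\<^sub>k)\<close> is \<open>\<O>(n\<^sub>k)\<close>; an element of \<open>PSL(n\<^sub>k)\<close> acts on
  its sections through any of its lifts to \<open>SL(n\<^sub>k)\<close>.\<close>

definition Y :: "nat \<Rightarrow> nat \<Rightarrow> (nat set \<Rightarrow> complex) set set fspace" where
  "Y q k = (if k = 0 then point_fspace {} else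
     git_quotient (ksubsets k (nk q k)) (schubert k (nk q k) (w_min q k))
       {ext_power k (nk q k) A | A. A \<in> \<Union>(T_J q k)} (nk q k))"


section \<open>Vector bundles and projective bundles\<close>

text \<open>A vector bundle of rank \<open>m\<close> is given by an open cover and \<open>GL(m)\<close>-valued transition functions,
  where \<open>trans E i j\<close> passes from the \<open>j\<close>-th to the \<open>i\<close>-th trivialization.\<close>

record ('i, 'a) bundle_data =
  idx :: "'i set"
  cov :: "'i \<Rightarrow> 'a set"
  trans :: "'i \<Rightarrow> 'i \<Rightarrow> 'a \<Rightarrow> complex mat"

definition vector_bundle :: "'a fspace \<Rightarrow> nat \<Rightarrow> ('i, 'a) bundle_data \<Rightarrow> bool" where
  "vector_bundle X m E \<longleftrightarrow>
     (\<forall>i\<in>idx E. openin (ftop X) (cov E i)) \<and> (\<Union>i\<in>idx E. cov E i) = pts X \<and>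
     (\<forall>i\<in>idx E. \<forall>j\<in>idx E. \<forall>x \<in> cov E i \<inter> cov E j.
        trans E i j x \<in> carrier_mat m m \<and> invertible_mat (trans E i j x)) \<and>
     (\<forall>i\<in>idx E. \<forall>j\<in>idx E. \<forall>a<m. \<forall>b<m.
        (\<lambda>x. trans E i j x $$ (a, b)) \<in> regf X (cov E i \<inter> cov E j)) \<and>
     (\<forall>i\<in>idx E. \<forall>x \<in> cov E i. trans E i i x = 1\<^sub>m m) \<and>
     (\<forall>i\<in>idx E. \<forall>j\<in>idx E. \<forall>l\<in>idx E. \<forall>x \<in> cov E i \<inter> cov E j \<inter> cov E l.
        trans E i j x * trans E j l x = trans E i l x)"

abbreviation line_bundle :: "'a fspace \<Rightarrow> ('i, 'a) bundle_data \<Rightarrow> bool" where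
  "line_bundle X L \<equiv> vector_bundle X 1 L"

text \<open>\<open>u\<close> is an isomorphism from the trivial line bundle.\<close>

definition trivial_line_bundle :: "'a fspace \<Rightarrow> ('i, 'a) bundle_data \<Rightarrow> bool" where
  "trivial_line_bundle X L \<longleftrightarrow> line_bundle X L \<and>
     (\<exists>u. (\<forall>i\<in>idx L. u i \<in> regf X (cov L i) \<and> (\<forall>x\<in>cov L i. u i x \<noteq> 0)) \<and>
          (\<forall>i\<in>idx L. \<forall>j\<in>idx L. \<forall>x \<in> cov L i \<inter> cov L j. u i x = trans L i j x $$ (0, 0) * u j x))"

text \<open>\<open>L 0 \<oplus> \<dots> \<oplus> L n\<close>, on the common refinement of the covers of the summands.\<close>

definition line_bundle_sum ::
  "nat \<Rightarrow> (nat \<Rightarrow> ('i, 'a) bundle_data) \<Rightarrow> (nat \<Rightarrow> 'i, 'a) bundle_data" where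
  "line_bundle_sum n L = \<lparr>
     idx = (\<Pi>\<^sub>E a\<in>{..n}. idx (L a)),
     cov = (\<lambda>i. \<Inter>a\<in>{..n}. cov (L a) (i a)),
     trans = (\<lambda>i j x. mat_diag (Suc n) (\<lambda>a. trans (L a) (i a) (j a) x $$ (0, 0)))\<rparr>"

definition mat_act :: "nat \<Rightarrow> complex mat \<Rightarrow> (nat \<Rightarrow> complex) \<Rightarrow> nat \<Rightarrow> complex" where
  "mat_act m A v = (\<lambda>a. if a < m then \<Sum>b<m. A $$ (a, b) * v b else 0)"

text \<open>\<open>\<P>(E)\<close> is glued from the products of the \<open>cov E i\<close> with projective space; a point of it is
  the set of its representatives in all the charts containing it.\<close>

definition pbundle_class ::
  "nat \<Rightarrow> ('i, 'a) bundle_data \<Rightarrow> 'i \<times> 'a \<times> (nat \<Rightarrow> complex) set \<Rightarrow>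
     ('i \<times> 'a \<times> (nat \<Rightarrow> complex) set) set" where
  "pbundle_class m E = (\<lambda>(i, x, l).
     {(j, x, mat_act m (trans E j i x) ` l) | j. j \<in> idx E \<and> x \<in> cov E j})"

definition pbundle ::
  "'a fspace \<Rightarrow> nat \<Rightarrow> ('i, 'a) bundle_data \<Rightarrow> ('i \<times> 'a \<times> (nat \<Rightarrow> complex) set) set fspace" where
  "pbundle X m E = quotient_fspace
     (sum_fspace (idx E) (\<lambda>i. prod_fspace (sub_fspace X (cov E i)) (proj_space {..<m})))
     (pbundle_class m E)"

definition pbundle_proj :: "('i \<times> 'a \<times> (nat \<Rightarrow> complex) set) set \<Rightarrow> 'a" where
  "pbundle_proj c = (THE x. \<exists>i l. (i, x, l) \<in> c)"

definition isomorphic_over :: "('e \<Rightarrow> 'a) \<Rightarrow> ('f \<Rightarrow> 'a) \<Rightarrow> 'e fspace \<Rightarrow> 'f fspace \<Rightarrow> bool" where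
  "isomorphic_over \<pi> \<pi>' E F \<longleftrightarrow> (\<exists>\<psi>. fisomorphism E F \<psi> \<and> (\<forall>y\<in>pts E. \<pi>' (\<psi> y) = \<pi> y))"


section \<open>Generalized Bott towers\<close>

text \<open>Indexing the covers of the line bundles by sets of points is no restriction, since one
  trivialization per open set suffices. The fibre dimensions \<open>n\<close> are positive.\<close>

definition generalized_bott_tower :: "nat \<Rightarrow> (nat \<Rightarrow> 'a fspace) \<Rightarrow> (nat \<Rightarrow> 'a \<Rightarrow> 'a) \<Rightarrow> bool" where
  "generalized_bott_tower m X \<pi> \<longleftrightarrow> (\<exists>p. X 0 = point_fspace p) \<and>
     (\<forall>i\<in>{1..m}. fmorphism (X i) (X (i - 1)) (\<pi> i) \<and>
        (\<exists>n\<ge>1. \<exists>L :: nat \<Rightarrow> ('a set, 'a) bundle_data.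
           (\<forall>a\<le>n. line_bundle (X (i - 1)) (L a)) \<and> trivial_line_bundle (X (i - 1)) (L 0) \<and>
           isomorphic_over (\<pi> i) pbundle_proj (X i)
             (pbundle (X (i - 1)) (Suc n) (line_bundle_sum n L))))"

end

theory Submission
  imports Defs
begin

text \<open>
  A semistable point of the Schubert variety is a \<open>k\<close>-dimensional subspace in the open cell, given by
  a reduced echelon basis whose pivots are the coordinates \<open>q, 2q, \<dots>, kq\<close> (numbered from \<open>0\<close>), such
  that no basis vector is a coordinate vector. Grouping the coordinates into blocks of length \<open>q\<close>,
  the torus acts on an entry of the \<open>j\<close>-th basis vector in block \<open>b\<close> by the weight \<open>a b / a j\<close> with
  \<open>b < j\<close>. Forgetting the last basis vector therefore maps \<open>Y\<^sub>k\<close> to \<open>Y\<^sub>k\<^sub>-\<^sub>1\<close>, the fibre over a point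
  is the set of nonzero vectors modulo scaling by \<open>a k\<close>, and the weights \<open>a b\<close>, \<open>b < k\<close>, turn the
  coordinates of the fibre into sections of line bundles on \<open>Y\<^sub>k\<^sub>-\<^sub>1\<close>.

  Points outside this locus are unstable by a one-parameter subgroup whose limit stays in the
  Schubert variety. For the points inside, chains of nonzero entries produce Pluecker coordinates
  whose product is an invariant section.
\<close>

section \<open>Spaces with functions given by local fractions\<close>

text \<open>The bundle argument never sees a Grassmannian. It uses only that \<open>Y q k\<close> is
  the orbit space of the echelon bases, with the quotient topology and functions
  (\<open>torus_quotient\<close>). This is available because orbits are closed in the semistable
  locus, so the classes of the good quotient are orbits. A common scalar acts trivially on echelon
  bases, hence the determinant condition on lifts to SL drops out and only ratios of the scalars
  \<open>a b\<close> matter. Normalising by \<open>a 0\<close> makes each block weight a function of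
  weight a b / a 0 on a chart, a product of inverses of selected entries. Ratios of these functions
  for two charts are the transition functions, and block 0, where the function is 1, supplies the
  trivial summand. The selection of one nonzero entry per basis vector is used twice: it gives a
  regular section of the quotient map, which makes the inverse of the bundle map regular, and it
  gives nonzero Pluecker coordinates that avoid one prescribed block. All blocks have
  \<open>q\<close> coordinates except the last, which has one; with n = k q + 1 this balances the
  invariant monomial in degree n and makes the destabilising inequalities strict.\<close>

lemma ex4I: "P a b c d \<Longrightarrow> \<exists>a b c d. P a b c d"
  by blast

text \<open>The record \<open>fspace\<close> imposes no axioms; these are the ones used of a
  variety. Membership in \<open>regf X U\<close> constrains values on \<open>U\<close> only, so
  \<open>regf_local\<close> compares functions on \<open>V \<inter> U\<close> and also allows values
  outside \<open>U\<close> to be altered.\<close>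

locale function_sheaf =
  fixes X :: "'a fspace"
  assumes regf_const: "openin (ftop X) U \<Longrightarrow> (\<lambda>_. c) \<in> regf X U"
    and regf_add: "openin (ftop X) U \<Longrightarrow> f \<in> regf X U \<Longrightarrow> g \<in> regf X U \<Longrightarrow> (\<lambda>x. f x + g x) \<in> regf X U"
    and regf_mult: "openin (ftop X) U \<Longrightarrow> f \<in> regf X U \<Longrightarrow> g \<in> regf X U \<Longrightarrow> (\<lambda>x. f x * g x) \<in> regf X U"
    and regf_restrict: "openin (ftop X) U \<Longrightarrow> openin (ftop X) V \<Longrightarrow> V \<subseteq> U \<Longrightarrow> f \<in> regf X U \<Longrightarrow> f \<in> regf X V"
    and regf_local: "openin (ftop X) U \<Longrightarrow>
      (\<And>x. x \<in> U \<Longrightarrow> \<exists>V g. openin (ftop X) V \<and> x \<in> V \<and> g \<in> regf X V \<and> (\<forall>y\<in>V \<inter> U. f y = g y)) \<Longrightarrow> f \<in> regf X U"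
    and open_nonzero: "openin (ftop X) U \<Longrightarrow> f \<in> regf X U \<Longrightarrow> openin (ftop X) {x \<in> U. f x \<noteq> 0}"
    and regf_inverse: "openin (ftop X) U \<Longrightarrow> f \<in> regf X U \<Longrightarrow> (\<And>x. x \<in> U \<Longrightarrow> f x \<noteq> 0) \<Longrightarrow>
      (\<lambda>x. inverse (f x)) \<in> regf X U"
begin

lemma regf_cong:
  assumes "openin (ftop X) U" "f \<in> regf X U" "\<And>x. x \<in> U \<Longrightarrow> f x = g x"
  shows "g \<in> regf X U"
proof (rule regf_local[OF assms(1)])
  fix x assume "x \<in> U"
  then show "\<exists>V h. openin (ftop X) V \<and> x \<in> V \<and> h \<in> regf X V \<and> (\<forall>y\<in>V \<inter> U. g y = h y)"
    using assms by (intro exI[of _ U] exI[of _ f]) auto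
qed

lemma regf_divide:
  assumes "openin (ftop X) U" "f \<in> regf X U" "g \<in> regf X U" "\<And>x. x \<in> U \<Longrightarrow> g x \<noteq> 0"
  shows "(\<lambda>x. f x / g x) \<in> regf X U"
  unfolding divide_inverse by (intro regf_mult regf_inverse assms)

lemma regf_sum:
  assumes "openin (ftop X) U" "\<And>i. i \<in> I \<Longrightarrow> f i \<in> regf X U"
  shows "(\<lambda>x. \<Sum>i\<in>I. f i x) \<in> regf X U"
  using assms(2)
proof (induction I rule: infinite_finite_induct)
  case (insert i I)
  then show ?case by (simp add: regf_add[OF assms(1)])
qed (simp_all add: regf_const[OF assms(1)])

lemma regf_prod:
  assumes "openin (ftop X) U" "\<And>i. i \<in> I \<Longrightarrow> f i \<in> regf X U"
  shows "(\<lambda>x. \<Prod>i\<in>I. f i x) \<in> regf X U"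
  using assms(2)
proof (induction I rule: infinite_finite_induct)
  case (insert i I)
  then show ?case by (simp add: regf_mult[OF assms(1)])
qed (simp_all add: regf_const[OF assms(1)])

lemma regf_power:
  assumes "openin (ftop X) U" "f \<in> regf X U"
  shows "(\<lambda>x. f x ^ n) \<in> regf X U"
  by (induction n) (simp_all add: regf_const[OF assms(1)] regf_mult[OF assms(1,2)])

end

text \<open>Agreement is asked on open sets only: the two descriptions of projective space agree on
  sets of its points, while on a set with a foreign element the fraction description admits no
  function at all.\<close>

lemma function_sheaf_cong:
  assumes "function_sheaf X" "ftop X' = ftop X" "\<And>U. openin (ftop X) U \<Longrightarrow> regf X' U = regf X U"
  shows "function_sheaf X'"
proof -
  interpret function_sheaf X by fact
  have op: "openin (ftop X') U \<longleftrightarrow> openin (ftop X) U" for U by (simp add: assms(2))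
  show ?thesis
  proof (unfold_locales, unfold op)
    fix U f assume U: "openin (ftop X) U" and loc: "\<And>x. x \<in> U \<Longrightarrow> \<exists>V g. openin (ftop X) V \<and> x \<in> V \<and>
      g \<in> regf X' V \<and> (\<forall>y\<in>V \<inter> U. f y = g y)"
    show "f \<in> regf X' U" unfolding assms(3)[OF U]
    proof (rule regf_local[OF U])
      fix x assume "x \<in> U"
      from loc[OF this] show "\<exists>V g. openin (ftop X) V \<and> x \<in> V \<and> g \<in> regf X V \<and> (\<forall>y\<in>V \<inter> U. f y = g y)"
        using assms(3) by blast
    qed
  next
    fix U V f assume "openin (ftop X) U" "openin (ftop X) V" "V \<subseteq> U" "f \<in> regf X' U"
    then show "f \<in> regf X' V" using regf_restrict assms(3) by blast
  qed (simp_all add: assms(3) regf_const regf_add regf_mult regf_inverse open_nonzero)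
qed

text \<open>A base element \<open>(U, R)\<close> consists of an open set and a vector space \<open>R\<close> of numerators and
  denominators; forms of one degree on projective space are the reason not to require a ring.\<close>

definition frac_fspace :: "('a set \<times> ('a \<Rightarrow> complex) set) set \<Rightarrow> 'a fspace" where
  "frac_fspace B = \<lparr>ftop = topology_generated_by {{x \<in> U. h x \<noteq> 0} | U R h. (U, R) \<in> B \<and> h \<in> R},
     regf = (\<lambda>W. {f. \<forall>w\<in>W. \<exists>U R g h. (U, R) \<in> B \<and> w \<in> U \<and> g \<in> R \<and> h \<in> R \<and> h w \<noteq> 0 \<and>
        (\<forall>z\<in>W \<inter> U. h z \<noteq> 0 \<longrightarrow> f z = g z / h z)})\<rparr>"

text \<open>Products may lie in a third numerator space over the intersection: degrees add for
  forms, and open sets shrink for products of varieties.\<close>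

definition frac_base :: "('a set \<times> ('a \<Rightarrow> complex) set) set \<Rightarrow> bool" where
  "frac_base B \<longleftrightarrow>
     (\<forall>U R U' R'. (U, R) \<in> B \<longrightarrow> (U', R') \<in> B \<longrightarrow>
        (\<exists>R''. (U \<inter> U', R'') \<in> B \<and> (\<forall>f\<in>R. \<forall>g\<in>R'. (\<lambda>x. f x * g x) \<in> R''))) \<and>
     (\<forall>U R. (U, R) \<in> B \<longrightarrow> (\<forall>f\<in>R. \<forall>g\<in>R. (\<lambda>x. f x + g x) \<in> R) \<and> (\<forall>f\<in>R. \<forall>c. (\<lambda>x. c * f x) \<in> R))"

lemma openin_generated_by_base:
  assumes "\<And>a b. a \<in> B \<Longrightarrow> b \<in> B \<Longrightarrow> a \<inter> b \<in> B"
  shows "openin (topology_generated_by B) W \<longleftrightarrow> (\<forall>x\<in>W. \<exists>b\<in>B. x \<in> b \<and> b \<subseteq> W)"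
proof
  assume "openin (topology_generated_by B) W"
  then have "generate_topology_on B W" by (rule openin_topology_generated_by)
  then show "\<forall>x\<in>W. \<exists>b\<in>B. x \<in> b \<and> b \<subseteq> W"
  proof (induction rule: generate_topology_on.induct)
    case (Int a b)
    show ?case
    proof
      fix x assume "x \<in> a \<inter> b"
      then obtain a' b' where "a' \<in> B" "b' \<in> B" "x \<in> a'" "x \<in> b'" "a' \<subseteq> a" "b' \<subseteq> b"
        using Int.IH by (meson IntD1 IntD2)
      then show "\<exists>c\<in>B. x \<in> c \<and> c \<subseteq> a \<inter> b"
        using assms[of a' b'] by (intro bexI[of _ "a' \<inter> b'"]) auto
    qed
  next
    case (UN K)
    show ?case
    proof
      fix x assume "x \<in> \<Union>K"
      then obtain k where k: "k \<in> K" "x \<in> k" by blast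
      then obtain b where "b \<in> B" "x \<in> b" "b \<subseteq> k" using UN by blast
      then show "\<exists>b\<in>B. x \<in> b \<and> b \<subseteq> \<Union>K" using k by blast
    qed
  qed auto
next
  assume *: "\<forall>x\<in>W. \<exists>b\<in>B. x \<in> b \<and> b \<subseteq> W"
  show "openin (topology_generated_by B) W"
  proof (rule openin_subopen[THEN iffD2], rule ballI)
    fix x assume "x \<in> W"
    with * obtain b where b: "b \<in> B" "x \<in> b" "b \<subseteq> W" by blast
    show "\<exists>T. openin (topology_generated_by B) T \<and> x \<in> T \<and> T \<subseteq> W"
      by (intro exI[of _ b] conjI topology_generated_by_Basis b)
  qed
qed

context
  fixes B :: "('a set \<times> ('a \<Rightarrow> complex) set) set"
  assumes B: "frac_base B"
begin

lemma frac_base_mult: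
  assumes "(U, R) \<in> B" "(U', R') \<in> B"
  obtains R'' where "(U \<inter> U', R'') \<in> B" "\<And>f g. f \<in> R \<Longrightarrow> g \<in> R' \<Longrightarrow> (\<lambda>x. f x * g x) \<in> R''"
proof -
  obtain R'' where "(U \<inter> U', R'') \<in> B" "\<forall>f\<in>R. \<forall>g\<in>R'. (\<lambda>x. f x * g x) \<in> R''"
    using B[unfolded frac_base_def, THEN conjunct1, rule_format, OF assms] by (elim exE conjE)
  then show thesis by (intro that[of R'']) auto
qed

lemma frac_base_add: "(U, R) \<in> B \<Longrightarrow> f \<in> R \<Longrightarrow> g \<in> R \<Longrightarrow> (\<lambda>x. f x + g x) \<in> R"
  using B[unfolded frac_base_def, THEN conjunct2, rule_format, THEN conjunct1, rule_format] .

lemma frac_base_scale: "(U, R) \<in> B \<Longrightarrow> f \<in> R \<Longrightarrow> (\<lambda>x. c * f x) \<in> R"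
  using B[unfolded frac_base_def, THEN conjunct2, rule_format, THEN conjunct2, rule_format] .

lemma openin_frac_fspace:
  "openin (ftop (frac_fspace B)) W \<longleftrightarrow>
     (\<forall>w\<in>W. \<exists>U R h. (U, R) \<in> B \<and> h \<in> R \<and> w \<in> U \<and> h w \<noteq> 0 \<and> {x \<in> U. h x \<noteq> 0} \<subseteq> W)"
proof -
  let ?S = "{{x \<in> U. h x \<noteq> 0} | U R h. (U, R) \<in> B \<and> h \<in> R}"
  have "a \<inter> b \<in> ?S" if ab: "a \<in> ?S" "b \<in> ?S" for a b
  proof -
    obtain U R h where 1: "(U, R) \<in> B" "h \<in> R" "a = {x \<in> U. h x \<noteq> 0}" using ab(1) by auto
    obtain U' R' h' where 2: "(U', R') \<in> B" "h' \<in> R'" "b = {x \<in> U'. h' x \<noteq> 0}" using ab(2) by auto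
    obtain R'' where 3: "(U \<inter> U', R'') \<in> B" "\<And>f g. f \<in> R \<Longrightarrow> g \<in> R' \<Longrightarrow> (\<lambda>x. f x * g x) \<in> R''"
      using frac_base_mult[OF 1(1) 2(1)] by blast
    have "a \<inter> b = {x \<in> U \<inter> U'. h x * h' x \<noteq> 0}" using 1 2 by auto
    then show ?thesis using 3(1) 3(2)[OF 1(2) 2(2)]
      by (intro CollectI exI[of _ "U \<inter> U'"] exI[of _ R''] exI[of _ "\<lambda>x. h x * h' x"]) simp
  qed
  moreover have ex_in: "(\<exists>b\<in>?S. P b) \<longleftrightarrow> (\<exists>U R h. (U, R) \<in> B \<and> h \<in> R \<and> P {x \<in> U. h x \<noteq> 0})" for P
    by auto
  moreover have "w \<in> {x \<in> U. h x \<noteq> 0} \<longleftrightarrow> w \<in> U \<and> h w \<noteq> 0" for w U and h :: "'a \<Rightarrow> complex" by simp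
  ultimately show ?thesis
    unfolding frac_fspace_def fspace.select_convs
    by (subst openin_generated_by_base) (simp_all only: ex_in conj_assoc mem_Collect_eq)
qed

lemma frac_fspace_point:
  assumes "openin (ftop (frac_fspace B)) W" "w \<in> W"
  obtains U R h where "(U, R) \<in> B" "h \<in> R" "w \<in> U" "h w \<noteq> 0" "{x \<in> U. h x \<noteq> 0} \<subseteq> W"
  using assms openin_frac_fspace by meson

lemma openin_frac_basic: "(U, R) \<in> B \<Longrightarrow> h \<in> R \<Longrightarrow> openin (ftop (frac_fspace B)) {x \<in> U. h x \<noteq> 0}"
  unfolding openin_frac_fspace by blast

lemma mem_regf_frac_fspace:
  "f \<in> regf (frac_fspace B) W \<longleftrightarrow> (\<forall>w\<in>W. \<exists>U R g h. (U, R) \<in> B \<and> w \<in> U \<and> g \<in> R \<and> h \<in> R \<and> h w \<noteq> 0 \<and>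
        (\<forall>z\<in>W \<inter> U. h z \<noteq> 0 \<longrightarrow> f z = g z / h z))"
  unfolding frac_fspace_def by simp

text \<open>Fractions over two base elements are brought to a common denominator over the
  intersection, where one product space contains both numerators and can be added in.\<close>

lemma function_sheaf_frac_fspace: "function_sheaf (frac_fspace B)"
proof
  fix W c assume W: "openin (ftop (frac_fspace B)) W"
  show "(\<lambda>_. c) \<in> regf (frac_fspace B) W" unfolding mem_regf_frac_fspace
  proof
    fix w assume "w \<in> W"
    then obtain U R h where *: "(U, R) \<in> B" "h \<in> R" "w \<in> U" "h w \<noteq> 0" "{x \<in> U. h x \<noteq> 0} \<subseteq> W"
      using frac_fspace_point W by blast
    show "\<exists>U R g h. (U, R) \<in> B \<and> w \<in> U \<and> g \<in> R \<and> h \<in> R \<and> h w \<noteq> 0 \<and>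
        (\<forall>z\<in>W \<inter> U. h z \<noteq> 0 \<longrightarrow> c = g z / h z)"
      using * frac_base_scale[OF *(1,2), of c]
      by (intro ex4I[where a = U and b = R and c = "\<lambda>x. c * h x" and d = h]) simp
  qed
next
  fix W f g assume W: "openin (ftop (frac_fspace B)) W"
    and f: "f \<in> regf (frac_fspace B) W" and g: "g \<in> regf (frac_fspace B) W"
  {
    fix w assume w: "w \<in> W"
    from f w obtain U R p h where 1: "(U, R) \<in> B" "w \<in> U" "p \<in> R" "h \<in> R" "h w \<noteq> 0"
        "\<forall>z\<in>W \<inter> U. h z \<noteq> 0 \<longrightarrow> f z = p z / h z"
      unfolding mem_regf_frac_fspace by blast
    from g w obtain U' R' p' h' where 2: "(U', R') \<in> B" "w \<in> U'" "p' \<in> R'" "h' \<in> R'" "h' w \<noteq> 0"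
        "\<forall>z\<in>W \<inter> U'. h' z \<noteq> 0 \<longrightarrow> g z = p' z / h' z"
      unfolding mem_regf_frac_fspace by blast
    obtain R'' where 3: "(U \<inter> U', R'') \<in> B" "\<And>f g. f \<in> R \<Longrightarrow> g \<in> R' \<Longrightarrow> (\<lambda>x. f x * g x) \<in> R''"
      using frac_base_mult[OF 1(1) 2(1)] by blast
    have add_fracs: "p z / h z + p' z / h' z = (p z * h' z + h z * p' z) / (h z * h' z)"
      if "h z \<noteq> 0" "h' z \<noteq> 0" for z using that by (simp add: field_simps)
    have "\<exists>U R g' h. (U, R) \<in> B \<and> w \<in> U \<and> g' \<in> R \<and> h \<in> R \<and> h w \<noteq> 0 \<and>
        (\<forall>z\<in>W \<inter> U. h z \<noteq> 0 \<longrightarrow> f z + g z = g' z / h z)"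
      using 1 2 3(1) 3(2)[OF 1(4) 2(4)] frac_base_add[OF 3(1) 3(2)[OF 1(3) 2(4)] 3(2)[OF 1(4) 2(3)]]
      by (intro ex4I[where a = "U \<inter> U'" and b = R'' and c = "\<lambda>z. p z * h' z + h z * p' z" and d = "\<lambda>z. h z * h' z"]) (auto simp: add_fracs)
    moreover have "\<exists>U R g' h. (U, R) \<in> B \<and> w \<in> U \<and> g' \<in> R \<and> h \<in> R \<and> h w \<noteq> 0 \<and>
        (\<forall>z\<in>W \<inter> U. h z \<noteq> 0 \<longrightarrow> f z * g z = g' z / h z)"
      using 1 2 3
      by (intro ex4I[where a = "U \<inter> U'" and b = R'' and c = "\<lambda>z. p z * p' z" and d = "\<lambda>z. h z * h' z"]) auto
    ultimately have "\<exists>U R g' h. (U, R) \<in> B \<and> w \<in> U \<and> g' \<in> R \<and> h \<in> R \<and> h w \<noteq> 0 \<and>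
        (\<forall>z\<in>W \<inter> U. h z \<noteq> 0 \<longrightarrow> f z + g z = g' z / h z)"
      "\<exists>U R g' h. (U, R) \<in> B \<and> w \<in> U \<and> g' \<in> R \<and> h \<in> R \<and> h w \<noteq> 0 \<and>
        (\<forall>z\<in>W \<inter> U. h z \<noteq> 0 \<longrightarrow> f z * g z = g' z / h z)" .
  }
  then show "(\<lambda>x. f x + g x) \<in> regf (frac_fspace B) W" "(\<lambda>x. f x * g x) \<in> regf (frac_fspace B) W"
    unfolding mem_regf_frac_fspace by blast+
next
  fix W V f assume "openin (ftop (frac_fspace B)) W" "openin (ftop (frac_fspace B)) V" "V \<subseteq> W"
    "f \<in> regf (frac_fspace B) W"
  show "f \<in> regf (frac_fspace B) V" unfolding mem_regf_frac_fspace
  proof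
    fix w assume "w \<in> V"
    then have "w \<in> W" using \<open>V \<subseteq> W\<close> by blast
    then obtain U R g h where "(U, R) \<in> B" "w \<in> U" "g \<in> R" "h \<in> R" "h w \<noteq> 0"
        "\<forall>z\<in>W \<inter> U. h z \<noteq> 0 \<longrightarrow> f z = g z / h z"
      using \<open>f \<in> regf (frac_fspace B) W\<close> unfolding mem_regf_frac_fspace by blast
    then show "\<exists>U R g h. (U, R) \<in> B \<and> w \<in> U \<and> g \<in> R \<and> h \<in> R \<and> h w \<noteq> 0 \<and>
        (\<forall>z\<in>V \<inter> U. h z \<noteq> 0 \<longrightarrow> f z = g z / h z)"
      using \<open>V \<subseteq> W\<close> by (intro ex4I[where a = U and b = R and c = g and d = h]) auto
  qed
next
  fix W f assume W: "openin (ftop (frac_fspace B)) W"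
    and loc: "\<And>x. x \<in> W \<Longrightarrow> \<exists>V g. openin (ftop (frac_fspace B)) V \<and> x \<in> V \<and>
      g \<in> regf (frac_fspace B) V \<and> (\<forall>y\<in>V \<inter> W. f y = g y)"
  show "f \<in> regf (frac_fspace B) W" unfolding mem_regf_frac_fspace
  proof
    fix w assume "w \<in> W"
    then obtain V g where V: "openin (ftop (frac_fspace B)) V" "w \<in> V"
      "g \<in> regf (frac_fspace B) V" "\<forall>y\<in>V \<inter> W. f y = g y" using loc by blast
    obtain U R h where 1: "(U, R) \<in> B" "h \<in> R" "w \<in> U" "h w \<noteq> 0" "{x \<in> U. h x \<noteq> 0} \<subseteq> V"
      using frac_fspace_point V by blast
    obtain U' R' p' h' where 2: "(U', R') \<in> B" "w \<in> U'" "p' \<in> R'" "h' \<in> R'" "h' w \<noteq> 0"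
        "\<forall>z\<in>V \<inter> U'. h' z \<noteq> 0 \<longrightarrow> g z = p' z / h' z"
      using V(2,3) unfolding mem_regf_frac_fspace by blast
    obtain R'' where 3: "(U \<inter> U', R'') \<in> B" "\<And>f g. f \<in> R \<Longrightarrow> g \<in> R' \<Longrightarrow> (\<lambda>x. f x * g x) \<in> R''"
      using frac_base_mult[OF 1(1) 2(1)] by blast
    \<comment> \<open>The extra factor \<open>h\<close> above and below confines the nonvanishing
      locus of the denominator to \<open>V\<close>, where \<open>g\<close> is the known
      fraction.\<close>
    show "\<exists>U R g h. (U, R) \<in> B \<and> w \<in> U \<and> g \<in> R \<and> h \<in> R \<and> h w \<noteq> 0 \<and>
        (\<forall>z\<in>W \<inter> U. h z \<noteq> 0 \<longrightarrow> f z = g z / h z)"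
      using 1 2 3 V
      by (intro ex4I[where a = "U \<inter> U'" and b = R'' and c = "\<lambda>z. h z * p' z" and d = "\<lambda>z. h z * h' z"]) auto
  qed
next
  fix W f assume W: "openin (ftop (frac_fspace B)) W" and f: "f \<in> regf (frac_fspace B) W"
  have *: "\<exists>U R g h. (U, R) \<in> B \<and> w \<in> U \<and> g \<in> R \<and> h \<in> R \<and> h w \<noteq> 0 \<and> g w \<noteq> 0 \<and>
      {x \<in> U. h x \<noteq> 0} \<subseteq> W \<and> (\<forall>z\<in>U. h z \<noteq> 0 \<longrightarrow> f z = g z / h z)" if w: "w \<in> W" "f w \<noteq> 0" for w
  proof -
    obtain U R h where 1: "(U, R) \<in> B" "h \<in> R" "w \<in> U" "h w \<noteq> 0" "{x \<in> U. h x \<noteq> 0} \<subseteq> W"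
      using frac_fspace_point[OF W w(1)] by blast
    obtain U' R' p' h' where 2: "(U', R') \<in> B" "w \<in> U'" "p' \<in> R'" "h' \<in> R'" "h' w \<noteq> 0"
        "\<forall>z\<in>W \<inter> U'. h' z \<noteq> 0 \<longrightarrow> f z = p' z / h' z"
      using f w(1) unfolding mem_regf_frac_fspace by blast
    obtain R'' where 3: "(U \<inter> U', R'') \<in> B" "\<And>f g. f \<in> R \<Longrightarrow> g \<in> R' \<Longrightarrow> (\<lambda>x. f x * g x) \<in> R''"
      using frac_base_mult[OF 1(1) 2(1)] by blast
    have "p' w \<noteq> 0" using 2 w by auto
    then show ?thesis
      using 1 2 3
      by (intro ex4I[where a = "U \<inter> U'" and b = R'' and c = "\<lambda>z. h z * p' z" and d = "\<lambda>z. h z * h' z"]) auto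
  qed
  show "openin (ftop (frac_fspace B)) {x \<in> W. f x \<noteq> 0}" unfolding openin_frac_fspace
  proof
    fix w assume "w \<in> {x \<in> W. f x \<noteq> 0}"
    then have w: "w \<in> W" "f w \<noteq> 0" by auto
    obtain U R g h where 1: "(U, R) \<in> B" "w \<in> U" "g \<in> R" "h \<in> R" "h w \<noteq> 0" "g w \<noteq> 0"
      "{x \<in> U. h x \<noteq> 0} \<subseteq> W" "\<forall>z\<in>U. h z \<noteq> 0 \<longrightarrow> f z = g z / h z" using *[OF w] by blast
    obtain R'' where 3: "(U \<inter> U, R'') \<in> B" "\<And>f g. f \<in> R \<Longrightarrow> g \<in> R \<Longrightarrow> (\<lambda>x. f x * g x) \<in> R''"
      using frac_base_mult[OF 1(1) 1(1)] by blast
    show "\<exists>U R h. (U, R) \<in> B \<and> h \<in> R \<and> w \<in> U \<and> h w \<noteq> 0 \<and> {x \<in> U. h x \<noteq> 0} \<subseteq> {x \<in> W. f x \<noteq> 0}"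
      using 1 3 by (intro exI[of _ U] exI[of _ R''] exI[of _ "\<lambda>x. g x * h x"]) auto
  qed
  assume nz: "\<And>x. x \<in> W \<Longrightarrow> f x \<noteq> 0"
  show "(\<lambda>x. inverse (f x)) \<in> regf (frac_fspace B) W" unfolding mem_regf_frac_fspace
  proof
    fix w assume w: "w \<in> W"
    obtain U R g h where 1: "(U, R) \<in> B" "w \<in> U" "g \<in> R" "h \<in> R" "h w \<noteq> 0" "g w \<noteq> 0"
      "{x \<in> U. h x \<noteq> 0} \<subseteq> W" "\<forall>z\<in>U. h z \<noteq> 0 \<longrightarrow> f z = g z / h z" using *[OF w nz[OF w]] by blast
    obtain R'' where 3: "(U \<inter> U, R'') \<in> B" "\<And>f g. f \<in> R \<Longrightarrow> g \<in> R \<Longrightarrow> (\<lambda>x. f x * g x) \<in> R''"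
      using frac_base_mult[OF 1(1) 1(1)] by blast
    \<comment> \<open>The inverse of g / h is written as h^2 / (g h): where g h does not vanish,
      neither does h, so the formula for \<open>f\<close> applies there.\<close>
    show "\<exists>U R g h. (U, R) \<in> B \<and> w \<in> U \<and> g \<in> R \<and> h \<in> R \<and> h w \<noteq> 0 \<and>
        (\<forall>z\<in>W \<inter> U. h z \<noteq> 0 \<longrightarrow> inverse (f z) = g z / h z)"
      using 1 3 by (intro ex4I[where a = U and b = R'' and c = "\<lambda>x. h x * h x" and d = "\<lambda>x. g x * h x"]) auto
  qed
qed

text \<open>Only ratios of elements of \<open>R\<close> are regular functions, so a pullback of a
  single element may fail to be regular. The factor \<open>u\<close>, common to all of
  \<open>R\<close>, corrects this and cancels in every ratio. On projective space it undoes the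
  arbitrary choice of representatives.\<close>

lemma fmorphism_frac_fspace:
  assumes "function_sheaf X"
    and "\<And>x. x \<in> pts X \<Longrightarrow> \<exists>U R h. (U, R) \<in> B \<and> h \<in> R \<and> f x \<in> U \<and> h (f x) \<noteq> 0"
    and op: "\<And>U R. (U, R) \<in> B \<Longrightarrow> openin (ftop X) {x \<in> pts X. f x \<in> U}"
    and reg: "\<And>U R. (U, R) \<in> B \<Longrightarrow> \<exists>u. (\<forall>x\<in>pts X. f x \<in> U \<longrightarrow> u x \<noteq> 0) \<and>
       (\<forall>h\<in>R. (\<lambda>x. u x * h (f x)) \<in> regf X {x \<in> pts X. f x \<in> U})"
  shows "fmorphism X (frac_fspace B) f"
proof -
  interpret function_sheaf X by fact
  have basic: "openin (ftop X) {x \<in> pts X. f x \<in> U \<and> h (f x) \<noteq> 0}" if UR: "(U, R) \<in> B" "h \<in> R" for U R h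
  proof -
    obtain u where u: "\<forall>x\<in>pts X. f x \<in> U \<longrightarrow> u x \<noteq> 0"
       "\<forall>h\<in>R. (\<lambda>x. u x * h (f x)) \<in> regf X {x \<in> pts X. f x \<in> U}" using reg UR by meson
    have "openin (ftop X) {x \<in> {x \<in> pts X. f x \<in> U}. u x * h (f x) \<noteq> 0}"
      using open_nonzero[OF op[OF UR(1)]] u UR by blast
    also have "{x \<in> {x \<in> pts X. f x \<in> U}. u x * h (f x) \<noteq> 0} = {x \<in> pts X. f x \<in> U \<and> h (f x) \<noteq> 0}"
      using u by auto
    finally show ?thesis .
  qed
  have pre: "openin (ftop X) {x \<in> pts X. f x \<in> W}" if W: "openin (ftop (frac_fspace B)) W" for W
  proof (rule openin_subopen[THEN iffD2], rule ballI)
    fix x assume x: "x \<in> {x \<in> pts X. f x \<in> W}"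
    then obtain U R h where 1: "(U, R) \<in> B" "h \<in> R" "f x \<in> U" "h (f x) \<noteq> 0" "{x \<in> U. h x \<noteq> 0} \<subseteq> W"
      using frac_fspace_point[OF W] by blast
    show "\<exists>T. openin (ftop X) T \<and> x \<in> T \<and> T \<subseteq> {x \<in> pts X. f x \<in> W}"
      using 1 x basic by (intro exI[of _ "{x \<in> pts X. f x \<in> U \<and> h (f x) \<noteq> 0}"]) auto
  qed
  have cont: "continuous_map (ftop X) (ftop (frac_fspace B)) f"
    unfolding continuous_map_def
  proof (intro conjI allI impI)
    have "f x \<in> pts (frac_fspace B)" if x: "x \<in> pts X" for x
    proof -
      obtain U R h where 1: "(U, R) \<in> B" "h \<in> R" "f x \<in> U" "h (f x) \<noteq> 0" using assms(2)[OF x] by blast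
      then show ?thesis using openin_subset[OF openin_frac_basic[OF 1(1,2)]] by auto
    qed
    then show "f \<in> pts X \<rightarrow> pts (frac_fspace B)" by blast
  qed (use pre in auto)
  have "p \<circ> f \<in> regf X {x \<in> pts X. f x \<in> V}"
    if V: "openin (ftop (frac_fspace B)) V" "p \<in> regf (frac_fspace B) V" for V p
  proof (rule regf_local[OF pre[OF V(1)]])
    fix x assume x: "x \<in> {x \<in> pts X. f x \<in> V}"
    then obtain U R g h where 1: "(U, R) \<in> B" "f x \<in> U" "g \<in> R" "h \<in> R" "h (f x) \<noteq> 0"
      "\<forall>z\<in>V \<inter> U. h z \<noteq> 0 \<longrightarrow> p z = g z / h z"
      using V(2) unfolding mem_regf_frac_fspace by blast
    obtain u where u: "\<forall>x\<in>pts X. f x \<in> U \<longrightarrow> u x \<noteq> 0"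
       "\<forall>h\<in>R. (\<lambda>x. u x * h (f x)) \<in> regf X {x \<in> pts X. f x \<in> U}" using reg 1(1) by meson
    let ?D = "{x \<in> pts X. f x \<in> U \<and> h (f x) \<noteq> 0}"
    have D: "openin (ftop X) ?D" using basic 1 by blast
    have "(\<lambda>x. (u x * g (f x)) / (u x * h (f x))) \<in> regf X ?D"
      by (rule regf_divide[OF D]; (rule regf_restrict[OF op[OF 1(1)] D])?) (use u 1 in auto)
    then show "\<exists>V' g. openin (ftop X) V' \<and> x \<in> V' \<and> g \<in> regf X V' \<and>
        (\<forall>y\<in>V' \<inter> {x \<in> pts X. f x \<in> V}. (p \<circ> f) y = g y)"
      using D 1 x u by (intro exI[of _ ?D] exI[of _ "\<lambda>x. (u x * g (f x)) / (u x * h (f x))"]) auto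
  qed
  with cont show ?thesis unfolding fmorphism_def by blast
qed

end

section \<open>Morphisms\<close>

lemma fmorphism_comp:
  assumes "fmorphism X Y' f" "fmorphism Y' Z g"
  shows "fmorphism X Z (g \<circ> f)"
  unfolding fmorphism_def
proof (intro conjI allI impI)
  show "continuous_map (ftop X) (ftop Z) (g \<circ> f)"
    using continuous_map_compose[OF assms[unfolded fmorphism_def, THEN conjunct1]] .
  fix V h assume V: "openin (ftop Z) V" "h \<in> regf Z V"
  have "h \<circ> g \<in> regf Y' {x \<in> pts Y'. g x \<in> V}" "openin (ftop Y') {x \<in> pts Y'. g x \<in> V}"
    using assms(2) V unfolding fmorphism_def continuous_map_def by blast+
  then have "h \<circ> g \<circ> f \<in> regf X {x \<in> pts X. f x \<in> {x \<in> pts Y'. g x \<in> V}}"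
    using assms(1) unfolding fmorphism_def by blast
  moreover have "{x \<in> pts X. f x \<in> {x \<in> pts Y'. g x \<in> V}} = {x \<in> pts X. (g \<circ> f) x \<in> V}"
    using assms(1) unfolding fmorphism_def continuous_map_def by auto
  ultimately show "h \<circ> (g \<circ> f) \<in> regf X {x \<in> pts X. (g \<circ> f) x \<in> V}" by (simp add: o_assoc)
qed

lemma fmorphism_pts: "fmorphism X Y' f \<Longrightarrow> x \<in> pts X \<Longrightarrow> f x \<in> pts Y'"
  unfolding fmorphism_def continuous_map_def by blast

lemma fmorphism_open: "fmorphism X Y' f \<Longrightarrow> openin (ftop Y') V \<Longrightarrow> openin (ftop X) {x \<in> pts X. f x \<in> V}"
  unfolding fmorphism_def continuous_map_def by blast

lemma fmorphism_regf: "fmorphism X Y' f \<Longrightarrow> openin (ftop Y') V \<Longrightarrow> g \<in> regf Y' V \<Longrightarrow> g \<circ> f \<in> regf X {x \<in> pts X. f x \<in> V}"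
  unfolding fmorphism_def by blast

lemma pts_sub_fspace [simp]: "pts (sub_fspace X A) = pts X \<inter> A"
  unfolding sub_fspace_def by simp

lemma mem_regf_sub_fspace: "f \<in> regf (sub_fspace X A) W \<longleftrightarrow>
   (\<forall>x\<in>W. \<exists>U g. openin (ftop X) U \<and> x \<in> U \<and> g \<in> regf X U \<and> (\<forall>y \<in> U \<inter> W. f y = g y))"
  unfolding sub_fspace_def by simp

context function_sheaf
begin

lemma openin_sub_fspace:
  assumes "openin (ftop X) A"
  shows "openin (ftop (sub_fspace X A)) W \<longleftrightarrow> openin (ftop X) W \<and> W \<subseteq> A"
  using assms unfolding sub_fspace_def by (simp add: openin_open_subtopology)

lemma regf_sub_fspace:
  assumes "openin (ftop X) A" "openin (ftop X) W"
  shows "regf (sub_fspace X A) W = regf X W"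
proof (intro subset_antisym subsetI)
  fix f assume "f \<in> regf (sub_fspace X A) W"
  then show "f \<in> regf X W"
    unfolding mem_regf_sub_fspace by (intro regf_local[OF assms(2)]) blast
next
  fix f assume "f \<in> regf X W"
  then show "f \<in> regf (sub_fspace X A) W"
    unfolding mem_regf_sub_fspace using assms(2) by blast
qed

lemma function_sheaf_sub_fspace:
  assumes A: "openin (ftop X) A"
  shows "function_sheaf (sub_fspace X A)"
proof
  fix W c assume "openin (ftop (sub_fspace X A)) W"
  then show "(\<lambda>_. c) \<in> regf (sub_fspace X A) W"
    using regf_const A by (simp add: openin_sub_fspace regf_sub_fspace)
next
  fix W f g assume "openin (ftop (sub_fspace X A)) W" "f \<in> regf (sub_fspace X A) W" "g \<in> regf (sub_fspace X A) W"
  then show "(\<lambda>x. f x + g x) \<in> regf (sub_fspace X A) W" "(\<lambda>x. f x * g x) \<in> regf (sub_fspace X A) W"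
    using regf_add regf_mult A by (simp_all add: openin_sub_fspace regf_sub_fspace)
next
  fix U V f assume "openin (ftop (sub_fspace X A)) U" "openin (ftop (sub_fspace X A)) V" "V \<subseteq> U"
    "f \<in> regf (sub_fspace X A) U"
  then show "f \<in> regf (sub_fspace X A) V"
    using regf_restrict[of U V f] A by (auto simp: openin_sub_fspace regf_sub_fspace)
next
  fix U f assume U: "openin (ftop (sub_fspace X A)) U"
    and loc: "\<And>x. x \<in> U \<Longrightarrow> \<exists>V g. openin (ftop (sub_fspace X A)) V \<and> x \<in> V \<and> g \<in> regf (sub_fspace X A) V \<and>
      (\<forall>y\<in>V \<inter> U. f y = g y)"
  from U have U': "openin (ftop X) U" by (simp add: openin_sub_fspace[OF A])
  have "f \<in> regf X U"
  proof (rule regf_local[OF U'])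
    fix x assume "x \<in> U"
    then obtain V g where V: "openin (ftop (sub_fspace X A)) V" "x \<in> V" "g \<in> regf (sub_fspace X A) V"
      "\<forall>y\<in>V \<inter> U. f y = g y" using loc by blast
    then have V': "openin (ftop X) V" by (simp add: openin_sub_fspace[OF A])
    with V show "\<exists>V g. openin (ftop X) V \<and> x \<in> V \<and> g \<in> regf X V \<and> (\<forall>y\<in>V \<inter> U. f y = g y)"
      using regf_sub_fspace[OF A V'] by auto
  qed
  then show "f \<in> regf (sub_fspace X A) U" using regf_sub_fspace[OF A U'] by simp
next
  fix U f assume "openin (ftop (sub_fspace X A)) U" "f \<in> regf (sub_fspace X A) U"
  then show "openin (ftop (sub_fspace X A)) {x \<in> U. f x \<noteq> 0}"
    using open_nonzero[of U f] A by (auto simp: openin_sub_fspace regf_sub_fspace)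
next
  fix U f assume "openin (ftop (sub_fspace X A)) U" "f \<in> regf (sub_fspace X A) U" "\<And>x. x \<in> U \<Longrightarrow> f x \<noteq> 0"
  then show "(\<lambda>x. inverse (f x)) \<in> regf (sub_fspace X A) U"
    using regf_inverse[of U f] A by (auto simp: openin_sub_fspace regf_sub_fspace)
qed

lemma fmorphism_local:
  assumes "\<And>x. x \<in> pts X \<Longrightarrow> \<exists>A. openin (ftop X) A \<and> x \<in> A \<and> fmorphism (sub_fspace X A) Y' f"
  shows "fmorphism X Y' f"
proof -
  have pre: "openin (ftop X) {x \<in> pts X. f x \<in> V}" if V: "openin (ftop Y') V" for V
  proof (rule openin_subopen[THEN iffD2], rule ballI)
    fix x assume x: "x \<in> {x \<in> pts X. f x \<in> V}"
    then obtain A where A: "openin (ftop X) A" "x \<in> A" "fmorphism (sub_fspace X A) Y' f"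
      using assms by blast
    from fmorphism_open[OF A(3) V] have "openin (ftop X) {x \<in> pts X \<inter> A. f x \<in> V}"
      by (simp add: openin_sub_fspace[OF A(1)])
    then show "\<exists>T. openin (ftop X) T \<and> x \<in> T \<and> T \<subseteq> {x \<in> pts X. f x \<in> V}"
      using x A(2) by (intro exI[of _ "{x \<in> pts X \<inter> A. f x \<in> V}"]) auto
  qed
  show ?thesis unfolding fmorphism_def continuous_map_def
  proof (intro conjI allI impI)
    have "f x \<in> pts Y'" if x: "x \<in> pts X" for x
    proof -
      obtain A where A: "openin (ftop X) A" "x \<in> A" "fmorphism (sub_fspace X A) Y' f"
        using assms x by blast
      then show ?thesis using fmorphism_pts[OF A(3), of x] x by simp
    qed
    then show "f \<in> pts X \<rightarrow> pts Y'" by blast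
    fix V g assume V: "openin (ftop Y') V" "g \<in> regf Y' V"
    show "g \<circ> f \<in> regf X {x \<in> pts X. f x \<in> V}"
    proof (rule regf_local[OF pre[OF V(1)]])
      fix x assume x: "x \<in> {x \<in> pts X. f x \<in> V}"
      then obtain A where A: "openin (ftop X) A" "x \<in> A" "fmorphism (sub_fspace X A) Y' f"
        using assms by blast
      let ?D = "{x \<in> pts X \<inter> A. f x \<in> V}"
      have D: "openin (ftop X) ?D"
        using fmorphism_open[OF A(3) V(1)] by (simp add: openin_sub_fspace[OF A(1)])
      have "g \<circ> f \<in> regf X ?D"
        using fmorphism_regf[OF A(3) V] regf_sub_fspace[OF A(1) D] by simp
      then show "\<exists>Va ga. openin (ftop X) Va \<and> x \<in> Va \<and> ga \<in> regf X Va \<and>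
          (\<forall>y\<in>Va \<inter> {x \<in> pts X. f x \<in> V}. (g \<circ> f) y = ga y)"
        using D x A(2) by (intro exI[of _ ?D] exI[of _ "g \<circ> f"]) auto
    qed
  qed (use pre in auto)
qed

lemma fmorphism_cong:
  assumes "fmorphism X Y' f" "\<And>x. x \<in> pts X \<Longrightarrow> f x = g x"
  shows "fmorphism X Y' g"
proof -
  have *: "{x \<in> pts X. g x \<in> V} = {x \<in> pts X. f x \<in> V}" for V using assms(2) by auto
  have "continuous_map (ftop X) (ftop Y') g"
    using assms continuous_map_eq unfolding fmorphism_def by blast
  moreover have "h \<circ> g \<in> regf X {x \<in> pts X. g x \<in> V}" if V: "openin (ftop Y') V" "h \<in> regf Y' V" for V h
    unfolding * by (rule regf_cong[OF fmorphism_open[OF assms(1) V(1)] fmorphism_regf[OF assms(1) V]])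
      (use assms(2) in auto)
  ultimately show ?thesis unfolding fmorphism_def by blast
qed

lemma fmorphism_sub_fspace:
  assumes "openin (ftop X) A" "fmorphism X Y' f"
  shows "fmorphism (sub_fspace X A) Y' f"
  unfolding fmorphism_def
proof (intro conjI allI impI)
  show "continuous_map (ftop (sub_fspace X A)) (ftop Y') f"
    using assms(2) unfolding fmorphism_def sub_fspace_def by (simp add: continuous_map_from_subtopology)
  fix V g assume V: "openin (ftop Y') V" "g \<in> regf Y' V"
  have eq: "{x \<in> pts (sub_fspace X A). f x \<in> V} = A \<inter> {x \<in> pts X. f x \<in> V}" by auto
  have op: "openin (ftop X) (A \<inter> {x \<in> pts X. f x \<in> V})"
    using fmorphism_open[OF assms(2) V(1)] assms(1) by blast
  show "g \<circ> f \<in> regf (sub_fspace X A) {x \<in> pts (sub_fspace X A). f x \<in> V}"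
    unfolding eq regf_sub_fspace[OF assms(1) op]
    using regf_restrict[OF fmorphism_open[OF assms(2) V(1)] op _ fmorphism_regf[OF assms(2) V]] by blast
qed

end

section \<open>Products, projective spaces and quotients\<close>

text \<open>As a space of fractions the product inherits the axioms of \<open>function_sheaf\<close>
  and the criterion for morphisms into it.\<close>

lemma prod_fspace_eq_frac:
  "prod_fspace X Y' = frac_fspace {(U \<times> V, tensor_funs X Y' U V) | U V. openin (ftop X) U \<and> openin (ftop Y') V}"
  unfolding prod_fspace_def frac_fspace_def
  apply (rule arg_cong2[where f = "\<lambda>a b. \<lparr>ftop = topology_generated_by a, regf = b\<rparr>"])
  subgoal
    apply (intro Collect_cong iffI; elim exE conjE)
    subgoal for A U V h
      by (intro exI[of _ "U \<times> V"] exI[of _ "tensor_funs X Y' U V"] exI[of _ h]) auto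
    subgoal for A R S h
      by (elim CollectE exE conjE) auto
    done
  subgoal
    apply (intro ext Collect_cong ball_cong refl)
    apply (rule iffI)
     apply (elim exE conjE)
    subgoal for W f w U V g h
      by (rule ex4I[where a = "U \<times> V" and b = "tensor_funs X Y' U V" and c = g and d = h]) auto
    apply (elim exE conjE CollectE)
    subgoal for W f w A R g h U V
      by (rule ex4I[where a = U and b = V and c = g and d = h]) auto
    done
  done

lemma tensor_funs_simple: "a \<in> regf X U \<Longrightarrow> b \<in> regf Y' V \<Longrightarrow> (\<lambda>(x, y). a x * b y) \<in> tensor_funs X Y' U V"
  unfolding tensor_funs_def
  by (intro CollectI exI[of _ "1::nat"] exI[of _ "\<lambda>_. a"] exI[of _ "\<lambda>_. b"]) auto

lemma sum_lessThan_add: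
  fixes f :: "nat \<Rightarrow> 'b::comm_monoid_add"
  shows "(\<Sum>i<N+M. f i) = (\<Sum>i<N. f i) + (\<Sum>i<M. f (N + i))"
  by (induction M) (simp_all add: add.assoc)

lemma prod_lessThan_add: "(\<Prod>i<l + m. g i) = (\<Prod>i<l. g i) * (\<Prod>i<m. g (l + i))"
  for g :: "nat \<Rightarrow> 'b::comm_monoid_mult"
  by (induction m) (simp_all add: mult.assoc)

text \<open>The index \<open>i div q\<close> is constant on blocks of length \<open>q\<close>. With
  \<open>l = k\<close> this is the determinant of a block-constant diagonal matrix without its last
  coordinate.\<close>

lemma prod_blocks: "(\<Prod>i<l * q. \<alpha> (i div q)) = (\<Prod>b<l. \<alpha> b ^ q)" for \<alpha> :: "nat \<Rightarrow> complex"
proof (induction l)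
  case (Suc l)
  have "(\<Prod>i<l * q + q. \<alpha> (i div q)) = (\<Prod>i<l * q. \<alpha> (i div q)) * (\<Prod>i<q. \<alpha> ((l * q + i) div q))"
    by (rule prod_lessThan_add)
  also have "(\<Prod>i<q. \<alpha> ((l * q + i) div q)) = (\<Prod>i<q. \<alpha> l)" by (intro prod.cong) auto
  finally show ?case using Suc by (simp add: add.commute)
qed simp

lemma tensor_funs_add:
  assumes "f \<in> tensor_funs X Y' U V" "g \<in> tensor_funs X Y' U V"
  shows "(\<lambda>z. f z + g z) \<in> tensor_funs X Y' U V"
proof -
  obtain N a b where 1: "\<forall>i<N. a i \<in> regf X U \<and> b i \<in> regf Y' V" "f = (\<lambda>(x, y). \<Sum>i<N::nat. a i x * b i y)"
    using assms(1) unfolding tensor_funs_def by blast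
  obtain M a' b' where 2: "\<forall>i<M. a' i \<in> regf X U \<and> b' i \<in> regf Y' V" "g = (\<lambda>(x, y). \<Sum>i<M::nat. a' i x * b' i y)"
    using assms(2) unfolding tensor_funs_def by blast
  have 3: "(\<Sum>i<N+M. (if i < N then a i else a' (i - N)) x * (if i < N then b i else b' (i - N)) y) =
     (\<Sum>i<N. a i x * b i y) + (\<Sum>i<M. a' i x * b' i y)" for x y
    by (subst sum_lessThan_add) simp
  show ?thesis unfolding tensor_funs_def
    apply (intro CollectI exI[of _ "N+M"] exI[of _ "\<lambda>i. if i < N then a i else a' (i - N)"]
      exI[of _ "\<lambda>i. if i < N then b i else b' (i - N)"])
    using 1 2 3 by (auto simp: fun_eq_iff)
qed

lemma tensor_funs_sum:
  assumes "finite I" "\<And>i. i \<in> I \<Longrightarrow> f i \<in> tensor_funs X Y' U V"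
  shows "(\<lambda>z. \<Sum>i\<in>I. f i z) \<in> tensor_funs X Y' U V"
  using assms
proof (induction I)
  case empty
  show ?case unfolding tensor_funs_def by (intro CollectI exI[of _ "0::nat"]) auto
next
  case (insert i I)
  then show ?case using tensor_funs_add[of "f i" X Y' U V "\<lambda>z. \<Sum>i\<in>I. f i z"] by simp
qed

locale function_sheaf_pair = X: function_sheaf X + Y: function_sheaf Y'
  for X :: "'a fspace" and Y' :: "'b fspace"
begin

lemma tensor_funs_mult:
  assumes "openin (ftop X) U" "openin (ftop Y') V" "openin (ftop X) U'" "openin (ftop Y') V'"
    and "f \<in> tensor_funs X Y' U V" "g \<in> tensor_funs X Y' U' V'"
  shows "(\<lambda>z. f z * g z) \<in> tensor_funs X Y' (U \<inter> U') (V \<inter> V')"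
proof -
  obtain N a b where 1: "\<forall>i<N. a i \<in> regf X U \<and> b i \<in> regf Y' V" "f = (\<lambda>(x, y). \<Sum>i<N::nat. a i x * b i y)"
    using assms(5) unfolding tensor_funs_def by blast
  obtain M a' b' where 2: "\<forall>i<M. a' i \<in> regf X U' \<and> b' i \<in> regf Y' V'" "g = (\<lambda>(x, y). \<Sum>i<M::nat. a' i x * b' i y)"
    using assms(6) unfolding tensor_funs_def by blast
  have open_Int: "openin (ftop X) (U \<inter> U')" "openin (ftop Y') (V \<inter> V')" using assms by auto
  have "(\<lambda>z. \<Sum>i<N. \<Sum>j<M. (\<lambda>(x, y). (a i x * a' j x) * (b i y * b' j y)) z) \<in> tensor_funs X Y' (U \<inter> U') (V \<inter> V')"
  proof (intro tensor_funs_sum tensor_funs_simple X.regf_mult Y.regf_mult open_Int)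
    fix i j assume "i \<in> {..<N}" "j \<in> {..<M}"
    then show "a i \<in> regf X (U \<inter> U')" "b i \<in> regf Y' (V \<inter> V')"
      "a' j \<in> regf X (U \<inter> U')" "b' j \<in> regf Y' (V \<inter> V')"
      using 1 2 X.regf_restrict[OF assms(1) open_Int(1)] X.regf_restrict[OF assms(3) open_Int(1)]
        Y.regf_restrict[OF assms(2) open_Int(2)] Y.regf_restrict[OF assms(4) open_Int(2)] by auto
  qed auto
  also have "(\<lambda>z. \<Sum>i<N. \<Sum>j<M. (\<lambda>(x, y). (a i x * a' j x) * (b i y * b' j y)) z) = (\<lambda>z. f z * g z)"
    unfolding 1(2) 2(2) by (auto simp: fun_eq_iff sum_product intro!: sum.cong)
  finally show ?thesis .
qed

lemma frac_base_prod:
  "frac_base {(U \<times> V, tensor_funs X Y' U V) | U V. openin (ftop X) U \<and> openin (ftop Y') V}"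
  unfolding frac_base_def
proof (intro conjI allI impI ballI)
  let ?B = "{(U \<times> V, tensor_funs X Y' U V) | U V. openin (ftop X) U \<and> openin (ftop Y') V}"
  fix A R A' R' assume "(A, R) \<in> ?B" "(A', R') \<in> ?B"
  then obtain U V U' V' where *: "A = U \<times> V" "R = tensor_funs X Y' U V" "openin (ftop X) U" "openin (ftop Y') V"
    "A' = U' \<times> V'" "R' = tensor_funs X Y' U' V'" "openin (ftop X) U'" "openin (ftop Y') V'" by auto
  have "(A \<inter> A', tensor_funs X Y' (U \<inter> U') (V \<inter> V')) \<in> ?B"
    unfolding * using *(3,4,7,8) by (auto simp: Times_Int_Times)
  moreover have "\<forall>f\<in>R. \<forall>g\<in>R'. (\<lambda>x. f x * g x) \<in> tensor_funs X Y' (U \<inter> U') (V \<inter> V')"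
    using tensor_funs_mult * by simp
  ultimately show "\<exists>R''. (A \<inter> A', R'') \<in> ?B \<and> (\<forall>f\<in>R. \<forall>g\<in>R'. (\<lambda>x. f x * g x) \<in> R'')"
    by (intro exI[of _ "tensor_funs X Y' (U \<inter> U') (V \<inter> V')"] conjI)
next
  let ?B = "{(U \<times> V, tensor_funs X Y' U V) | U V. openin (ftop X) U \<and> openin (ftop Y') V}"
  fix A R f assume "(A, R) \<in> ?B" and f: "f \<in> R"
  then obtain U V where *: "A = U \<times> V" "R = tensor_funs X Y' U V" "openin (ftop X) U" "openin (ftop Y') V"
    by auto
  show "(\<lambda>x. f x + g x) \<in> R" if "g \<in> R" for g using that f tensor_funs_add * by auto
  show "(\<lambda>x. c * f x) \<in> R" for c
    using tensor_funs_mult[OF *(3,4,3,4) tensor_funs_simple[OF X.regf_const[OF *(3), of c] Y.regf_const[OF *(4), of 1]]] f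
    by (auto simp: *(2) case_prod_unfold)
qed

lemma function_sheaf_prod_fspace: "function_sheaf (prod_fspace X Y')"
  unfolding prod_fspace_eq_frac by (rule function_sheaf_frac_fspace[OF frac_base_prod])

lemma tensor_funs_const:
  "openin (ftop X) U \<Longrightarrow> openin (ftop Y') V \<Longrightarrow> (\<lambda>_. c) \<in> tensor_funs X Y' U V"
  using tensor_funs_simple[of "\<lambda>_. c" X U "\<lambda>_. 1" Y' V] X.regf_const Y.regf_const by (simp add: case_prod_unfold)

lemma openin_prod_fspace:
  assumes "openin (ftop X) U" "openin (ftop Y') V"
  shows "openin (ftop (prod_fspace X Y')) (U \<times> V)"
  unfolding prod_fspace_eq_frac
  using openin_frac_basic[OF frac_base_prod, of "U \<times> V" "tensor_funs X Y' U V" "\<lambda>_. 1"] assms tensor_funs_const[OF assms]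
  by auto

lemma pts_prod_fspace [simp]: "pts (prod_fspace X Y') = pts X \<times> pts Y'"
proof
  show "pts X \<times> pts Y' \<subseteq> pts (prod_fspace X Y')"
    using openin_subset[OF openin_prod_fspace[OF openin_topspace openin_topspace]] .
  show "pts (prod_fspace X Y') \<subseteq> pts X \<times> pts Y'"
    unfolding prod_fspace_def using openin_subset[of "ftop X"] openin_subset[of "ftop Y'"] by fastforce
qed

lemma tensor_funs_regf:
  assumes "openin (ftop X) U" "openin (ftop Y') V" "f \<in> tensor_funs X Y' U V"
  shows "f \<in> regf (prod_fspace X Y') (U \<times> V)"
  unfolding prod_fspace_eq_frac mem_regf_frac_fspace[OF frac_base_prod]
  using assms tensor_funs_const[OF assms(1,2), of 1]
  by (intro ballI ex4I[where a = "U \<times> V" and b = "tensor_funs X Y' U V" and c = f and d = "\<lambda>_. 1"]) auto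

lemma fmorphism_fst: "fmorphism (prod_fspace X Y') X fst"
  unfolding fmorphism_def continuous_map_def
proof (intro conjI allI impI)
  fix U assume U: "openin (ftop X) U"
  have eq: "{x \<in> pts (prod_fspace X Y'). fst x \<in> U} = U \<times> pts Y'" using openin_subset[OF U] by auto
  show "openin (ftop (prod_fspace X Y')) {x \<in> pts (prod_fspace X Y'). fst x \<in> U}"
    unfolding eq by (rule openin_prod_fspace[OF U openin_topspace])
  fix g assume "g \<in> regf X U"
  then show "g \<circ> fst \<in> regf (prod_fspace X Y') {x \<in> pts (prod_fspace X Y'). fst x \<in> U}"
    unfolding eq
    using tensor_funs_regf[OF U openin_topspace tensor_funs_simple[OF _ Y.regf_const[OF openin_topspace, of 1]]]
    by (simp add: comp_def case_prod_unfold)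
qed auto

lemma fmorphism_snd: "fmorphism (prod_fspace X Y') Y' snd"
  unfolding fmorphism_def continuous_map_def
proof (intro conjI allI impI)
  fix U assume U: "openin (ftop Y') U"
  have eq: "{x \<in> pts (prod_fspace X Y'). snd x \<in> U} = pts X \<times> U" using openin_subset[OF U] by auto
  show "openin (ftop (prod_fspace X Y')) {x \<in> pts (prod_fspace X Y'). snd x \<in> U}"
    unfolding eq by (rule openin_prod_fspace[OF openin_topspace U])
  fix g assume "g \<in> regf Y' U"
  then show "g \<circ> snd \<in> regf (prod_fspace X Y') {x \<in> pts (prod_fspace X Y'). snd x \<in> U}"
    unfolding eq
    using tensor_funs_regf[OF openin_topspace U tensor_funs_simple[OF X.regf_const[OF openin_topspace, of 1]]]
    by (simp add: comp_def case_prod_unfold)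
qed auto

lemma fmorphism_Pair:
  assumes "function_sheaf Z" and f: "fmorphism Z X f" and g: "fmorphism Z Y' g"
  shows "fmorphism Z (prod_fspace X Y') (\<lambda>z. (f z, g z))"
  unfolding prod_fspace_eq_frac
proof (rule fmorphism_frac_fspace[OF frac_base_prod assms(1)])
  let ?B = "{(U \<times> V, tensor_funs X Y' U V) | U V. openin (ftop X) U \<and> openin (ftop Y') V}"
  interpret Z: function_sheaf Z by fact
  fix z assume z: "z \<in> pts Z"
  show "\<exists>U R h. (U, R) \<in> ?B \<and> h \<in> R \<and> (f z, g z) \<in> U \<and> h (f z, g z) \<noteq> 0"
    using tensor_funs_const[OF openin_topspace openin_topspace, of 1] fmorphism_pts[OF f z] fmorphism_pts[OF g z]
    by (intro exI[of _ "pts X \<times> pts Y'"] exI[of _ "tensor_funs X Y' (pts X) (pts Y')"] exI[of _ "\<lambda>_. 1"]) auto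
next
  let ?B = "{(U \<times> V, tensor_funs X Y' U V) | U V. openin (ftop X) U \<and> openin (ftop Y') V}"
  interpret Z: function_sheaf Z by fact
  fix A R assume "(A, R) \<in> ?B"
  then obtain U V where *: "A = U \<times> V" "R = tensor_funs X Y' U V" "openin (ftop X) U" "openin (ftop Y') V"
    by auto
  let ?D = "{z \<in> pts Z. (f z, g z) \<in> A}"
  have D: "?D = {z \<in> pts Z. f z \<in> U} \<inter> {z \<in> pts Z. g z \<in> V}" using * by auto
  show op: "openin (ftop Z) ?D" unfolding D
    by (intro openin_Int fmorphism_open[OF f] fmorphism_open[OF g] *)
  have "(\<lambda>z. h (f z, g z)) \<in> regf Z ?D" if "h \<in> R" for h
  proof -
    have "h \<in> tensor_funs X Y' U V" using that * by simp
    then obtain N a b where 1: "\<forall>i<N. a i \<in> regf X U \<and> b i \<in> regf Y' V" "h = (\<lambda>(x, y). \<Sum>i<N::nat. a i x * b i y)"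
      unfolding tensor_funs_def by blast
    have "(\<lambda>z. \<Sum>i<N. (a i \<circ> f) z * (b i \<circ> g) z) \<in> regf Z ?D"
    proof (intro Z.regf_sum Z.regf_mult op)
      fix i assume "i \<in> {..<N}"
      then show "a i \<circ> f \<in> regf Z ?D" "b i \<circ> g \<in> regf Z ?D"
        using 1 Z.regf_restrict[OF fmorphism_open[OF f *(3)] op _ fmorphism_regf[OF f *(3)]]
          Z.regf_restrict[OF fmorphism_open[OF g *(4)] op _ fmorphism_regf[OF g *(4)]] unfolding D by auto
    qed
    then show ?thesis unfolding 1(2) by simp
  qed
  then show "\<exists>u. (\<forall>z\<in>pts Z. (f z, g z) \<in> A \<longrightarrow> u z \<noteq> 0) \<and> (\<forall>h\<in>R. (\<lambda>z. u z * h (f z, g z)) \<in> regf Z ?D)"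
    by (intro exI[of _ "\<lambda>_. 1"]) auto
qed

end

section \<open>Forms, and projective space as a space of fractions\<close>

lemma hom_polys_scale:
  assumes "F \<in> hom_polys S d"
  shows "F (\<lambda>b. c * v b) = c ^ d * F v"
proof -
  obtain M k where 1: "finite M" "\<forall>\<alpha>\<in>M. (\<Sum>b\<in>S. \<alpha> b) = d"
    "F = (\<lambda>v. \<Sum>\<alpha>\<in>M. k \<alpha> * (\<Prod>b\<in>S. v b ^ \<alpha> b))"
    using assms unfolding hom_polys_def by blast
  have "k \<alpha> * (\<Prod>b\<in>S. (c * v b) ^ \<alpha> b) = c ^ d * (k \<alpha> * (\<Prod>b\<in>S. v b ^ \<alpha> b))" if "\<alpha> \<in> M" for \<alpha>
    using 1(2) that by (auto simp: power_mult_distrib prod.distrib power_sum)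
  then show ?thesis unfolding 1(3) sum_distrib_left by (intro sum.cong refl)
qed

lemma hom_polys_monomial:
  assumes "(\<Sum>b\<in>S. \<alpha> b) = d"
  shows "(\<lambda>v. c * (\<Prod>b\<in>S. v b ^ \<alpha> b)) \<in> hom_polys S d"
  unfolding hom_polys_def using assms
  by (intro CollectI exI[of _ "{\<alpha>}"] exI[of _ "\<lambda>_. c"]) auto

lemma hom_polys_add:
  assumes "F \<in> hom_polys S d" "G \<in> hom_polys S d"
  shows "(\<lambda>v. F v + G v) \<in> hom_polys S d"
proof -
  obtain M k where 1: "finite M" "\<forall>\<alpha>\<in>M. (\<Sum>b\<in>S. \<alpha> b) = d"
    "F = (\<lambda>v. \<Sum>\<alpha>\<in>M. k \<alpha> * (\<Prod>b\<in>S. v b ^ \<alpha> b))"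
    using assms(1) unfolding hom_polys_def by blast
  obtain N l where 2: "finite N" "\<forall>\<alpha>\<in>N. (\<Sum>b\<in>S. \<alpha> b) = d"
    "G = (\<lambda>v. \<Sum>\<alpha>\<in>N. l \<alpha> * (\<Prod>b\<in>S. v b ^ \<alpha> b))"
    using assms(2) unfolding hom_polys_def by blast
  let ?k = "\<lambda>\<alpha>. (if \<alpha> \<in> M then k \<alpha> else 0) + (if \<alpha> \<in> N then l \<alpha> else 0)"
  have "(\<Sum>\<alpha>\<in>M \<union> N. ?k \<alpha> * (\<Prod>b\<in>S. v b ^ \<alpha> b)) = F v + G v" for v
  proof -
    have "(\<Sum>\<alpha>\<in>M \<union> N. (if \<alpha> \<in> M then k \<alpha> else 0) * (\<Prod>b\<in>S. v b ^ \<alpha> b)) = F v"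
      unfolding 1(3) using 1(1) 2(1) by (intro sum.mono_neutral_cong_right) auto
    moreover have "(\<Sum>\<alpha>\<in>M \<union> N. (if \<alpha> \<in> N then l \<alpha> else 0) * (\<Prod>b\<in>S. v b ^ \<alpha> b)) = G v"
      unfolding 2(3) using 1(1) 2(1) by (intro sum.mono_neutral_cong_right) auto
    ultimately show ?thesis by (simp add: distrib_right sum.distrib)
  qed
  then show ?thesis unfolding hom_polys_def using 1(1,2) 2(1,2)
    by (intro CollectI exI[of _ "M \<union> N"] exI[of _ ?k]) auto
qed

lemma hom_polys_zero: "(\<lambda>_. 0) \<in> hom_polys S d"
  unfolding hom_polys_def by (intro CollectI exI[of _ "{}"]) auto

lemma hom_polys_sum:
  assumes "finite I" "\<And>i. i \<in> I \<Longrightarrow> F i \<in> hom_polys S d"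
  shows "(\<lambda>v. \<Sum>i\<in>I. F i v) \<in> hom_polys S d"
  using assms by (induction I) (auto simp: hom_polys_zero intro!: hom_polys_add)

lemma hom_polys_mult:
  assumes "F \<in> hom_polys S d" "G \<in> hom_polys S e"
  shows "(\<lambda>v. F v * G v) \<in> hom_polys S (d + e)"
proof -
  obtain M k where 1: "finite M" "\<forall>\<alpha>\<in>M. (\<Sum>b\<in>S. \<alpha> b) = d"
    "F = (\<lambda>v. \<Sum>\<alpha>\<in>M. k \<alpha> * (\<Prod>b\<in>S. v b ^ \<alpha> b))"
    using assms(1) unfolding hom_polys_def by blast
  obtain N l where 2: "finite N" "\<forall>\<alpha>\<in>N. (\<Sum>b\<in>S. \<alpha> b) = e"
    "G = (\<lambda>v. \<Sum>\<alpha>\<in>N. l \<alpha> * (\<Prod>b\<in>S. v b ^ \<alpha> b))"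
    using assms(2) unfolding hom_polys_def by blast
  have "(\<lambda>v. \<Sum>\<alpha>\<in>M. \<Sum>\<beta>\<in>N. (k \<alpha> * l \<beta>) * (\<Prod>b\<in>S. v b ^ (\<alpha> b + \<beta> b))) \<in> hom_polys S (d + e)"
    using 1(1,2) 2(1,2) by (intro hom_polys_sum hom_polys_monomial) (auto simp: sum.distrib)
  also have "(\<lambda>v. \<Sum>\<alpha>\<in>M. \<Sum>\<beta>\<in>N. (k \<alpha> * l \<beta>) * (\<Prod>b\<in>S. v b ^ (\<alpha> b + \<beta> b))) = (\<lambda>v. F v * G v)"
    unfolding 1(3) 2(3) by (auto simp: fun_eq_iff sum_product power_add prod.distrib mult_ac intro!: sum.cong)
  finally show ?thesis .
qed

lemma hom_polys_const: "(\<lambda>_. c) \<in> hom_polys S 0"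
  using hom_polys_monomial[of "\<lambda>_. 0" S 0 c] by simp

lemma hom_polys_coord:
  assumes "finite S" "b \<in> S"
  shows "(\<lambda>v. v b) \<in> hom_polys S 1"
proof -
  have "(\<Prod>a\<in>S. v a ^ (if a = b then 1 else 0)) = v b" for v :: "'a \<Rightarrow> complex"
    using assms by (subst prod.remove[of _ b]) (auto intro!: prod.neutral)
  then show ?thesis
    using hom_polys_monomial[of "\<lambda>a. if a = b then 1 else 0" S 1 1] assms by (simp add: fun_eq_iff cong: if_cong)
qed

lemma hom_polys_power:
  assumes "F \<in> hom_polys S d"
  shows "(\<lambda>v. F v ^ n) \<in> hom_polys S (n * d)"
  by (induction n) (simp_all add: hom_polys_const hom_polys_mult[OF assms])

lemma hom_polys_prod:
  assumes "finite I" "\<And>i. i \<in> I \<Longrightarrow> F i \<in> hom_polys S (d i)"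
  shows "(\<lambda>v. \<Prod>i\<in>I. F i v) \<in> hom_polys S (\<Sum>i\<in>I. d i)"
  using assms by (induction I) (auto simp: hom_polys_const intro!: hom_polys_mult)

lemma pt_class_self: "v \<in> pt_class v"
  unfolding pt_class_def by (intro CollectI exI[of _ 1]) simp

lemma mem_pt_class: "w \<in> pt_class v \<longleftrightarrow> (\<exists>c. c \<noteq> 0 \<and> w = (\<lambda>b. c * v b))"
  unfolding pt_class_def by blast

lemma pt_class_scale:
  assumes "c \<noteq> 0" "\<And>b. w b = c * v b"
  shows "pt_class w = pt_class v"
proof -
  have "(\<exists>e. e \<noteq> 0 \<and> u = (\<lambda>b. e * w b)) \<longleftrightarrow> (\<exists>e. e \<noteq> 0 \<and> u = (\<lambda>b. e * v b))" for u
  proof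
    assume "\<exists>e. e \<noteq> 0 \<and> u = (\<lambda>b. e * w b)"
    then obtain e where "e \<noteq> 0" "u = (\<lambda>b. e * w b)" by blast
    then show "\<exists>e. e \<noteq> 0 \<and> u = (\<lambda>b. e * v b)" using assms by (intro exI[of _ "e * c"]) auto
  next
    assume "\<exists>e. e \<noteq> 0 \<and> u = (\<lambda>b. e * v b)"
    then obtain e where "e \<noteq> 0" "u = (\<lambda>b. e * v b)" by blast
    then show "\<exists>e. e \<noteq> 0 \<and> u = (\<lambda>b. e * w b)" using assms by (intro exI[of _ "e / c"]) auto
  qed
  then show ?thesis unfolding pt_class_def by auto
qed

lemma pt_class_eq_iff: "pt_class w = pt_class v \<longleftrightarrow> (\<exists>c. c \<noteq> 0 \<and> w = (\<lambda>b. c * v b))"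
proof
  assume "pt_class w = pt_class v"
  then show "\<exists>c. c \<noteq> 0 \<and> w = (\<lambda>b. c * v b)" using pt_class_self[of w] by (simp add: mem_pt_class)
next
  assume "\<exists>c. c \<noteq> 0 \<and> w = (\<lambda>b. c * v b)"
  then obtain c where "c \<noteq> 0" "w = (\<lambda>b. c * v b)" by blast
  then show "pt_class w = pt_class v" by (intro pt_class_scale[of c]) auto
qed

lemma mem_pt_class_eq: "w \<in> pt_class v \<Longrightarrow> pt_class w = pt_class v"
  unfolding pt_class_eq_iff mem_pt_class .

lemma proj_ptsE:
  assumes "x \<in> proj_pts S"
  obtains v where "x = pt_class v" "v \<in> cvecs S" "v \<noteq> (\<lambda>_. 0)"
  using assms unfolding proj_pts_def by blast

lemma pt_class_in_proj_pts: "v \<in> cvecs S \<Longrightarrow> v b \<noteq> 0 \<Longrightarrow> pt_class v \<in> proj_pts S"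
  unfolding proj_pts_def by auto

lemma hom_polys_nonzero_iff:
  assumes "F \<in> hom_polys S d" "w \<in> pt_class v"
  shows "F w \<noteq> 0 \<longleftrightarrow> F v \<noteq> 0"
  using assms hom_polys_scale[OF assms(1)] by (auto simp: mem_pt_class)

lemma hom_polys_ball_iff:
  assumes "F \<in> hom_polys S d"
  shows "(\<forall>w\<in>pt_class v. F w \<noteq> 0) \<longleftrightarrow> F v \<noteq> 0"
  using hom_polys_nonzero_iff[OF assms] pt_class_self by blast

lemma hom_polys_ratio:
  assumes "F \<in> hom_polys S d" "G \<in> hom_polys S d" "w \<in> pt_class v"
  shows "F w / G w = F v / G v"
  using assms(3) hom_polys_scale[OF assms(1)] hom_polys_scale[OF assms(2)] by (auto simp: mem_pt_class)

text \<open>An arbitrary representative turns a form into a function on points. The value depends on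
  the choice, but the ratio of two forms of one degree does not.\<close>

definition rep :: "('b \<Rightarrow> complex) set \<Rightarrow> 'b \<Rightarrow> complex" where
  "rep x = (SOME v. v \<in> x)"

lemma rep_pt_class: "rep (pt_class v) \<in> pt_class v"
  unfolding rep_def using pt_class_self someI[of "\<lambda>w. w \<in> pt_class v"] by blast

text \<open>All base elements share one open set and differ in the degree of the forms; this is
  where a single ring of numerators would not do.\<close>

definition proj_base :: "'b set \<Rightarrow> (('b \<Rightarrow> complex) set set \<times> (('b \<Rightarrow> complex) set \<Rightarrow> complex) set) set" where
  "proj_base S = {(proj_pts S, {F \<circ> rep | F. F \<in> hom_polys S d}) | d. True}"

lemma frac_base_proj: "frac_base (proj_base S)"
  unfolding frac_base_def
proof (intro conjI allI impI ballI)
  fix A R A' R' assume "(A, R) \<in> proj_base S" "(A', R') \<in> proj_base S"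
  then obtain d e where *: "A = proj_pts S" "A' = proj_pts S" "R = {F \<circ> rep | F. F \<in> hom_polys S d}"
     "R' = {F \<circ> rep | F. F \<in> hom_polys S e}" unfolding proj_base_def by auto
  have "(\<lambda>x. f x * g x) \<in> {F \<circ> rep | F. F \<in> hom_polys S (d + e)}" if fg: "f \<in> R" "g \<in> R'" for f g
  proof -
    obtain F where "f = F \<circ> rep" "F \<in> hom_polys S d" using fg(1) unfolding *(3) by blast
    moreover obtain G where "g = G \<circ> rep" "G \<in> hom_polys S e" using fg(2) unfolding *(4) by blast
    ultimately have "f = F \<circ> rep" "g = G \<circ> rep" "F \<in> hom_polys S d" "G \<in> hom_polys S e" by auto
    then show ?thesis using hom_polys_mult[of F S d G e] by (intro CollectI exI[of _ "\<lambda>v. F v * G v"]) auto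
  qed
  then show "\<exists>R''. (A \<inter> A', R'') \<in> proj_base S \<and> (\<forall>f\<in>R. \<forall>g\<in>R'. (\<lambda>x. f x * g x) \<in> R'')"
    unfolding * by (intro exI[of _ "{F \<circ> rep | F. F \<in> hom_polys S (d + e)}"]) (auto simp: proj_base_def)
next
  fix A R f assume "(A, R) \<in> proj_base S" and f: "f \<in> R"
  then obtain d where *: "A = proj_pts S" "R = {F \<circ> rep | F. F \<in> hom_polys S d}"
    unfolding proj_base_def by auto
  obtain F where F: "f = F \<circ> rep" "F \<in> hom_polys S d" using f * by auto
  show "(\<lambda>x. f x + g x) \<in> R" if g: "g \<in> R" for g
  proof -
    obtain G where "g = G \<circ> rep" "G \<in> hom_polys S d" using g unfolding *(2) by blast
    then show ?thesis unfolding * using F hom_polys_add[of F S d G]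
      by (intro CollectI exI[of _ "\<lambda>v. F v + G v"]) auto
  qed
  show "(\<lambda>x. c * f x) \<in> R" for c
    unfolding * using F hom_polys_mult[OF hom_polys_const[of c S] F(2)]
    by (intro CollectI exI[of _ "\<lambda>v. c * F v"]) auto
qed

lemma ftop_proj_space: "ftop (proj_space S) = ftop (frac_fspace (proj_base S))"
proof -
  have "{x \<in> proj_pts S. \<forall>v\<in>x. F v \<noteq> 0} = {x \<in> proj_pts S. (F \<circ> rep) x \<noteq> 0}" if "F \<in> hom_polys S d" for F d
  proof (rule Collect_cong, rule conj_cong[OF refl])
    fix x assume "x \<in> proj_pts S"
    then obtain v where "x = pt_class v" by (rule proj_ptsE)
    then show "(\<forall>v\<in>x. F v \<noteq> 0) = ((F \<circ> rep) x \<noteq> 0)"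
      using hom_polys_ball_iff[OF that] hom_polys_nonzero_iff[OF that rep_pt_class] by auto
  qed
  then have "{{x \<in> proj_pts S. \<forall>v\<in>x. F v \<noteq> 0} | d F. F \<in> hom_polys S d} =
     {{x \<in> U. h x \<noteq> 0} | U R h. (U, R) \<in> proj_base S \<and> h \<in> R}"
    apply (intro subset_antisym subsetI)
    subgoal for A
      apply (elim CollectE exE conjE)
      subgoal for d F
        by (intro CollectI exI[of _ "proj_pts S"] exI[of _ "{F \<circ> rep | F. F \<in> hom_polys S d}"] exI[of _ "F \<circ> rep"])
          (auto simp: proj_base_def)
      done
    subgoal for A
      apply (elim CollectE exE conjE)
      subgoal for U R h
        unfolding proj_base_def by blast
      done
    done
  then show ?thesis unfolding proj_space_def frac_fspace_def by simp
qed

lemma pts_proj_space [simp]: "pts (proj_space S) = proj_pts S"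
proof -
  have "proj_pts S = {x \<in> proj_pts S. \<forall>v\<in>x. (1::complex) \<noteq> 0}" by simp
  then have "proj_pts S \<in> {{x \<in> proj_pts S. \<forall>v\<in>x. F v \<noteq> 0} | d F. F \<in> hom_polys S d}"
    using hom_polys_const[of 1 S] by (intro CollectI exI[of _ 0] exI[of _ "\<lambda>_. 1"] conjI) auto
  then show ?thesis unfolding proj_space_def fspace.select_convs topology_generated_by_topspace by auto
qed

lemma mem_regf_proj_space:
  "f \<in> regf (proj_space S) W \<longleftrightarrow> (\<forall>x\<in>W. \<exists>d. \<exists>F\<in>hom_polys S d. \<exists>G\<in>hom_polys S d. (\<forall>v\<in>x. G v \<noteq> 0) \<and>
       (\<forall>y\<in>W. \<forall>v\<in>y. G v \<noteq> 0 \<longrightarrow> f y = F v / G v))"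
  unfolding proj_space_def by simp

lemma regf_proj_space:
  assumes "W \<subseteq> proj_pts S"
  shows "regf (proj_space S) W = regf (frac_fspace (proj_base S)) W"
proof (intro subset_antisym subsetI)
  fix f assume f: "f \<in> regf (proj_space S) W"
  show "f \<in> regf (frac_fspace (proj_base S)) W" unfolding mem_regf_frac_fspace[OF frac_base_proj]
  proof
    fix w assume w: "w \<in> W"
    obtain d F G where *: "F \<in> hom_polys S d" "G \<in> hom_polys S d" "\<forall>v\<in>w. G v \<noteq> 0"
      "\<forall>y\<in>W. \<forall>v\<in>y. G v \<noteq> 0 \<longrightarrow> f y = F v / G v"
      using bspec[OF f[unfolded mem_regf_proj_space] w] by (elim exE bexE conjE)
    have rep: "rep y \<in> y" if "y \<in> W" for y
      using that assms rep_pt_class by (auto elim!: proj_ptsE)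
    show "\<exists>U R g h. (U, R) \<in> proj_base S \<and> w \<in> U \<and> g \<in> R \<and> h \<in> R \<and> h w \<noteq> 0 \<and>
       (\<forall>z\<in>W \<inter> U. h z \<noteq> 0 \<longrightarrow> f z = g z / h z)"
      using * w assms rep
      by (intro ex4I[where a = "proj_pts S" and b = "{F \<circ> rep | F. F \<in> hom_polys S d}" and c = "F \<circ> rep" and d = "G \<circ> rep"])
        (auto simp: proj_base_def)
  qed
next
  fix f assume f: "f \<in> regf (frac_fspace (proj_base S)) W"
  show "f \<in> regf (proj_space S) W" unfolding mem_regf_proj_space
  proof
    fix w assume w: "w \<in> W"
    then obtain U R g h where 1: "(U, R) \<in> proj_base S" "g \<in> R" "h \<in> R" "h w \<noteq> 0"
       "\<forall>z\<in>W \<inter> U. h z \<noteq> 0 \<longrightarrow> f z = g z / h z"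
      using f unfolding mem_regf_frac_fspace[OF frac_base_proj] by blast
    obtain d F G where 2: "U = proj_pts S" "g = F \<circ> rep" "h = G \<circ> rep" "F \<in> hom_polys S d" "G \<in> hom_polys S d"
      using 1(1-3) unfolding proj_base_def by blast
    have "\<forall>v\<in>w. G v \<noteq> 0"
    proof -
      obtain v where v: "w = pt_class v" using w assms by (auto elim!: proj_ptsE)
      show ?thesis using 1(4) unfolding v hom_polys_ball_iff[OF 2(5)] 2(3)
        using hom_polys_nonzero_iff[OF 2(5) rep_pt_class] by auto
    qed
    moreover have "f y = F u / G u" if yu: "y \<in> W" "u \<in> y" "G u \<noteq> 0" for y u
    proof -
      obtain v where v: "y = pt_class v" using yu assms by (auto elim!: proj_ptsE)
      have y: "y = pt_class u" using mem_pt_class_eq yu v by blast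
      have "G (rep y) \<noteq> 0" using yu(3) hom_polys_nonzero_iff[OF 2(5) rep_pt_class, of u] y by simp
      then have "f y = F (rep y) / G (rep y)" using 1(5) yu(1) assms 2 by auto
      also have "\<dots> = F u / G u" unfolding y by (rule hom_polys_ratio[OF 2(4,5) rep_pt_class])
      finally show ?thesis .
    qed
    ultimately show "\<exists>d. \<exists>F\<in>hom_polys S d. \<exists>G\<in>hom_polys S d. (\<forall>v\<in>w. G v \<noteq> 0) \<and>
       (\<forall>y\<in>W. \<forall>v\<in>y. G v \<noteq> 0 \<longrightarrow> f y = F v / G v)" using 2 by blast
  qed
qed

lemma function_sheaf_proj_space: "function_sheaf (proj_space S)"
  by (rule function_sheaf_cong[OF function_sheaf_frac_fspace[OF frac_base_proj] ftop_proj_space regf_proj_space])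
    (metis ftop_proj_space openin_subset pts_proj_space)

lemma openin_proj_basic: "F \<in> hom_polys S d \<Longrightarrow> openin (ftop (proj_space S)) {x \<in> proj_pts S. \<forall>v\<in>x. F v \<noteq> 0}"
  unfolding proj_space_def fspace.select_convs by (rule topology_generated_by_Basis) blast

lemma openin_proj_space_point:
  assumes "openin (ftop (proj_space S)) W" "x \<in> W"
  obtains d F where "F \<in> hom_polys S d" "\<forall>v\<in>x. F v \<noteq> 0" "{x \<in> proj_pts S. \<forall>v\<in>x. F v \<noteq> 0} \<subseteq> W"
proof -
  have WS: "W \<subseteq> proj_pts S" using openin_subset[OF assms(1)] by simp
  obtain U R h where 1: "(U, R) \<in> proj_base S" "h \<in> R" "x \<in> U" "h x \<noteq> 0" "{x \<in> U. h x \<noteq> 0} \<subseteq> W"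
    using frac_fspace_point[OF frac_base_proj assms(1)[unfolded ftop_proj_space] assms(2)] by blast
  obtain d F where 2: "U = proj_pts S" "h = F \<circ> rep" "F \<in> hom_polys S d"
    using 1(1-3) unfolding proj_base_def by blast
  have eq: "(\<forall>v\<in>y. F v \<noteq> 0) \<longleftrightarrow> F (rep y) \<noteq> 0" if "y \<in> proj_pts S" for y
    using that hom_polys_ball_iff[OF 2(3)] hom_polys_nonzero_iff[OF 2(3) rep_pt_class] by (auto elim!: proj_ptsE)
  show thesis
    by (rule that[OF 2(3)]) (use 1 2 eq WS assms in auto)
qed

lemma fmorphism_proj_space:
  assumes "function_sheaf X"
    and phi: "\<And>b. b \<in> S \<Longrightarrow> (\<lambda>x. \<phi> x b) \<in> regf X (pts X)"
    and "\<And>x. x \<in> pts X \<Longrightarrow> \<phi> x \<in> cvecs S" "\<And>x. x \<in> pts X \<Longrightarrow> \<phi> x \<noteq> (\<lambda>_. 0)"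
  shows "fmorphism X (proj_space S) (\<lambda>x. pt_class (\<phi> x))"
proof -
  interpret function_sheaf X by fact
  interpret P: function_sheaf "proj_space S" by (rule function_sheaf_proj_space)
  have in_P: "pt_class (\<phi> x) \<in> proj_pts S" if "x \<in> pts X" for x
    using that assms(3,4) unfolding proj_pts_def by blast
  have F: "(\<lambda>x. F (\<phi> x)) \<in> regf X (pts X)" if F: "F \<in> hom_polys S d" for F d
  proof -
    obtain M k where 1: "finite M" "F = (\<lambda>v. \<Sum>\<alpha>\<in>M. k \<alpha> * (\<Prod>b\<in>S. v b ^ \<alpha> b))"
      using F unfolding hom_polys_def by blast
    show ?thesis unfolding 1(2)
      by (intro regf_sum regf_mult regf_prod regf_power regf_const openin_topspace phi)
  qed
  have "fmorphism X (frac_fspace (proj_base S)) (\<lambda>x. pt_class (\<phi> x))"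
  proof (rule fmorphism_frac_fspace[OF frac_base_proj assms(1)])
    fix x assume x: "x \<in> pts X"
    show "\<exists>U R h. (U, R) \<in> proj_base S \<and> h \<in> R \<and> pt_class (\<phi> x) \<in> U \<and> h (pt_class (\<phi> x)) \<noteq> 0"
      using in_P[OF x] hom_polys_const[of 1 S]
      by (intro exI[of _ "proj_pts S"] exI[of _ "{F \<circ> rep | F. F \<in> hom_polys S 0}"] exI[of _ "(\<lambda>_. 1) \<circ> rep"])
        (auto simp: proj_base_def)
  next
    fix U R assume "(U, R) \<in> proj_base S"
    then obtain d where *: "U = proj_pts S" "R = {F \<circ> rep | F. F \<in> hom_polys S d}"
      unfolding proj_base_def by blast
    have D: "{x \<in> pts X. pt_class (\<phi> x) \<in> U} = pts X" using in_P * by auto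
    show "openin (ftop X) {x \<in> pts X. pt_class (\<phi> x) \<in> U}" unfolding D by simp
    \<comment> \<open>The chosen representative differs from \<open>\<phi> x\<close> by a scalar
      \<open>c x\<close>; dividing by \<open>c x ^ d\<close> corrects all forms of degree
      \<open>d\<close> at once.\<close>
    have "\<forall>x. \<exists>c. c \<noteq> 0 \<and> rep (pt_class (\<phi> x)) = (\<lambda>b. c * \<phi> x b)"
      by (rule allI, rule rep_pt_class[unfolded mem_pt_class])
    then obtain c where c: "\<And>x. c x \<noteq> 0" "\<And>x. rep (pt_class (\<phi> x)) = (\<lambda>b. c x * \<phi> x b)" by metis
    have "(\<lambda>x. inverse (c x ^ d) * h (pt_class (\<phi> x))) \<in> regf X (pts X)" if "h \<in> R" for h
    proof -
      obtain G where G: "h = G \<circ> rep" "G \<in> hom_polys S d" using * \<open>h \<in> R\<close> by auto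
      have "inverse (c x ^ d) * h (pt_class (\<phi> x)) = G (\<phi> x)" for x
        using c by (simp add: G(1) hom_polys_scale[OF G(2)])
      then show ?thesis using F[OF G(2)] by simp
    qed
    then show "\<exists>u. (\<forall>x\<in>pts X. pt_class (\<phi> x) \<in> U \<longrightarrow> u x \<noteq> 0) \<and>
       (\<forall>h\<in>R. (\<lambda>x. u x * h (pt_class (\<phi> x))) \<in> regf X {x \<in> pts X. pt_class (\<phi> x) \<in> U})"
      unfolding D using c by (intro exI[of _ "\<lambda>x. inverse (c x ^ d)"]) auto
  qed
  moreover have "regf (proj_space S) V = regf (frac_fspace (proj_base S)) V" if "openin (ftop (proj_space S)) V" for V
    using regf_proj_space openin_subset[OF that] by simp
  ultimately show ?thesis
    unfolding fmorphism_def ftop_proj_space[symmetric] by simp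
qed

section \<open>Quotients\<close>

text \<open>A property instead of a construction, so that composites qualify: the passage from
  echelon bases to \<open>Y q k\<close> goes through the semistable locus and then through the
  classes of the good quotient.\<close>

definition is_quotient :: "'a fspace \<Rightarrow> 'b fspace \<Rightarrow> ('a \<Rightarrow> 'b) \<Rightarrow> bool" where
  "is_quotient Z X \<pi> \<longleftrightarrow> \<pi> ` pts Z = pts X \<and>
     (\<forall>W. openin (ftop X) W \<longleftrightarrow> W \<subseteq> pts X \<and> openin (ftop Z) {z \<in> pts Z. \<pi> z \<in> W}) \<and>
     (\<forall>W f. openin (ftop X) W \<longrightarrow> (f \<in> regf X W \<longleftrightarrow> f \<circ> \<pi> \<in> regf Z {z \<in> pts Z. \<pi> z \<in> W}))"

lemma is_quotient_pts: "is_quotient Z X \<pi> \<Longrightarrow> pts X = \<pi> ` pts Z"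
  unfolding is_quotient_def by blast

lemma is_quotient_openin: "is_quotient Z X \<pi> \<Longrightarrow>
    openin (ftop X) W \<longleftrightarrow> W \<subseteq> pts X \<and> openin (ftop Z) {z \<in> pts Z. \<pi> z \<in> W}"
  unfolding is_quotient_def by blast

lemma is_quotient_regf: "is_quotient Z X \<pi> \<Longrightarrow> openin (ftop X) W \<Longrightarrow>
    f \<in> regf X W \<longleftrightarrow> f \<circ> \<pi> \<in> regf Z {z \<in> pts Z. \<pi> z \<in> W}"
  unfolding is_quotient_def by blast

lemma is_quotient_quotient_fspace: "is_quotient X (quotient_fspace X p) p"
proof -
  have op: "openin (ftop (quotient_fspace X p)) W \<longleftrightarrow> W \<subseteq> p ` pts X \<and> openin (ftop X) {x \<in> pts X. p x \<in> W}" for W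
    unfolding quotient_fspace_def by (simp add: openin_final_topology)
  have "{x \<in> pts X. p x \<in> p ` pts X} = pts X" by auto
  then have "openin (ftop (quotient_fspace X p)) (p ` pts X)" unfolding op by simp
  then have "pts (quotient_fspace X p) = p ` pts X"
    using op openin_subset by (metis openin_topspace subset_antisym)
  then show ?thesis unfolding is_quotient_def using op by (simp add: quotient_fspace_def)
qed

lemma is_quotient_comp:
  assumes "is_quotient A B f" "is_quotient B C g"
  shows "is_quotient A C (g \<circ> f)"
  unfolding is_quotient_def
proof (intro conjI allI impI)
  show "(g \<circ> f) ` pts A = pts C" using is_quotient_pts[OF assms(1)] is_quotient_pts[OF assms(2)] by (simp add: image_comp)
  have pre: "{a \<in> pts A. f a \<in> {b \<in> pts B. g b \<in> W}} = {a \<in> pts A. (g \<circ> f) a \<in> W}" for W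
    using is_quotient_pts[OF assms(1)] by auto
  fix W
  show "openin (ftop C) W = (W \<subseteq> pts C \<and> openin (ftop A) {a \<in> pts A. (g \<circ> f) a \<in> W})"
    unfolding is_quotient_openin[OF assms(2), of W] is_quotient_openin[OF assms(1), of "{b \<in> pts B. g b \<in> W}"] pre by auto
  fix h assume W: "openin (ftop C) W"
  then have "openin (ftop B) {b \<in> pts B. g b \<in> W}" using is_quotient_openin[OF assms(2)] by blast
  then show "(h \<in> regf C W) = (h \<circ> (g \<circ> f) \<in> regf A {a \<in> pts A. (g \<circ> f) a \<in> W})"
    unfolding is_quotient_regf[OF assms(2) W] using is_quotient_regf[OF assms(1)] pre by (simp add: comp_assoc)
qed

lemma fmorphism_quotient:
  assumes "is_quotient Z X \<pi>"
  shows "fmorphism Z X \<pi>"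
  unfolding fmorphism_def continuous_map_def
  using is_quotient_pts[OF assms] is_quotient_openin[OF assms] is_quotient_regf[OF assms] by auto

text \<open>The descended map agrees with \<open>f\<close> only on the points of \<open>Z\<close>,
  hence the hypothesis that regularity depends on the values on \<open>U\<close> alone. It takes the
  place of \<open>function_sheaf Z\<close> because the lemma also serves for disjoint unions, where
  exactly this is provided by \<open>regf_sum_fspace_cong\<close>.\<close>

lemma fmorphism_descend:
  assumes Q: "is_quotient Z X \<pi>" and f: "fmorphism Z T f"
    and ext: "\<And>U g h. openin (ftop Z) U \<Longrightarrow> g \<in> regf Z U \<Longrightarrow> (\<And>x. x \<in> U \<Longrightarrow> g x = h x) \<Longrightarrow> h \<in> regf Z U"
    and fib: "\<And>z z'. z \<in> pts Z \<Longrightarrow> z' \<in> pts Z \<Longrightarrow> \<pi> z = \<pi> z' \<Longrightarrow> f z = f z'"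
  obtains g where "fmorphism X T g" "\<And>z. z \<in> pts Z \<Longrightarrow> g (\<pi> z) = f z"
proof -
  define g where "g x = f (SOME z. z \<in> pts Z \<and> \<pi> z = x)" for x
  have g: "g (\<pi> z) = f z" if "z \<in> pts Z" for z
    unfolding g_def using that someI[of "\<lambda>z'. z' \<in> pts Z \<and> \<pi> z' = \<pi> z" z] by (intro fib) auto
  have pre: "{z \<in> pts Z. \<pi> z \<in> {x \<in> pts X. g x \<in> V}} = {z \<in> pts Z. f z \<in> V}" for V
  proof (intro Collect_cong conj_cong refl)
    fix z assume z: "z \<in> pts Z"
    then show "\<pi> z \<in> {x \<in> pts X. g x \<in> V} \<longleftrightarrow> f z \<in> V" using g[OF z] is_quotient_pts[OF Q] by simp
  qed
  have op: "openin (ftop X) {x \<in> pts X. g x \<in> V}" if "openin (ftop T) V" for V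
    unfolding is_quotient_openin[OF Q] pre using fmorphism_open[OF f that] by auto
  have "fmorphism X T g"
    unfolding fmorphism_def continuous_map_def
  proof (intro conjI allI impI)
    show "g \<in> pts X \<rightarrow> pts T" using is_quotient_pts[OF Q] g fmorphism_pts[OF f] by auto
    fix V h assume V: "openin (ftop T) V" "h \<in> regf T V"
    show "h \<circ> g \<in> regf X {x \<in> pts X. g x \<in> V}"
      unfolding is_quotient_regf[OF Q op[OF V(1)]] pre
      by (rule ext[OF fmorphism_open[OF f V(1)] fmorphism_regf[OF f V]]) (simp add: g)
  qed (use op in auto)
  then show thesis using that g by blast
qed

lemma function_sheaf_quotient:
  assumes "function_sheaf Z" and Q: "is_quotient Z X \<pi>"
  shows "function_sheaf X"
proof -
  interpret Z: function_sheaf Z by fact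
  note op = is_quotient_openin[OF Q] and reg = is_quotient_regf[OF Q]
  have pre: "openin (ftop Z) {z \<in> pts Z. \<pi> z \<in> W}" if "openin (ftop X) W" for W using that op by blast
  show ?thesis
  proof
    fix U c assume U: "openin (ftop X) U"
    then show "(\<lambda>_. c) \<in> regf X U" using Z.regf_const[OF pre[OF U]] by (simp add: reg comp_def)
  next
    fix U f g assume U: "openin (ftop X) U" and "f \<in> regf X U" "g \<in> regf X U"
    then have "f \<circ> \<pi> \<in> regf Z {z \<in> pts Z. \<pi> z \<in> U}" "g \<circ> \<pi> \<in> regf Z {z \<in> pts Z. \<pi> z \<in> U}" using reg by auto
    then show "(\<lambda>x. f x + g x) \<in> regf X U" "(\<lambda>x. f x * g x) \<in> regf X U"
      using Z.regf_add[OF pre[OF U]] Z.regf_mult[OF pre[OF U]] by (simp_all add: reg U comp_def)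
  next
    fix U V f assume U: "openin (ftop X) U" and V: "openin (ftop X) V" and "V \<subseteq> U" "f \<in> regf X U"
    moreover have "{z \<in> pts Z. \<pi> z \<in> V} \<subseteq> {z \<in> pts Z. \<pi> z \<in> U}" using \<open>V \<subseteq> U\<close> by auto
    ultimately show "f \<in> regf X V"
      using Z.regf_restrict[OF pre[OF U] pre[OF V]] by (auto simp: reg)
  next
    fix U f assume U: "openin (ftop X) U" and loc: "\<And>x. x \<in> U \<Longrightarrow> \<exists>V g. openin (ftop X) V \<and> x \<in> V \<and>
      g \<in> regf X V \<and> (\<forall>y\<in>V \<inter> U. f y = g y)"
    show "f \<in> regf X U" unfolding reg[OF U]
    proof (rule Z.regf_local[OF pre[OF U]])
      fix z assume z: "z \<in> {z \<in> pts Z. \<pi> z \<in> U}"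
      then obtain V g where V: "openin (ftop X) V" "\<pi> z \<in> V" "g \<in> regf X V" "\<forall>y\<in>V \<inter> U. f y = g y"
        using loc[of "\<pi> z"] by blast
      then show "\<exists>V g. openin (ftop Z) V \<and> z \<in> V \<and> g \<in> regf Z V \<and>
          (\<forall>y\<in>V \<inter> {z \<in> pts Z. \<pi> z \<in> U}. (f \<circ> \<pi>) y = g y)"
        using pre[OF V(1)] reg[OF V(1)] z
        by (intro exI[of _ "{z \<in> pts Z. \<pi> z \<in> V}"] exI[of _ "g \<circ> \<pi>"]) auto
    qed
  next
    fix U f assume U: "openin (ftop X) U" and f: "f \<in> regf X U"
    have "{z \<in> pts Z. \<pi> z \<in> {x \<in> U. f x \<noteq> 0}} = {z \<in> {z \<in> pts Z. \<pi> z \<in> U}. (f \<circ> \<pi>) z \<noteq> 0}" by auto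
    then show "openin (ftop X) {x \<in> U. f x \<noteq> 0}"
      using Z.open_nonzero[OF pre[OF U], of "f \<circ> \<pi>"] f reg[OF U] openin_subset[OF U]
      unfolding op[of "{x \<in> U. f x \<noteq> 0}"] by auto
  next
    fix U f assume U: "openin (ftop X) U" and f: "f \<in> regf X U" "\<And>x. x \<in> U \<Longrightarrow> f x \<noteq> 0"
    then show "(\<lambda>x. inverse (f x)) \<in> regf X U"
      using Z.regf_inverse[OF pre[OF U], of "f \<circ> \<pi>"] by (simp add: reg comp_def)
  qed
qed

section \<open>Disjoint unions, and maps into open subspaces\<close>

lemma openin_sum_fspace: "openin (ftop (sum_fspace I X)) W \<longleftrightarrow>
   W \<subseteq> Sigma I (\<lambda>i. pts (X i)) \<and> (\<forall>i\<in>I. openin (ftop (X i)) {x. (i, x) \<in> W})"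
  unfolding sum_fspace_def by (simp add: openin_sum_topology comp_def)

lemma pts_sum_fspace [simp]: "pts (sum_fspace I X) = Sigma I (\<lambda>i. pts (X i))"
  unfolding sum_fspace_def by (simp add: comp_def)

lemma mem_regf_sum_fspace: "f \<in> regf (sum_fspace I X) W \<longleftrightarrow> (\<forall>i\<in>I. (\<lambda>x. f (i, x)) \<in> regf (X i) {x. (i, x) \<in> W})"
  unfolding sum_fspace_def by simp

lemma fmorphism_sum_inj:
  assumes "i \<in> I"
  shows "fmorphism (X i) (sum_fspace I X) (Pair i)"
proof -
  have eq: "{x \<in> pts (X i). (i, x) \<in> V} = {x. (i, x) \<in> V}" if "openin (ftop (sum_fspace I X)) V" for V
    using that unfolding openin_sum_fspace by auto
  show ?thesis
    unfolding fmorphism_def continuous_map_def using assms eq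
    by (auto simp: openin_sum_fspace mem_regf_sum_fspace comp_def)
qed

lemma fmorphism_from_sum:
  assumes "\<And>i. i \<in> I \<Longrightarrow> fmorphism (X i) T (\<lambda>x. f (i, x))"
  shows "fmorphism (sum_fspace I X) T f"
proof -
  have eq: "{x. (i, x) \<in> {z \<in> pts (sum_fspace I X). f z \<in> V}} = {x \<in> pts (X i). f (i, x) \<in> V}" if "i \<in> I" for i V
    using that by auto
  show ?thesis
    unfolding fmorphism_def continuous_map_def
  proof (intro conjI allI impI)
    show "f \<in> pts (sum_fspace I X) \<rightarrow> pts T" using fmorphism_pts[OF assms] by auto
  next
    fix V assume "openin (ftop T) V"
    then show "openin (ftop (sum_fspace I X)) {x \<in> pts (sum_fspace I X). f x \<in> V}"
      unfolding openin_sum_fspace using eq fmorphism_open[OF assms] by auto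
  next
    fix V g assume "openin (ftop T) V" "g \<in> regf T V"
    then show "g \<circ> f \<in> regf (sum_fspace I X) {x \<in> pts (sum_fspace I X). f x \<in> V}"
      unfolding mem_regf_sum_fspace using eq fmorphism_regf[OF assms] by (simp add: comp_def)
  qed
qed

lemma regf_sum_fspace_cong:
  assumes "\<And>i. i \<in> I \<Longrightarrow> function_sheaf (X i)"
    and "openin (ftop (sum_fspace I X)) U" "g \<in> regf (sum_fspace I X) U" "\<And>x. x \<in> U \<Longrightarrow> g x = h x"
  shows "h \<in> regf (sum_fspace I X) U"
  unfolding mem_regf_sum_fspace
proof
  fix i assume i: "i \<in> I"
  interpret function_sheaf "X i" by (rule assms(1)[OF i])
  show "(\<lambda>x. h (i, x)) \<in> regf (X i) {x. (i, x) \<in> U}"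
    by (rule regf_cong[of _ "\<lambda>x. g (i, x)"])
      (use assms i in \<open>auto simp: openin_sum_fspace mem_regf_sum_fspace\<close>)
qed

lemma (in function_sheaf) fmorphism_into_sub_fspace:
  assumes A: "openin (ftop X) A" and f: "fmorphism T X f" and "\<And>t. t \<in> pts T \<Longrightarrow> f t \<in> A"
  shows "fmorphism T (sub_fspace X A) f"
  unfolding fmorphism_def
proof (intro conjI allI impI)
  show "continuous_map (ftop T) (ftop (sub_fspace X A)) f"
    using f assms(3) unfolding fmorphism_def sub_fspace_def by (auto simp: continuous_map_in_subtopology)
  fix V g assume V: "openin (ftop (sub_fspace X A)) V" "g \<in> regf (sub_fspace X A) V"
  then have V': "openin (ftop X) V" by (simp add: openin_sub_fspace[OF A])
  then show "g \<circ> f \<in> regf T {x \<in> pts T. f x \<in> V}"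
    using fmorphism_regf[OF f V'] V(2) regf_sub_fspace[OF A V'] by simp
qed

section \<open>The tower of torus quotients\<close>

text \<open>The algebra of functions generated by \<open>C\<close>. For \<open>C = entries\<close>
  these are the polynomial functions in the matrix entries.\<close>

inductive_set funalg :: "('a \<Rightarrow> complex) set \<Rightarrow> ('a \<Rightarrow> complex) set" for C where
  gen: "f \<in> C \<Longrightarrow> f \<in> funalg C"
| const: "(\<lambda>_. c) \<in> funalg C"
| add: "f \<in> funalg C \<Longrightarrow> g \<in> funalg C \<Longrightarrow> (\<lambda>x. f x + g x) \<in> funalg C"
| mult: "f \<in> funalg C \<Longrightarrow> g \<in> funalg C \<Longrightarrow> (\<lambda>x. f x * g x) \<in> funalg C"

lemma funalg_sum: "(\<And>i. i \<in> I \<Longrightarrow> f i \<in> funalg C) \<Longrightarrow> (\<lambda>x. \<Sum>i\<in>I. f i x) \<in> funalg C"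
  by (induction I rule: infinite_finite_induct) (auto intro: funalg.intros)

lemma funalg_prod: "(\<And>i. i \<in> I \<Longrightarrow> f i \<in> funalg C) \<Longrightarrow> (\<lambda>x. \<Prod>i\<in>I. f i x) \<in> funalg C"
  by (induction I rule: infinite_finite_induct) (auto intro: funalg.intros)

lemma funalg_power: "f \<in> funalg C \<Longrightarrow> (\<lambda>x. f x ^ m) \<in> funalg C"
  by (induction m) (auto intro: funalg.intros)

lemma frac_base_funalg: "frac_base {(Z, funalg C)}"
  unfolding frac_base_def by (auto intro: funalg.intros)

text \<open>The columns left of the pivot \<open>j * q\<close> that are not pivots of earlier rows.
  Column 0 is a multiple of \<open>q\<close> but no pivot, hence the exception.\<close>

definition free_cols :: "nat \<Rightarrow> nat \<Rightarrow> nat set" where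
  "free_cols q j = {p. p < j * q \<and> (q dvd p \<longrightarrow> p = 0)}"

text \<open>\<open>z j p\<close> is the entry in the \<open>p\<close>-th coordinate of the \<open>j\<close>-th vector (\<open>1 \<le> j \<le> k\<close>) of the
  reduced echelon basis of a subspace; its leading entry \<open>1\<close> in the coordinate \<open>j * q\<close> is omitted.\<close>

definition echelon_pts :: "nat \<Rightarrow> nat \<Rightarrow> (nat \<Rightarrow> nat \<Rightarrow> complex) set" where
  "echelon_pts q k = {z. (\<forall>j p. z j p \<noteq> 0 \<longrightarrow> j \<in> {1..k} \<and> p \<in> free_cols q j) \<and>
     (\<forall>j\<in>{1..k}. \<exists>p\<in>free_cols q j. z j p \<noteq> 0)}"

definition entries :: "((nat \<Rightarrow> nat \<Rightarrow> complex) \<Rightarrow> complex) set" where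
  "entries = {\<lambda>z. z j p | j p. True}"

definition echelon_space :: "nat \<Rightarrow> nat \<Rightarrow> (nat \<Rightarrow> nat \<Rightarrow> complex) fspace" where
  "echelon_space q k = frac_fspace {(echelon_pts q k, funalg entries)}"

text \<open>Scaling coordinate \<open>i\<close> by \<open>a (i div q)\<close> multiplies the pivot
  \<open>j * q\<close> by \<open>a j\<close>; dividing row \<open>j\<close> by \<open>a j\<close>
  restores the leading 1.\<close>

definition torus_act :: "nat \<Rightarrow> (nat \<Rightarrow> complex) \<Rightarrow> (nat \<Rightarrow> nat \<Rightarrow> complex) \<Rightarrow> nat \<Rightarrow> nat \<Rightarrow> complex" where
  "torus_act q a z = (\<lambda>j p. a (p div q) / a j * z j p)"

text \<open>The interface between the geometry of the Grassmannian and the construction of the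
  bundles. The tuples \<open>a\<close> carry no determinant condition, since the action depends on
  ratios only.\<close>

definition torus_quotient :: "nat \<Rightarrow> nat \<Rightarrow> 'a fspace \<Rightarrow> ((nat \<Rightarrow> nat \<Rightarrow> complex) \<Rightarrow> 'a) \<Rightarrow> bool" where
  "torus_quotient q k X \<pi> \<longleftrightarrow> is_quotient (echelon_space q k) X \<pi> \<and>
     (\<forall>z\<in>echelon_pts q k. \<forall>z'\<in>echelon_pts q k.
        \<pi> z = \<pi> z' \<longleftrightarrow> (\<exists>a. (\<forall>b. a b \<noteq> 0) \<and> z' = torus_act q a z))"

lemma openin_echelon_space:
  "openin (ftop (echelon_space q k)) W \<longleftrightarrow>
     (\<forall>w\<in>W. \<exists>h\<in>funalg entries. w \<in> echelon_pts q k \<and> h w \<noteq> 0 \<and> {x \<in> echelon_pts q k. h x \<noteq> 0} \<subseteq> W)"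
  unfolding echelon_space_def openin_frac_fspace[OF frac_base_funalg] by auto

lemma mem_regf_echelon_space:
  "f \<in> regf (echelon_space q k) W \<longleftrightarrow> (\<forall>w\<in>W. w \<in> echelon_pts q k \<and> (\<exists>g\<in>funalg entries. \<exists>h\<in>funalg entries. h w \<noteq> 0 \<and>
        (\<forall>z\<in>W \<inter> echelon_pts q k. h z \<noteq> 0 \<longrightarrow> f z = g z / h z)))"
  unfolding echelon_space_def mem_regf_frac_fspace[OF frac_base_funalg]
proof (intro ball_cong refl iffI; elim exE conjE bexE)
  fix w U R g h assume "(U, R) \<in> {(echelon_pts q k, funalg entries)}" "w \<in> U" "g \<in> R" "h \<in> R" "h w \<noteq> 0"
    "\<forall>z\<in>W \<inter> U. h z \<noteq> 0 \<longrightarrow> f z = g z / h z"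
  then show "w \<in> echelon_pts q k \<and> (\<exists>g\<in>funalg entries. \<exists>h\<in>funalg entries. h w \<noteq> 0 \<and>
        (\<forall>z\<in>W \<inter> echelon_pts q k. h z \<noteq> 0 \<longrightarrow> f z = g z / h z))"
    by (intro conjI bexI[of _ g] bexI[of _ h]) auto
next
  fix w g h assume "w \<in> echelon_pts q k" "g \<in> funalg entries" "h \<in> funalg entries" "h w \<noteq> 0"
    "\<forall>z\<in>W \<inter> echelon_pts q k. h z \<noteq> 0 \<longrightarrow> f z = g z / h z"
  then show "\<exists>U R g h. (U, R) \<in> {(echelon_pts q k, funalg entries)} \<and> w \<in> U \<and> g \<in> R \<and> h \<in> R \<and> h w \<noteq> 0 \<and>
      (\<forall>z\<in>W \<inter> U. h z \<noteq> 0 \<longrightarrow> f z = g z / h z)"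
    by (intro ex4I[where a = "echelon_pts q k" and b = "funalg entries" and c = g and d = h]) auto
qed

lemma function_sheaf_echelon_space: "function_sheaf (echelon_space q k)"
  unfolding echelon_space_def by (rule function_sheaf_frac_fspace[OF frac_base_funalg])

lemma pts_echelon_space [simp]: "pts (echelon_space q k) = echelon_pts q k"
proof -
  have "openin (ftop (echelon_space q k)) (echelon_pts q k)"
    unfolding openin_echelon_space using funalg.const[of 1 entries] by (intro ballI bexI[of _ "\<lambda>_. 1"]) auto
  moreover have "pts (echelon_space q k) \<subseteq> echelon_pts q k"
    using openin_topspace[of "ftop (echelon_space q k)"] unfolding openin_echelon_space by auto
  ultimately show ?thesis using openin_subset by blast
qed

lemma funalg_regf:
  assumes "openin (ftop (echelon_space q k)) U" "h \<in> funalg entries"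
  shows "h \<in> regf (echelon_space q k) U"
  unfolding mem_regf_echelon_space
proof (intro ballI conjI)
  show "w \<in> echelon_pts q k" if "w \<in> U" for w using that openin_subset[OF assms(1)] by auto
qed (use assms(2) funalg.const[of 1 entries] in \<open>intro bexI[of _ h] bexI[of _ "\<lambda>_. 1"], auto\<close>)

lemma regf_entry:
  assumes "openin (ftop (echelon_space q k)) U"
  shows "(\<lambda>z. z j p) \<in> regf (echelon_space q k) U"
  by (rule funalg_regf[OF assms], rule funalg.gen) (auto simp: entries_def)

lemma fmorphism_echelon_space:
  assumes "function_sheaf X" "\<And>x. x \<in> pts X \<Longrightarrow> f x \<in> echelon_pts q k"
    and reg: "\<And>j p. (\<lambda>x. f x j p) \<in> regf X (pts X)"
  shows "fmorphism X (echelon_space q k) f"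
  unfolding echelon_space_def
proof (rule fmorphism_frac_fspace[OF frac_base_funalg assms(1)])
  interpret function_sheaf X by fact
  fix U R assume "(U, R) \<in> {(echelon_pts q k, funalg entries)}"
  then have UR: "U = echelon_pts q k" "R = funalg entries" by auto
  have D: "{x \<in> pts X. f x \<in> U} = pts X" using assms(2) UR by auto
  show "openin (ftop X) {x \<in> pts X. f x \<in> U}" unfolding D by simp
  have "(\<lambda>x. h (f x)) \<in> regf X (pts X)" if "h \<in> funalg entries" for h
    using that by induction (auto simp: entries_def intro!: reg regf_const regf_add regf_mult)
  then show "\<exists>u. (\<forall>x\<in>pts X. f x \<in> U \<longrightarrow> u x \<noteq> 0) \<and> (\<forall>h\<in>R. (\<lambda>x. u x * h (f x)) \<in> regf X {x \<in> pts X. f x \<in> U})"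
    unfolding D unfolding UR by (intro exI[of _ "\<lambda>_. 1"]) auto
next
  fix x assume "x \<in> pts X"
  then show "\<exists>U R h. (U, R) \<in> {(echelon_pts q k, funalg entries)} \<and> h \<in> R \<and> f x \<in> U \<and> h (f x) \<noteq> 0"
    using assms(2) funalg.const[of 1 entries]
    by (intro exI[of _ "echelon_pts q k"] exI[of _ "funalg entries"] exI[of _ "\<lambda>_. 1"]) auto
qed

section \<open>The torus action on echelon bases, its charts and normal forms\<close>

lemma torus_act_echelon_pts:
  assumes "z \<in> echelon_pts q k" "\<And>b. a b \<noteq> 0"
  shows "torus_act q a z \<in> echelon_pts q k"
  using assms unfolding echelon_pts_def torus_act_def by auto

lemma torus_act_one: "torus_act q (\<lambda>_. 1) z = z"
  unfolding torus_act_def by simp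

lemma torus_act_torus_act: "torus_act q a (torus_act q b z) = torus_act q (\<lambda>i. a i * b i) z"
  unfolding torus_act_def by (simp add: fun_eq_iff)

text \<open>Triangularity of the weights: an entry of row \<open>j\<close> involves only scalars of
  earlier blocks besides \<open>a j\<close>. It makes the recursion for \<open>weight\<close>
  descend, and it lets the weights of a new row be expressed on the stage below.\<close>

lemma free_cols_div: "p \<in> free_cols q j \<Longrightarrow> p div q < j"
  unfolding free_cols_def by (auto simp: less_mult_imp_div_less)

text \<open>A chart \<open>f\<close> selects an entry \<open>f j\<close> in every vector; the torus weight of that entry is
  \<open>a (f j div q) / a j\<close>. Multiplying inverses along the path \<open>b, f b div q, \<dots>, 0\<close> gives
  a function of weight \<open>a b / a 0\<close>.\<close>

fun weight :: "nat \<Rightarrow> (nat \<Rightarrow> nat) \<Rightarrow> (nat \<Rightarrow> nat \<Rightarrow> complex) \<Rightarrow> nat \<Rightarrow> complex" where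
  "weight q f z j = (if 0 < j \<and> f j div q < j then weight q f z (f j div q) / z j (f j) else 1)"

declare weight.simps [simp del]

lemma weight_0 [simp]: "weight q f z 0 = 1"
  by (simp add: weight.simps)

definition is_chart :: "nat \<Rightarrow> nat \<Rightarrow> (nat \<Rightarrow> nat) \<Rightarrow> bool" where
  "is_chart q m f \<longleftrightarrow> (\<forall>j\<in>{1..m}. f j \<in> free_cols q j)"

definition chart_dom :: "nat \<Rightarrow> nat \<Rightarrow> (nat \<Rightarrow> nat) \<Rightarrow> (nat \<Rightarrow> nat \<Rightarrow> complex) set" where
  "chart_dom q m f = {z \<in> echelon_pts q m. \<forall>j\<in>{1..m}. z j (f j) \<noteq> 0}"

lemma weight_rec:
  assumes "is_chart q m f" "j \<in> {1..m}"
  shows "weight q f z j = weight q f z (f j div q) / z j (f j)" "f j div q < j"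
proof -
  show "f j div q < j" using assms free_cols_div unfolding is_chart_def by blast
  then show "weight q f z j = weight q f z (f j div q) / z j (f j)"
    using assms(2) by (subst weight.simps) auto
qed

lemma weight_nonzero:
  assumes "is_chart q m f" "z \<in> chart_dom q m f" "b \<le> m"
  shows "weight q f z b \<noteq> 0"
  using assms(3)
proof (induction b rule: less_induct)
  case (less b)
  show ?case
  proof (cases "b = 0")
    case False
    then have b: "b \<in> {1..m}" using less.prems by auto
    from weight_rec[OF assms(1) b] less.IH[of "f b div q"] less.prems assms(2) b
    show ?thesis by (auto simp: chart_dom_def)
  qed simp
qed

lemma weight_torus_act:
  assumes "is_chart q m f" "b \<le> m" and a: "\<And>b. a b \<noteq> 0"
  shows "weight q f (torus_act q a z) b = a b / a 0 * weight q f z b"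
  using assms(2)
proof (induction b rule: less_induct)
  case (less b)
  show ?case
  proof (cases "b = 0")
    case False
    then have b: "b \<in> {1..m}" using less.prems by auto
    have "weight q f (torus_act q a z) b = weight q f (torus_act q a z) (f b div q) / (torus_act q a z b (f b))"
      by (rule weight_rec(1)[OF assms(1) b])
    also have "\<dots> = (a (f b div q) / a 0 * weight q f z (f b div q)) / (a (f b div q) / a b * z b (f b))"
      using less.IH[of "f b div q"] weight_rec(2)[OF assms(1) b] less.prems by (simp add: torus_act_def)
    also have "\<dots> = a b / a 0 * (weight q f z (f b div q) / z b (f b))" using a by (simp add: field_simps)
    also have "\<dots> = a b / a 0 * weight q f z b" by (simp add: weight_rec(1)[OF assms(1) b])
    finally show ?thesis .
  qed (simp add: a)
qed

lemma openin_chart_dom: "openin (ftop (echelon_space q m)) (chart_dom q m f)"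
proof -
  interpret function_sheaf "echelon_space q m" by (rule function_sheaf_echelon_space)
  have "openin (ftop (echelon_space q m)) {z \<in> echelon_pts q m. (\<Prod>j\<in>{1..m}. z j (f j)) \<noteq> 0}"
    using open_nonzero[OF openin_topspace regf_prod[OF openin_topspace regf_entry[OF openin_topspace]]]
    unfolding pts_echelon_space .
  also have "{z \<in> echelon_pts q m. (\<Prod>j\<in>{1..m}. z j (f j)) \<noteq> 0} = chart_dom q m f"
    unfolding chart_dom_def by auto
  finally show ?thesis .
qed

lemma weight_regf:
  assumes "is_chart q m f" "b \<le> m"
  shows "(\<lambda>z. weight q f z b) \<in> regf (echelon_space q m) (chart_dom q m f)"
proof -
  interpret function_sheaf "echelon_space q m" by (rule function_sheaf_echelon_space)
  show ?thesis using assms(2)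
  proof (induction b rule: less_induct)
    case (less b)
    show ?case
    proof (cases "b = 0")
      case True
      then show ?thesis by (simp add: regf_const[OF openin_chart_dom])
    next
      case False
      then have b: "b \<in> {1..m}" using less.prems by auto
      show ?thesis unfolding weight_rec(1)[OF assms(1) b]
        using less weight_rec(2)[OF assms(1) b] b
        by (intro regf_divide openin_chart_dom regf_entry) (auto simp: chart_dom_def)
    qed
  qed
qed

lemma chart_exists:
  assumes "z \<in> echelon_pts q m"
  obtains f where "is_chart q m f" "z \<in> chart_dom q m f"
proof -
  have "\<forall>j. \<exists>p. j \<in> {1..m} \<longrightarrow> p \<in> free_cols q j \<and> z j p \<noteq> 0" using assms unfolding echelon_pts_def by blast
  then obtain f where "\<And>j. j \<in> {1..m} \<Longrightarrow> f j \<in> free_cols q j \<and> z j (f j) \<noteq> 0" by metis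
  then show thesis using that[of f] assms unfolding is_chart_def chart_dom_def by blast
qed

lemma chart_dom_torus_act:
  assumes "z \<in> chart_dom q m f" "\<And>b. a b \<noteq> 0"
  shows "torus_act q a z \<in> chart_dom q m f"
  using assms torus_act_echelon_pts[of z q m a] unfolding chart_dom_def by (auto simp: torus_act_def)

text \<open>On the chart of \<open>f\<close> this is the translate of \<open>z\<close> whose
  selected entries are all 1. Its entries are invariant regular functions, so it provides a regular
  section of the quotient map over the chart.\<close>

definition normal_form :: "nat \<Rightarrow> (nat \<Rightarrow> nat) \<Rightarrow> (nat \<Rightarrow> nat \<Rightarrow> complex) \<Rightarrow> nat \<Rightarrow> nat \<Rightarrow> complex" where
  "normal_form q f z = (\<lambda>j p. z j p * weight q f z j / weight q f z (p div q))"

lemma echelon_pts_zero: "z \<in> echelon_pts q m \<Longrightarrow> \<not> (j \<in> {1..m} \<and> p \<in> free_cols q j) \<Longrightarrow> z j p = 0"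
  unfolding echelon_pts_def by blast

text \<open>The scalar is set to 1 beyond \<open>m\<close>: such blocks do not meet the support of
  \<open>z\<close>, and nonvanishing of \<open>weight\<close> is known only up to
  \<open>m\<close>.\<close>

lemma normal_form_eq_torus_act:
  assumes "is_chart q m f" "z \<in> chart_dom q m f"
  shows "normal_form q f z = torus_act q (\<lambda>b. if b \<le> m then inverse (weight q f z b) else 1) z"
proof (intro ext)
  fix j p
  show "normal_form q f z j p = torus_act q (\<lambda>b. if b \<le> m then inverse (weight q f z b) else 1) z j p"
  proof (cases "j \<in> {1..m} \<and> p \<in> free_cols q j")
    case True
    then have "p div q < j" "j \<le> m" using free_cols_div by auto
    then show ?thesis unfolding normal_form_def torus_act_def by (simp add: divide_inverse)
  next
    case False
    then have "z j p = 0" using assms(2) echelon_pts_zero unfolding chart_dom_def by blast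
    then show ?thesis unfolding normal_form_def torus_act_def by simp
  qed
qed

text \<open>The two weights contribute a j / a 0 and its counterpart for block
  \<open>p div q\<close>; their quotient cancels the weight of \<open>z j p\<close>.\<close>

lemma normal_form_torus_act:
  assumes "is_chart q m f" "z \<in> echelon_pts q m" and a: "\<And>b. a b \<noteq> 0"
  shows "normal_form q f (torus_act q a z) = normal_form q f z"
proof (intro ext)
  fix j p
  show "normal_form q f (torus_act q a z) j p = normal_form q f z j p"
  proof (cases "j \<in> {1..m} \<and> p \<in> free_cols q j")
    case True
    then have "p div q \<le> m" "j \<le> m" using free_cols_div by fastforce+
    then show ?thesis using a
      by (simp add: normal_form_def weight_torus_act[OF assms(1) _ a]) (simp add: torus_act_def field_simps)
  next
    case False
    then have "z j p = 0" using assms(2) echelon_pts_zero by blast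
    then show ?thesis unfolding normal_form_def torus_act_def by simp
  qed
qed

lemma normal_form_regf:
  assumes "is_chart q m f"
  shows "(\<lambda>z. normal_form q f z j p) \<in> regf (echelon_space q m) (chart_dom q m f)"
proof -
  interpret function_sheaf "echelon_space q m" by (rule function_sheaf_echelon_space)
  show ?thesis
  proof (cases "j \<in> {1..m} \<and> p \<in> free_cols q j")
    case True
    then have "p div q \<le> m" "j \<le> m" using free_cols_div by fastforce+
    then show ?thesis unfolding normal_form_def
      using weight_nonzero[OF assms]
      by (intro regf_divide regf_mult openin_chart_dom regf_entry weight_regf[OF assms]) auto
  next
    case False
    show ?thesis
      by (rule regf_cong[OF openin_chart_dom regf_const[OF openin_chart_dom, of 0]])
        (use False echelon_pts_zero in \<open>auto simp: normal_form_def chart_dom_def\<close>)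
  qed
qed

section \<open>One stage of the tower\<close>

definition drop_row :: "nat \<Rightarrow> (nat \<Rightarrow> nat \<Rightarrow> complex) \<Rightarrow> nat \<Rightarrow> nat \<Rightarrow> complex" where
  "drop_row m z = (\<lambda>j p. if j \<le> m then z j p else 0)"

lemma drop_row_echelon_pts: "z \<in> echelon_pts q (Suc m) \<Longrightarrow> drop_row m z \<in> echelon_pts q m"
  unfolding echelon_pts_def drop_row_def by auto

lemma drop_row_torus_act: "drop_row m (torus_act q a z) = torus_act q a (drop_row m z)"
  unfolding drop_row_def torus_act_def by (auto simp: fun_eq_iff)

lemma fmorphism_drop_row: "fmorphism (echelon_space q (Suc m)) (echelon_space q m) (drop_row m)"
proof (rule fmorphism_echelon_space[OF function_sheaf_echelon_space])
  interpret function_sheaf "echelon_space q (Suc m)" by (rule function_sheaf_echelon_space)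
  show "(\<lambda>x. drop_row m x j p) \<in> regf (echelon_space q (Suc m)) (pts (echelon_space q (Suc m)))" for j p
    unfolding drop_row_def using regf_entry[OF openin_topspace] regf_const[OF openin_topspace]
    by (cases "j \<le> m") simp_all
qed (simp add: drop_row_echelon_pts)

text \<open>The charts index themselves, each being its own member of the cover; this fits the index
  type in \<open>generalized_bott_tower\<close>.\<close>

definition weight_ratio_bundle where
  "weight_ratio_bundle I t = \<lparr>idx = I, cov = (\<lambda>C. C), trans = (\<lambda>C C' x. mat 1 1 (\<lambda>_. t C C' x))\<rparr>"

lemma mat_1_1_mult: "mat 1 1 (\<lambda>_. a) * mat 1 1 (\<lambda>_. b) = (mat 1 1 (\<lambda>_. a * b) :: complex mat)"
  by (rule eq_matI) (auto simp: scalar_prod_def)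

lemma mat_1_1_one: "(mat 1 1 (\<lambda>_. 1) :: complex mat) = 1\<^sub>m 1"
  by (rule eq_matI) auto

lemma invertible_mat_1_1: "a \<noteq> 0 \<Longrightarrow> invertible_mat (mat 1 1 (\<lambda>_. a) :: complex mat)"
  unfolding invertible_mat_def inverts_mat_def
  by (intro conjI exI[of _ "mat 1 1 (\<lambda>_. inverse a)"]; (subst mat_1_1_mult)?)
    (simp_all add: mat_1_1_one[simplified])

lemma mat_act_mat_diag:
  "mat_act (Suc n) (mat_diag (Suc n) d) v = (\<lambda>a. if a \<le> n then d a * v a else 0)"
proof
  fix a
  have "(\<Sum>b<Suc n. mat_diag (Suc n) d $$ (a, b) * v b) = (\<Sum>b<Suc n. if b = a then d a * v a else 0)" if "a < Suc n"
    using that by (intro sum.cong) (auto simp: mat_diag_def)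
  then show "mat_act (Suc n) (mat_diag (Suc n) d) v a = (if a \<le> n then d a * v a else 0)"
    unfolding mat_act_def by auto
qed

lemma image_pt_class:
  assumes "\<And>c v. h (\<lambda>b. c * v b) = (\<lambda>b. c * h v b)"
  shows "h ` pt_class v = pt_class (h v)"
  unfolding pt_class_def using assms by (auto simp: image_iff) metis

text \<open>The bijection \<open>e\<close> numbers the free columns of the new row, hence the
  homogeneous coordinates of the fibre. With \<open>e 0 = 0\<close> coordinate 0 belongs to block 0,
  whose weight function is 1, so that summand 0 is trivial.\<close>

locale tower_stage =
  fixes q m :: nat and X :: "'a fspace" and \<pi> :: "(nat \<Rightarrow> nat \<Rightarrow> complex) \<Rightarrow> 'a"
    and X' :: "'b fspace" and \<pi>' :: "(nat \<Rightarrow> nat \<Rightarrow> complex) \<Rightarrow> 'b"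
    and n :: nat and e :: "nat \<Rightarrow> nat"
  assumes X: "torus_quotient q m X \<pi>" and X': "torus_quotient q (Suc m) X' \<pi>'"
    and e: "bij_betw e {..n} (free_cols q (Suc m))" and e0: "e 0 = 0"
begin

lemma quot: "is_quotient (echelon_space q m) X \<pi>" and quot': "is_quotient (echelon_space q (Suc m)) X' \<pi>'"
  using X X' unfolding torus_quotient_def by blast+

sublocale X: function_sheaf X
  by (rule function_sheaf_quotient[OF function_sheaf_echelon_space quot])

sublocale Z: function_sheaf "echelon_space q m"
  by (rule function_sheaf_echelon_space)

sublocale Z': function_sheaf "echelon_space q (Suc m)"
  by (rule function_sheaf_echelon_space)

lemma fibre: "z \<in> echelon_pts q m \<Longrightarrow> z' \<in> echelon_pts q m \<Longrightarrow> \<pi> z = \<pi> z' \<longleftrightarrow> (\<exists>a. (\<forall>b. a b \<noteq> 0) \<and> z' = torus_act q a z)"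
  using X unfolding torus_quotient_def by blast

lemma fibre': "z \<in> echelon_pts q (Suc m) \<Longrightarrow> z' \<in> echelon_pts q (Suc m) \<Longrightarrow>
    \<pi>' z = \<pi>' z' \<longleftrightarrow> (\<exists>a. (\<forall>b. a b \<noteq> 0) \<and> z' = torus_act q a z)"
  using X' unfolding torus_quotient_def by blast

lemma pi_torus_act: "z \<in> echelon_pts q m \<Longrightarrow> (\<And>b. a b \<noteq> 0) \<Longrightarrow> \<pi> (torus_act q a z) = \<pi> z"
  using fibre[of z "torus_act q a z"] torus_act_echelon_pts[of z q m a] by metis

lemma pi'_torus_act: "z \<in> echelon_pts q (Suc m) \<Longrightarrow> (\<And>b. a b \<noteq> 0) \<Longrightarrow> \<pi>' (torus_act q a z) = \<pi>' z"
  using fibre'[of z "torus_act q a z"] torus_act_echelon_pts[of z q "Suc m" a] by metis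

lemma pts_X: "pts X = \<pi> ` echelon_pts q m"
  using is_quotient_pts[OF quot] by simp

definition charts :: "'a set set" where
  "charts = {\<pi> ` chart_dom q m f | f. is_chart q m f}"

text \<open>Selections that differ only outside \<open>{1..m}\<close> have the same chart, so one of
  them is fixed for each open set.\<close>

definition sel :: "'a set \<Rightarrow> nat \<Rightarrow> nat" where
  "sel C = (SOME f. is_chart q m f \<and> C = \<pi> ` chart_dom q m f)"

lemma sel:
  assumes "C \<in> charts"
  shows "is_chart q m (sel C)" "C = \<pi> ` chart_dom q m (sel C)"
  using assms someI_ex[of "\<lambda>f. is_chart q m f \<and> C = \<pi> ` chart_dom q m f"] unfolding charts_def sel_def by blast+

text \<open>The torus keeps nonzero entries nonzero, so \<open>chart_dom\<close> is a union of
  fibres of \<open>\<pi>\<close>.\<close>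

lemma preimage_chart:
  assumes "C \<in> charts"
  shows "{z \<in> echelon_pts q m. \<pi> z \<in> C} = chart_dom q m (sel C)"
proof (intro subset_antisym subsetI)
  fix z assume z: "z \<in> {z \<in> echelon_pts q m. \<pi> z \<in> C}"
  then obtain w where w: "w \<in> chart_dom q m (sel C)" "\<pi> z = \<pi> w" using sel[OF assms] by blast
  then have "w \<in> echelon_pts q m" unfolding chart_dom_def by blast
  then obtain a where "\<forall>b. a b \<noteq> 0" "z = torus_act q a w" using fibre[of w z] w z by auto
  then show "z \<in> chart_dom q m (sel C)" using chart_dom_torus_act w by blast
next
  fix z assume "z \<in> chart_dom q m (sel C)"
  then show "z \<in> {z \<in> echelon_pts q m. \<pi> z \<in> C}" using sel[OF assms] unfolding chart_dom_def by blast
qed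

lemma in_chart: "C \<in> charts \<Longrightarrow> z \<in> echelon_pts q m \<Longrightarrow> \<pi> z \<in> C \<longleftrightarrow> z \<in> chart_dom q m (sel C)"
  using preimage_chart by blast

lemma chart_subset: "C \<in> charts \<Longrightarrow> C \<subseteq> pts X"
  unfolding pts_X using sel(2) unfolding chart_dom_def by blast

lemma openin_chart: "C \<in> charts \<Longrightarrow> openin (ftop X) C"
  unfolding is_quotient_openin[OF quot] using chart_subset preimage_chart openin_chart_dom by simp

lemma charts_cover: "\<Union>charts = pts X"
proof
  show "pts X \<subseteq> \<Union>charts"
  proof
    fix x assume "x \<in> pts X"
    then obtain z where z: "x = \<pi> z" "z \<in> echelon_pts q m" unfolding pts_X by blast
    then obtain f where "is_chart q m f" "z \<in> chart_dom q m f" using chart_exists by blast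
    then show "x \<in> \<Union>charts" unfolding charts_def z(1) by blast
  qed
qed (use chart_subset in blast)

definition lift :: "'a \<Rightarrow> nat \<Rightarrow> nat \<Rightarrow> complex" where
  "lift x = (SOME z. z \<in> echelon_pts q m \<and> \<pi> z = x)"

lemma lift: "x \<in> pts X \<Longrightarrow> lift x \<in> echelon_pts q m" "x \<in> pts X \<Longrightarrow> \<pi> (lift x) = x"
  using someI_ex[of "\<lambda>z. z \<in> echelon_pts q m \<and> \<pi> z = x"] unfolding pts_X lift_def by blast+

lemma lift_pi:
  assumes "z \<in> echelon_pts q m"
  obtains a where "\<And>b. a b \<noteq> 0" "lift (\<pi> z) = torus_act q a z"
proof -
  have "\<pi> z \<in> pts X" using assms pts_X by blast
  then show thesis using fibre[OF assms, of "lift (\<pi> z)"] lift[of "\<pi> z"] that by auto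
qed

text \<open>Both weights are multiplied by a b / a 0 along an orbit, so the quotient does not depend
  on \<open>lift\<close>, which is a mere choice of preimage.\<close>

definition ratio :: "nat \<Rightarrow> 'a set \<Rightarrow> 'a set \<Rightarrow> 'a \<Rightarrow> complex" where
  "ratio b C C' x = weight q (sel C') (lift x) b / weight q (sel C) (lift x) b"

lemma ratio_pi:
  assumes "z \<in> echelon_pts q m" "C \<in> charts" "C' \<in> charts" "b \<le> m"
  shows "ratio b C C' (\<pi> z) = weight q (sel C') z b / weight q (sel C) z b"
proof -
  obtain a where "\<And>b. a b \<noteq> 0" "lift (\<pi> z) = torus_act q a z" using lift_pi assms(1) by blast
  then show ?thesis unfolding ratio_def
    using weight_torus_act[OF sel(1)[OF assms(2)] assms(4), of a] weight_torus_act[OF sel(1)[OF assms(3)] assms(4), of a]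
    by simp
qed

lemma weight_ne:
  assumes "z \<in> echelon_pts q m" "C \<in> charts" "b \<le> m" "\<pi> z \<in> C"
  shows "weight q (sel C) z b \<noteq> 0"
  using weight_nonzero[OF sel(1)[OF assms(2)] _ assms(3)] in_chart assms by blast

definition L :: "nat \<Rightarrow> ('a set, 'a) bundle_data" where
  "L b = weight_ratio_bundle charts (ratio b)"

lemma ratio_regf:
  assumes "C \<in> charts" "C' \<in> charts" "b \<le> m"
  shows "ratio b C C' \<in> regf X (C \<inter> C')"
proof -
  have op: "openin (ftop X) (C \<inter> C')" using openin_chart assms by blast
  have eq: "{z \<in> pts (echelon_space q m). \<pi> z \<in> C \<inter> C'} = chart_dom q m (sel C) \<inter> chart_dom q m (sel C')"
    using preimage_chart[OF assms(1)] preimage_chart[OF assms(2)] by auto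
  have op': "openin (ftop (echelon_space q m)) (chart_dom q m (sel C) \<inter> chart_dom q m (sel C'))"
    using openin_chart_dom by blast
  show ?thesis unfolding is_quotient_regf[OF quot op] eq
  proof (rule Z.regf_cong[OF op'])
    show "(\<lambda>z. weight q (sel C') z b / weight q (sel C) z b) \<in> regf (echelon_space q m) (chart_dom q m (sel C) \<inter> chart_dom q m (sel C'))"
      using weight_nonzero[OF sel(1)[OF assms(1)] _ assms(3)]
      by (intro Z.regf_divide op' Z.regf_restrict[OF openin_chart_dom op' _ weight_regf] sel(1) assms) auto
    show "weight q (sel C') z b / weight q (sel C) z b = (ratio b C C' \<circ> \<pi>) z"
      if "z \<in> chart_dom q m (sel C) \<inter> chart_dom q m (sel C')" for z
      using that ratio_pi assms unfolding chart_dom_def by simp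
  qed
qed

lemma line_bundle_L:
  assumes "b \<le> m"
  shows "line_bundle X (L b)"
  unfolding vector_bundle_def L_def weight_ratio_bundle_def bundle_data.select_convs
proof (intro conjI ballI allI impI)
  show "(\<Union>i\<in>charts. i) = pts X" using charts_cover by simp
next
  fix i j x assume ij: "i \<in> charts" "j \<in> charts" "x \<in> i \<inter> j"
  then obtain z where z: "x = \<pi> z" "z \<in> echelon_pts q m" using chart_subset unfolding pts_X by blast
  have "ratio b i j x \<noteq> 0" unfolding z(1) ratio_pi[OF z(2) ij(1,2) assms]
    using weight_ne[OF z(2) _ assms] ij z(1) by auto
  then show "invertible_mat (mat 1 1 (\<lambda>_. ratio b i j x))" by (rule invertible_mat_1_1)
next
  fix i j and a c :: nat assume "i \<in> charts" "j \<in> charts" "a < 1" "c < 1"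
  then show "(\<lambda>x. mat 1 1 (\<lambda>_. ratio b i j x) $$ (a, c)) \<in> regf X (i \<inter> j)"
    using ratio_regf[OF _ _ assms] by simp
next
  fix i x assume i: "i \<in> charts" "x \<in> i"
  then obtain z where z: "x = \<pi> z" "z \<in> echelon_pts q m" using chart_subset unfolding pts_X by blast
  have "ratio b i i x = 1" unfolding z(1) ratio_pi[OF z(2) i(1,1) assms]
    using weight_ne[OF z(2) _ assms] i z(1) by auto
  then show "mat 1 1 (\<lambda>_. ratio b i i x) = 1\<^sub>m 1" by (simp only: mat_1_1_one)
next
  fix i j l x assume ij: "i \<in> charts" "j \<in> charts" "l \<in> charts" "x \<in> i \<inter> j \<inter> l"
  then obtain z where z: "x = \<pi> z" "z \<in> echelon_pts q m" using chart_subset unfolding pts_X by blast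
  have "ratio b i j x * ratio b j l x = ratio b i l x"
    unfolding z(1) ratio_pi[OF z(2) ij(1,2) assms] ratio_pi[OF z(2) ij(2,3) assms] ratio_pi[OF z(2) ij(1,3) assms]
    using weight_ne[OF z(2) _ assms] ij z(1) by auto
  then show "mat 1 1 (\<lambda>_. ratio b i j x) * mat 1 1 (\<lambda>_. ratio b j l x) = mat 1 1 (\<lambda>_. ratio b i l x)"
    by (simp only: mat_1_1_mult)
qed (use openin_chart in auto)

text \<open>The weight function of block 0 is 1 in every chart, so all transition functions are 1
  and the constant section trivialises.\<close>

lemma trivial_L0: "trivial_line_bundle X (L 0)"
  unfolding trivial_line_bundle_def
proof (intro conjI line_bundle_L exI[of _ "\<lambda>_ _. 1"] ballI)
  fix i j x assume "i \<in> idx (L 0)" "j \<in> idx (L 0)" "x \<in> cov (L 0) i \<inter> cov (L 0) j"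
  then show "1 = trans (L 0) i j x $$ (0, 0) * 1"
    by (simp add: L_def weight_ratio_bundle_def ratio_def)
qed (use openin_chart X.regf_const in \<open>auto simp: L_def weight_ratio_bundle_def\<close>)

section \<open>The sum of the weight bundles and its projective bundle\<close>

abbreviation blk :: "nat \<Rightarrow> nat" where "blk a \<equiv> e a div q"

lemma e_free_cols: "a \<le> n \<Longrightarrow> e a \<in> free_cols q (Suc m)"
  using e unfolding bij_betw_def by auto

lemma blk: "a \<le> n \<Longrightarrow> blk a \<le> m"
  using e_free_cols free_cols_div less_Suc_eq_le by blast

text \<open>Columns in one block contribute the same line bundle, so summands repeat. An index
  selects a chart for each summand separately.\<close>

definition Bun :: "(nat \<Rightarrow> 'a set, 'a) bundle_data" where
  "Bun = line_bundle_sum n (\<lambda>a. L (blk a))"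

lemma idx_Bun: "i \<in> idx Bun \<Longrightarrow> a \<le> n \<Longrightarrow> i a \<in> charts"
  unfolding Bun_def line_bundle_sum_def L_def weight_ratio_bundle_def by auto

lemma const_idx_Bun: "C \<in> charts \<Longrightarrow> restrict (\<lambda>_. C) {..n} \<in> idx Bun"
  unfolding Bun_def line_bundle_sum_def L_def weight_ratio_bundle_def by auto

lemma cov_Bun: "cov Bun i = (\<Inter>a\<in>{..n}. i a)"
  unfolding Bun_def line_bundle_sum_def L_def weight_ratio_bundle_def by simp

lemma trans_Bun: "trans Bun i j x = mat_diag (Suc n) (\<lambda>a. ratio (blk a) (i a) (j a) x)"
  unfolding Bun_def line_bundle_sum_def L_def weight_ratio_bundle_def by simp

lemma openin_cov: "i \<in> idx Bun \<Longrightarrow> openin (ftop X) (cov Bun i)"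
  unfolding cov_Bun by (intro openin_INT2) (auto intro: openin_chart idx_Bun)

lemma cov_subset: "i \<in> idx Bun \<Longrightarrow> cov Bun i \<subseteq> pts X"
  using openin_cov openin_subset by blast

text \<open>Dividing by it turns the entry of a new last row in column \<open>e a\<close> into the
  coordinate of summand \<open>a\<close> in the trivialisation \<open>i\<close>.\<close>

definition w :: "(nat \<Rightarrow> 'a set) \<Rightarrow> (nat \<Rightarrow> nat \<Rightarrow> complex) \<Rightarrow> nat \<Rightarrow> complex" where
  "w i z a = weight q (sel (i a)) z (blk a)"

lemma w_ne: "z \<in> echelon_pts q m \<Longrightarrow> i \<in> idx Bun \<Longrightarrow> \<pi> z \<in> cov Bun i \<Longrightarrow> a \<le> n \<Longrightarrow> w i z a \<noteq> 0"
  unfolding w_def by (rule weight_ne) (auto simp: cov_Bun idx_Bun blk)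

lemma w_torus_act:
  "i \<in> idx Bun \<Longrightarrow> a \<le> n \<Longrightarrow> (\<And>b. c b \<noteq> 0) \<Longrightarrow> w i (torus_act q c z) a = c (blk a) / c 0 * w i z a"
  unfolding w_def by (rule weight_torus_act[OF sel(1)[OF idx_Bun] blk])

lemma cov_preimage_subset:
  assumes "i \<in> idx Bun" "a \<le> n"
  shows "{z \<in> echelon_pts q m. \<pi> z \<in> cov Bun i} \<subseteq> chart_dom q m (sel (i a))"
  using preimage_chart[OF idx_Bun[OF assms]] assms(2) unfolding cov_Bun by auto

lemma openin_cov_preimage: "i \<in> idx Bun \<Longrightarrow> openin (ftop (echelon_space q m)) {z \<in> echelon_pts q m. \<pi> z \<in> cov Bun i}"
  using is_quotient_openin[OF quot, of "cov Bun i"] openin_cov[of i] by simp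

lemma w_regf:
  assumes "i \<in> idx Bun" "a \<le> n"
  shows "(\<lambda>z. w i z a) \<in> regf (echelon_space q m) {z \<in> echelon_pts q m. \<pi> z \<in> cov Bun i}"
  unfolding w_def using assms
  by (intro Z.regf_restrict[OF openin_chart_dom openin_cov_preimage cov_preimage_subset weight_regf] sel(1) idx_Bun blk)

definition cls where "cls = pbundle_class (Suc n) Bun"

definition vec_in :: "(nat \<Rightarrow> complex) \<Rightarrow> nat \<Rightarrow> complex" where
  "vec_in v = (\<lambda>a. if a \<le> n then v a else 0)"

lemma cls_eq:
  assumes "i \<in> idx Bun" "z \<in> echelon_pts q m"
  shows "cls (i, \<pi> z, pt_class (vec_in v)) =
    {(k, \<pi> z, pt_class (vec_in (\<lambda>a. w i z a / w k z a * v a))) | k. k \<in> idx Bun \<and> \<pi> z \<in> cov Bun k}"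
proof -
  have "mat_act (Suc n) (trans Bun k i (\<pi> z)) ` pt_class (vec_in v) =
     pt_class (vec_in (\<lambda>a. w i z a / w k z a * v a))" if k: "k \<in> idx Bun" for k
  proof -
    have "mat_act (Suc n) (trans Bun k i (\<pi> z)) ` pt_class (vec_in v) =
      pt_class (mat_act (Suc n) (trans Bun k i (\<pi> z)) (vec_in v))"
      unfolding trans_Bun mat_act_mat_diag by (rule image_pt_class) (auto simp: fun_eq_iff)
    also have "mat_act (Suc n) (trans Bun k i (\<pi> z)) (vec_in v) = vec_in (\<lambda>a. w i z a / w k z a * v a)"
      unfolding trans_Bun mat_act_mat_diag vec_in_def w_def using ratio_pi[OF assms(2)] idx_Bun assms(1) k blk
      by (auto simp: fun_eq_iff)
    finally show ?thesis .
  qed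
  then show ?thesis unfolding cls_def pbundle_class_def by auto
qed

text \<open>The numbers \<open>v a\<close> do not refer to any trivialisation. Dividing them by the
  weights for \<open>i\<close> or for \<open>j\<close> gives two local expressions of one point,
  since the transition functions are the ratios of these weights.\<close>

lemma cls_change:
  assumes "i \<in> idx Bun" "j \<in> idx Bun" "z \<in> echelon_pts q m" "\<pi> z \<in> cov Bun i" "\<pi> z \<in> cov Bun j"
  shows "cls (i, \<pi> z, pt_class (vec_in (\<lambda>a. v a / w i z a))) = cls (j, \<pi> z, pt_class (vec_in (\<lambda>a. v a / w j z a)))"
proof -
  have "vec_in (\<lambda>a. w i z a / w k z a * (v a / w i z a)) = vec_in (\<lambda>a. w j z a / w k z a * (v a / w j z a))" for k
    using w_ne[OF assms(3)] assms by (auto simp: vec_in_def fun_eq_iff)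
  then show ?thesis unfolding cls_eq[OF assms(1,3)] cls_eq[OF assms(2,3)] by simp
qed

lemma cls_self:
  assumes "i \<in> idx Bun" "z \<in> echelon_pts q m" "\<pi> z \<in> cov Bun i"
  shows "(i, \<pi> z, pt_class (vec_in v)) \<in> cls (i, \<pi> z, pt_class (vec_in v))"
proof -
  have "vec_in (\<lambda>a. w i z a / w i z a * v a) = vec_in v"
    using w_ne[OF assms(2,1,3)] by (auto simp: vec_in_def fun_eq_iff)
  then show ?thesis unfolding cls_eq[OF assms(1,2)] using assms
    by (intro CollectI exI[of _ i]) (simp only: simp_thms)
qed

lemma pbundle_proj_cls:
  assumes "i \<in> idx Bun" "z \<in> echelon_pts q m" "\<pi> z \<in> cov Bun i"
  shows "pbundle_proj (cls (i, \<pi> z, pt_class (vec_in v))) = \<pi> z"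
  unfolding pbundle_proj_def
proof (rule the_equality)
  show "\<exists>i' l. (i', \<pi> z, l) \<in> cls (i, \<pi> z, pt_class (vec_in v))" using cls_self[OF assms] by blast
  show "x = \<pi> z" if "\<exists>i' l. (i', x, l) \<in> cls (i, \<pi> z, pt_class (vec_in v))" for x
    using that unfolding cls_eq[OF assms(1,2)] by blast
qed

abbreviation fibre_space where "fibre_space \<equiv> proj_space {..<Suc n}"

definition piece where "piece i = prod_fspace (sub_fspace X (cov Bun i)) fibre_space"

definition P where "P = pbundle X (Suc n) Bun"

lemma quot_P: "is_quotient (sum_fspace (idx Bun) piece) P cls"
  unfolding P_def pbundle_def piece_def cls_def by (rule is_quotient_quotient_fspace)

lemma sheaf_pair_piece: "i \<in> idx Bun \<Longrightarrow> function_sheaf_pair (sub_fspace X (cov Bun i)) fibre_space"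
  unfolding function_sheaf_pair_def
  using X.function_sheaf_sub_fspace[OF openin_cov] function_sheaf_proj_space by blast

lemma pts_piece: "i \<in> idx Bun \<Longrightarrow> pts (piece i) = cov Bun i \<times> proj_pts {..<Suc n}"
  unfolding piece_def function_sheaf_pair.pts_prod_fspace[OF sheaf_pair_piece] using cov_subset by auto

lemma vec_in_cvecs: "vec_in v \<in> cvecs {..<Suc n}"
  unfolding vec_in_def cvecs_def by auto

lemma proj_pts_vec_in: "v a \<noteq> 0 \<Longrightarrow> a \<le> n \<Longrightarrow> pt_class (vec_in v) \<in> proj_pts {..<Suc n}"
  by (rule pt_class_in_proj_pts[OF vec_in_cvecs, of _ a]) (simp add: vec_in_def)

lemma proj_ptsE':
  assumes "l \<in> proj_pts {..<Suc n}"
  obtains v a where "l = pt_class (vec_in v)" "a \<le> n" "v a \<noteq> 0"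
proof -
  obtain v where v: "l = pt_class v" "v \<in> cvecs {..<Suc n}" "v \<noteq> (\<lambda>_. 0)" using proj_ptsE[OF assms] .
  then have 1: "vec_in v = v" unfolding vec_in_def cvecs_def by (auto simp: fun_eq_iff)
  obtain a where a: "v a \<noteq> 0" using v(3) by auto
  then have "a \<le> n" using v(2) by (intro leI notI) (simp add: cvecs_def)
  then show thesis using that[of v a] v 1 a by simp
qed

section \<open>The map from the upper stage to the projective bundle\<close>

lemma last_row_nonzero:
  assumes "z \<in> echelon_pts q (Suc m)"
  obtains a where "a \<le> n" "z (Suc m) (e a) \<noteq> 0"
proof -
  have "\<exists>p\<in>free_cols q (Suc m). z (Suc m) p \<noteq> 0" using assms unfolding echelon_pts_def by simp
  then obtain p where "p \<in> free_cols q (Suc m)" "z (Suc m) p \<noteq> 0" by blast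
  moreover then obtain a where "a \<in> {..n}" "p = e a" using bij_betw_imp_surj_on[OF e] by blast
  ultimately show thesis using that by auto
qed

text \<open>Under the torus the entry has weight given by block \<open>blk a\<close> over block
  \<open>Suc m\<close>, and the divisor has weight given by \<open>blk a\<close> over block 0. The
  quotient has weight block 0 over block \<open>Suc m\<close>, the same for all \<open>a\<close>, so
  its class in projective space is invariant.\<close>

definition fibre_coord :: "(nat \<Rightarrow> 'a set) \<Rightarrow> (nat \<Rightarrow> nat \<Rightarrow> complex) \<Rightarrow> nat \<Rightarrow> complex" where
  "fibre_coord i z = vec_in (\<lambda>a. z (Suc m) (e a) / w i (drop_row m z) a)"

definition dom' where "dom' i = {z \<in> echelon_pts q (Suc m). \<pi> (drop_row m z) \<in> cov Bun i}"

lemma openin_dom': "i \<in> idx Bun \<Longrightarrow> openin (ftop (echelon_space q (Suc m))) (dom' i)"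
  using fmorphism_open[OF fmorphism_comp[OF fmorphism_drop_row fmorphism_quotient[OF quot]] openin_cov[of i]]
  unfolding dom'_def by simp

lemma dom'_cover:
  assumes "z \<in> echelon_pts q (Suc m)"
  obtains i where "i \<in> idx Bun" "z \<in> dom' i"
proof -
  have "\<pi> (drop_row m z) \<in> pts X" using drop_row_echelon_pts[OF assms] pts_X by blast
  then obtain C where "C \<in> charts" "\<pi> (drop_row m z) \<in> C" using charts_cover by blast
  then show thesis using that[OF const_idx_Bun[of C]] assms unfolding dom'_def cov_Bun by auto
qed

lemma pts_dom' [simp]: "echelon_pts q (Suc m) \<inter> dom' i = dom' i" unfolding dom'_def by blast

lemma fmorphism_fibre_coord:
  assumes i: "i \<in> idx Bun"
  shows "fmorphism (sub_fspace (echelon_space q (Suc m)) (dom' i)) fibre_space (\<lambda>z. pt_class (fibre_coord i z))"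
proof (rule fmorphism_proj_space)
  note op = openin_dom'[OF i]
  show "function_sheaf (sub_fspace (echelon_space q (Suc m)) (dom' i))"
    by (rule Z'.function_sheaf_sub_fspace[OF op])
  fix a assume "a \<in> {..<Suc n}"
  then have a: "a \<le> n" by simp
  have "(\<lambda>z. w i z a) \<circ> drop_row m \<in> regf (echelon_space q (Suc m))
     {z \<in> pts (echelon_space q (Suc m)). drop_row m z \<in> {z \<in> echelon_pts q m. \<pi> z \<in> cov Bun i}}"
    by (rule fmorphism_regf[OF fmorphism_drop_row openin_cov_preimage w_regf]) (use i a in auto)
  also have "{z \<in> pts (echelon_space q (Suc m)). drop_row m z \<in> {z \<in> echelon_pts q m. \<pi> z \<in> cov Bun i}} = dom' i"
    unfolding dom'_def using drop_row_echelon_pts by auto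
  finally have "(\<lambda>z. z (Suc m) (e a) / w i (drop_row m z) a) \<in> regf (echelon_space q (Suc m)) (dom' i)"
    using w_ne[OF drop_row_echelon_pts i _ a] unfolding comp_def
    by (intro Z'.regf_divide regf_entry op) (auto simp: dom'_def)
  then show "(\<lambda>z. fibre_coord i z a) \<in> regf (sub_fspace (echelon_space q (Suc m)) (dom' i))
      (pts (sub_fspace (echelon_space q (Suc m)) (dom' i)))"
    using a by (simp add: Z'.regf_sub_fspace[OF op op] fibre_coord_def vec_in_def)
next
  fix z assume z: "z \<in> pts (sub_fspace (echelon_space q (Suc m)) (dom' i))"
  show "fibre_coord i z \<in> cvecs {..<Suc n}" unfolding fibre_coord_def by (rule vec_in_cvecs)
  have "z \<in> echelon_pts q (Suc m)" using z by (simp add: dom'_def)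
  then obtain a where "a \<le> n" "z (Suc m) (e a) \<noteq> 0" by (rule last_row_nonzero)
  then have "fibre_coord i z a \<noteq> 0"
    using w_ne[OF drop_row_echelon_pts i, of z a] z by (auto simp: fibre_coord_def vec_in_def dom'_def)
  then show "fibre_coord i z \<noteq> (\<lambda>_. 0)" by auto
qed

definition to_bundle where
  "to_bundle z = (let i = SOME i. i \<in> idx Bun \<and> z \<in> dom' i in cls (i, \<pi> (drop_row m z), pt_class (fibre_coord i z)))"

lemma to_bundle:
  assumes "i \<in> idx Bun" "z \<in> dom' i"
  shows "to_bundle z = cls (i, \<pi> (drop_row m z), pt_class (fibre_coord i z))"
proof -
  define j where "j = (SOME i. i \<in> idx Bun \<and> z \<in> dom' i)"
  have j: "j \<in> idx Bun" "z \<in> dom' j" using someI[of "\<lambda>i. i \<in> idx Bun \<and> z \<in> dom' i" i] assms unfolding j_def by blast+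
  show ?thesis unfolding to_bundle_def Let_def j_def[symmetric] fibre_coord_def
    by (rule cls_change) (use assms j drop_row_echelon_pts in \<open>auto simp: dom'_def\<close>)
qed

lemma fmorphism_to_bundle: "fmorphism (echelon_space q (Suc m)) P to_bundle"
proof (rule Z'.fmorphism_local)
  fix z assume "z \<in> pts (echelon_space q (Suc m))"
  then obtain i where i: "i \<in> idx Bun" "z \<in> dom' i" using dom'_cover by auto
  let ?S = "sub_fspace (echelon_space q (Suc m)) (dom' i)"
  note op = openin_dom'[OF i(1)]
  have S: "function_sheaf ?S" by (rule Z'.function_sheaf_sub_fspace[OF op])
  have "fmorphism ?S X (\<pi> \<circ> drop_row m)"
    by (rule Z'.fmorphism_sub_fspace[OF op fmorphism_comp[OF fmorphism_drop_row fmorphism_quotient[OF quot]]])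
  then have "fmorphism ?S (sub_fspace X (cov Bun i)) (\<pi> \<circ> drop_row m)"
    by (rule X.fmorphism_into_sub_fspace[OF openin_cov[OF i(1)]]) (simp add: dom'_def)
  then have "fmorphism ?S (piece i) (\<lambda>z. ((\<pi> \<circ> drop_row m) z, pt_class (fibre_coord i z)))"
    unfolding piece_def
    by (rule function_sheaf_pair.fmorphism_Pair[OF sheaf_pair_piece[OF i(1)] S _ fmorphism_fibre_coord[OF i(1)]])
  then have "fmorphism ?S P (cls \<circ> (Pair i \<circ> (\<lambda>z. ((\<pi> \<circ> drop_row m) z, pt_class (fibre_coord i z)))))"
    by (rule fmorphism_comp[OF fmorphism_comp[OF _ fmorphism_sum_inj[of i "idx Bun" piece, OF i(1)]] fmorphism_quotient[OF quot_P]])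
  then have "fmorphism ?S P to_bundle"
    by (rule function_sheaf.fmorphism_cong[OF S]) (use to_bundle[OF i(1)] in auto)
  then show "\<exists>A. openin (ftop (echelon_space q (Suc m))) A \<and> z \<in> A \<and>
      fmorphism (sub_fspace (echelon_space q (Suc m)) A) P to_bundle" using op i by blast
qed

section \<open>The inverse map, which adjoins a last basis vector\<close>

definition glue :: "(nat \<Rightarrow> nat \<Rightarrow> complex) \<Rightarrow> (nat \<Rightarrow> complex) \<Rightarrow> nat \<Rightarrow> nat \<Rightarrow> complex" where
  "glue z c = (\<lambda>j p. if j = Suc m then (if p \<in> free_cols q (Suc m) then c (inv_into {..n} e p) else 0) else z j p)"

lemma inv_e: "a \<le> n \<Longrightarrow> inv_into {..n} e (e a) = a"
  using e unfolding bij_betw_def by (simp add: inv_into_f_f)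

lemma e_inv: "p \<in> free_cols q (Suc m) \<Longrightarrow> e (inv_into {..n} e p) = p" "p \<in> free_cols q (Suc m) \<Longrightarrow> inv_into {..n} e p \<le> n"
proof -
  assume "p \<in> free_cols q (Suc m)"
  then have "p \<in> e ` {..n}" using e unfolding bij_betw_def by simp
  then show "e (inv_into {..n} e p) = p" "inv_into {..n} e p \<le> n"
    using f_inv_into_f[of p e "{..n}"] inv_into_into[of p e "{..n}"] by auto
qed

lemma glue_echelon_pts:
  assumes "z \<in> echelon_pts q m" "a \<le> n" "c a \<noteq> 0"
  shows "glue z c \<in> echelon_pts q (Suc m)"
proof -
  have "glue z c (Suc m) (e a) \<noteq> 0" using e_free_cols[OF assms(2)] inv_e[OF assms(2)] assms(3) by (simp add: glue_def)
  moreover have "glue z c j = z j" if "j \<in> {1..m}" for j using that by (auto simp: glue_def)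
  moreover have "\<exists>p\<in>free_cols q j. glue z c j p \<noteq> 0" if "j \<in> {1..Suc m}" for j
    using that calculation assms(1) e_free_cols[OF assms(2)] unfolding echelon_pts_def
    by (cases "j = Suc m") (auto dest!: bspec[of _ _ j])
  moreover have "j \<in> {1..Suc m} \<and> p \<in> free_cols q j" if "glue z c j p \<noteq> 0" for j p
  proof (cases "j = Suc m")
    case False
    then have "z j p \<noteq> 0" using that by (simp add: glue_def)
    then have "j \<in> {1..m} \<and> p \<in> free_cols q j" using echelon_pts_zero[OF assms(1)] by blast
    then show ?thesis by auto
  qed (use that in \<open>auto simp: glue_def split: if_splits\<close>)
  ultimately show ?thesis unfolding echelon_pts_def by blast
qed

lemma drop_row_glue: "z \<in> echelon_pts q m \<Longrightarrow> drop_row m (glue z c) = z"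
  unfolding drop_row_def glue_def echelon_pts_def by (fastforce simp: fun_eq_iff)

lemma glue_drop_row:
  assumes "z \<in> echelon_pts q (Suc m)"
  shows "glue (drop_row m z) (\<lambda>a. z (Suc m) (e a)) = z"
proof (intro ext)
  fix j p
  show "glue (drop_row m z) (\<lambda>a. z (Suc m) (e a)) j p = z j p"
    using echelon_pts_zero[OF assms, of j p] e_inv[of p] by (auto simp: glue_def drop_row_def)
qed

lemma glue_cong: "(\<And>a. a \<le> n \<Longrightarrow> c a = c' a) \<Longrightarrow> glue z c = glue z c'"
  using e_inv by (auto simp: glue_def fun_eq_iff)

text \<open>Multiplication by the weights undoes \<open>fibre_coord\<close>. Both
  \<open>lift\<close> and \<open>rep\<close> are arbitrary choices; changing them moves the glued
  basis within its torus orbit, which \<open>\<pi>'\<close> does not notice.\<close>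

definition from_piece where
  "from_piece = (\<lambda>(i, x, l). \<pi>' (glue (lift x) (\<lambda>a. rep l a * w i (lift x) a)))"

lemma pi'_glue_torus_act:
  assumes "i \<in> idx Bun" "z \<in> echelon_pts q m" "\<pi> z \<in> cov Bun i" "a \<le> n" "v a \<noteq> 0" "s \<noteq> 0" "\<And>b. c b \<noteq> 0"
  shows "\<pi>' (glue (torus_act q c z) (\<lambda>a. s * v a * w i (torus_act q c z) a)) = \<pi>' (glue z (\<lambda>a. v a * w i z a))"
proof -
  \<comment> \<open>The last row changes by \<open>s\<close> and by the weight ratios c b / c 0, so
    the scalar of the new block \<open>Suc m\<close> must be c 0 / s; earlier rows dictate
    \<open>c\<close>.\<close>
  define d where "d b = (if b \<le> m then c b else c 0 / s)" for b
  have "glue (torus_act q c z) (\<lambda>a. s * v a * w i (torus_act q c z) a) = torus_act q d (glue z (\<lambda>a. v a * w i z a))"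
  proof (intro ext)
    fix j p
    show "glue (torus_act q c z) (\<lambda>a. s * v a * w i (torus_act q c z) a) j p = torus_act q d (glue z (\<lambda>a. v a * w i z a)) j p"
    proof (cases "j = Suc m")
      case True
      show ?thesis
      proof (cases "p \<in> free_cols q (Suc m)")
        case p: True
        then have "p div q \<le> m" using free_cols_div by fastforce
        then have d: "d (p div q) = c (p div q)" "d (Suc m) = c 0 / s" unfolding d_def by auto
        define a' where "a' = inv_into {..n} e p"
        have a': "a' \<le> n" "e a' = p" unfolding a'_def using e_inv[OF p] by auto
        have "s * v a' * w i (torus_act q c z) a' = d (p div q) / d (Suc m) * (v a' * w i z a')"
          using assms(6,7) by (simp add: w_torus_act[OF assms(1) a'(1) assms(7)] a'(2) d)
        then show ?thesis unfolding torus_act_def[of q d] True using p by (simp add: glue_def a'_def)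
      qed (simp add: True glue_def torus_act_def)
    next
      case False
      show ?thesis
      proof (cases "j \<in> {1..m} \<and> p \<in> free_cols q j")
        case True
        then have "p div q \<le> m" "j \<le> m" using free_cols_div by fastforce+
        then show ?thesis using False by (simp add: glue_def torus_act_def d_def)
      next
        case F: False
        then show ?thesis using False echelon_pts_zero[OF assms(2) F] by (simp add: glue_def torus_act_def)
      qed
    qed
  qed
  moreover have "glue z (\<lambda>a. v a * w i z a) \<in> echelon_pts q (Suc m)"
    by (rule glue_echelon_pts[OF assms(2,4)]) (use w_ne assms in auto)
  ultimately show ?thesis using pi'_torus_act[of _ d] assms(6,7) by (auto simp: d_def)
qed

lemma from_piece:
  assumes "i \<in> idx Bun" "z \<in> echelon_pts q m" "\<pi> z \<in> cov Bun i" "a \<le> n" "v a \<noteq> 0"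
  shows "from_piece (i, \<pi> z, pt_class (vec_in v)) = \<pi>' (glue z (\<lambda>a. v a * w i z a))"
proof -
  obtain c where c: "\<And>b. c b \<noteq> 0" "lift (\<pi> z) = torus_act q c z" using lift_pi assms(2) by blast
  obtain s where s: "s \<noteq> 0" "rep (pt_class (vec_in v)) = (\<lambda>a. s * vec_in v a)"
    using rep_pt_class[of "vec_in v"] unfolding mem_pt_class by blast
  have "glue (torus_act q c z) (\<lambda>a. s * vec_in v a * w i (torus_act q c z) a) =
    glue (torus_act q c z) (\<lambda>a. s * v a * w i (torus_act q c z) a)" by (rule glue_cong) (simp add: vec_in_def)
  then show ?thesis
    using pi'_glue_torus_act[where v = v and c = c, OF assms s(1) c(1)] by (simp add: from_piece_def c(2) s(2))
qed

lemma from_piece_cls: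
  assumes "i \<in> idx Bun" "p \<in> pts (piece i)" "j \<in> idx Bun" "p' \<in> pts (piece j)" "cls (i, p) = cls (j, p')"
  shows "from_piece (i, p) = from_piece (j, p')"
proof -
  obtain x l where p: "p = (x, l)" "x \<in> cov Bun i" "l \<in> proj_pts {..<Suc n}"
    using assms(1,2) pts_piece by auto
  obtain x' l' where p': "p' = (x', l')" "x' \<in> cov Bun j" "l' \<in> proj_pts {..<Suc n}"
    using assms(3,4) pts_piece by auto
  obtain z where z: "x = \<pi> z" "z \<in> echelon_pts q m" using p(2) cov_subset[OF assms(1)] unfolding pts_X by blast
  obtain z' where z': "x' = \<pi> z'" "z' \<in> echelon_pts q m" using p'(2) cov_subset[OF assms(3)] unfolding pts_X by blast
  obtain v a where v: "l = pt_class (vec_in v)" "a \<le> n" "v a \<noteq> 0" using proj_ptsE'[OF p(3)] .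
  obtain v' a' where v': "l' = pt_class (vec_in v')" "a' \<le> n" "v' a' \<noteq> 0" using proj_ptsE'[OF p'(3)] .
  have "(i, x, l) \<in> cls (j, \<pi> z', pt_class (vec_in v'))"
    using cls_self[OF assms(1) z(2), of v] assms(5) p p' z z' v v' by simp
  then have 1: "x = \<pi> z'" "l = pt_class (vec_in (\<lambda>a. w j z' a / w i z' a * v' a))"
    unfolding cls_eq[OF assms(3) z'(2)] by auto
  have ne: "w i z' a \<noteq> 0" "w j z' a \<noteq> 0" if "a \<le> n" for a
    using w_ne[OF z'(2)] that assms p p' 1 z' by auto
  have "from_piece (i, p) = \<pi>' (glue z' (\<lambda>a. (w j z' a / w i z' a * v' a) * w i z' a))"
    unfolding p(1) 1 by (rule from_piece[OF assms(1) z'(2) _ v'(2)]) (use 1 p ne v' in auto)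
  also have "glue z' (\<lambda>a. (w j z' a / w i z' a * v' a) * w i z' a) = glue z' (\<lambda>a. v' a * w j z' a)"
    by (rule glue_cong) (use ne in auto)
  also have "\<pi>' \<dots> = from_piece (j, p')"
    unfolding p'(1) v'(1) z'(1) by (rule from_piece[where v = v', symmetric, OF assms(3) z'(2) _ v'(2,3)]) (use p' z' in auto)
  finally show ?thesis .
qed

lemma regf_ratio_coord:
  assumes "a \<le> n" "c \<le> n"
  shows "openin (ftop fibre_space) {l \<in> proj_pts {..<Suc n}. \<forall>v\<in>l. v c \<noteq> 0}"
    and "(\<lambda>l. rep l a / rep l c) \<in> regf fibre_space {l \<in> proj_pts {..<Suc n}. \<forall>v\<in>l. v c \<noteq> 0}"
proof -
  have coord: "(\<lambda>v. v b) \<in> hom_polys {..<Suc n} 1" if "b \<le> n" for b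
    using that by (intro hom_polys_coord) auto
  show "openin (ftop fibre_space) {l \<in> proj_pts {..<Suc n}. \<forall>v\<in>l. v c \<noteq> 0}"
    using openin_proj_basic[OF coord[OF assms(2)]] .
  show "(\<lambda>l. rep l a / rep l c) \<in> regf fibre_space {l \<in> proj_pts {..<Suc n}. \<forall>v\<in>l. v c \<noteq> 0}"
    unfolding mem_regf_proj_space
  proof (intro ballI exI[of _ 1], rule bexI[OF _ coord[OF assms(1)]], rule bexI[OF _ coord[OF assms(2)]], intro conjI ballI impI)
    fix l v assume l: "l \<in> {l \<in> proj_pts {..<Suc n}. \<forall>v\<in>l. v c \<noteq> 0}" "v \<in> l" "v c \<noteq> 0"
    then obtain u where "l = pt_class u" by (auto elim!: proj_ptsE)
    then have "l = pt_class v" using mem_pt_class_eq l by blast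
    then show "rep l a / rep l c = v a / v c"
      using hom_polys_ratio[OF coord[OF assms(1)] coord[OF assms(2)] rep_pt_class] by simp
  qed auto
qed

text \<open>The choices in \<open>from_piece\<close> are not regular, so they are replaced locally
  by regular ones with the same image: \<open>lift\<close> by the normal form of a chart, and
  \<open>rep\<close> by the representative whose coordinate \<open>c\<close> is 1 on the affine open
  set where that coordinate does not vanish.\<close>

lemma fmorphism_from_piece:
  assumes i: "i \<in> idx Bun"
  shows "fmorphism (piece i) X' (\<lambda>p. from_piece (i, p))"
proof -
  interpret pr: function_sheaf_pair "sub_fspace X (cov Bun i)" fibre_space by (rule sheaf_pair_piece[OF i])
  interpret S: function_sheaf "piece i" unfolding piece_def by (rule pr.function_sheaf_prod_fspace)
  note op = openin_cov[OF i]
  have op_sub: "openin (ftop (sub_fspace X (cov Bun i))) (cov Bun i)" by (simp add: X.openin_sub_fspace[OF op] op)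
  \<comment> \<open>The chart of summand 0 contains the whole of \<open>cov Bun i\<close>, so its
    normal form is available there.\<close>
  define f where "f = sel (i 0)"
  have f: "is_chart q m f" unfolding f_def by (rule sel(1)[OF idx_Bun[OF i]]) simp
  define nf where "nf x = normal_form q f (lift x)" for x
  have dom: "{z \<in> echelon_pts q m. \<pi> z \<in> cov Bun i} \<subseteq> chart_dom q m f"
    unfolding f_def by (rule cov_preimage_subset[OF i]) simp
  have nf_pi: "nf (\<pi> z) = normal_form q f z" if z: "z \<in> echelon_pts q m" for z
  proof -
    obtain c where c: "\<And>b. c b \<noteq> 0" "lift (\<pi> z) = torus_act q c z" using lift_pi z by blast
    then show ?thesis unfolding nf_def using normal_form_torus_act[OF f z] by simp
  qed
  have nf_pts: "nf x \<in> echelon_pts q m" "\<pi> (nf x) = x" if x: "x \<in> cov Bun i" for x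
  proof -
    have x': "x \<in> pts X" using cov_subset[OF i] x by auto
    then have d: "lift x \<in> chart_dom q m f" using dom lift[OF x'] x by auto
    have nz: "(if b \<le> m then inverse (weight q f (lift x) b) else 1) \<noteq> 0" for b
      using weight_nonzero[OF f d, of b] by simp
    show "nf x \<in> echelon_pts q m" "\<pi> (nf x) = x"
      unfolding nf_def normal_form_eq_torus_act[OF f d]
      using torus_act_echelon_pts[OF lift(1)[OF x'] nz] pi_torus_act[OF lift(1)[OF x'] nz] lift(2)[OF x'] by auto
  qed
  have pre: "{z \<in> pts (echelon_space q m). \<pi> z \<in> cov Bun i} = {z \<in> echelon_pts q m. \<pi> z \<in> cov Bun i}" by simp
  have nf_reg: "(\<lambda>x. nf x j p) \<in> regf X (cov Bun i)" for j p
    unfolding is_quotient_regf[OF quot op] pre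
    by (rule Z.regf_cong[OF openin_cov_preimage[OF i]
        Z.regf_restrict[OF openin_chart_dom openin_cov_preimage[OF i] dom normal_form_regf[OF f, of j p]]])
      (simp add: nf_pi)
  \<comment> \<open>The normal form is the translate by the inverse weights of \<open>f\<close>, and
    the weight of block 0 is 1. Evaluating \<open>w i\<close> there divides it by the weight of
    \<open>f\<close> for the same block, and this quotient is invariant.\<close>
  have w_nf_reg: "(\<lambda>x. w i (nf x) a) \<in> regf X (cov Bun i)" if a: "a \<le> n" for a
    unfolding is_quotient_regf[OF quot op] pre
  proof (rule Z.regf_cong[OF openin_cov_preimage[OF i]])
    let ?D = "{z \<in> echelon_pts q m. \<pi> z \<in> cov Bun i}"
    show "(\<lambda>z. w i z a / weight q f z (blk a)) \<in> regf (echelon_space q m) ?D"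
      using weight_nonzero[OF f _ blk[OF a]] dom
      by (intro Z.regf_divide openin_cov_preimage i w_regf a
        Z.regf_restrict[OF openin_chart_dom openin_cov_preimage[OF i] dom weight_regf[OF f blk[OF a]]]) auto
    fix z assume z: "z \<in> ?D"
    then have d: "z \<in> chart_dom q m f" using dom by blast
    have nz: "(if b \<le> m then inverse (weight q f z b) else 1) \<noteq> 0" for b
      using weight_nonzero[OF f d, of b] by simp
    show "w i z a / weight q f z (blk a) = ((\<lambda>x. w i (nf x) a) \<circ> \<pi>) z"
      using z nf_pi w_torus_act[OF i a nz] blk[OF a]
      by (simp add: normal_form_eq_torus_act[OF f d] divide_inverse mult.commute)
  qed
  show ?thesis
  proof (rule S.fmorphism_local)
    fix p assume "p \<in> pts (piece i)"
    then obtain x l where p: "p = (x, l)" "x \<in> cov Bun i" "l \<in> proj_pts {..<Suc n}" using pts_piece[OF i] by auto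
    obtain v c where v: "l = pt_class (vec_in v)" "c \<le> n" "v c \<noteq> 0" using proj_ptsE'[OF p(3)] .
    define V where "V = {l \<in> proj_pts {..<Suc n}. \<forall>v\<in>l. v c \<noteq> 0}"
    define A where "A = cov Bun i \<times> V"
    have V: "openin (ftop fibre_space) V" unfolding V_def using regf_ratio_coord[OF v(2,2)] by blast
    have A: "openin (ftop (piece i)) A" unfolding A_def piece_def by (rule pr.openin_prod_fspace[OF op_sub V])
    have "p \<in> A" using p v by (auto simp: A_def V_def mem_pt_class vec_in_def)
    define g where "g = (\<lambda>(x, l). glue (nf x) (\<lambda>a. (rep l a / rep l c) * w i (nf x) a))"
    have rep_c: "rep l c \<noteq> 0" if "l \<in> V" for l
      using that rep_pt_class unfolding V_def by (auto elim!: proj_ptsE)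
    have ptsA: "pts (sub_fspace (piece i) A) = A" using openin_subset[OF A] by auto
    have fst_reg: "(\<lambda>p. h (fst p)) \<in> regf (sub_fspace (piece i) A) A" if "h \<in> regf X (cov Bun i)" for h
    proof -
      have "h \<in> regf (sub_fspace X (cov Bun i)) (cov Bun i)" using that by (simp add: X.regf_sub_fspace[OF op op])
      from fmorphism_regf[OF pr.fmorphism_fst op_sub this]
      have *: "h \<circ> fst \<in> regf (piece i) {p \<in> pts (piece i). fst p \<in> cov Bun i}" by (simp add: piece_def)
      have "h \<circ> fst \<in> regf (piece i) A"
        by (rule S.regf_restrict[OF _ A _ *])
          (use fmorphism_open[OF pr.fmorphism_fst op_sub] openin_subset[OF A] in \<open>auto simp: piece_def A_def\<close>)
      then show ?thesis by (simp add: S.regf_sub_fspace[OF A A] comp_def)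
    qed
    have snd_reg: "(\<lambda>p. h (snd p)) \<in> regf (sub_fspace (piece i) A) A" if "h \<in> regf fibre_space V" for h
    proof -
      from fmorphism_regf[OF pr.fmorphism_snd V that]
      have *: "h \<circ> snd \<in> regf (piece i) {p \<in> pts (piece i). snd p \<in> V}" by (simp add: piece_def)
      have "h \<circ> snd \<in> regf (piece i) A"
        by (rule S.regf_restrict[OF _ A _ *])
          (use fmorphism_open[OF pr.fmorphism_snd V] openin_subset[OF A] in \<open>auto simp: piece_def A_def\<close>)
      then show ?thesis by (simp add: S.regf_sub_fspace[OF A A] comp_def)
    qed
    have shA: "function_sheaf (sub_fspace (piece i) A)" by (rule S.function_sheaf_sub_fspace[OF A])
    interpret SA: function_sheaf "sub_fspace (piece i) A" by (rule shA)
    have opA: "openin (ftop (sub_fspace (piece i) A)) A" using openin_topspace[of "ftop (sub_fspace (piece i) A)"] ptsA by simp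
    have g_reg: "(\<lambda>p. g p j k) \<in> regf (sub_fspace (piece i) A) A" for j k
    proof (cases "j = Suc m \<and> k \<in> free_cols q (Suc m)")
      case True
      define a where "a = inv_into {..n} e k"
      have a: "a \<le> n" unfolding a_def using e_inv True by blast
      have "(\<lambda>p. (rep (snd p) a / rep (snd p) c) * w i (nf (fst p)) a) \<in> regf (sub_fspace (piece i) A) A"
        using snd_reg[OF regf_ratio_coord(2)[OF a v(2), folded V_def]] fst_reg[OF w_nf_reg[OF a]]
        by (intro SA.regf_mult opA)
      then show ?thesis using True by (simp add: g_def glue_def case_prod_unfold a_def)
    next
      case False
      then show ?thesis
        using fst_reg[OF nf_reg[of j k]] SA.regf_const[OF opA, of 0]
        by (cases "j = Suc m") (auto simp: g_def glue_def case_prod_unfold)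
    qed
    have g_pts: "g p \<in> echelon_pts q (Suc m)" "\<pi>' (g p) = from_piece (i, p)" if pA: "p \<in> A" for p
    proof -
      obtain x l where p: "p = (x, l)" "x \<in> cov Bun i" "l \<in> V" using pA unfolding A_def by auto
      have nz: "w i (nf x) c \<noteq> 0" using w_ne[OF nf_pts(1)[OF p(2)] i _ v(2)] nf_pts(2) p by simp
      show "g p \<in> echelon_pts q (Suc m)" unfolding p(1) g_def prod.case
        by (rule glue_echelon_pts[OF nf_pts(1)[OF p(2)] v(2)]) (use nz rep_c[OF p(3)] in auto)
      obtain v' a' where v': "l = pt_class (vec_in v')" using proj_ptsE'[of l] p(3) unfolding V_def by blast
      obtain s where s: "s \<noteq> 0" "rep l = (\<lambda>a. s * vec_in v' a)"
        using rep_pt_class[of "vec_in v'"] unfolding mem_pt_class v' by blast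
      have l: "l = pt_class (vec_in (\<lambda>a. rep l a / rep l c))"
        unfolding v' by (rule pt_class_scale[of "rep l c / s"])
          (use s rep_c[OF p(3)] v' in \<open>auto simp: vec_in_def\<close>)
      have "from_piece (i, p) = from_piece (i, \<pi> (nf x), pt_class (vec_in (\<lambda>a. rep l a / rep l c)))"
        unfolding p(1) nf_pts(2)[OF p(2)] l[symmetric] ..
      also have "\<dots> = \<pi>' (glue (nf x) (\<lambda>a. rep l a / rep l c * w i (nf x) a))"
        by (rule from_piece[OF i nf_pts(1)[OF p(2)] _ v(2)]) (use nf_pts p rep_c[OF p(3)] in auto)
      finally show "\<pi>' (g p) = from_piece (i, p)" by (simp add: g_def p(1))
    qed
    have "fmorphism (sub_fspace (piece i) A) (echelon_space q (Suc m)) g"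
      by (rule fmorphism_echelon_space[OF shA]) (use g_pts(1) g_reg ptsA in auto)
    from fmorphism_comp[OF this fmorphism_quotient[OF quot']]
    have "fmorphism (sub_fspace (piece i) A) X' (\<lambda>p. from_piece (i, p))"
      by (rule SA.fmorphism_cong) (use g_pts(2) ptsA in auto)
    then show "\<exists>A. openin (ftop (piece i)) A \<and> p \<in> A \<and> fmorphism (sub_fspace (piece i) A) X' (\<lambda>p. from_piece (i, p))"
      using A \<open>p \<in> A\<close> by blast
  qed
qed

lemma to_bundle_torus_act:
  assumes "z \<in> echelon_pts q (Suc m)" "\<And>b. c b \<noteq> 0"
  shows "to_bundle (torus_act q c z) = to_bundle z"
proof -
  let ?z = "torus_act q c z"
  obtain i where i: "i \<in> idx Bun" "z \<in> dom' i" using dom'_cover[OF assms(1)] .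
  have eq: "\<pi> (drop_row m ?z) = \<pi> (drop_row m z)"
    unfolding drop_row_torus_act by (rule pi_torus_act[OF drop_row_echelon_pts[OF assms(1)] assms(2)])
  have i': "?z \<in> dom' i" using i(2) torus_act_echelon_pts[OF assms] unfolding dom'_def by (simp add: eq)
  have "w i (drop_row m ?z) b = c (blk b) / c 0 * w i (drop_row m z) b" if "b \<le> n" for b
    unfolding drop_row_torus_act by (rule w_torus_act[OF i(1) that assms(2)])
  moreover have "?z (Suc m) (e b) = c (blk b) / c (Suc m) * z (Suc m) (e b)" for b
    by (simp add: torus_act_def)
  ultimately have "pt_class (fibre_coord i ?z) = pt_class (fibre_coord i z)"
    using assms(2) by (intro pt_class_scale[of "c 0 / c (Suc m)"]) (auto simp: fibre_coord_def vec_in_def mult_ac)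
  then show ?thesis unfolding to_bundle[OF i] to_bundle[OF i(1) i'] eq by simp
qed

text \<open>The projection, the map to the bundle and the inverse are all obtained by descent along
  quotient maps. On representatives the two composites reduce to removing and readjoining the last
  row, with division and multiplication by the weights cancelling.\<close>

theorem bundle_iso:
  obtains \<phi> where "fmorphism X' X \<phi>" "isomorphic_over \<phi> pbundle_proj X' (pbundle X (Suc n) Bun)"
proof -
  have fib1: "(\<pi> \<circ> drop_row m) z = (\<pi> \<circ> drop_row m) z'"
    if "z \<in> pts (echelon_space q (Suc m))" "z' \<in> pts (echelon_space q (Suc m))" "\<pi>' z = \<pi>' z'" for z z'
    using fibre'[of z z'] that pi_torus_act[OF drop_row_echelon_pts[of z]] by (auto simp: drop_row_torus_act)
  have fib2: "to_bundle z = to_bundle z'"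
    if "z \<in> pts (echelon_space q (Suc m))" "z' \<in> pts (echelon_space q (Suc m))" "\<pi>' z = \<pi>' z'" for z z'
    using fibre'[of z z'] that to_bundle_torus_act[of z] by auto
  obtain \<phi> where phi: "fmorphism X' X \<phi>" "\<And>z. z \<in> pts (echelon_space q (Suc m)) \<Longrightarrow> \<phi> (\<pi>' z) = (\<pi> \<circ> drop_row m) z"
  proof (rule fmorphism_descend[OF quot' fmorphism_comp[OF fmorphism_drop_row fmorphism_quotient[OF quot]]])
    show "h \<in> regf (echelon_space q (Suc m)) U" if "openin (ftop (echelon_space q (Suc m))) U"
      "g \<in> regf (echelon_space q (Suc m)) U" "\<And>x. x \<in> U \<Longrightarrow> g x = h x" for U g h
      by (rule Z'.regf_cong[OF that])
    show "(\<pi> \<circ> drop_row m) z = (\<pi> \<circ> drop_row m) z'" if "z \<in> pts (echelon_space q (Suc m))"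
      "z' \<in> pts (echelon_space q (Suc m))" "\<pi>' z = \<pi>' z'" for z z' by (rule fib1[OF that])
  qed (rule that, assumption, simp)
  obtain \<psi> where psi: "fmorphism X' P \<psi>" "\<And>z. z \<in> pts (echelon_space q (Suc m)) \<Longrightarrow> \<psi> (\<pi>' z) = to_bundle z"
  proof (rule fmorphism_descend[OF quot' fmorphism_to_bundle])
    show "h \<in> regf (echelon_space q (Suc m)) U" if "openin (ftop (echelon_space q (Suc m))) U"
      "g \<in> regf (echelon_space q (Suc m)) U" "\<And>x. x \<in> U \<Longrightarrow> g x = h x" for U g h
      by (rule Z'.regf_cong[OF that])
    show "to_bundle z = to_bundle z'" if "z \<in> pts (echelon_space q (Suc m))"
      "z' \<in> pts (echelon_space q (Suc m))" "\<pi>' z = \<pi>' z'" for z z' by (rule fib2[OF that])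
  qed (rule that, assumption, simp)
  have sheaf_piece: "function_sheaf (piece i)" if "i \<in> idx Bun" for i
    unfolding piece_def by (rule function_sheaf_pair.function_sheaf_prod_fspace[OF sheaf_pair_piece[OF that]])
  obtain \<theta> where theta: "fmorphism P X' \<theta>" "\<And>s. s \<in> pts (sum_fspace (idx Bun) piece) \<Longrightarrow> \<theta> (cls s) = from_piece s"
  proof (rule fmorphism_descend[OF quot_P fmorphism_from_sum[OF fmorphism_from_piece]])
    show "h \<in> regf (sum_fspace (idx Bun) piece) U"
      if "openin (ftop (sum_fspace (idx Bun) piece)) U" "g \<in> regf (sum_fspace (idx Bun) piece) U"
        "\<And>x. x \<in> U \<Longrightarrow> g x = h x" for U g h
      by (rule regf_sum_fspace_cong[OF sheaf_piece that])
    show "from_piece s = from_piece s'" if "s \<in> pts (sum_fspace (idx Bun) piece)"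
      "s' \<in> pts (sum_fspace (idx Bun) piece)" "cls s = cls s'" for s s'
    proof -
      obtain i p j p' where *: "s = (i, p)" "s' = (j, p')" by (metis surj_pair)
      then have "i \<in> idx Bun" "p \<in> pts (piece i)" "j \<in> idx Bun" "p' \<in> pts (piece j)" using that by auto
      then show ?thesis using that(3) unfolding * by (rule from_piece_cls)
    qed
  qed auto
  have 1: "\<theta> (\<psi> y) = y \<and> pbundle_proj (\<psi> y) = \<phi> y" if y: "y \<in> pts X'" for y
  proof -
    obtain z where z: "y = \<pi>' z" "z \<in> echelon_pts q (Suc m)" using y is_quotient_pts[OF quot'] by auto
    obtain i where i: "i \<in> idx Bun" "z \<in> dom' i" using dom'_cover[OF z(2)] .
    let ?t = "drop_row m z"
    have t: "?t \<in> echelon_pts q m" "\<pi> ?t \<in> cov Bun i" using drop_row_echelon_pts[OF z(2)] i by (auto simp: dom'_def)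
    obtain a where a: "a \<le> n" "z (Suc m) (e a) \<noteq> 0" using last_row_nonzero[OF z(2)] .
    have ne: "z (Suc m) (e a) / w i ?t a \<noteq> 0" using a w_ne[OF t(1) i(1) t(2)] by simp
    have psi_y: "\<psi> y = cls (i, \<pi> ?t, pt_class (fibre_coord i z))" using psi(2) z to_bundle[OF i] by simp
    have "(i, \<pi> ?t, pt_class (fibre_coord i z)) \<in> pts (sum_fspace (idx Bun) piece)"
      unfolding fibre_coord_def
      using i(1) t(2) proj_pts_vec_in[where v = "\<lambda>a. z (Suc m) (e a) / w i ?t a", OF ne a(1)] by (simp add: pts_piece)
    then have "\<theta> (\<psi> y) = from_piece (i, \<pi> ?t, pt_class (fibre_coord i z))" unfolding psi_y by (rule theta(2))
    also have "\<dots> = \<pi>' (glue ?t (\<lambda>a. z (Suc m) (e a) / w i ?t a * w i ?t a))"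
      unfolding fibre_coord_def by (rule from_piece[OF i(1) t a(1)]) (rule ne)
    also have "glue ?t (\<lambda>a. z (Suc m) (e a) / w i ?t a * w i ?t a) = glue ?t (\<lambda>a. z (Suc m) (e a))"
      by (rule glue_cong) (use w_ne[OF t(1) i(1) t(2)] in simp)
    also have "\<dots> = z" by (rule glue_drop_row[OF z(2)])
    finally have "\<theta> (\<psi> y) = y" using z by simp
    moreover have "pbundle_proj (\<psi> y) = \<phi> y"
      unfolding psi_y fibre_coord_def pbundle_proj_cls[OF i(1) t] using phi(2) z by simp
    ultimately show ?thesis by blast
  qed
  have 2: "\<psi> (\<theta> c) = c" if c: "c \<in> pts P" for c
  proof -
    obtain s where s: "c = cls s" "s \<in> pts (sum_fspace (idx Bun) piece)" using c is_quotient_pts[OF quot_P] by auto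
    then obtain i p where ip: "s = (i, p)" "i \<in> idx Bun" "p \<in> pts (piece i)" by auto
    then obtain x l where p: "p = (x, l)" "x \<in> cov Bun i" "l \<in> proj_pts {..<Suc n}" using pts_piece by auto
    obtain z where z: "x = \<pi> z" "z \<in> echelon_pts q m" using p(2) cov_subset[OF ip(2)] unfolding pts_X by blast
    obtain v a where v: "l = pt_class (vec_in v)" "a \<le> n" "v a \<noteq> 0" using proj_ptsE'[OF p(3)] .
    let ?g = "glue z (\<lambda>a. v a * w i z a)"
    have zi: "\<pi> z \<in> cov Bun i" using p z by simp
    have g: "?g \<in> echelon_pts q (Suc m)"
      by (rule glue_echelon_pts[OF z(2) v(2)]) (use v w_ne[OF z(2) ip(2) zi] in auto)
    have g_dom: "?g \<in> dom' i" using g zi unfolding dom'_def by (simp add: drop_row_glue[OF z(2)])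
    have "\<theta> c = from_piece s" using theta(2) s by simp
    also have "\<dots> = \<pi>' ?g" unfolding ip p z(1) v(1) by (rule from_piece[where v = v, OF ip(2) z(2) zi v(2,3)])
    finally have "\<psi> (\<theta> c) = to_bundle ?g" using psi(2) g by simp
    also have "\<dots> = cls (i, \<pi> z, pt_class (fibre_coord i ?g))"
      unfolding to_bundle[OF ip(2) g_dom] drop_row_glue[OF z(2)] ..
    also have "fibre_coord i ?g = vec_in v"
      unfolding fibre_coord_def drop_row_glue[OF z(2)] using w_ne[OF z(2) ip(2) zi] inv_e e_free_cols
      by (auto simp: vec_in_def fun_eq_iff glue_def)
    finally show ?thesis using s ip p z v by simp
  qed
  have "fisomorphism X' P \<psi>" unfolding fisomorphism_def
    using psi(1) theta(1) 1 2 by blast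
  then have "isomorphic_over \<phi> pbundle_proj X' (pbundle X (Suc n) Bun)"
    unfolding isomorphic_over_def using 1 unfolding P_def by blast
  then show thesis using that phi(1) by blast
qed

end

lemma finite_free_cols: "finite (free_cols q j)"
  unfolding free_cols_def by (rule finite_subset[of _ "{..<j*q}"]) auto

theorem torus_quotient_tower:
  fixes X :: "'a fspace" and X' :: "'b fspace"
  assumes "2 \<le> q" "torus_quotient q m X \<pi>" "torus_quotient q (Suc m) X' \<pi>'"
  shows "\<exists>\<phi>. fmorphism X' X \<phi> \<and> (\<exists>n\<ge>1. \<exists>L :: nat \<Rightarrow> ('a set, 'a) bundle_data.
     (\<forall>a\<le>n. line_bundle X (L a)) \<and> trivial_line_bundle X (L 0) \<and>
     isomorphic_over \<phi> pbundle_proj X' (pbundle X (Suc n) (line_bundle_sum n L)))"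
proof -
  let ?C = "free_cols q (Suc m)"
  \<comment> \<open>Here \<open>q \<ge> 2\<close> enters: column 1 is then not a multiple of
    \<open>q\<close>. Two free columns make the fibre dimension positive.\<close>
  have "{0, 1} \<subseteq> ?C" using assms(1) unfolding free_cols_def by auto
  then have C: "card ?C \<ge> 2" using card_mono[OF finite_free_cols, of "{0, 1}" q "Suc m"] by simp
  define n where "n = card ?C - 1"
  have n: "card ?C = Suc n" "n \<ge> 1" using C unfolding n_def by auto
  obtain h where h: "bij_betw h {0..<Suc n} ?C" using ex_bij_betw_nat_finite[OF finite_free_cols, of q "Suc m"] n by auto
  have "0 \<in> ?C" using \<open>{0, 1} \<subseteq> ?C\<close> by blast
  then have "0 \<in> h ` {0..<Suc n}" using bij_betw_imp_surj_on[OF h] by simp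
  then obtain i0 where i0: "i0 \<in> {0..<Suc n}" "0 = h i0" by blast
  \<comment> \<open>The transposition moves column 0 to the front, as summand 0 has to be the
    trivial one.\<close>
  define e where "e = h \<circ> Transposition.transpose 0 i0"
  have "bij_betw (Transposition.transpose 0 i0) {0..<Suc n} {0..<Suc n}"
    using permutes_imp_bij[OF permutes_swap_id[of 0 "{0..<Suc n}" i0]] i0 by simp
  then have "bij_betw e {0..<Suc n} ?C" unfolding e_def using bij_betw_trans h by blast
  moreover have "{0..<Suc n} = {..n}" by auto
  ultimately have e: "bij_betw e {..n} ?C" "e 0 = 0" using i0 by (auto simp: e_def)
  interpret tower_stage q m X \<pi> X' \<pi>' n e
    by unfold_locales (use assms e in auto)
  obtain \<phi> where phi: "fmorphism X' X \<phi>" "isomorphic_over \<phi> pbundle_proj X' (pbundle X (Suc n) Bun)"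
    using bundle_iso .
  show ?thesis
  proof (intro exI[of _ \<phi>] conjI exI[of _ n] exI[of _ "\<lambda>a. L (e a div q)"] allI impI)
    show "line_bundle X (L (e a div q))" if "a \<le> n" for a by (rule line_bundle_L[OF blk[OF that]])
    show "trivial_line_bundle X (L (e 0 div q))" using trivial_L0 by (simp add: e0)
    show "isomorphic_over \<phi> pbundle_proj X' (pbundle X (Suc n) (line_bundle_sum n (\<lambda>a. L (e a div q))))"
      using phi(2) unfolding Bun_def .
  qed (use phi n in auto)
qed

section \<open>Minors and Pluecker coordinates\<close>

text \<open>Rows are selected by a function instead of a set: exchanging rows produces unsorted
  selections, and a sign is paid only when the Pluecker coordinate is needed.\<close>

definition minor :: "nat \<Rightarrow> (nat \<Rightarrow> nat \<Rightarrow> complex) \<Rightarrow> (nat \<Rightarrow> nat) \<Rightarrow> complex" where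
  "minor k M \<tau> = det (mat k k (\<lambda>(i, j). M (\<tau> i) j))"

definition plucker :: "nat \<Rightarrow> nat \<Rightarrow> (nat \<Rightarrow> nat \<Rightarrow> complex) \<Rightarrow> nat set \<Rightarrow> complex" where
  "plucker k n M = (\<lambda>I. if I \<in> ksubsets k n then minor k M (pick I) else 0)"

lemma minor_def': "minor k M \<tau> = (\<Sum>p | p permutes {0..<k}. signof p * (\<Prod>i = 0..<k. M (\<tau> i) (p i)))"
proof -
  have "(\<Prod>i = 0..<k. mat k k (\<lambda>(i, j). M (\<tau> i) j) $$ (i, p i)) = (\<Prod>i = 0..<k. M (\<tau> i) (p i))"
    if p: "p permutes {0..<k}" for p
  proof (rule prod.cong[OF refl])
    fix i assume "i \<in> {0..<k}"
    then have "i < k" "p i < k" using permutes_in_image[OF p, of i] by auto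
    then show "mat k k (\<lambda>(i, j). M (\<tau> i) j) $$ (i, p i) = M (\<tau> i) (p i)" by simp
  qed
  then show ?thesis unfolding minor_def by (subst det_def'[of _ k]) (auto intro!: sum.cong)
qed

lemma minor_cong:
  assumes "\<And>i j. i < k \<Longrightarrow> j < k \<Longrightarrow> M (\<tau> i) j = M' (\<tau>' i) j"
  shows "minor k M \<tau> = minor k M' \<tau>'"
  unfolding minor_def using assms by (intro arg_cong[of _ _ det] eq_matI) auto

lemma finite_ksubsets [simp]: "finite (ksubsets k n)"
  unfolding ksubsets_def by (rule finite_subset[of _ "Pow {..<n}"]) auto

lemma ksubsets_finite: "I \<in> ksubsets k n \<Longrightarrow> finite I"
  unfolding ksubsets_def by (auto intro: finite_subset)

lemma pick_bij:
  assumes "card I = k" "finite I"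
  shows "bij_betw (pick I) {..<k} I"
proof -
  have inj: "inj_on (pick I) {..<k}"
  proof (rule inj_onI)
    fix i j assume "i \<in> {..<k}" "j \<in> {..<k}" "pick I i = pick I j"
    then show "i = j" using pick_mono_le[of i I j] pick_mono_le[of j I i] assms by (metis lessThan_iff less_irrefl nat_neq_iff)
  qed
  have "pick I ` {..<k} \<subseteq> I" using pick_in_set_le assms by auto
  moreover have "card (pick I ` {..<k}) = card I" using card_image[OF inj] assms by simp
  ultimately have "pick I ` {..<k} = I" using assms by (intro card_subset_eq) auto
  then show ?thesis using inj unfolding bij_betw_def by blast
qed

lemma ksubsets_pick_bij: "I \<in> ksubsets k n \<Longrightarrow> bij_betw (pick I) {..<k} I"
  by (rule pick_bij) (auto simp: ksubsets_def intro: finite_subset)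

lemma ksubsets_pick_less: "I \<in> ksubsets k n \<Longrightarrow> i < k \<Longrightarrow> pick I i < n"
  using ksubsets_pick_bij[of I k n] unfolding ksubsets_def bij_betw_def by auto

lemma ksubsets_image: "inj_on \<tau> {..<k} \<Longrightarrow> (\<And>i. i < k \<Longrightarrow> \<tau> i < n) \<Longrightarrow> \<tau> ` {..<k} \<in> ksubsets k n"
  unfolding ksubsets_def by (auto simp: card_image)

text \<open>Sorting the rows is a permutation determined by \<open>\<tau>\<close>, so one sign
  serves all matrices. Thus an unsorted minor is a fixed linear form in the Pluecker
  coordinates.\<close>

lemma minor_pick:
  assumes "bij_betw \<tau> {..<k} I"
  obtains s :: complex where "s \<in> {1, -1}" "\<And>M. minor k M \<tau> = s * minor k M (pick I)"
proof -
  have I: "card I = k" "finite I" using bij_betw_same_card[OF assms] bij_betw_finite[OF assms] by auto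
  note b = pick_bij[OF I]
  define p where "p i = (if i < k then inv_into {..<k} (pick I) (\<tau> i) else i)" for i
  have "bij_betw (inv_into {..<k} (pick I) \<circ> \<tau>) {..<k} {..<k}"
    by (rule bij_betw_trans[OF assms bij_betw_inv_into[OF b]])
  then have "bij_betw p {..<k} {..<k}"
    by (rule bij_betw_cong[THEN iffD1, rotated]) (simp add: p_def)
  then have p: "p permutes {0..<k}"
    by (intro bij_imp_permutes) (auto simp: p_def lessThan_atLeast0)
  have pick_p: "pick I (p i) = \<tau> i" if "i < k" for i
    unfolding p_def using that b assms f_inv_into_f[of "\<tau> i" "pick I" "{..<k}"] unfolding bij_betw_def by auto
  have "minor k M \<tau> = signof p * minor k M (pick I)" for M
  proof -
    let ?A = "mat k k (\<lambda>(i, j). M (pick I i) j)"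
    have "minor k M \<tau> = det (mat k k (\<lambda>(i, j). ?A $$ (p i, j)))"
      unfolding minor_def
    proof (intro arg_cong[of _ _ det] eq_matI)
      fix i j assume "i < dim_row (mat k k (\<lambda>(i, j). ?A $$ (p i, j)))" "j < dim_col (mat k k (\<lambda>(i, j). ?A $$ (p i, j)))"
      then have "i < k" "j < k" "p i < k" using permutes_in_image[OF p, of i] by auto
      then show "mat k k (\<lambda>(i, j). M (\<tau> i) j) $$ (i, j) = mat k k (\<lambda>(i, j). ?A $$ (p i, j)) $$ (i, j)"
        using pick_p by simp
    qed auto
    also have "\<dots> = signof p * det ?A" by (rule det_permute_rows[OF _ p]) simp
    finally show ?thesis unfolding minor_def .
  qed
  moreover have "(signof p :: complex) \<in> {1, -1}" by (rule signof_pm_one)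
  ultimately show thesis using that by blast
qed

lemma minor_mult:
  "minor k (\<lambda>i j. \<Sum>l<k. M i l * g l j) \<tau> = minor k M \<tau> * det (mat k k (\<lambda>(i, j). g i j))"
proof -
  have "mat k k (\<lambda>(i, j). \<Sum>l<k. M (\<tau> i) l * g l j) = mat k k (\<lambda>(i, j). M (\<tau> i) j) * mat k k (\<lambda>(i, j). g i j)"
    by (rule eq_matI) (auto simp: scalar_prod_def lessThan_atLeast0)
  then show ?thesis unfolding minor_def by (simp add: det_mult[of _ k])
qed

lemma minor_scale_rows: "minor k (\<lambda>i j. d i * M i j) \<tau> = (\<Prod>i<k. d (\<tau> i)) * minor k M \<tau>"
  unfolding minor_def' by (simp add: prod.distrib sum_distrib_left lessThan_atLeast0 mult_ac)

lemma minor_scale_cols: "minor k (\<lambda>i j. M i j * c j) \<tau> = (\<Prod>j<k. c j) * minor k M \<tau>"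
proof -
  have "(\<Prod>i = 0..<k. c (p i)) = (\<Prod>j<k. c j)" if "p permutes {0..<k}" for p
    using prod.permute[OF that, of c] by (simp add: comp_def lessThan_atLeast0)
  then show ?thesis unfolding minor_def' sum_distrib_left
    by (intro sum.cong) (auto simp: prod.distrib mult_ac)
qed

lemma minor_nonzeroI:
  assumes "\<And>x i. (\<And>i. i < k \<Longrightarrow> (\<Sum>j<k. M (\<tau> i) j * x j) = 0) \<Longrightarrow> i < k \<Longrightarrow> x i = 0"
  shows "minor k M \<tau> \<noteq> 0"
proof
  assume "minor k M \<tau> = 0"
  then obtain v where v: "v \<in> carrier_vec k" "v \<noteq> 0\<^sub>v k" "mat k k (\<lambda>(i, j). M (\<tau> i) j) *\<^sub>v v = 0\<^sub>v k"
    unfolding minor_def by (subst (asm) det_0_iff_vec_prod_zero[of _ k]) auto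
  have "(\<Sum>j<k. M (\<tau> i) j * v $ j) = 0" if "i < k" for i
    using arg_cong[OF v(3), of "\<lambda>u. u $ i"] v(1) that by (simp add: scalar_prod_def lessThan_atLeast0)
  then have "v $ i = 0" if "i < k" for i using assms[of "\<lambda>j. v $ j"] that by blast
  then have "v = 0\<^sub>v k" using v(1) by (intro eq_vecI) auto
  then show False using v(2) by contradiction
qed

lemma minor_identity:
  assumes "\<And>i j. i < k \<Longrightarrow> j < k \<Longrightarrow> M (\<tau> i) j = (if i = j then 1 else 0)"
  shows "minor k M \<tau> = 1"
proof -
  have "mat k k (\<lambda>(i, j). M (\<tau> i) j) = 1\<^sub>m k" by (rule eq_matI) (auto simp: assms)
  then show ?thesis unfolding minor_def by simp
qed

text \<open>The submatrix is an identity matrix with one row replaced; up to transposition this is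
  Cramer's rule for the identity. It recovers entries of an echelon matrix from its Pluecker
  coordinates.\<close>

lemma minor_exchange:
  assumes "\<And>i j. i < k \<Longrightarrow> j < k \<Longrightarrow> M (\<tau> i) j = (if i = j then 1 else 0)" "j < k"
  shows "minor k M (\<tau>(j := p)) = M p j"
proof -
  let ?A = "mat k k (\<lambda>(i, l). M ((\<tau>(j := p)) i) l)"
  have "replace_col (1\<^sub>m k) (1\<^sub>m k *\<^sub>v vec k (M p)) j = transpose_mat ?A"
    by (rule eq_matI) (use assms in \<open>auto simp: replace_col_def\<close>)
  then have "det (transpose_mat ?A) = M p j"
    using cramer_lemma_mat[of "1\<^sub>m k" k "vec k (M p)" j] assms(2) by simp
  then show ?thesis unfolding minor_def by (subst (asm) det_transpose[of _ k]) auto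
qed

text \<open>The columns in \<open>B\<close> are supported on the rows in \<open>A\<close>, which are
  too few: by the pigeonhole principle every permutation meets a zero entry in some column of
  \<open>B\<close>.\<close>

lemma minor_zeroI:
  assumes "finite A" "card A < card B" "B \<subseteq> {..<k}"
    and "\<And>i j. i < k \<Longrightarrow> j \<in> B \<Longrightarrow> M (\<tau> i) j \<noteq> 0 \<Longrightarrow> i \<in> A"
  shows "minor k M \<tau> = 0"
proof -
  have "(\<Prod>i = 0..<k. M (\<tau> i) (p i)) = 0" if p: "p permutes {0..<k}" for p
  proof (rule ccontr)
    assume nz: "\<not> ?thesis"
    have "Hilbert_Choice.inv p ` B \<subseteq> A"
    proof
      fix i assume "i \<in> Hilbert_Choice.inv p ` B"
      then obtain j where j: "j \<in> B" "i = Hilbert_Choice.inv p j" by blast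
      then have pi: "p i = j" using permutes_inverses(1)[OF p] by simp
      have ik: "i < k" using permutes_in_image[OF permutes_inv[OF p], of j] j assms(3) by auto
      have "M (\<tau> i) (p i) \<noteq> 0" using nz ik by auto
      then show "i \<in> A" unfolding pi using assms(4)[OF ik j(1)] by blast
    qed
    then have "card (Hilbert_Choice.inv p ` B) \<le> card A" using assms(1) card_mono by blast
    moreover have "card (Hilbert_Choice.inv p ` B) = card B"
      by (rule card_image, rule inj_on_subset[OF permutes_inj[OF permutes_inv[OF p]]]) simp
    ultimately show False using assms(2) by simp
  qed
  then show ?thesis unfolding minor_def' by (intro sum.neutral) auto
qed

lemma plucker_scale:
  assumes "\<And>\<tau>. minor k M \<tau> = c * minor k M' \<tau>"
  shows "plucker k n M = (\<lambda>I. c * plucker k n M' I)"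
  unfolding plucker_def using assms by auto

lemma plucker_cvecs: "plucker k n M \<in> cvecs (ksubsets k n)"
  unfolding plucker_def cvecs_def by auto

lemma plucker_cong:
  assumes "\<And>i j. i < n \<Longrightarrow> j < k \<Longrightarrow> M i j = M' i j"
  shows "plucker k n M = plucker k n M'"
  unfolding plucker_def using assms ksubsets_pick_less
  by (intro ext if_cong refl minor_cong) auto

lemma plucker_image:
  assumes "inj_on \<tau> {..<k}" "\<And>i. i < k \<Longrightarrow> \<tau> i < n"
  obtains s :: complex where "s \<in> {1, -1}" "\<And>M. minor k M \<tau> = s * plucker k n M (\<tau> ` {..<k})"
proof -
  have "bij_betw \<tau> {..<k} (\<tau> ` {..<k})" using assms(1) by (rule inj_on_imp_bij_betw)
  then obtain s :: complex where "s \<in> {1, -1}" "\<And>M. minor k M \<tau> = s * minor k M (pick (\<tau> ` {..<k}))"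
    using minor_pick by blast
  then show thesis using that[of s] ksubsets_image[OF assms] by (simp add: plucker_def)
qed

lemma inverse_mat_exists:
  assumes "A \<in> carrier_mat k k" "det A \<noteq> (0::complex)"
  obtains B where "B \<in> carrier_mat k k" "A * B = 1\<^sub>m k" "B * A = 1\<^sub>m k"
proof -
  define B where "B = inverse (det A) \<cdot>\<^sub>m adj_mat A"
  have B: "B \<in> carrier_mat k k" unfolding B_def using adj_mat(1)[OF assms(1)] by simp
  have "A * B = inverse (det A) \<cdot>\<^sub>m (A * adj_mat A)" "B * A = inverse (det A) \<cdot>\<^sub>m (adj_mat A * A)"
    unfolding B_def using assms(1) adj_mat(1)[OF assms(1)] by (auto intro!: mult_smult_distrib mult_smult_assoc_mat)
  moreover have "inverse (det A) \<cdot>\<^sub>m (det A \<cdot>\<^sub>m 1\<^sub>m k) = 1\<^sub>m k" using assms(2) by (intro eq_matI) auto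
  ultimately show thesis using that[OF B] adj_mat(2,3)[OF assms(1)] by simp
qed

text \<open>If \<open>I\<close> maximises the sum of its elements among the nonvanishing Pluecker
  coordinates, then the reduced matrix is in echelon form with pivots \<open>I\<close>.\<close>

lemma echelon_form:
  assumes "plucker k n M J \<noteq> 0"
  obtains I N c where "I \<in> ksubsets k n" "plucker k n M I \<noteq> 0" "c \<noteq> 0" "plucker k n N = (\<lambda>J. c * plucker k n M J)"
    "\<forall>i<k. \<forall>j<k. N (pick I i) j = (if i = j then 1 else 0)"
    "\<forall>j<k. \<forall>p<n. N p j \<noteq> 0 \<longrightarrow> p \<le> pick I j"
proof -
  let ?S = "{I \<in> ksubsets k n. plucker k n M I \<noteq> 0}"
  have "finite ?S" "J \<in> ?S" using assms by (auto simp: plucker_def split: if_splits)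
  then have "Max (Sum ` ?S) \<in> Sum ` ?S" and max: "I' \<in> ?S \<Longrightarrow> \<Sum>I' \<le> Max (Sum ` ?S)" for I'
    by (intro Max_in Max_ge; auto)+
  then obtain I where I: "I \<in> ?S" "\<And>I'. I' \<in> ?S \<Longrightarrow> \<Sum>I' \<le> \<Sum>I" by fastforce
  then have Ik: "I \<in> ksubsets k n" by blast
  note bij = ksubsets_pick_bij[OF Ik]
  let ?A = "mat k k (\<lambda>(i, j). M (pick I i) j)"
  have "det ?A \<noteq> 0" using I(1) by (auto simp: plucker_def minor_def)
  then obtain B where B: "B \<in> carrier_mat k k" "?A * B = 1\<^sub>m k" "B * ?A = 1\<^sub>m k"
    using inverse_mat_exists[of ?A k] by auto
  define N where "N i j = (\<Sum>l<k. M i l * B $$ (l, j))" for i j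
  have id: "N (pick I i) j = (if i = j then 1 else 0)" if "i < k" "j < k" for i j
    using arg_cong[OF B(2), of "\<lambda>C. C $$ (i, j)"] that B(1) by (simp add: N_def scalar_prod_def lessThan_atLeast0)
  define c where "c = det B"
  have "mat k k (\<lambda>(i, j). B $$ (i, j)) = B" by (rule eq_matI) (use B(1) in auto)
  then have minor: "minor k N \<tau> = c * minor k M \<tau>" for \<tau>
    unfolding N_def minor_mult c_def by simp
  have "det (?A * B) = det ?A * c" unfolding c_def by (rule det_mult[OF _ B(1)]) simp
  then have c: "c \<noteq> 0" using B(2) by auto
  have pl: "plucker k n N = (\<lambda>J. c * plucker k n M J)" by (rule plucker_scale[OF minor])
  have "p \<le> pick I j" if j: "j < k" and p: "p < n" and nz: "N p j \<noteq> 0" for p j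
  proof (rule ccontr)
    assume gt: "\<not> p \<le> pick I j"
    have pI: "p \<notin> I"
    proof
      assume "p \<in> I"
      then obtain i where "i < k" "p = pick I i" using bij unfolding bij_betw_def by auto
      then show False using id j nz gt by (auto split: if_splits)
    qed
    \<comment> \<open>Exchanging the pivot of column \<open>j\<close> for the later row
      \<open>p\<close> gives another nonvanishing coordinate with a larger sum, against the
      maximality of \<open>I\<close>.\<close>
    let ?t = "(pick I)(j := p)"
    have pj: "pick I j \<in> I" using bij j unfolding bij_betw_def by auto
    have inj: "inj_on ?t {..<k}"
      using bij pI unfolding bij_betw_def by (auto simp: inj_on_def)
    have less: "?t i < n" if "i < k" for i using that p ksubsets_pick_less[OF Ik] by auto
    obtain s :: complex where s: "s \<in> {1, -1}" "\<And>M. minor k M ?t = s * plucker k n M (?t ` {..<k})"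
      using plucker_image[OF inj less] by blast
    have "minor k N ?t \<noteq> 0" using minor_exchange[of k N "pick I" j p, OF id j] nz by simp
    then have nz': "plucker k n M (?t ` {..<k}) \<noteq> 0" using s pl by auto
    have im: "?t ` {..<k} = insert p (I - {pick I j})"
      using bij j unfolding bij_betw_def by (auto simp: image_iff inj_on_def)
    have fin: "finite I" by (rule ksubsets_finite[OF Ik])
    have "\<Sum>(insert p (I - {pick I j})) = p + \<Sum>(I - {pick I j})" using fin pI by simp
    moreover have "\<Sum>I = pick I j + \<Sum>(I - {pick I j})" using fin pj by (simp add: sum.remove)
    moreover have "\<Sum>(?t ` {..<k}) \<le> \<Sum>I"
      by (rule I(2)) (use nz' ksubsets_image[OF inj less] in auto)
    ultimately show False using gt unfolding im by simp
  qed
  then show thesis using that[of I c N] Ik I(1) c pl id by simp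
qed

section \<open>The groups, the Grassmannian and the Schubert variety\<close>

lemma smult_smult_mat': "a \<cdot>\<^sub>m (b \<cdot>\<^sub>m A) = (a * b) \<cdot>\<^sub>m (A :: complex mat)"
  by (rule eq_matI) auto

lemma mem_SL: "A \<in> carrier (SL n) \<longleftrightarrow> A \<in> carrier_mat n n \<and> det A = 1"
  unfolding SL_def by auto

lemma group_SL: "group (SL n)"
proof (rule groupI)
  fix x assume "x \<in> carrier (SL n)"
  then have x: "x \<in> carrier_mat n n" "det x = 1" by (auto simp: mem_SL)
  then obtain y where y: "y \<in> carrier_mat n n" "x * y = 1\<^sub>m n" "y * x = 1\<^sub>m n" using inverse_mat_exists[of x n] by auto
  have "det (y * x) = det y * det x" by (rule det_mult[OF y(1) x(1)])
  then have "y \<in> carrier (SL n)" using y x by (simp add: mem_SL)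
  then show "\<exists>y\<in>carrier (SL n). y \<otimes>\<^bsub>SL n\<^esub> x = \<one>\<^bsub>SL n\<^esub>" using y by (intro bexI[of _ y]) (auto simp: SL_def)
qed (auto simp: SL_def det_mult[of _ n])

lemma SL_mult [simp]: "A \<otimes>\<^bsub>SL n\<^esub> B = A * B" and SL_one [simp]: "\<one>\<^bsub>SL n\<^esub> = 1\<^sub>m n"
  by (simp_all add: SL_def)

lemma SL_center_normal: "SL_center n \<lhd> SL n"
proof -
  interpret group "SL n" by (rule group_SL)
  have comm: "c \<cdot>\<^sub>m 1\<^sub>m n * x = x * (c \<cdot>\<^sub>m 1\<^sub>m n)" if "x \<in> carrier_mat n n" for c and x :: "complex mat"
    using that mult_smult_assoc_mat[of "1\<^sub>m n" n n x n c] mult_smult_distrib[of x n n "1\<^sub>m n" n c] by simp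
  have sub: "subgroup (SL_center n) (SL n)"
  proof
    show "SL_center n \<subseteq> carrier (SL n)" unfolding SL_center_def by auto
    show "\<one>\<^bsub>SL n\<^esub> \<in> SL_center n" unfolding SL_center_def
      by (auto simp: mem_SL intro!: exI[of _ 1] eq_matI)
    fix x y assume "x \<in> SL_center n" "y \<in> SL_center n"
    then obtain c d where *: "x \<in> carrier (SL n)" "y \<in> carrier (SL n)" "x = c \<cdot>\<^sub>m 1\<^sub>m n" "y = d \<cdot>\<^sub>m 1\<^sub>m n"
      unfolding SL_center_def by blast
    have "x * y = (c * d) \<cdot>\<^sub>m 1\<^sub>m n" unfolding *(3,4)
      by (subst mult_smult_assoc_mat[of _ n n _ n]) (auto simp: smult_smult_mat')
    moreover have "x * y \<in> carrier (SL n)" using m_closed[OF *(1,2)] by simp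
    ultimately show "x \<otimes>\<^bsub>SL n\<^esub> y \<in> SL_center n" unfolding SL_center_def by auto
  next
    fix x assume "x \<in> SL_center n"
    then obtain c where x: "x \<in> carrier (SL n)" "x = c \<cdot>\<^sub>m 1\<^sub>m n" unfolding SL_center_def by blast
    let ?y = "inv\<^bsub>SL n\<^esub> x"
    have y: "?y \<in> carrier (SL n)" "x * ?y = 1\<^sub>m n" using inv_closed[OF x(1)] r_inv[OF x(1)] by auto
    have yc: "?y \<in> carrier_mat n n" using y(1) by (simp add: mem_SL)
    have "c \<cdot>\<^sub>m ?y = 1\<^sub>m n" using y(2) yc x(2) mult_smult_assoc_mat[of "1\<^sub>m n" n n ?y n c] by simp
    then have idx: "c * ?y $$ (i, j) = (if i = j then 1 else 0)" if "i < n" "j < n" for i j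
    proof -
      have "c * ?y $$ (i, j) = (c \<cdot>\<^sub>m ?y) $$ (i, j)" using that yc by simp
      then show ?thesis using \<open>c \<cdot>\<^sub>m ?y = 1\<^sub>m n\<close> that by simp
    qed
    have "?y $$ (i, j) = (inverse c \<cdot>\<^sub>m 1\<^sub>m n) $$ (i, j)" if ij: "i < n" "j < n" for i j
    proof -
      have "c \<noteq> 0" using idx[OF ij(1,1)] by auto
      then show ?thesis using idx[OF ij] ij by (auto simp: field_simps split: if_splits)
    qed
    then have "?y = inverse c \<cdot>\<^sub>m 1\<^sub>m n" using yc by (intro eq_matI) auto
    then show "inv\<^bsub>SL n\<^esub> x \<in> SL_center n" using y(1) unfolding SL_center_def by blast
  qed
  show ?thesis
  proof (rule normalI[OF sub], rule ballI)
    fix x assume "x \<in> carrier (SL n)"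
    then have "z * x = x * z" if "z \<in> SL_center n" for z using that comm unfolding SL_center_def by (auto simp: mem_SL)
    then show "SL_center n #>\<^bsub>SL n\<^esub> x = x <#\<^bsub>SL n\<^esub> SL_center n"
      unfolding r_coset_def l_coset_def by auto
  qed
qed

lemma group_PSL: "group (PSL n)"
  unfolding PSL_def by (rule normal.factorgroup_is_group[OF SL_center_normal])

lemma complex_root_exists:
  assumes "n \<ge> 1" "z \<noteq> 0"
  obtains c :: complex where "c \<noteq> 0" "c ^ n = z"
proof (rule that)
  let ?c = "rcis (root n (cmod z)) (Arg z / real n)"
  show "?c \<noteq> 0" using assms by (simp add: rcis_def)
  show "?c ^ n = z" using assms by (simp add: DeMoivre2 rcis_cmod_Arg)
qed

text \<open>An \<open>n\<close>-th root of the inverse determinant scales \<open>M\<close> into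
  SL(n).\<close>

lemma mat_class_nonempty:
  assumes "n \<ge> 1" "M \<in> carrier_mat n n" "det M \<noteq> 0"
  obtains c where "c \<noteq> 0" "c \<cdot>\<^sub>m M \<in> mat_class n M"
proof -
  obtain c where c: "c \<noteq> 0" "c ^ n = inverse (det M)" using complex_root_exists[of n "inverse (det M)"] assms by auto
  have "c \<cdot>\<^sub>m M \<in> carrier (SL n)" using c assms by (simp add: mem_SL det_smult)
  then show thesis using that[OF c(1)] unfolding mat_class_def by blast
qed

lemma mat_classE:
  assumes "n \<ge> 1" "A \<in> mat_class n M"
  obtains c where "c \<noteq> 0" "A = c \<cdot>\<^sub>m M" "A \<in> carrier_mat n n" "M \<in> carrier_mat n n" "det A = 1"
proof -
  obtain c where c: "A = c \<cdot>\<^sub>m M" "A \<in> carrier_mat n n" "det A = 1"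
    using assms unfolding mat_class_def by (auto simp: mem_SL)
  have "c \<cdot>\<^sub>m M \<in> carrier_mat n n" using c(1,2) by simp
  then have M: "M \<in> carrier_mat n n" unfolding carrier_mat_def by simp
  have "c \<noteq> 0" using c assms(1) M by (auto simp: power_0_left)
  then show thesis using that c M by blast
qed

lemma mat_class_mult:
  assumes "n \<ge> 1" "M \<in> carrier_mat n n" "det M \<noteq> 0" "M' \<in> carrier_mat n n" "det M' \<noteq> 0"
  shows "mat_class n M \<otimes>\<^bsub>PSL n\<^esub> mat_class n M' = mat_class n (M * M')"
proof -
  have mult: "(c \<cdot>\<^sub>m M) * (d \<cdot>\<^sub>m M') = (c * d) \<cdot>\<^sub>m (M * M')" for c d
    using assms(2,4) by (subst mult_smult_assoc_mat[of _ n n _ n])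
      (auto simp: smult_smult_mat' mult_smult_distrib[of _ n n _ n])
  have "mat_class n M <#>\<^bsub>SL n\<^esub> mat_class n M' = mat_class n (M * M')"
  proof (intro subset_antisym subsetI)
    fix A assume "A \<in> mat_class n M <#>\<^bsub>SL n\<^esub> mat_class n M'"
    then obtain B C where A: "A = B * C" "B \<in> mat_class n M" "C \<in> mat_class n M'"
      unfolding set_mult_def by auto
    obtain c where B: "B = c \<cdot>\<^sub>m M" "B \<in> carrier_mat n n" "det B = 1" using mat_classE[OF assms(1) A(2)] .
    obtain d where C: "C = d \<cdot>\<^sub>m M'" "C \<in> carrier_mat n n" "det C = 1" using mat_classE[OF assms(1) A(3)] .
    have "A \<in> carrier (SL n)" unfolding A(1) using B C by (simp add: mem_SL det_mult[of _ n])
    moreover have "A = (c * d) \<cdot>\<^sub>m (M * M')" unfolding A(1) B(1) C(1) by (rule mult)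
    ultimately show "A \<in> mat_class n (M * M')" unfolding mat_class_def by blast
  next
    fix A assume A: "A \<in> mat_class n (M * M')"
    obtain e where e: "e \<noteq> 0" "A = e \<cdot>\<^sub>m (M * M')" "det A = 1" using mat_classE[OF assms(1) A] .
    obtain c where c: "c \<noteq> 0" "c \<cdot>\<^sub>m M \<in> mat_class n M" using mat_class_nonempty[OF assms(1-3)] .
    have A': "A = (c \<cdot>\<^sub>m M) * ((e / c) \<cdot>\<^sub>m M')" unfolding mult e(2) using c by simp
    have "det (c \<cdot>\<^sub>m M) = 1" using c(2) unfolding mat_class_def by (auto simp: mem_SL)
    then have "det ((e / c) \<cdot>\<^sub>m M') = 1" using e(3) assms unfolding A' by (subst (asm) det_mult[of _ n]) auto
    then have "(e / c) \<cdot>\<^sub>m M' \<in> mat_class n M'" using assms unfolding mat_class_def by (auto simp: mem_SL)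
    then show "A \<in> mat_class n M <#>\<^bsub>SL n\<^esub> mat_class n M'"
      unfolding set_mult_def using A' c(2) by auto
  qed
  then show ?thesis unfolding PSL_def FactGroup_def by simp
qed

lemma mat_class_one: "mat_class n (1\<^sub>m n) = \<one>\<^bsub>PSL n\<^esub>"
  unfolding mat_class_def PSL_def FactGroup_def SL_center_def by simp

lemma mat_class_carrier:
  assumes "n \<ge> 1" "M \<in> carrier_mat n n" "det M \<noteq> 0"
  shows "mat_class n M \<in> carrier (PSL n)"
proof -
  obtain c where c: "c \<noteq> 0" "c \<cdot>\<^sub>m M \<in> mat_class n M" using mat_class_nonempty[OF assms] .
  let ?A = "c \<cdot>\<^sub>m M"
  have A: "?A \<in> carrier (SL n)" using c(2) unfolding mat_class_def by blast
  have smult: "(d \<cdot>\<^sub>m 1\<^sub>m n) * ?A = (d * c) \<cdot>\<^sub>m M" for d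
    using assms(2) by (subst mult_smult_assoc_mat[of _ n n _ n]) (auto simp: smult_smult_mat')
  have "mat_class n M = SL_center n #>\<^bsub>SL n\<^esub> ?A"
  proof (intro subset_antisym subsetI)
    fix B assume B: "B \<in> mat_class n M"
    obtain e where e: "e \<noteq> 0" "B = e \<cdot>\<^sub>m M" "det B = 1" using mat_classE[OF assms(1) B] .
    have B': "B = ((e / c) \<cdot>\<^sub>m 1\<^sub>m n) * ?A" unfolding smult e(2) using c by simp
    have "det ((e / c) \<cdot>\<^sub>m 1\<^sub>m n) = 1"
      using e(3) A unfolding B' by (subst (asm) det_mult[of _ n]) (auto simp: mem_SL)
    then have "(e / c) \<cdot>\<^sub>m 1\<^sub>m n \<in> SL_center n" unfolding SL_center_def by (auto simp: mem_SL)
    then show "B \<in> SL_center n #>\<^bsub>SL n\<^esub> ?A" unfolding r_coset_def using B' by auto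
  next
    fix B assume "B \<in> SL_center n #>\<^bsub>SL n\<^esub> ?A"
    then obtain d where d: "d \<cdot>\<^sub>m 1\<^sub>m n \<in> carrier (SL n)" "B = (d \<cdot>\<^sub>m 1\<^sub>m n) * ?A"
      unfolding r_coset_def SL_center_def by auto
    have "?A \<in> carrier_mat n n" "d \<cdot>\<^sub>m 1\<^sub>m n \<in> carrier_mat n n" "det ?A = 1" "det (d \<cdot>\<^sub>m 1\<^sub>m n) = 1"
      using A d(1) by (simp_all only: mem_SL)
    then have "B \<in> carrier (SL n)" unfolding d(2) mem_SL by (simp only: mult_carrier_mat det_mult[of _ n]) simp
    then show "B \<in> mat_class n M" unfolding mat_class_def using d(2) smult by auto
  qed
  then show ?thesis unfolding PSL_def FactGroup_def RCOSETS_def using A by auto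
qed

section \<open>Diagonal matrices and orbits in Pluecker coordinates\<close>

abbreviation entry :: "complex mat \<Rightarrow> nat \<Rightarrow> nat \<Rightarrow> complex" where
  "entry A \<equiv> (\<lambda>i j. A $$ (i, j))"

lemma card_less_ksubset: "I \<in> ksubsets k n \<Longrightarrow> card {i. i < n \<and> i \<in> I} = k"
proof -
  assume "I \<in> ksubsets k n"
  then have "{i. i < n \<and> i \<in> I} = I" "card I = k" unfolding ksubsets_def by auto
  then show ?thesis by simp
qed

lemma pick_lessThan: "j < k \<Longrightarrow> pick {..<k} j = j"
proof -
  assume j: "j < k"
  then have "{a \<in> {..<k}. a < j} = {..<j}" by auto
  then show ?thesis using pick_card_in_set[of j "{..<k}"] j by simp
qed

lemma det_submatrix:
  assumes "A \<in> carrier_mat n n" "k \<le> n" "I \<in> ksubsets k n"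
  shows "det (submatrix A I {..<k}) = minor k (entry A) (pick I)"
proof -
  have "{..<k} \<in> ksubsets k n" using assms(2) unfolding ksubsets_def by auto
  note card = card_less_ksubset[OF this] card_less_ksubset[OF assms(3)]
  show ?thesis unfolding minor_def submatrix_def
    using assms(1) card by (intro arg_cong[of _ _ det] eq_matI) (auto simp: pick_lessThan)
qed

lemma det_mat_diag: "det (mat_diag n f) = (\<Prod>i<n. f i :: complex)"
proof -
  have "det (mat_diag n f) = prod_list (diag_mat (mat_diag n f))"
    by (rule det_upper_triangular[of _ n]) (auto simp: mat_diag_def upper_triangular_def)
  then show ?thesis by (simp add: prod_list_diag_prod mat_diag_def lessThan_atLeast0)
qed

lemma smult_mat_diag: "c \<cdot>\<^sub>m mat_diag n f = mat_diag n (\<lambda>i. c * f i :: complex)"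
  by (rule eq_matI) (auto simp: mat_diag_def)

definition diag_act :: "nat \<Rightarrow> nat \<Rightarrow> (nat \<Rightarrow> complex) \<Rightarrow> (nat set \<Rightarrow> complex) \<Rightarrow> nat set \<Rightarrow> complex" where
  "diag_act k n d v = (\<lambda>I. if I \<in> ksubsets k n then (\<Prod>i\<in>I. d i) * v I else 0)"

lemma det_submatrix_mat_diag:
  fixes d :: "nat \<Rightarrow> complex"
  assumes I: "I \<in> ksubsets k n" and J: "J \<in> ksubsets k n"
  shows "det (submatrix (mat_diag n d) I J) = (if I = J then (\<Prod>i\<in>I. d i) else 0)"
proof -
  have sub: "submatrix (mat_diag n d) I J = mat k k (\<lambda>(i, j). if pick I i = pick J j then d (pick J j) else 0)"
    unfolding submatrix_def using card_less_ksubset[OF I] card_less_ksubset[OF J]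
      ksubsets_pick_less[OF I] ksubsets_pick_less[OF J]
    by (intro eq_matI) (auto simp: mat_diag_def)
  show ?thesis
  proof (cases "I = J")
    case True
    note b = ksubsets_pick_bij[OF J]
    have "submatrix (mat_diag n d) I J = mat_diag k (\<lambda>i. d (pick J i))"
      unfolding sub using b True by (intro eq_matI) (auto simp: mat_diag_def bij_betw_def inj_on_def)
    then show ?thesis using True prod.reindex_bij_betw[OF b, of d] by (simp add: det_mat_diag)
  next
    case False
    \<comment> \<open>The two sets have equally many elements, so some element of \<open>I\<close>
      is outside \<open>J\<close>, and its row of the submatrix is zero.\<close>
    have "\<not> I \<subseteq> J" using False card_subset_eq[of J I] I J ksubsets_finite[OF J] unfolding ksubsets_def by auto
    then obtain x where "x \<in> pick I ` {..<k}" "x \<notin> J" using bij_betw_imp_surj_on[OF ksubsets_pick_bij[OF I]] by blast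
    then obtain i where i: "i < k" "pick I i \<notin> J" by auto
    have "minor k (\<lambda>a j. if pick I a = pick J j then d (pick J j) else 0) id = 0"
    proof (rule minor_zeroI[of "{..<k} - {i}" "{..<k}"])
      fix a j assume "a < k" "j \<in> {..<k}" "(if pick I (id a) = pick J j then d (pick J j) else 0) \<noteq> 0"
      then show "a \<in> {..<k} - {i}" using i ksubsets_pick_bij[OF J] unfolding bij_betw_def by (auto split: if_splits)
    qed (use i in auto)
    then show ?thesis using False unfolding minor_def sub by simp
  qed
qed

lemma ext_power_mat_diag: "ext_power k n (mat_diag n d) = diag_act k n d"
proof (intro ext)
  fix v I
  have "(\<Sum>J\<in>ksubsets k n. det (submatrix (mat_diag n d) I J) * v J) = (\<Prod>i\<in>I. d i) * v I" if I: "I \<in> ksubsets k n"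
  proof -
    have "(\<Sum>J\<in>ksubsets k n. det (submatrix (mat_diag n d) I J) * v J) =
      (\<Sum>J\<in>ksubsets k n. if I = J then (\<Prod>i\<in>I. d i) * v J else 0)"
      by (intro sum.cong refl) (simp add: det_submatrix_mat_diag[OF I])
    then show ?thesis using I by simp
  qed
  then show "ext_power k n (mat_diag n d) v I = diag_act k n d v I" unfolding ext_power_def diag_act_def by simp
qed

lemma diag_act_plucker: "diag_act k n d (plucker k n M) = plucker k n (\<lambda>i j. d i * M i j)"
proof
  fix I
  have "(\<Prod>i\<in>I. d i) = (\<Prod>i<k. d (pick I i))" if "I \<in> ksubsets k n"
    using prod.reindex_bij_betw[OF ksubsets_pick_bij[OF that], of d] by simp
  then show "diag_act k n d (plucker k n M) I = plucker k n (\<lambda>i j. d i * M i j) I"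
    unfolding diag_act_def plucker_def by (simp add: minor_scale_rows)
qed

lemma image_diag_act: "diag_act k n d ` pt_class v = pt_class (diag_act k n d v)"
proof -
  have "diag_act k n d (\<lambda>b. c * v b) = (\<lambda>b. c * diag_act k n d v b)" for c v
    unfolding diag_act_def by auto
  then show ?thesis unfolding pt_class_def by (auto simp: image_iff) metis
qed

text \<open>A factor \<open>c\<close> on a lift becomes \<open>c ^ k\<close> on the exterior power
  and is absorbed by the projective class. Only proportionality to \<open>A\<close> is asked of the
  lifts, which covers both cosets of the center and values of \<open>mat_class\<close>.\<close>

lemma psl_act_base_point:
  assumes "k \<le> n" "A \<in> carrier_mat n n" "g \<noteq> {}" "\<And>B. B \<in> g \<Longrightarrow> \<exists>c. c \<noteq> 0 \<and> B = c \<cdot>\<^sub>m A"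
  shows "psl_act k n g (base_point k) = pt_class (plucker k n (entry A))"
proof -
  define \<delta> :: "nat set \<Rightarrow> complex" where "\<delta> = (\<lambda>I. if I = {..<k} then 1 else 0)"
  have kk: "{..<k} \<in> ksubsets k n" using assms(1) unfolding ksubsets_def by auto
  have ext: "ext_power k n (c \<cdot>\<^sub>m A) (\<lambda>I. e * \<delta> I) = (\<lambda>I. (e * c ^ k) * plucker k n (entry A) I)" for c e
  proof
    fix I
    have "(\<Sum>J\<in>ksubsets k n. det (submatrix (c \<cdot>\<^sub>m A) I J) * (e * \<delta> J)) = (e * c ^ k) * minor k (entry A) (pick I)"
      if I: "I \<in> ksubsets k n"
    proof -
      have "(\<Sum>J\<in>ksubsets k n. det (submatrix (c \<cdot>\<^sub>m A) I J) * (e * \<delta> J)) =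
        (\<Sum>J\<in>ksubsets k n. if J = {..<k} then e * det (submatrix (c \<cdot>\<^sub>m A) I {..<k}) else 0)"
        by (intro sum.cong refl) (auto simp: \<delta>_def)
      also have "\<dots> = e * det (submatrix (c \<cdot>\<^sub>m A) I {..<k})" using kk by simp
      also have "det (submatrix (c \<cdot>\<^sub>m A) I {..<k}) = minor k (entry (c \<cdot>\<^sub>m A)) (pick I)"
        by (rule det_submatrix) (use assms(1,2) I in auto)
      also have "\<dots> = minor k (\<lambda>i j. c * entry A i j) (pick I)"
        by (rule minor_cong) (use assms(1,2) ksubsets_pick_less[OF I] in auto)
      also have "\<dots> = c ^ k * minor k (entry A) (pick I)" by (simp add: minor_scale_rows)
      finally show ?thesis by simp
    qed
    then show "ext_power k n (c \<cdot>\<^sub>m A) (\<lambda>I. e * \<delta> I) I = (e * c ^ k) * plucker k n (entry A) I"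
      unfolding ext_power_def plucker_def by simp
  qed
  have bp: "base_point k = pt_class \<delta>" unfolding base_point_def \<delta>_def ..
  show ?thesis
  proof (intro subset_antisym subsetI)
    fix w assume "w \<in> psl_act k n g (base_point k)"
    then obtain B v where B: "B \<in> g" "v \<in> base_point k" "w = ext_power k n B v" unfolding psl_act_def by blast
    obtain c where c: "c \<noteq> 0" "B = c \<cdot>\<^sub>m A" using assms(4) B(1) by blast
    obtain e where e: "e \<noteq> 0" "v = (\<lambda>I. e * \<delta> I)" using B(2) unfolding bp mem_pt_class by blast
    show "w \<in> pt_class (plucker k n (entry A))" unfolding B(3) c(2) e(2) ext mem_pt_class
      using c e by (intro exI[of _ "e * c ^ k"]) auto
  next
    fix w assume "w \<in> pt_class (plucker k n (entry A))"
    then obtain f where f: "f \<noteq> 0" "w = (\<lambda>I. f * plucker k n (entry A) I)" unfolding mem_pt_class by blast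
    obtain B where B: "B \<in> g" using assms(3) by blast
    obtain c where c: "c \<noteq> 0" "B = c \<cdot>\<^sub>m A" using assms(4) B(1) by blast
    have "w = ext_power k n B (\<lambda>I. (f / c ^ k) * \<delta> I)" unfolding c(2) ext f(2) using c(1) by simp
    moreover have "(\<lambda>I. (f / c ^ k) * \<delta> I) \<in> base_point k" unfolding bp mem_pt_class
      using f(1) c(1) by (intro exI[of _ "f / c ^ k"]) auto
    ultimately show "w \<in> psl_act k n g (base_point k)" unfolding psl_act_def using B by blast
  qed
qed

lemma grassmannian_eq:
  assumes "k \<le> n"
  shows "grassmannian k n = {pt_class (plucker k n (entry A)) | A. A \<in> carrier (SL n)}"
proof -
  interpret SL: group "SL n" by (rule group_SL)
  have *: "psl_act k n (SL_center n #>\<^bsub>SL n\<^esub> A) (base_point k) = pt_class (plucker k n (entry A))" if A: "A \<in> carrier (SL n)" for A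
  proof (rule psl_act_base_point[OF assms])
    show A': "A \<in> carrier_mat n n" using A by (simp add: mem_SL)
    show "SL_center n #>\<^bsub>SL n\<^esub> A \<noteq> {}" unfolding r_coset_def SL_center_def
      using SL.one_closed by (auto intro!: exI[of _ 1] exI[of _ "1\<^sub>m n"])
    fix B assume "B \<in> SL_center n #>\<^bsub>SL n\<^esub> A"
    then obtain c where c: "c \<cdot>\<^sub>m 1\<^sub>m n \<in> carrier (SL n)" "B = (c \<cdot>\<^sub>m 1\<^sub>m n) * A" unfolding r_coset_def SL_center_def by auto
    have B: "B = c \<cdot>\<^sub>m A" unfolding c(2) using A' by (subst mult_smult_assoc_mat[of _ n n _ n]) auto
    \<comment> \<open>For \<open>n = 0\<close> the determinant does not exclude
      \<open>c = 0\<close>, but then all matrices of this size are equal and the factor 1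
      serves.\<close>
    show "\<exists>c. c \<noteq> 0 \<and> B = c \<cdot>\<^sub>m A"
    proof (cases "n = 0")
      case True
      then have "B = 1 \<cdot>\<^sub>m A" using A' B by (intro eq_matI) auto
      then show ?thesis by (intro exI[of _ 1]) auto
    next
      case False
      have "c ^ n = 1" using c(1) by (simp add: mem_SL)
      then have "c \<noteq> 0" using False by (auto simp: power_0_left)
      then show ?thesis using B by blast
    qed
  qed
  have "carrier (PSL n) = {SL_center n #>\<^bsub>SL n\<^esub> A | A. A \<in> carrier (SL n)}"
    unfolding PSL_def FactGroup_def RCOSETS_def by auto
  then show ?thesis unfolding grassmannian_def using * by auto metis+
qed

section \<open>The torus\<close>

text \<open>With \<open>n = nk q k\<close> the coordinates form \<open>k\<close> blocks of length
  \<open>q\<close> and a last block consisting of coordinate \<open>k * q\<close> alone; the product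
  is the determinant.\<close>

definition block_torus :: "nat \<Rightarrow> nat \<Rightarrow> (nat \<Rightarrow> complex) set" where
  "block_torus q n = {a. (\<forall>b. a b \<noteq> 0) \<and> (\<Prod>i<n. a (i div q)) = 1}"

lemma block_one_param: "q \<ge> 1 \<Longrightarrow> one_param n (j * q) t = mat_class n (mat_diag n (\<lambda>i. (\<lambda>b. if b < j then t else 1) (i div q)))"
  unfolding one_param_def by (simp add: div_less_iff_less_mult)

lemma T_J_elem:
  assumes "q \<ge> 1" "g \<in> T_J q k"
  obtains a where "\<And>b. a b \<noteq> 0" "g = mat_class (nk q k) (mat_diag (nk q k) (\<lambda>i. a (i div q)))"
proof -
  let ?n = "nk q k"
  have n: "?n \<ge> 1" unfolding nk_def by simp
  let ?D = "\<lambda>a. mat_diag ?n (\<lambda>i. a (i div q)) :: complex mat"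
  have det: "det (?D a) \<noteq> 0" if "\<And>b. a b \<noteq> 0" for a using that by (simp add: det_mat_diag)
  have mult: "mat_class ?n (?D a) \<otimes>\<^bsub>PSL ?n\<^esub> mat_class ?n (?D b) = mat_class ?n (?D (\<lambda>i. a i * b i))"
    if "\<And>i. a i \<noteq> 0" "\<And>i. b i \<noteq> 0" for a b
    using mat_class_mult[OF n _ det[of a] _ det[of b]] that by simp
  have one: "mat_class ?n (?D (\<lambda>_. 1)) = \<one>\<^bsub>PSL ?n\<^esub>" using mat_class_one by simp
  have "\<exists>a. (\<forall>b. a b \<noteq> 0) \<and> g = mat_class ?n (?D a)" using assms(2) unfolding T_J_def
  proof (induction rule: generate.induct)
    case one
    then show ?case using \<open>mat_class ?n (?D (\<lambda>_. 1)) = \<one>\<^bsub>PSL ?n\<^esub>\<close> by (intro exI[of _ "\<lambda>_. 1"]) simp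
  next
    case (incl h)
    then obtain j t where "h = one_param ?n (j * q) t" "t \<noteq> 0" by blast
    then show ?case using block_one_param[OF assms(1)] by (intro exI[of _ "\<lambda>b. if b < j then t else 1"]) simp
  next
    case (inv h)
    then obtain j t where h: "h = one_param ?n (j * q) t" "t \<noteq> 0" by blast
    let ?a = "\<lambda>b. if b < j then t else 1"
    have h': "h = mat_class ?n (?D ?a)" unfolding h by (rule block_one_param[OF assms(1)])
    have nz: "?a b \<noteq> 0" "inverse (?a b) \<noteq> 0" for b using h by auto
    have "inv\<^bsub>PSL ?n\<^esub> h = mat_class ?n (?D (\<lambda>b. inverse (?a b)))"
    proof (rule group.inv_equality[OF group_PSL])
      show "mat_class ?n (?D (\<lambda>b. inverse (?a b))) \<otimes>\<^bsub>PSL ?n\<^esub> h = \<one>\<^bsub>PSL ?n\<^esub>"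
        unfolding h' mult[of "\<lambda>b. inverse (?a b)" ?a, OF nz(2,1)] using nz one by simp
      show "h \<in> carrier (PSL ?n)" unfolding h' by (rule mat_class_carrier[OF n _ det[of ?a, OF nz(1)]]) simp
      show "mat_class ?n (?D (\<lambda>b. inverse (?a b))) \<in> carrier (PSL ?n)"
        by (rule mat_class_carrier[OF n _ det[of "\<lambda>b. inverse (?a b)", OF nz(2)]]) simp
    qed
    then show ?case using nz by (intro exI[of _ "\<lambda>b. inverse (?a b)"]) blast
  next
    case (eng h1 h2)
    then obtain a b where "\<forall>i. a i \<noteq> 0" "\<forall>i. b i \<noteq> 0" "h1 = mat_class ?n (?D a)" "h2 = mat_class ?n (?D b)" by blast
    then show ?case using mult[of a b] by (intro exI[of _ "\<lambda>i. a i * b i"]) auto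
  qed
  then show thesis using that by blast
qed

text \<open>The tuple is built by telescoping: a factor a l / a (l + 1) on all blocks up to
  \<open>l\<close> replaces the normalisation by \<open>a l\<close> by that by
  \<open>a (Suc l)\<close>. This factor is a value of the one-parameter subgroup numbered
  \<open>Suc l * q\<close>.\<close>

lemma T_J_contains:
  assumes "q \<ge> 1" "\<And>b. a b \<noteq> (0::complex)"
  shows "mat_class (nk q k) (mat_diag (nk q k) (\<lambda>i. a (i div q) / a k)) \<in> T_J q k"
proof -
  let ?n = "nk q k"
  have n: "?n \<ge> 1" unfolding nk_def by simp
  let ?D = "\<lambda>a. mat_diag ?n (\<lambda>i. a (i div q)) :: complex mat"
  have det: "det (?D a) \<noteq> 0" if "\<And>b. a b \<noteq> 0" for a using that by (simp add: det_mat_diag)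
  have step: "mat_class ?n (?D (\<lambda>b. if b < l then a b / a l else 1)) \<in> T_J q k" if "l \<le> k" for l
    using that
  proof (induction l)
    case 0
    have "\<one>\<^bsub>PSL ?n\<^esub> \<in> T_J q k" unfolding T_J_def by (rule generate.one)
    then show ?case by (simp add: mat_class_one)
  next
    case (Suc l)
    let ?b = "\<lambda>b. if b < l then a b / a l else 1" and ?c = "\<lambda>b. if b < Suc l then a l / a (Suc l) else 1"
    have nz: "?b i \<noteq> 0" "?c i \<noteq> 0" for i using assms(2) by auto
    have "one_param ?n (Suc l * q) (a l / a (Suc l)) \<in> T_J q k"
      unfolding T_J_def using Suc.prems assms(2)
      by (intro generate.incl CollectI exI[of _ "Suc l"] exI[of _ "a l / a (Suc l)"]) auto
    then have "mat_class ?n (?D ?c) \<in> T_J q k" unfolding block_one_param[OF assms(1)] .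
    moreover have "mat_class ?n (?D ?b) \<in> T_J q k" using Suc by simp
    ultimately have "mat_class ?n (?D ?b) \<otimes>\<^bsub>PSL ?n\<^esub> mat_class ?n (?D ?c) \<in> T_J q k"
      unfolding T_J_def by (intro generate.eng)
    moreover have "mat_class ?n (?D ?b) \<otimes>\<^bsub>PSL ?n\<^esub> mat_class ?n (?D ?c) = mat_class ?n (?D ?b * ?D ?c)"
      by (rule mat_class_mult[OF n _ det[of ?b, OF nz(1)] _ det[of ?c, OF nz(2)]]) auto
    moreover have "?D ?b * ?D ?c = ?D (\<lambda>b. if b < Suc l then a b / a (Suc l) else 1)"
      unfolding mat_diag_diag using assms(2)
      by (intro arg_cong[of _ _ "mat_diag ?n"] ext) (auto simp: less_Suc_eq)
    ultimately show ?case by simp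
  qed
  have "?D (\<lambda>b. if b < k then a b / a k else 1) = mat_diag ?n (\<lambda>i. a (i div q) / a k)"
  proof (rule eq_matI)
    fix i j assume ij: "i < dim_row (mat_diag ?n (\<lambda>i. a (i div q) / a k))" "j < dim_col (mat_diag ?n (\<lambda>i. a (i div q) / a k))"
    then have "j \<le> k * q" by (simp add: mat_diag_def nk_def)
    then have "j div q \<le> k" using div_le_mono[of j "k * q" q] assms(1) by simp
    then show "?D (\<lambda>b. if b < k then a b / a k else 1) $$ (i, j) = mat_diag ?n (\<lambda>i. a (i div q) / a k) $$ (i, j)"
      using ij assms(2)[of k] by (cases "j div q = k") (auto simp: mat_diag_def)
  qed (auto simp: mat_diag_def)
  then show ?thesis using step[of k] by simp
qed

text \<open>The lifts of the class of a block-constant diagonal matrix are its multiples of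
  determinant one. Conversely, dividing a tuple of determinant one by its last scalar brings it to
  the form reached by the one-parameter subgroups, without changing its class.\<close>

lemma T_J_lifts:
  assumes "q \<ge> 1"
  shows "{ext_power k (nk q k) A | A. A \<in> \<Union>(T_J q k)} = {diag_act k (nk q k) (\<lambda>i. a (i div q)) | a. a \<in> block_torus q (nk q k)}"
proof -
  let ?n = "nk q k"
  have n: "?n \<ge> 1" unfolding nk_def by simp
  have lifts: "\<Union>(T_J q k) = {mat_diag ?n (\<lambda>i. a (i div q)) | a. a \<in> block_torus q ?n}"
  proof (intro subset_antisym subsetI)
    fix A assume "A \<in> \<Union>(T_J q k)"
    then obtain g where g: "g \<in> T_J q k" "A \<in> g" by blast
    obtain a where a: "\<And>b. a b \<noteq> 0" "g = mat_class ?n (mat_diag ?n (\<lambda>i. a (i div q)))" using T_J_elem[OF assms g(1)] by blast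
    have A: "A \<in> mat_class ?n (mat_diag ?n (\<lambda>i. a (i div q)))" using g(2) a(2) by simp
    obtain c where c: "c \<noteq> 0" "A = c \<cdot>\<^sub>m mat_diag ?n (\<lambda>i. a (i div q))" "det A = 1" using mat_classE[OF n A] .
    have A': "A = mat_diag ?n (\<lambda>i. (\<lambda>b. c * a b) (i div q))" unfolding c(2) smult_mat_diag ..
    have "(\<lambda>b. c * a b) \<in> block_torus q ?n" unfolding block_torus_def using a(1) c(1,3) unfolding A' det_mat_diag by simp
    then show "A \<in> {mat_diag ?n (\<lambda>i. a (i div q)) | a. a \<in> block_torus q ?n}"
      using A' by (intro CollectI exI[of _ "\<lambda>b. c * a b"]) simp
  next
    fix A assume "A \<in> {mat_diag ?n (\<lambda>i. a (i div q)) | a. a \<in> block_torus q ?n}"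
    then obtain a where a: "A = mat_diag ?n (\<lambda>i. a (i div q))" "\<And>b. a b \<noteq> 0" "(\<Prod>i<?n. a (i div q)) = 1"
      unfolding block_torus_def by blast
    have "A = a k \<cdot>\<^sub>m mat_diag ?n (\<lambda>i. a (i div q) / a k)" unfolding a(1) smult_mat_diag using a(2)[of k] by simp
    moreover have "A \<in> carrier (SL ?n)" unfolding a(1) mem_SL det_mat_diag using a(3) by simp
    ultimately have "A \<in> mat_class ?n (mat_diag ?n (\<lambda>i. a (i div q) / a k))" unfolding mat_class_def by blast
    then show "A \<in> \<Union>(T_J q k)" using T_J_contains[of q a k, OF assms a(2)] by blast
  qed
  show ?thesis unfolding lifts ext_power_mat_diag[symmetric] by blast
qed

section \<open>The Weyl group element\<close>

lemma foldr_comp_append: "foldr (\<circ>) (xs @ ys) id = foldr (\<circ>) xs id \<circ> foldr (\<circ>) ys id"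
  by (induction xs) (auto simp: comp_assoc)

text \<open>The word s_l ... s_m, applied from the right; it is empty if l < m. Position m - 1 is
  carried step by step up to l.\<close>

definition cycle_word :: "nat \<Rightarrow> nat \<Rightarrow> nat \<Rightarrow> nat" where
  "cycle_word m l = foldr (\<circ>) (map simple_reflection (rev [m..<Suc l])) id"

lemma cycle_word_Suc: "m \<le> Suc l \<Longrightarrow> cycle_word m (Suc l) = simple_reflection (Suc l) \<circ> cycle_word m l"
  unfolding cycle_word_def by simp

lemma cycle_word_start: "1 \<le> m \<Longrightarrow> m \<le> Suc l \<Longrightarrow> cycle_word m l (m - 1) = l"
proof (induction l)
  case 0
  then show ?case by (auto simp: cycle_word_def)
next
  case (Suc l)
  show ?case
  proof (cases "m = Suc (Suc l)")
    case True
    then show ?thesis by (simp add: cycle_word_def)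
  next
    case False
    then show ?thesis using Suc by (simp add: cycle_word_Suc simple_reflection_def)
  qed
qed

lemma cycle_word_below: "x + 1 < m \<Longrightarrow> cycle_word m l x = x"
proof (induction l)
  case 0
  then show ?case by (auto simp: cycle_word_def)
next
  case (Suc l)
  then show ?case
    by (cases "m \<le> Suc l") (auto simp: cycle_word_Suc simple_reflection_def Transposition.transpose_def cycle_word_def)
qed

lemma cycle_word_above: "l < x \<Longrightarrow> cycle_word m l x = x"
proof (induction l)
  case 0
  then show ?case by (cases "m = 0") (auto simp: cycle_word_def simple_reflection_def)
next
  case (Suc l)
  then show ?case
    by (cases "m \<le> Suc l") (auto simp: cycle_word_Suc simple_reflection_def Transposition.transpose_def cycle_word_def)
qed

lemma cycle_word_permutes: "1 \<le> m \<Longrightarrow> l < n \<Longrightarrow> cycle_word m l permutes {..<n}"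
proof (induction l)
  case 0
  then show ?case by (auto simp: cycle_word_def permutes_def)
next
  case (Suc l)
  show ?case
  proof (cases "m \<le> Suc l")
    case True
    have "simple_reflection (Suc l) permutes {..<n}"
      unfolding simple_reflection_def using Suc.prems by (intro permutes_swap_id) auto
    then show ?thesis unfolding cycle_word_Suc[OF True] using Suc by (intro permutes_compose) auto
  qed (simp add: cycle_word_def permutes_def)
qed

lemma w_min_Suc: "w_min q (Suc k) = w_min q k \<circ> cycle_word (Suc k) (Suc k * q)"
proof -
  have "[1..<Suc (Suc k)] = [1..<Suc k] @ [Suc k]" by (rule upt_Suc_append) simp
  then show ?thesis unfolding w_min_def cycle_word_def
    by (simp only: map_append concat_append list.map concat.simps append_Nil2 foldr_comp_append)
qed

lemma w_min_above: "k * q < x \<Longrightarrow> w_min q k x = x"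
proof (induction k)
  case 0
  then show ?case by (simp add: w_min_def)
next
  case (Suc k)
  then show ?case by (simp add: w_min_Suc cycle_word_above)
qed

text \<open>The factor for the last position carries it to its final value, which lies above
  everything the earlier factors move, and it fixes all earlier positions. The one-line notation
  appears here with values lowered by 1.\<close>

lemma w_min_eq: "1 \<le> q \<Longrightarrow> j < k \<Longrightarrow> w_min q k j = Suc j * q"
proof (induction k)
  case (Suc k)
  show ?case
  proof (cases "j = k")
    case True
    have "Suc k \<le> Suc (Suc k * q)" using Suc.prems(1) by (metis le_SucI mult.right_neutral mult_le_mono2)
    then have "cycle_word (Suc k) (Suc k * q) k = Suc k * q" using cycle_word_start[of "Suc k" "Suc k * q"] by simp
    then show ?thesis using True Suc.prems(1) by (simp add: w_min_Suc w_min_above)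
  next
    case False
    then show ?thesis using Suc by (simp add: w_min_Suc cycle_word_below)
  qed
qed simp

lemma w_min_permutes: "k * q < n \<Longrightarrow> w_min q k permutes {..<n}"
proof (induction k)
  case 0
  then show ?case by (simp add: w_min_def permutes_def)
next
  case (Suc k)
  then show ?case unfolding w_min_Suc by (intro permutes_compose cycle_word_permutes) auto
qed

text \<open>The Schubert cell: multiplying \<open>B\<close> by the permutation matrix makes column
  \<open>j\<close> of the product equal to column \<open>Suc j * q\<close> of
  \<open>B\<close>.\<close>

definition cell :: "nat \<Rightarrow> nat \<Rightarrow> (nat set \<Rightarrow> complex) set set" where
  "cell q k = {pt_class (plucker k (nk q k) (\<lambda>i j. B $$ (i, Suc j * q))) | B. B \<in> carrier (SL (nk q k)) \<and> upper_triangular B}"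

lemma cell_eq:
  assumes "q \<ge> 1"
  shows "{psl_act k (nk q k) (b \<otimes>\<^bsub>PSL (nk q k)\<^esub> weyl_class (nk q k) (w_min q k)) (base_point k) | b. b \<in> borel_subgroup (nk q k)} = cell q k"
proof -
  let ?n = "nk q k" and ?w = "w_min q k"
  have n: "?n \<ge> 1" unfolding nk_def by simp
  have kn: "k \<le> ?n" using assms unfolding nk_def by (simp add: le_SucI)
  have wp: "?w permutes {..<?n}" by (rule w_min_permutes) (simp add: nk_def)
  let ?P = "mat ?n ?n (\<lambda>(i, j). if i = ?w j then 1 else 0) :: complex mat"
  have P: "?P \<in> carrier_mat ?n ?n" by simp
  have detP: "det ?P \<noteq> 0"
  proof -
    have "minor ?n (\<lambda>i j. if i = ?w j then 1 else 0) id \<noteq> 0"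
    proof (rule minor_nonzeroI)
      fix x :: "nat \<Rightarrow> complex" and i assume *: "\<And>i. i < ?n \<Longrightarrow> (\<Sum>j<?n. (if id i = ?w j then 1 else 0) * x j) = 0" and i: "i < ?n"
      have wi: "?w i < ?n" using permutes_in_image[OF wp, of i] i by simp
      have "(\<Sum>j<?n. (if id (?w i) = ?w j then 1 else 0) * x j) = (\<Sum>j<?n. if j = i then x j else 0)"
        using permutes_inj[OF wp] by (intro sum.cong) (auto simp: inj_def)
      then show "x i = 0" using *[OF wi] i by simp
    qed
    then show ?thesis unfolding minor_def by simp
  qed
  have "psl_act k ?n (mat_class ?n B \<otimes>\<^bsub>PSL ?n\<^esub> weyl_class ?n ?w) (base_point k) =
      pt_class (plucker k ?n (\<lambda>i j. B $$ (i, Suc j * q)))" if B: "B \<in> carrier (SL ?n)" for B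
  proof -
    have B': "B \<in> carrier_mat ?n ?n" "det B \<noteq> 0" using B by (auto simp: mem_SL)
    have mult: "mat_class ?n B \<otimes>\<^bsub>PSL ?n\<^esub> weyl_class ?n ?w = mat_class ?n (B * ?P)"
      unfolding weyl_class_def by (rule mat_class_mult[OF n B' P detP])
    have BP: "B * ?P \<in> carrier_mat ?n ?n" "det (B * ?P) \<noteq> 0" using B' P detP by (auto simp: det_mult[of _ ?n])
    have "psl_act k ?n (mat_class ?n (B * ?P)) (base_point k) = pt_class (plucker k ?n (entry (B * ?P)))"
    proof (rule psl_act_base_point[OF kn BP(1)])
      show "mat_class ?n (B * ?P) \<noteq> {}" using mat_class_nonempty[OF n BP] by blast
      show "\<exists>c. c \<noteq> 0 \<and> C = c \<cdot>\<^sub>m (B * ?P)" if "C \<in> mat_class ?n (B * ?P)" for C using mat_classE[OF n that] by blast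
    qed
    also have "plucker k ?n (entry (B * ?P)) = plucker k ?n (\<lambda>i j. B $$ (i, Suc j * q))"
    proof (rule plucker_cong)
      fix i j assume i: "i < ?n" and j: "j < k"
      have wj: "?w j = Suc j * q" by (rule w_min_eq[OF assms j])
      have "Suc j * q \<le> k * q" using j by (intro mult_le_mono1) simp
      then have wjn: "Suc j * q < ?n" unfolding nk_def by simp
      have "(B * ?P) $$ (i, j) = (\<Sum>l<?n. B $$ (i, l) * (if l = ?w j then 1 else 0))"
        using B'(1) i j kn by (simp add: scalar_prod_def lessThan_atLeast0)
      also have "\<dots> = (\<Sum>l<?n. if l = ?w j then B $$ (i, l) else 0)" by (intro sum.cong) auto
      also have "\<dots> = B $$ (i, Suc j * q)" using wjn unfolding wj by simp
      finally show "(B * ?P) $$ (i, j) = B $$ (i, Suc j * q)" .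
    qed
    finally show ?thesis unfolding mult .
  qed
  then show ?thesis unfolding cell_def borel_subgroup_def by auto
qed

section \<open>Unstable points\<close>

lemma hom_polys_scale_coords:
  assumes "F \<in> hom_polys S d"
  shows "(\<lambda>v. F (\<lambda>I. if I \<in> S then c I * v I else 0)) \<in> hom_polys S d"
proof -
  obtain M k where 1: "finite M" "\<forall>\<alpha>\<in>M. (\<Sum>b\<in>S. \<alpha> b) = d"
    "F = (\<lambda>v. \<Sum>\<alpha>\<in>M. k \<alpha> * (\<Prod>b\<in>S. v b ^ \<alpha> b))"
    using assms unfolding hom_polys_def by blast
  have "(\<lambda>v. \<Sum>\<alpha>\<in>M. (k \<alpha> * (\<Prod>b\<in>S. c b ^ \<alpha> b)) * (\<Prod>b\<in>S. v b ^ \<alpha> b)) \<in> hom_polys S d"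
    using 1 by (intro hom_polys_sum hom_polys_monomial) auto
  also have "(\<lambda>v. \<Sum>\<alpha>\<in>M. (k \<alpha> * (\<Prod>b\<in>S. c b ^ \<alpha> b)) * (\<Prod>b\<in>S. v b ^ \<alpha> b)) =
     (\<lambda>v. F (\<lambda>I. if I \<in> S then c I * v I else 0))"
    unfolding 1(3) by (intro ext sum.cong refl) (simp add: power_mult_distrib prod.distrib)
  finally show ?thesis .
qed

lemma hom_polys_isCont:
  assumes "F \<in> hom_polys S d" "\<And>b. b \<in> S \<Longrightarrow> isCont (\<lambda>t::complex. v t b) t0"
  shows "isCont (\<lambda>t. F (v t)) t0"
proof -
  obtain M k where 1: "F = (\<lambda>v. \<Sum>\<alpha>\<in>M. k \<alpha> * (\<Prod>b\<in>S. v b ^ \<alpha> b))"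
    using assms(1) unfolding hom_polys_def by blast
  show ?thesis unfolding 1 using assms(2) by (intro continuous_intros) auto
qed

text \<open>Basis vectors are the columns here. Column \<open>j\<close>, counted from 0, is row
  \<open>Suc j\<close> of \<open>z\<close> with its leading 1 restored.\<close>

definition echelon_matrix :: "nat \<Rightarrow> (nat \<Rightarrow> nat \<Rightarrow> complex) \<Rightarrow> nat \<Rightarrow> nat \<Rightarrow> complex" where
  "echelon_matrix q z = (\<lambda>i j. if i = Suc j * q then 1 else z (Suc j) i)"

definition cell_pts :: "nat \<Rightarrow> nat \<Rightarrow> (nat \<Rightarrow> nat \<Rightarrow> complex) set" where
  "cell_pts q k = {z. \<forall>j p. z j p \<noteq> 0 \<longrightarrow> j \<in> {1..k} \<and> p \<in> free_cols q j}"

lemma echelon_pts_iff: "z \<in> echelon_pts q k \<longleftrightarrow> z \<in> cell_pts q k \<and> (\<forall>j\<in>{1..k}. \<exists>p. z j p \<noteq> 0)"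
  unfolding echelon_pts_def cell_pts_def by blast

section \<open>Pivots, the Schubert cell and its closure\<close>

locale tower_params =
  fixes q k :: nat
  assumes q: "1 \<le> q" and k: "1 \<le> k"
begin

abbreviation "n \<equiv> nk q k"
abbreviation "S \<equiv> ksubsets k n"
abbreviation "X \<equiv> schubert k n (w_min q k)"

definition pivots :: "nat set" where "pivots = (\<lambda>j. Suc j * q) ` {..<k}"

lemma n: "n = k * q + 1" "1 \<le> n" "k \<le> n"
  using q by (auto simp: nk_def le_SucI)

lemma pivot_less: "j < k \<Longrightarrow> Suc j * q < n"
proof -
  assume "j < k"
  then have "Suc j * q \<le> k * q" by (intro mult_le_mono1) simp
  then show ?thesis by (simp add: n)
qed

lemma pivot_inj: "Suc i * q = Suc j * q \<longleftrightarrow> i = j"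
  using q by simp

lemma inj_pivot: "inj_on (\<lambda>j. Suc j * q) {..<k}"
  by (rule inj_onI) (simp only: pivot_inj)

lemma pivots_S: "pivots \<in> S"
  unfolding pivots_def by (rule ksubsets_image[OF inj_pivot pivot_less])

lemma pick_pivots:
  assumes "j < k"
  shows "pick pivots j = Suc j * q"
proof -
  have "{a \<in> pivots. a < Suc j * q} = (\<lambda>j. Suc j * q) ` {..<j}"
    unfolding pivots_def using assms q by auto
  moreover have "inj_on (\<lambda>j. Suc j * q) {..<j}" by (rule inj_onI) (simp only: pivot_inj)
  ultimately have "card {a \<in> pivots. a < Suc j * q} = j" by (simp add: card_image)
  moreover have "Suc j * q \<in> pivots" unfolding pivots_def using assms by blast
  ultimately show ?thesis using pick_card_in_set[of "Suc j * q" pivots] by simp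
qed

lemma plucker_pivots: "plucker k n M pivots = minor k M (\<lambda>j. Suc j * q)"
  unfolding plucker_def using pivots_S by (simp) (rule minor_cong, simp add: pick_pivots)

lemma pivot_not_free: "Suc i * q \<notin> free_cols q j"
  using q unfolding free_cols_def by auto

lemma echelon_matrix_pivot:
  assumes "z \<in> cell_pts q k"
  shows "echelon_matrix q z (Suc i * q) j = (if i = j then 1 else 0)"
  using assms pivot_not_free[of i "Suc j"] q unfolding echelon_matrix_def cell_pts_def by auto

lemma echelon_matrix_above:
  assumes "z \<in> cell_pts q k" "Suc j * q < i"
  shows "echelon_matrix q z i j = 0"
proof -
  have "i \<notin> free_cols q (Suc j)" using assms(2) unfolding free_cols_def by auto
  then show ?thesis using assms unfolding echelon_matrix_def cell_pts_def by auto
qed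

lemma plucker_echelon_pivots: "z \<in> cell_pts q k \<Longrightarrow> plucker k n (echelon_matrix q z) pivots = 1"
  unfolding plucker_pivots by (rule minor_identity) (rule echelon_matrix_pivot)

definition grass_pt :: "(nat \<Rightarrow> nat \<Rightarrow> complex) \<Rightarrow> (nat set \<Rightarrow> complex) set" where
  "grass_pt z = pt_class (plucker k n (echelon_matrix q z))"

text \<open>The \<open>k\<close> columns are completed by unit vectors at the rows outside
  \<open>I\<close> to an invertible matrix, which is then scaled to determinant one.\<close>

lemma grassmannian_identity:
  assumes I: "I \<in> S" and id: "\<And>i j. i < k \<Longrightarrow> j < k \<Longrightarrow> N (pick I i) j = (if i = j then 1 else 0)"
  shows "pt_class (plucker k n N) \<in> grassmannian k n"
proof -
  note b = ksubsets_pick_bij[OF I]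
  have In: "I \<subseteq> {..<n}" "finite I" "card I = k" using I ksubsets_finite[OF I] by (auto simp: ksubsets_def)
  have "card ({..<n} - I) = card {k..<n}" using In by (simp add: card_Diff_subset)
  then obtain \<sigma> where \<sigma>: "bij_betw \<sigma> {k..<n} ({..<n} - I)"
    using finite_same_card_bij[of "{k..<n}" "{..<n} - I"] by auto
  define A0 where "A0 i j = (if j < k then N i j else if i = \<sigma> j then 1 else 0)" for i j
  have ne: "minor n A0 id \<noteq> 0"
  proof (rule minor_nonzeroI)
    fix x :: "nat \<Rightarrow> complex" and i
    assume *: "\<And>i. i < n \<Longrightarrow> (\<Sum>j<n. A0 (id i) j * x j) = 0" and i: "i < n"
    have x0: "x j = 0" if j: "j < k" for j
    proof -
      have p: "pick I j < n" "pick I j \<in> I" using ksubsets_pick_less[OF I j] b j unfolding bij_betw_def by auto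
      have "A0 (pick I j) l * x l = (if l = j then x l else 0)" if "l < n" for l
        using id[OF j, of l] that p \<sigma> j unfolding A0_def bij_betw_def by auto
      then have "(\<Sum>l<n. A0 (pick I j) l * x l) = (\<Sum>l<n. if l = j then x l else 0)" by (intro sum.cong) auto
      then show ?thesis using *[OF p(1)] j n(3) by simp
    qed
    show "x i = 0"
    proof (cases "i < k")
      case False
      then have ik: "i \<in> {k..<n}" using i by simp
      then have s: "\<sigma> i < n" using \<sigma> unfolding bij_betw_def by auto
      have "A0 (\<sigma> i) l * x l = (if l = i then x l else 0)" if "l < n" for l
        using x0 that \<sigma> ik False unfolding A0_def bij_betw_def inj_on_def by auto
      then have "(\<Sum>l<n. A0 (\<sigma> i) l * x l) = (\<Sum>l<n. if l = i then x l else 0)" by (intro sum.cong) auto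
      then show ?thesis using *[OF s] i by simp
    qed (rule x0)
  qed
  define D where "D = minor n A0 id"
  \<comment> \<open>Column 0 absorbs the whole determinant. As \<open>1 \<le> k\<close>, it is among
    the first \<open>k\<close> columns, so their Pluecker coordinates all change by one
    factor.\<close>
  define c where "c j = (if j = (0::nat) then inverse D else 1)" for j
  define A where "A = mat n n (\<lambda>(i, j). A0 i j * c j)"
  have prod_c: "(\<Prod>j<l. c j) = inverse D" if "1 \<le> l" for l
    using that by (induction l rule: dec_induct) (auto simp: c_def)
  have "det A = minor n (\<lambda>i j. A0 i j * c j) id" unfolding A_def minor_def by simp
  also have "\<dots> = 1" unfolding minor_scale_cols prod_c[OF n(2)] using ne by (simp add: D_def)
  finally have A: "A \<in> carrier (SL n)" unfolding mem_SL A_def by simp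
  have "plucker k n (entry A) = plucker k n (\<lambda>i j. N i j * c j)"
    by (rule plucker_cong) (use n(3) in \<open>auto simp: A_def A0_def\<close>)
  also have "\<dots> = (\<lambda>I. inverse D * plucker k n N I)"
    by (rule plucker_scale) (simp only: minor_scale_cols prod_c[OF k])
  finally have "pt_class (plucker k n (entry A)) = pt_class (plucker k n N)"
    using ne by (intro pt_class_scale[of "inverse D"]) (auto simp: D_def)
  then show ?thesis unfolding grassmannian_eq[OF n(3)] using A by blast
qed

lemma grassmannian_nonzero:
  assumes "plucker k n M J \<noteq> 0"
  shows "pt_class (plucker k n M) \<in> grassmannian k n" "pt_class (plucker k n M) \<in> proj_pts S"
proof -
  show "pt_class (plucker k n M) \<in> proj_pts S" by (rule pt_class_in_proj_pts[where b = J, OF plucker_cvecs assms])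
  obtain I N c where *: "I \<in> S" "plucker k n M I \<noteq> 0" "c \<noteq> 0" "plucker k n N = (\<lambda>J. c * plucker k n M J)"
    "\<forall>i<k. \<forall>j<k. N (pick I i) j = (if i = j then 1 else 0)"
    "\<forall>j<k. \<forall>p<n. N p j \<noteq> 0 \<longrightarrow> p \<le> pick I j" using echelon_form[OF assms] .
  have "pt_class (plucker k n N) = pt_class (plucker k n M)" using * by (intro pt_class_scale[of c]) auto
  then show "pt_class (plucker k n M) \<in> grassmannian k n" using grassmannian_identity[of I N] * by simp
qed

text \<open>The minor at the pivots is triangular with diagonal entries of \<open>B\<close>. The
  first \<open>j\<close> selected columns vanish below row \<open>j * q\<close>, so a set
  \<open>I\<close> with fewer than \<open>j\<close> elements up to that row has too few rows to
  support them and its minor is zero.\<close>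

lemma cell_plucker:
  assumes "y \<in> cell q k"
  obtains M where "y = pt_class (plucker k n M)" "plucker k n M pivots \<noteq> 0"
    "\<And>I j. plucker k n M I \<noteq> 0 \<Longrightarrow> j \<in> {1..k} \<Longrightarrow> j \<le> card (I \<inter> {..j * q})"
proof -
  obtain B where B: "y = pt_class (plucker k n (\<lambda>i j. B $$ (i, Suc j * q)))" "B \<in> carrier_mat n n" "det B = 1" "upper_triangular B"
    using assms unfolding cell_def by (auto simp: mem_SL)
  let ?M = "\<lambda>i j. B $$ (i, Suc j * q)"
  have detB: "det B = (\<Prod>i = 0..<n. B $$ (i, i))" using det_upper_triangular[OF B(4,2)] B(2) by (simp add: prod_list_diag_prod)
  then have diag: "B $$ (i, i) \<noteq> 0" if "i < n" for i
  proof -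
    have "(\<Prod>i = 0..<n. B $$ (i, i)) \<noteq> 0" using B(3) detB by simp
    then show ?thesis using that by simp
  qed
  have zero: "B $$ (i, j) = 0" if "j < i" "i < n" for i j using B(2,4) that unfolding upper_triangular_def by auto
  let ?A = "mat k k (\<lambda>(i, j). ?M (Suc i * q) j)"
  have "upper_triangular ?A"
  proof
    fix i j assume "j < i" "i < dim_row ?A"
    moreover then have "Suc j * q < Suc i * q" using q by simp
    ultimately show "?A $$ (i, j) = 0" using zero[of "Suc j * q" "Suc i * q"] pivot_less[of i] by simp
  qed
  then have "det ?A = (\<Prod>i = 0..<k. B $$ (Suc i * q, Suc i * q))"
    by (subst det_upper_triangular[of _ k]) (auto simp: prod_list_diag_prod)
  then have "plucker k n ?M pivots \<noteq> 0" unfolding plucker_pivots minor_def using diag pivot_less by simp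
  moreover have "j \<le> card (I \<inter> {..j * q})" if I: "plucker k n ?M I \<noteq> 0" and j: "j \<in> {1..k}" for I j
  proof (rule ccontr)
    assume lt: "\<not> ?thesis"
    have IS: "I \<in> S" using I by (auto simp: plucker_def split: if_splits)
    note b = ksubsets_pick_bij[OF IS]
    let ?R = "{i. i < k \<and> pick I i \<le> j * q}"
    have "pick I ` ?R \<subseteq> I \<inter> {..j * q}" using b unfolding bij_betw_def by auto
    then have "card (pick I ` ?R) \<le> card (I \<inter> {..j * q})" by (intro card_mono) auto
    moreover have "card (pick I ` ?R) = card ?R"
      using b unfolding bij_betw_def by (intro card_image) (auto simp: inj_on_def)
    ultimately have cardR: "card ?R < card {..<j}" using lt by simp
    have "minor k ?M (pick I) = 0"
    proof (rule minor_zeroI[OF _ cardR])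
      show "{..<j} \<subseteq> {..<k}" using j by auto
      fix i l assume i: "i < k" and l: "l \<in> {..<j}" and nz: "B $$ (pick I i, Suc l * q) \<noteq> 0"
      have "pick I i \<le> Suc l * q" using zero[of "Suc l * q" "pick I i"] nz ksubsets_pick_less[OF IS i] by force
      also have "\<dots> \<le> j * q" using l by (intro mult_le_mono1) auto
      finally show "i \<in> ?R" using i by simp
    qed simp
    then show False using I IS by (simp add: plucker_def)
  qed
  ultimately show thesis using that[of ?M] B(1) by blast
qed

lemma cell_subset: "cell q k \<subseteq> grassmannian k n \<inter> proj_pts S"
proof
  fix y assume "y \<in> cell q k"
  then obtain M where "y = pt_class (plucker k n M)" "plucker k n M pivots \<noteq> 0" using cell_plucker by blast
  then show "y \<in> grassmannian k n \<inter> proj_pts S" using grassmannian_nonzero by blast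
qed

text \<open>Nonvanishing loci of forms are a base, so they suffice to test membership in the
  closure. This version is stable under limits and under pulling forms back along the torus.\<close>

lemma mem_schubert:
  "x \<in> X \<longleftrightarrow> x \<in> proj_pts S \<and> x \<in> grassmannian k n \<and>
     (\<forall>d. \<forall>F\<in>hom_polys S d. (\<forall>v\<in>x. F v \<noteq> 0) \<longrightarrow> (\<exists>y\<in>cell q k. \<forall>v\<in>y. F v \<noteq> 0))"
proof -
  let ?T = "ftop (proj_space S)"
  have X: "X = subtopology ?T (grassmannian k n) closure_of cell q k"
    unfolding schubert_def cell_eq[OF q] ..
  show ?thesis
  proof
    assume x: "x \<in> X"
    then have "x \<in> topspace (subtopology ?T (grassmannian k n))" unfolding X in_closure_of by blast
    then have 1: "x \<in> proj_pts S" "x \<in> grassmannian k n" by auto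
    have "\<exists>y\<in>cell q k. \<forall>v\<in>y. F v \<noteq> 0" if F: "F \<in> hom_polys S d" "\<forall>v\<in>x. F v \<noteq> 0" for d F
    proof -
      let ?U = "{x \<in> proj_pts S. \<forall>v\<in>x. F v \<noteq> 0} \<inter> grassmannian k n"
      have "openin (subtopology ?T (grassmannian k n)) ?U"
        using openin_proj_basic[OF F(1)] by (rule openin_subtopology_Int)
      moreover have "x \<in> ?U" using 1 F(2) by blast
      moreover have all: "\<forall>T. x \<in> T \<and> openin (subtopology ?T (grassmannian k n)) T \<longrightarrow> (\<exists>y. y \<in> cell q k \<and> y \<in> T)"
        using x unfolding X in_closure_of by (rule conjunct2)
      ultimately have "\<exists>y. y \<in> cell q k \<and> y \<in> ?U" using all[THEN spec, of ?U] by simp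
      then show ?thesis by blast
    qed
    then show "x \<in> proj_pts S \<and> x \<in> grassmannian k n \<and>
     (\<forall>d. \<forall>F\<in>hom_polys S d. (\<forall>v\<in>x. F v \<noteq> 0) \<longrightarrow> (\<exists>y\<in>cell q k. \<forall>v\<in>y. F v \<noteq> 0))" using 1 by blast
  next
    assume *: "x \<in> proj_pts S \<and> x \<in> grassmannian k n \<and>
     (\<forall>d. \<forall>F\<in>hom_polys S d. (\<forall>v\<in>x. F v \<noteq> 0) \<longrightarrow> (\<exists>y\<in>cell q k. \<forall>v\<in>y. F v \<noteq> 0))"
    show "x \<in> X" unfolding X in_closure_of
    proof (intro conjI allI impI)
      show "x \<in> topspace (subtopology ?T (grassmannian k n))" using * by simp
      fix U assume "x \<in> U \<and> openin (subtopology ?T (grassmannian k n)) U"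
      then obtain V where V: "openin ?T V" "U = V \<inter> grassmannian k n" "x \<in> V" unfolding openin_subtopology by auto
      obtain d F where F: "F \<in> hom_polys S d" "\<forall>v\<in>x. F v \<noteq> 0" "{x \<in> proj_pts S. \<forall>v\<in>x. F v \<noteq> 0} \<subseteq> V"
        using openin_proj_space_point[OF V(1,3)] .
      obtain y where "y \<in> cell q k" "\<forall>v\<in>y. F v \<noteq> 0" using * F by blast
      then show "\<exists>y. y \<in> cell q k \<and> y \<in> U" using F(3) cell_subset V(2) by blast
    qed
  qed
qed

lemma schubert_closed:
  assumes "x \<in> X" "F \<in> hom_polys S d" "\<And>v. v \<in> x \<Longrightarrow> F v \<noteq> 0"
  obtains y where "y \<in> cell q k" "\<And>v. v \<in> y \<Longrightarrow> F v \<noteq> 0"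
proof -
  have "\<forall>v\<in>x. F v \<noteq> 0" using assms(3) by simp
  then have "\<exists>y\<in>cell q k. \<forall>v\<in>y. F v \<noteq> 0"
    using mem_schubert[THEN iffD1, OF assms(1), THEN conjunct2, THEN conjunct2, rule_format, OF assms(2)] by blast
  then show thesis using that by blast
qed

lemma cell_subset_schubert: "cell q k \<subseteq> X"
  using cell_subset mem_schubert by blast

text \<open>A coordinate is a form, so if it is nonzero at a point of the closure it is nonzero
  somewhere on the cell, where the bound is known.\<close>

lemma schubert_vanish:
  assumes "pt_class v \<in> X" "I \<in> S" "v I \<noteq> 0" "j \<in> {1..k}"
  shows "j \<le> card (I \<inter> {..j * q})"
proof -
  have F: "(\<lambda>v. v I) \<in> hom_polys S 1" by (rule hom_polys_coord) (use assms in auto)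
  have "\<forall>u\<in>pt_class v. u I \<noteq> 0" using hom_polys_ball_iff[OF F] assms(3) by simp
  then obtain y where y: "y \<in> cell q k" "\<And>v. v \<in> y \<Longrightarrow> v I \<noteq> 0"
    using schubert_closed[OF assms(1) F] by blast
  obtain M where M: "y = pt_class (plucker k n M)"
    "\<And>I j. plucker k n M I \<noteq> 0 \<Longrightarrow> j \<in> {1..k} \<Longrightarrow> j \<le> card (I \<inter> {..j * q})" using cell_plucker[OF y(1)] by blast
  have "plucker k n M I \<noteq> 0" using y(2) pt_class_self unfolding M(1) by blast
  then show ?thesis using M(2) assms(4) by blast
qed

lemma schubert_point:
  assumes "x \<in> X"
  obtains v J where "x = pt_class v" "v J \<noteq> 0"
proof -
  have "x \<in> proj_pts S" using assms unfolding mem_schubert by blast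
  then obtain v where v: "x = pt_class v" "v \<noteq> (\<lambda>_. 0)" by (auto elim!: proj_ptsE)
  then obtain J where "v J \<noteq> 0" by auto
  then show thesis using that v(1) by blast
qed

lemma diag_act_eq: "diag_act k n d v = (\<lambda>I. if I \<in> S then (\<Prod>i\<in>I. d i) * v I else 0)"
  unfolding diag_act_def ..

lemma diag_act_cell:
  assumes "a \<in> block_torus q n" "y \<in> cell q k"
  shows "diag_act k n (\<lambda>i. a (i div q)) ` y \<in> cell q k"
proof -
  let ?d = "\<lambda>i. a (i div q)"
  obtain B where B: "y = pt_class (plucker k n (\<lambda>i j. B $$ (i, Suc j * q)))" "B \<in> carrier_mat n n" "det B = 1" "upper_triangular B"
    using assms unfolding cell_def by (auto simp: mem_SL)
  let ?B = "mat_diag n ?d * B"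
  have eq: "?B = mat n n (\<lambda>(i, j). ?d i * B $$ (i, j))" by (rule mat_diag_mult_left[OF B(2)])
  have "det ?B = det (mat_diag n ?d) * det B" by (rule det_mult[of _ n]) (use B in auto)
  then have "?B \<in> carrier (SL n)" using B assms(1) mult_carrier_mat[OF mat_diag_dim B(2)]
    unfolding mem_SL det_mat_diag block_torus_def by simp
  moreover have "upper_triangular ?B" unfolding eq using B(2,4) by (auto simp: upper_triangular_def)
  moreover have "diag_act k n ?d ` y = pt_class (plucker k n (\<lambda>i j. ?B $$ (i, Suc j * q)))"
    unfolding B(1) image_diag_act diag_act_plucker eq
    by (rule arg_cong[of _ _ pt_class], rule plucker_cong) (simp add: pivot_less del: mult_Suc)
  ultimately show ?thesis unfolding cell_def by blast
qed

lemma diag_act_schubert: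
  assumes a: "a \<in> block_torus q n" and x: "x \<in> X"
  shows "diag_act k n (\<lambda>i. a (i div q)) ` x \<in> X"
proof -
  let ?d = "\<lambda>i. a (i div q)"
  let ?h = "diag_act k n ?d"
  obtain A where A: "x = pt_class (plucker k n (entry A))"
    using x unfolding mem_schubert grassmannian_eq[OF n(3)] by blast
  obtain v J where v: "x = pt_class v" "v J \<noteq> 0" using schubert_point[OF x] .
  have "v \<in> pt_class (plucker k n (entry A))" using A v(1) pt_class_self[of v] by simp
  then have J: "plucker k n (entry A) J \<noteq> 0" using v(2) by (auto simp: mem_pt_class)
  have hx: "?h ` x = pt_class (plucker k n (\<lambda>i j. ?d i * entry A i j))"
    unfolding A image_diag_act diag_act_plucker ..
  have "?h (plucker k n (entry A)) J \<noteq> 0" unfolding diag_act_def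
    using J a by (auto simp: block_torus_def plucker_def ksubsets_finite split: if_splits)
  then have J': "plucker k n (\<lambda>i j. ?d i * entry A i j) J \<noteq> 0" unfolding diag_act_plucker .
  show ?thesis unfolding mem_schubert
  proof (intro conjI allI impI ballI)
    show "?h ` x \<in> proj_pts S" "?h ` x \<in> grassmannian k n" unfolding hx using grassmannian_nonzero[OF J'] by blast+
    fix d F assume F: "F \<in> hom_polys S d" "\<forall>v\<in>?h ` x. F v \<noteq> 0"
    have F': "(\<lambda>v. F (?h v)) \<in> hom_polys S d" unfolding diag_act_eq by (rule hom_polys_scale_coords[OF F(1)])
    have "F (?h v) \<noteq> 0" if "v \<in> x" for v using F(2) that by simp
    then obtain y where y: "y \<in> cell q k" "\<And>v. v \<in> y \<Longrightarrow> F (?h v) \<noteq> 0" using schubert_closed[OF x F'] by blast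
    then show "\<exists>y\<in>cell q k. \<forall>v\<in>y. F v \<noteq> 0" using diag_act_cell[OF a y(1)] by (intro bexI[of _ "?h ` y"]) auto
  qed
qed

section \<open>Invariant sections and destabilising one-parameter subgroups\<close>

definition H :: "((nat set \<Rightarrow> complex) \<Rightarrow> nat set \<Rightarrow> complex) set" where
  "H = {ext_power k n A | A. A \<in> \<Union>(T_J q k)}"

lemma H_eq: "H = {diag_act k n (\<lambda>i. a (i div q)) | a. a \<in> block_torus q n}"
  unfolding H_def by (rule T_J_lifts[OF q])

text \<open>If the limit of a one-parameter subgroup scales a representative of \<open>x\<close> to \<open>0\<close> while the point
  itself tends to a point of \<open>X\<close>, then every invariant section vanishes at \<open>x\<close>: near the limit it
  is a quotient of forms, so it stays bounded. The one-parameter subgroup used scales the rows in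
  a union of blocks against all the others.\<close>

lemma invariant_section_vanishes:
  assumes I: "I \<in> S" and id: "\<And>i j. i < k \<Longrightarrow> j < k \<Longrightarrow> N (pick I i) j = (if i = j then 1 else 0)"
    and x: "pt_class (plucker k n N) \<in> X"
    and C: "C = {i. i < n \<and> i div q \<in> Bk}"
    and supp: "\<And>p j. j < k \<Longrightarrow> p < n \<Longrightarrow> pick I j \<in> C \<Longrightarrow> N p j \<noteq> 0 \<Longrightarrow> p \<in> C"
    and gt: "k * card C < n * card (I \<inter> C)"
    and m: "m \<ge> 1" and s: "s \<in> sections S X (n * m)" and inv: "\<And>h v. h \<in> H \<Longrightarrow> v \<in> \<Union>X \<Longrightarrow> s (h v) = s v"
  shows "s (plucker k n N) = 0"
proof -
  note b = ksubsets_pick_bij[OF I]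
  define R where "R = {j. j < k \<and> pick I j \<in> C}"
  have "pick I ` R = I \<inter> C" using b unfolding R_def bij_betw_def by auto
  moreover have "inj_on (pick I) R" using b unfolding R_def bij_betw_def inj_on_def by auto
  ultimately have cardR: "card R = card (I \<inter> C)" by (metis card_image)
  have Rk: "R \<subseteq> {..<k}" unfolding R_def by auto
  have Cn: "C \<subseteq> {..<n}" unfolding C by auto
  define \<beta> where "\<beta> = card C"
  have \<beta>: "\<beta> \<le> n" unfolding \<beta>_def using card_mono[OF _ Cn] by simp
  define c0 where "c0 = card R"
  have c0: "c0 \<le> k" unfolding c0_def using card_mono[OF _ Rk] by simp
  \<comment> \<open>The exponent by which the one-parameter subgroup scales the representative;
    \<open>gt\<close> says that it is positive.\<close>
  define E where "E = n * c0 - k * \<beta>"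
  have E: "E \<ge> 1" "n * c0 = k * \<beta> + E" using gt cardR unfolding E_def c0_def \<beta>_def by auto
  \<comment> \<open>The exponents are chosen for determinant one: \<beta> coordinates receive n -
    \<beta> and the other n - \<beta> coordinates receive -\<beta>.\<close>
  define a where "a t b = (if b \<in> Bk then t ^ (n - \<beta>) else inverse t ^ \<beta>)" for t :: complex and b
  \<comment> \<open>The translated matrix after column \<open>j\<close> is divided by
    \<open>c t j\<close>, which keeps the pivot entries 1. The only negative power could arise in
    columns of \<open>R\<close> at rows outside \<open>C\<close>, where \<open>supp\<close> makes
    the entry zero; so the matrix is polynomial in \<open>t\<close> and has a value at 0.\<close>
  define M where "M t i j = (if j \<in> R then N i j else if i div q \<in> Bk then t ^ n * N i j else N i j)" for t :: complex and i j
  define c where "c t j = (if j \<in> R then t ^ (n - \<beta>) else inverse t ^ \<beta>)" for t :: complex and j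
  have a_torus: "a t \<in> block_torus q n" if t: "t \<noteq> 0" for t
  proof -
    have "(\<Prod>i<n. a t (i div q)) = (\<Prod>i\<in>C. t ^ (n - \<beta>)) * (\<Prod>i\<in>{..<n} - C. inverse t ^ \<beta>)"
      unfolding prod.subset_diff[OF Cn finite_lessThan] mult.commute[of "prod _ C"]
      by (intro arg_cong2[of _ _ _ _ "(*)"] prod.cong) (auto simp: a_def C)
    also have "\<dots> = t ^ ((n - \<beta>) * \<beta>) * inverse t ^ (\<beta> * (n - \<beta>))"
      using Cn by (simp add: \<beta>_def card_Diff_subset finite_subset[OF Cn] flip: power_mult)
    also have "\<dots> = 1" using t by (simp add: mult.commute power_inverse)
    finally show ?thesis using t unfolding block_torus_def a_def by auto
  qed
  have M_id: "M t (pick I i) j = (if i = j then 1 else 0)" if "i < k" "j < k" for t i j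
    using id[OF that] that ksubsets_pick_less[OF I that(2)] unfolding M_def R_def C by auto
  have scale: "a t (i div q) * N i j = M t i j * c t j" if "t \<noteq> 0" "i < n" "j < k" for t i j
  proof (cases "j \<in> R")
    case True
    then have "N i j \<noteq> 0 \<Longrightarrow> i div q \<in> Bk" using supp[OF that(3,2)] unfolding R_def C by auto
    then show ?thesis using True by (cases "N i j = 0") (auto simp: M_def a_def c_def)
  next
    case False
    have "t ^ (n - \<beta>) = t ^ n * inverse t ^ \<beta>" using \<beta> that(1)
      by (simp add: power_diff power_inverse divide_inverse)
    then show ?thesis using False by (auto simp: M_def a_def c_def)
  qed
  have prod_c: "(\<Prod>j<k. c t j) = t ^ E" if t: "t \<noteq> 0" for t
  proof -
    have "(\<Prod>j<k. c t j) = (\<Prod>j\<in>R. t ^ (n - \<beta>)) * (\<Prod>j\<in>{..<k} - R. inverse t ^ \<beta>)"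
      unfolding prod.subset_diff[OF Rk finite_lessThan] mult.commute[of "prod _ R"]
      by (intro arg_cong2[of _ _ _ _ "(*)"] prod.cong) (auto simp: c_def)
    also have "\<dots> = t ^ ((n - \<beta>) * c0) * inverse t ^ (\<beta> * (k - c0))"
      using Rk by (simp add: c0_def card_Diff_subset finite_subset[OF Rk] flip: power_mult)
    also have "(n - \<beta>) * c0 = E + \<beta> * (k - c0)"
      using E(2) c0 \<beta> by (simp add: algebra_simps diff_mult_distrib diff_mult_distrib2)
    finally show ?thesis using t by (simp add: power_add power_inverse)
  qed
  define v where "v t = plucker k n (M t)" for t
  have act: "diag_act k n (\<lambda>i. a t (i div q)) (plucker k n N) = (\<lambda>I. t ^ E * v t I)" if t: "t \<noteq> 0" for t
  proof -
    have "diag_act k n (\<lambda>i. a t (i div q)) (plucker k n N) = plucker k n (\<lambda>i j. M t i j * c t j)"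
      unfolding diag_act_plucker by (rule plucker_cong) (rule scale[OF t])
    also have "\<dots> = (\<lambda>I. t ^ E * v t I)"
      unfolding v_def by (rule plucker_scale) (simp only: minor_scale_cols prod_c[OF t])
    finally show ?thesis .
  qed
  have in_X: "pt_class (v t) \<in> X" if t: "t \<noteq> 0" for t
  proof -
    have "diag_act k n (\<lambda>i. a t (i div q)) ` pt_class (plucker k n N) = pt_class (v t)"
      unfolding image_diag_act act[OF t] using t by (intro pt_class_scale[of "t ^ E"]) auto
    then show ?thesis using diag_act_schubert[OF a_torus[OF t] x] by simp
  qed
  have v_I: "v t I = 1" for t unfolding v_def plucker_def using I minor_identity[of k "M t" "pick I", OF M_id] by simp
  have cont_v: "isCont (\<lambda>t. v t J) 0" if "J \<in> S" for J
  proof -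
    have "isCont (\<lambda>t. M t i j) 0" for i j
      unfolding M_def by (cases "j \<in> R"; cases "i div q \<in> Bk") (auto intro!: continuous_intros)
    then show ?thesis using that unfolding v_def plucker_def minor_def' by (simp add: continuous_intros)
  qed
  have cont: "isCont (\<lambda>t. F (v t)) 0" if "F \<in> hom_polys S d" for F d
    by (rule hom_polys_isCont[OF that cont_v])
  have near: "\<forall>\<^sub>F t in at 0. F (v t) \<noteq> 0" if "F \<in> hom_polys S d" "F (v 0) \<noteq> 0" for F d
    using tendsto_imp_eventually_ne[OF cont[OF that(1), unfolded isCont_def] that(2)] .
  \<comment> \<open>The limit stays in the closed set: a form that is nonzero at \<open>v 0\<close>
    is nonzero at \<open>v t\<close> for small \<open>t\<close>, and \<open>v t\<close> represents a
    point of \<open>X\<close>.\<close>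
  have x0: "pt_class (v 0) \<in> X" unfolding mem_schubert
  proof (intro conjI allI impI ballI)
    show "pt_class (v 0) \<in> proj_pts S" "pt_class (v 0) \<in> grassmannian k n"
      using grassmannian_nonzero[of "M 0" I] v_I[of 0] unfolding v_def by auto
    fix d F assume F: "F \<in> hom_polys S d" "\<forall>u\<in>pt_class (v 0). F u \<noteq> 0"
    then have "F (v 0) \<noteq> 0" using pt_class_self by blast
    then have "\<forall>\<^sub>F t in at 0. F (v t) \<noteq> 0 \<and> t \<noteq> 0"
      using near[OF F(1)] by (intro eventually_conj) (auto simp: eventually_at_filter)
    then obtain t where t: "F (v t) \<noteq> 0" "t \<noteq> 0" using eventually_happens'[OF at_neq_bot] by blast
    have "F u \<noteq> 0" if "u \<in> pt_class (v t)" for u using hom_polys_nonzero_iff[OF F(1) that] t(1) by simp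
    from schubert_closed[OF in_X[OF t(2)] F(1) this]
    obtain y where "y \<in> cell q k" "\<And>u. u \<in> y \<Longrightarrow> F u \<noteq> 0" by blast
    then show "\<exists>y\<in>cell q k. \<forall>v\<in>y. F v \<noteq> 0" by blast
  qed
  obtain e F G where FG: "F \<in> hom_polys S (n * m + e)" "G \<in> hom_polys S e" "\<forall>u\<in>pt_class (v 0). G u \<noteq> 0"
    "\<forall>y\<in>X. \<forall>u\<in>y. G u \<noteq> 0 \<longrightarrow> s u = F u / G u"
    using bspec[OF s[unfolded sections_def mem_Collect_eq] x0] by (elim exE bexE conjE)
  have G0: "G (v 0) \<noteq> 0" using FG(3) pt_class_self by blast
  \<comment> \<open>The degrees of \<open>F\<close> and \<open>G\<close> differ by
    \<open>n * m\<close>, so the scaling of the representative by \<open>t ^ E\<close> becomes the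
    factor \<open>t ^ (E * (n * m))\<close>.\<close>
  have val: "s (plucker k n N) = t ^ (E * (n * m)) * (F (v t) / G (v t))" if t: "t \<noteq> 0" "G (v t) \<noteq> 0" for t
  proof -
    let ?u = "\<lambda>I. t ^ E * v t I"
    have "s (plucker k n N) = s (diag_act k n (\<lambda>i. a t (i div q)) (plucker k n N))"
    proof (rule inv[symmetric])
      show "diag_act k n (\<lambda>i. a t (i div q)) \<in> H" unfolding H_eq using a_torus[OF t(1)] by blast
      show "plucker k n N \<in> \<Union>X" using x pt_class_self by blast
    qed
    also have "\<dots> = s ?u" by (simp only: act[OF t(1)])
    also have "\<dots> = F ?u / G ?u"
    proof -
      have "?u \<in> pt_class (v t)" using t(1) by (auto simp: mem_pt_class intro!: exI[of _ "t ^ E"])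
      moreover have "G ?u \<noteq> 0" using t hom_polys_scale[OF FG(2)] by simp
      ultimately show ?thesis using bspec[OF bspec[OF FG(4) in_X[OF t(1)]], of ?u] by simp
    qed
    also have "\<dots> = t ^ (E * (n * m)) * (F (v t) / G (v t))"
      unfolding hom_polys_scale[OF FG(1)] hom_polys_scale[OF FG(2)] using t
      by (simp add: power_add power_mult)
    finally show ?thesis .
  qed
  have "((\<lambda>t. t ^ (E * (n * m)) * (F (v t) / G (v t))) \<longlongrightarrow> 0 ^ (E * (n * m)) * (F (v 0) / G (v 0))) (at 0)"
    using cont[OF FG(1), unfolded isCont_def] cont[OF FG(2), unfolded isCont_def] G0
    by (intro tendsto_intros) auto
  moreover have "E * (n * m) > 0" using E(1) m n(2) by simp
  ultimately have "((\<lambda>t. t ^ (E * (n * m)) * (F (v t) / G (v t))) \<longlongrightarrow> 0) (at 0)" by (simp add: power_0_left)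
  moreover have "\<forall>\<^sub>F t in at 0. t ^ (E * (n * m)) * (F (v t) / G (v t)) = s (plucker k n N)"
  proof -
    have "\<forall>\<^sub>F t in at 0. G (v t) \<noteq> 0 \<and> t \<noteq> 0"
      using near[OF FG(2) G0] by (intro eventually_conj) (auto simp: eventually_at_filter)
    then show ?thesis by (rule eventually_mono) (use val in auto)
  qed
  ultimately have "((\<lambda>t. s (plucker k n N)) \<longlongrightarrow> 0) (at (0::complex))" using tendsto_cong by force
  then show ?thesis by (simp add: tendsto_const_iff)
qed

text \<open>Two families of one-parameter subgroups destabilise everything else: the blocks before
  \<open>j\<close> if there are at least \<open>j\<close> pivots in them, and block \<open>j\<close>
  alone if basis vector \<open>j\<close> is a coordinate vector.\<close>

lemma semistable_grass_pt:
  assumes "x \<in> semistable S X H n"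
  obtains z where "z \<in> echelon_pts q k" "x = grass_pt z"
proof -
  obtain m s where ms: "x \<in> X" "m \<ge> 1" "s \<in> sections S X (n * m)" "\<And>h v. h \<in> H \<Longrightarrow> v \<in> \<Union>X \<Longrightarrow> s (h v) = s v"
    "\<forall>v\<in>x. s v \<noteq> 0" using assms unfolding semistable_def by blast
  obtain A where A: "x = pt_class (plucker k n (entry A))"
    using ms(1) unfolding mem_schubert grassmannian_eq[OF n(3)] by blast
  obtain v J where v: "x = pt_class v" "v J \<noteq> 0" using schubert_point[OF ms(1)] .
  have "v \<in> pt_class (plucker k n (entry A))" using A v(1) pt_class_self[of v] by simp
  then have J: "plucker k n (entry A) J \<noteq> 0" using v(2) by (auto simp: mem_pt_class)
  obtain I N c where *: "I \<in> S" "plucker k n (entry A) I \<noteq> 0" "c \<noteq> 0" "plucker k n N = (\<lambda>J. c * plucker k n (entry A) J)"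
    and "\<forall>i<k. \<forall>j<k. N (pick I i) j = (if i = j then 1 else 0)"
    "\<forall>j<k. \<forall>p<n. N p j \<noteq> 0 \<longrightarrow> p \<le> pick I j" using echelon_form[OF J] .
  then have id: "\<And>i j. i < k \<Longrightarrow> j < k \<Longrightarrow> N (pick I i) j = (if i = j then 1 else 0)"
    and supp: "\<And>p j. j < k \<Longrightarrow> p < n \<Longrightarrow> N p j \<noteq> 0 \<Longrightarrow> p \<le> pick I j" by blast+
  have xN: "x = pt_class (plucker k n N)" unfolding A using * by (intro pt_class_scale[symmetric, of c]) auto
  have nonvanish: "s (plucker k n N) \<noteq> 0" using ms(5) pt_class_self unfolding xN by blast
  have low: "j \<le> card (I \<inter> {..j * q})" if "j \<in> {1..k}" for j
    by (rule schubert_vanish[of "plucker k n (entry A)" I]) (use ms(1) A * that in auto)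
  have fin: "finite I" "card I = k" using *(1) ksubsets_finite[OF *(1)] by (auto simp: ksubsets_def)
  have I_eq: "I = pivots"
  proof (rule ccontr)
    assume ne: "I \<noteq> pivots"
    \<comment> \<open>In the Schubert variety at least \<open>j\<close> pivots lie up to
      \<open>j * q\<close>. If fewer than \<open>j\<close> lay strictly before it for every
      \<open>j\<close>, each \<open>j * q\<close> would have to be a pivot itself.\<close>
    have "\<exists>j\<in>{1..k}. j \<le> card (I \<inter> {..<j * q})"
    proof (rule ccontr)
      assume neg: "\<not> ?thesis"
      have "Suc j * q \<in> I" if "j < k" for j
      proof (rule ccontr)
        assume "Suc j * q \<notin> I"
        then have "I \<inter> {..Suc j * q} = I \<inter> {..<Suc j * q}" by (auto simp: le_less simp del: mult_Suc)
        moreover have "Suc j \<in> {1..k}" using that by simp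
        ultimately show False using low[of "Suc j"] neg by (metis)
      qed
      then have "pivots \<subseteq> I" unfolding pivots_def by blast
      then have "pivots = I" using card_subset_eq[OF fin(1)] fin(2) pivots_S unfolding ksubsets_def by blast
      then show False using ne by simp
    qed
    then obtain j where j: "j \<in> {1..k}" "j \<le> card (I \<inter> {..<j * q})" by blast
    have jn: "j * q < n" using j(1) pivot_less[of "j - 1"] by auto
    have C: "{..<j * q} = {i. i < n \<and> i div q \<in> {..<j}}"
      using jn q by (auto simp: div_less_iff_less_mult)
    have "n * j \<le> n * card (I \<inter> {..<j * q})" using j(2) by (intro mult_le_mono2)
    \<comment> \<open>The left side is k j q, and n j = k j q + j because n = k q + 1.\<close>
    moreover have "k * card {..<j * q} < n * j" using j(1) by (simp add: n algebra_simps)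
    ultimately have gt: "k * card {..<j * q} < n * card (I \<inter> {..<j * q})" by linarith
    have "s (plucker k n N) = 0"
    proof (rule invariant_section_vanishes[where N = N and s = s and Bk = "{..<j}" and I = I and C = "{..<j * q}" and m = m])
      show "pt_class (plucker k n N) \<in> X" using ms(1) unfolding xN .
      show "p \<in> {..<j * q}" if "l < k" "p < n" "pick I l \<in> {..<j * q}" "N p l \<noteq> 0" for p l
        using supp[OF that(1,2,4)] that(3) by simp
    qed ((fact *(1) C gt ms(2) ms(3)) | (rule id, assumption+) | (rule ms(4), assumption+))+
    then show False using nonvanish by simp
  qed
  define z where "z j p = (if j \<in> {1..k} \<and> p \<in> free_cols q j then N p (j - 1) else 0)" for j p
  have z: "z \<in> cell_pts q k" unfolding cell_pts_def z_def by auto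
  have id': "N (Suc i * q) j = (if i = j then 1 else 0)" if "i < k" "j < k" for i j
    using id[OF that] that pick_pivots unfolding I_eq by simp
  have N_eq: "N i j = echelon_matrix q z i j" if i: "i < n" and j: "j < k" for i j
  proof -
    consider "i = Suc j * q" | "Suc j * q < i" | "i < Suc j * q" "i \<in> free_cols q (Suc j)" | "i < Suc j * q" "i \<notin> free_cols q (Suc j)"
      by linarith
    then show ?thesis
    proof cases
      case 1
      then show ?thesis using id'[OF j j] by (simp add: echelon_matrix_def)
    next
      case 2
      then have "N i j = 0" using supp[OF j i] pick_pivots[OF j] unfolding I_eq by force
      then show ?thesis using echelon_matrix_above[OF z 2] by simp
    next
      case 3
      then show ?thesis using j by (simp add: echelon_matrix_def z_def)
    next
      \<comment> \<open>A column left of the pivot that is not free is an earlier pivot, where both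
        matrices are 0.\<close>
      case 4
      then have "q dvd i" "i \<noteq> 0" unfolding free_cols_def by auto
      then obtain l where l: "i = l * q" "l \<noteq> 0" by (metis dvdE mult.commute mult_0_right)
      then obtain l' where l': "i = Suc l' * q" by (metis not0_implies_Suc)
      have "l' < j" using 4(1) q unfolding l' by simp
      then show ?thesis using id'[of l' j] echelon_matrix_pivot[OF z, of l' j] j unfolding l' by simp
    qed
  qed
  then have pl: "plucker k n N = plucker k n (echelon_matrix q z)" by (intro plucker_cong)
  have "\<exists>p. z j p \<noteq> 0" if j: "j \<in> {1..k}" for j
  proof (rule ccontr)
    assume zero: "\<nexists>p. z j p \<noteq> 0"
    let ?C = "{i. i < n \<and> i div q \<in> {j}}"
    have "?C \<subseteq> {j * q..<j * q + q}"
    proof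
      fix i assume "i \<in> ?C"
      then have "i = j * q + i mod q" using div_mult_mod_eq[of i q] by simp
      moreover have "i mod q < q" using q by simp
      ultimately show "i \<in> {j * q..<j * q + q}" unfolding atLeastLessThan_iff by linarith
    qed
    then have "card ?C \<le> q" using card_mono[of "{j * q..<j * q + q}" ?C] by simp
    then have "k * card ?C \<le> k * q" by (intro mult_le_mono2)
    \<comment> \<open>Block \<open>j\<close> has at most \<open>q\<close> coordinates and contains
      one pivot, so the inequality reduces to k q < n.\<close>
    then have less: "k * card ?C < n" unfolding n(1) by linarith
    have jn: "j * q < n" using j pivot_less[of "j - 1"] by auto
    have "I \<inter> ?C = {j * q}"
    proof (intro subset_antisym subsetI)
      fix i assume "i \<in> I \<inter> ?C"
      then show "i \<in> {j * q}" unfolding I_eq pivots_def using q by auto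
    next
      fix i assume "i \<in> {j * q}"
      moreover have "Suc (j - 1) = j" using j by simp
      then have "j * q \<in> pivots" unfolding pivots_def using j by (intro image_eqI[of _ _ "j - 1"]) auto
      ultimately show "i \<in> I \<inter> ?C" using jn q unfolding I_eq by auto
    qed
    then have "card (I \<inter> ?C) = 1" by simp
    then have gt: "k * card ?C < n * card (I \<inter> ?C)" using less by simp
    have "s (plucker k n (echelon_matrix q z)) = 0"
    proof (rule invariant_section_vanishes[where N = "echelon_matrix q z" and s = s and Bk = "{j}" and I = I and C = ?C and m = m])
      show "echelon_matrix q z (pick I i) l = (if i = l then 1 else 0)" if "i < k" "l < k" for i l
        using echelon_matrix_pivot[OF z, of i l] that unfolding I_eq by (simp add: pick_pivots)
      show "pt_class (plucker k n (echelon_matrix q z)) \<in> X" using ms(1) unfolding xN pl .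
      show "p \<in> ?C" if "l < k" "p < n" "pick I l \<in> ?C" "echelon_matrix q z p l \<noteq> 0" for p l
      proof -
        have "Suc l = j" using that(1,3) q unfolding I_eq by (auto simp: pick_pivots simp del: mult_Suc)
        then have "p = j * q" using that(4) zero by (auto simp: echelon_matrix_def split: if_splits)
        then show ?thesis using that(2) q by auto
      qed
    qed ((fact *(1) refl gt ms(2) ms(3)) | (rule ms(4), assumption+))+
    then show False using nonvanish pl by simp
  qed
  then have "z \<in> echelon_pts q k" unfolding echelon_pts_iff using z by blast
  then show thesis using that unfolding grass_pt_def xN pl by blast
qed

end

section \<open>Semistable points\<close>

text \<open>The nonzero vertices of the descending chain a, f a div q, ... that leads from block
  \<open>a\<close> to block 0. The guard ensures termination for arbitrary \<open>f\<close> and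
  always holds at positive vertices up to \<open>k\<close> when \<open>f\<close> is a chart.\<close>

fun path :: "nat \<Rightarrow> (nat \<Rightarrow> nat) \<Rightarrow> nat \<Rightarrow> nat set" where
  "path q f a = (if 0 < a \<and> f a div q < a then insert a (path q f (f a div q)) else {})"

declare path.simps [simp del]

context tower_params
begin

lemma path_0 [simp]: "path q f 0 = {}"
  by (simp add: path.simps)

context
  fixes f assumes f: "is_chart q k f"
begin

lemma next_less: "j \<in> {1..k} \<Longrightarrow> f j div q < j"
  using f free_cols_div unfolding is_chart_def by blast

lemma path_rec: "a \<in> {1..k} \<Longrightarrow> path q f a = insert a (path q f (f a div q))"
  using next_less[of a] by (subst path.simps) auto

lemma path_subset: "a \<le> k \<Longrightarrow> path q f a \<subseteq> {1..a}"
proof (induction a rule: less_induct)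
  case (less a)
  show ?case
  proof (cases "a = 0")
    case False
    then have a: "a \<in> {1..k}" using less.prems by auto
    have "path q f (f a div q) \<subseteq> {1..f a div q}" using less.IH next_less[OF a] less.prems by simp
    then show ?thesis using path_rec[OF a] next_less[OF a] a by auto
  qed simp
qed

text \<open>The chain is descending. Here it is the triangularity that decides the minor of the
  exchanged rows.\<close>

lemma path_chain: "a \<le> k \<Longrightarrow> j \<in> path q f a \<Longrightarrow> l \<in> path q f a \<Longrightarrow> l < j \<Longrightarrow> l \<le> f j div q"
proof (induction a rule: less_induct)
  case (less a)
  have "a \<noteq> 0" using less.prems by (intro notI) simp
  then have a: "a \<in> {1..k}" using less.prems by auto
  have sub: "path q f (f a div q) \<subseteq> {1..f a div q}" using path_subset next_less[OF a] less.prems by simp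
  show ?case
  proof (cases "j = a")
    case True
    then have "l \<in> path q f (f a div q)" using less.prems path_rec[OF a] by auto
    then show ?thesis using sub True by auto
  next
    case False
    then have j: "j \<in> path q f (f a div q)" using less.prems path_rec[OF a] by auto
    then have "l \<noteq> a" using sub less.prems next_less[OF a] by auto
    then have "l \<in> path q f (f a div q)" using less.prems path_rec[OF a] by auto
    then show ?thesis using less.IH[of "f a div q"] j next_less[OF a] less.prems by simp
  qed
qed

lemma path_closed: "a \<le> k \<Longrightarrow> j \<in> path q f a \<Longrightarrow> f j div q \<noteq> 0 \<Longrightarrow> f j div q \<in> path q f a"
proof (induction a rule: less_induct)
  case (less a)
  have "a \<noteq> 0" using less.prems by (intro notI) simp
  then have a: "a \<in> {1..k}" using less.prems by auto
  show ?case
  proof (cases "j = a")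
    case True
    then have "f j div q \<in> {1..k}" using less.prems next_less[OF a] a by auto
    then show ?thesis using path_rec[OF a] path_rec[of "f j div q"] True by auto
  next
    case False
    then have "j \<in> path q f (f a div q)" using less.prems path_rec[OF a] by auto
    then show ?thesis using less.IH[of "f a div q"] next_less[OF a] less.prems path_rec[OF a] by auto
  qed
qed

text \<open>Basis vectors on the path from \<open>a\<close> give up their pivot for their selected
  entry. In terms of blocks, every vertex of the path is replaced by its successor, so block
  \<open>a\<close> is vacated, block 0 is gained and all other blocks remain occupied once.\<close>

definition exchange :: "nat \<Rightarrow> nat \<Rightarrow> nat" where
  "exchange a i = (if Suc i \<in> path q f a then f (Suc i) else Suc i * q)"

lemma exchange_div: "exchange a i div q = (if Suc i \<in> path q f a then f (Suc i) div q else Suc i)"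
  using q unfolding exchange_def by (simp del: mult_Suc)

lemma exchange_div_inj:
  assumes "a \<le> k"
  shows "inj_on (\<lambda>i. exchange a i div q) {..<k}"
proof -
  have ne: "exchange a i div q \<noteq> exchange a j div q" if "i < j" "j < k" for i j
  proof
    assume eq: "exchange a i div q = exchange a j div q"
    have less: "f (Suc i) div q < Suc i" "f (Suc j) div q < Suc j" using next_less that by auto
    show False
    proof (cases "Suc j \<in> path q f a")
      case j: True
      show False
      proof (cases "Suc i \<in> path q f a")
        case True
        then show False using path_chain[OF assms j True] that eq j less by (simp add: exchange_div)
      next
        case False
        then have "f (Suc j) div q = Suc i" using eq j by (simp add: exchange_div)
        then show False using path_closed[OF assms j] False by simp
      qed
    next
      case False
      then show False using eq less that by (auto simp: exchange_div split: if_splits)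
    qed
  qed
  show ?thesis
  proof (rule inj_onI)
    fix i j assume "i \<in> {..<k}" "j \<in> {..<k}" "exchange a i div q = exchange a j div q"
    then show "i = j" using ne[of i j] ne[of j i] by (metis lessThan_iff nat_neq_iff)
  qed
qed

text \<open>Block \<open>a\<close> cannot be hit, because its own basis vector has moved on and
  successors on the path lie below \<open>a\<close>. Injectivity then leaves no other block
  unoccupied.\<close>

lemma exchange_div_image:
  assumes "a \<le> k"
  shows "(\<lambda>i. exchange a i div q) ` {..<k} = {0..k} - {a}"
proof (rule card_subset_eq)
  show "(\<lambda>i. exchange a i div q) ` {..<k} \<subseteq> {0..k} - {a}"
  proof
    fix b assume "b \<in> (\<lambda>i. exchange a i div q) ` {..<k}"
    then obtain i where i: "i < k" "b = exchange a i div q" by blast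
    have less: "f (Suc i) div q < Suc i" using next_less i by simp
    show "b \<in> {0..k} - {a}"
    proof (cases "Suc i \<in> path q f a")
      case True
      then have "Suc i \<le> a" using path_subset[OF assms] by auto
      then show ?thesis using True i less by (auto simp: exchange_div)
    next
      case False
      have "Suc i \<noteq> a" using False path_rec[of a] assms by auto
      then show ?thesis using False i by (auto simp: exchange_div)
    qed
  qed
  show "card ((\<lambda>i. exchange a i div q) ` {..<k}) = card ({0..k} - {a})"
    using card_image[OF exchange_div_inj[OF assms]] assms by simp
qed auto

lemma exchange_inj: "a \<le> k \<Longrightarrow> inj_on (exchange a) {..<k}"
  using exchange_div_inj[of a] unfolding inj_on_def by auto

lemma exchange_less: "i < k \<Longrightarrow> exchange a i < n"
proof -
  assume i: "i < k"
  then have "f (Suc i) \<in> free_cols q (Suc i)" using f unfolding is_chart_def by auto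
  then have "f (Suc i) < Suc i * q" unfolding free_cols_def by blast
  then show ?thesis using pivot_less[OF i] unfolding exchange_def by (auto simp del: mult_Suc)
qed

definition exchange_set :: "nat \<Rightarrow> nat set" where
  "exchange_set a = exchange a ` {..<k}"

lemma exchange_set_S: "a \<le> k \<Longrightarrow> exchange_set a \<in> S"
  unfolding exchange_set_def by (rule ksubsets_image[OF exchange_inj exchange_less])

lemma exchange_set_prod:
  assumes "a \<le> k"
  shows "(\<Prod>i\<in>exchange_set a. \<alpha> (i div q)) = (\<Prod>b\<in>{0..k} - {a}. \<alpha> b)"
proof -
  have "(\<Prod>i\<in>exchange_set a. \<alpha> (i div q)) = (\<Prod>i<k. \<alpha> (exchange a i div q))"
    unfolding exchange_set_def by (simp add: prod.reindex[OF exchange_inj[OF assms]])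
  also have "\<dots> = (\<Prod>b\<in>(\<lambda>i. exchange a i div q) ` {..<k}. \<alpha> b)"
    by (simp add: prod.reindex[OF exchange_div_inj[OF assms]])
  finally show ?thesis unfolding exchange_div_image[OF assms] .
qed

text \<open>The linear system is triangular. Vectors off the path keep their pivot row, which forces
  their unknown to be 0. For a vector on the path, the selected column lies at or beyond the pivots
  of all lower vertices of the path, so their entries there vanish.\<close>

lemma exchange_minor:
  assumes z: "z \<in> chart_dom q k f" and a: "a \<le> k"
  shows "minor k (echelon_matrix q z) (exchange a) \<noteq> 0"
proof (rule minor_nonzeroI)
  have zc: "z \<in> cell_pts q k" using z unfolding chart_dom_def echelon_pts_iff by blast
  fix x :: "nat \<Rightarrow> complex" and i
  assume eqs: "\<And>i. i < k \<Longrightarrow> (\<Sum>j<k. echelon_matrix q z (exchange a i) j * x j) = 0" and i: "i < k"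
  have off: "x i = 0" if "i < k" "Suc i \<notin> path q f a" for i
  proof -
    have "(\<Sum>j<k. echelon_matrix q z (exchange a i) j * x j) = (\<Sum>j<k. if j = i then x j else 0)"
      using that by (intro sum.cong) (auto simp: exchange_def echelon_matrix_pivot[OF zc] simp del: mult_Suc)
    then show ?thesis using eqs[OF that(1)] that(1) by simp
  qed
  \<comment> \<open>The induction descends from the largest index, as the equation of a vertex still
    involves the unknowns of larger indices.\<close>
  show "x i = 0" using i
  proof (induction "k - i" arbitrary: i rule: less_induct)
    case less
    show ?case
    proof (cases "Suc i \<in> path q f a")
      case True
      have fi: "f (Suc i) \<in> free_cols q (Suc i)" using f less.prems unfolding is_chart_def by auto
      have entry: "echelon_matrix q z (f (Suc i)) l = z (Suc l) (f (Suc i))" for l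
        using pivot_not_free[of l "Suc i"] fi unfolding echelon_matrix_def by auto
      have "echelon_matrix q z (exchange a i) l * x l = (if l = i then z (Suc i) (f (Suc i)) * x i else 0)" if l: "l < k" for l
      proof -
        consider "l = i" | "i < l" | "l < i" "Suc l \<notin> path q f a" | "l < i" "Suc l \<in> path q f a" by linarith
        then show ?thesis
        proof cases
          case 1
          then show ?thesis using True entry by (simp add: exchange_def)
        next
          case 2
          then have "x l = 0" using less.hyps[of l] l by simp
          then show ?thesis using 2 by simp
        next
          case 3
          then show ?thesis using off[OF l] by simp
        next
          case 4
          then have "Suc l \<le> f (Suc i) div q" using path_chain[OF a True] by simp
          then have "f (Suc i) \<notin> free_cols q (Suc l)" using free_cols_div by fastforce
          then have "z (Suc l) (f (Suc i)) = 0" using zc unfolding cell_pts_def by blast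
          then show ?thesis using True entry 4 by (simp add: exchange_def)
        qed
      qed
      then have "(\<Sum>l<k. echelon_matrix q z (exchange a i) l * x l) = (\<Sum>l<k. if l = i then z (Suc i) (f (Suc i)) * x i else 0)"
        by (intro sum.cong) auto
      then have "z (Suc i) (f (Suc i)) * x i = 0" using eqs[OF less.prems] less.prems by simp
      moreover have "z (Suc i) (f (Suc i)) \<noteq> 0" using z less.prems unfolding chart_dom_def by auto
      ultimately show ?thesis by simp
    qed (rule off[OF less.prems])
  qed
qed

lemma exchange_plucker:
  assumes z: "z \<in> chart_dom q k f" and a: "a \<le> k"
  shows "plucker k n (echelon_matrix q z) (exchange_set a) \<noteq> 0"
proof -
  obtain s :: complex where "s \<in> {1, -1}" "\<And>M. minor k M (exchange a) = s * plucker k n M (exchange a ` {..<k})"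
    using plucker_image[OF exchange_inj[OF a] exchange_less] by blast
  then show ?thesis using exchange_minor[OF assms] unfolding exchange_set_def by auto
qed

end

text \<open>The set \<open>exchange_set a\<close> meets every block but the \<open>a\<close>-th in one element, so the monomial below
  has equally many factors in each coordinate direction of the torus.\<close>

lemma chart_section:
  assumes f: "is_chart q k f"
  defines "s \<equiv> \<lambda>v :: nat set \<Rightarrow> complex. (\<Prod>a<k. v (exchange_set f a)) * v (exchange_set f k) ^ (n - k)"
  shows "s \<in> sections S X (n * 1)" "h \<in> H \<Longrightarrow> s (h v) = s v"
proof -
  have "s \<in> hom_polys S ((\<Sum>a<k. 1) + (n - k) * 1)" unfolding s_def
    by (intro hom_polys_mult hom_polys_prod hom_polys_power hom_polys_coord exchange_set_S[OF f]) auto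
  then have "s \<in> hom_polys S (n * 1 + 0)" using n(3) by simp
  then show "s \<in> sections S X (n * 1)" unfolding sections_def
    by (intro CollectI ballI exI[of _ 0] bexI[of _ s] bexI[of _ "\<lambda>_. 1"]) (auto simp: hom_polys_const)
  assume "h \<in> H"
  then obtain \<alpha> where \<alpha>: "h = diag_act k n (\<lambda>i. \<alpha> (i div q))" "\<And>b. \<alpha> b \<noteq> 0" "(\<Prod>i<n. \<alpha> (i div q)) = 1"
    unfolding H_eq block_torus_def by blast
  \<comment> \<open>The scalar of block \<open>k\<close> is kept apart from \<open>Q\<close>, as
    that block has one coordinate and the others have \<open>q\<close>. The determinant is therefore
    \<open>Q ^ q * \<alpha> k\<close>.\<close>
  define Q where "Q = (\<Prod>b<k. \<alpha> b)"
  define c where "c a = (\<Prod>b\<in>{0..k} - {a}. \<alpha> b)" for a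
  have Q: "Q \<noteq> 0" unfolding Q_def using \<alpha>(2) by simp
  have total: "(\<Prod>b\<in>{0..k}. \<alpha> b) = Q * \<alpha> k" unfolding Q_def by (simp add: atLeast0AtMost lessThan_Suc_atMost[symmetric])
  have c: "c a * \<alpha> a = Q * \<alpha> k" if "a \<le> k" for a
    unfolding total[symmetric] c_def using that by (subst (2) prod.remove[of _ a]) auto
  have ck: "c k = Q" using c[of k] \<alpha>(2) by simp
  have "(\<Prod>a<k. c a) * Q = (\<Prod>a<k. c a * \<alpha> a)" unfolding Q_def by (simp add: prod.distrib)
  also have "\<dots> = (Q * \<alpha> k) ^ k" using c by simp
  finally have prod_c: "(\<Prod>a<k. c a) * Q = (Q * \<alpha> k) ^ k" .
  have "1 = (\<Prod>i<k * q. \<alpha> (i div q)) * \<alpha> k"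
    using \<alpha>(3) q unfolding n(1) by simp
  also have "\<dots> = Q ^ q * \<alpha> k" unfolding prod_blocks Q_def by (simp add: prod_power_distrib)
  finally have one: "Q ^ q * \<alpha> k = 1" by simp
  have nk: "n - k = Suc (k * (q - 1))"
  proof -
    have "k \<le> k * q" using q by simp
    then show ?thesis by (simp add: n(1) diff_mult_distrib2 Suc_diff_le)
  qed
  \<comment> \<open>One of the \<open>n - k\<close> factors of weight \<open>Q\<close> completes the
    product over \<open>a < k\<close> to \<open>(Q * \<alpha> k) ^ k\<close>. The remaining k (q -
    1) factors raise \<open>Q\<close> to the exponent k q, giving the \<open>k\<close>-th power of
    the determinant; this explains the exponent of the last coordinate.\<close>
  have "(\<Prod>a<k. c a) * Q ^ (n - k) = (Q * \<alpha> k) ^ k * Q ^ (k * (q - 1))"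
    unfolding nk power_Suc mult.assoc[symmetric] prod_c ..
  also have "\<dots> = (Q ^ q * \<alpha> k) ^ k"
  proof -
    have "Q ^ q = Q * Q ^ (q - 1)" using q by (metis One_nat_def Suc_le_D diff_Suc_1 power_Suc)
    then show ?thesis by (simp add: power_mult_distrib mult.commute[of k] power_mult)
  qed
  finally have inv: "(\<Prod>a<k. c a) * c k ^ (n - k) = 1" unfolding one ck by simp
  have "h v (exchange_set f a) = c a * v (exchange_set f a)" if "a \<le> k" for a
    unfolding \<alpha>(1) diag_act_def c_def using exchange_set_S[OF f that] exchange_set_prod[OF f that, of \<alpha>] by simp
  then have "s (h v) = ((\<Prod>a<k. c a) * c k ^ (n - k)) * s v"
    unfolding s_def by (simp add: prod.distrib power_mult_distrib)
  then show "s (h v) = s v" unfolding inv by simp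
qed

lemma echelon_matrix_cell:
  assumes z: "z \<in> cell_pts q k"
  shows "grass_pt z \<in> cell q k"
proof -
  \<comment> \<open>A unitriangular matrix with the echelon columns at the positive multiples of
    \<open>q\<close> and unit vectors elsewhere. Column \<open>c\<close> holds echelon column
    \<open>c div q - 1\<close>, since pivots start at \<open>q\<close>.\<close>
  define B where "B = mat n n (\<lambda>(i, c). if c \<noteq> 0 \<and> q dvd c then echelon_matrix q z i (c div q - 1) else if i = c then 1 else 0)"
  have entry: "B $$ (i, Suc j * q) = echelon_matrix q z i j" if "i < n" "j < k" for i j
    unfolding B_def using that pivot_less[of j] q by (simp del: mult_Suc)
  have zero: "B $$ (i, c) = 0" if "c < i" "i < n" for i c
  proof (cases "c \<noteq> 0 \<and> q dvd c")
    case True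
    then obtain l where l: "c = Suc l * q" by (metis dvdE mult.commute mult_0_right not0_implies_Suc)
    have "Suc l * q \<le> k * q" using that unfolding l n(1) by linarith
    then have "l < k" using q by (simp del: mult_Suc add: Suc_le_eq)
    then show ?thesis using that entry[of i l] echelon_matrix_above[OF z] unfolding l by simp
  qed (use that in \<open>auto simp: B_def\<close>)
  have diag: "B $$ (i, i) = 1" if "i < n" for i
  proof (cases "i \<noteq> 0 \<and> q dvd i")
    case True
    then obtain l where "i = Suc l * q" by (metis dvdE mult.commute mult_0_right not0_implies_Suc)
    then show ?thesis using that q by (simp add: B_def echelon_matrix_def del: mult_Suc)
  qed (use that in \<open>auto simp: B_def\<close>)
  have ut: "upper_triangular B" using zero unfolding upper_triangular_def by (simp add: B_def)
  have Bc: "B \<in> carrier_mat n n" by (simp add: B_def)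
  have "det B = (\<Prod>i = 0..<n. B $$ (i, i))"
    using det_upper_triangular[OF ut Bc] Bc by (simp add: prod_list_diag_prod)
  then have "B \<in> carrier (SL n)" using Bc diag by (simp add: mem_SL)
  moreover have "plucker k n (\<lambda>i j. B $$ (i, Suc j * q)) = plucker k n (echelon_matrix q z)"
    by (rule plucker_cong) (rule entry)
  ultimately show ?thesis unfolding cell_def grass_pt_def using ut by (intro CollectI exI[of _ B]) simp
qed

lemma semistable_eq: "semistable S X H n = grass_pt ` echelon_pts q k"
proof (intro subset_antisym subsetI)
  fix x assume "x \<in> semistable S X H n"
  then show "x \<in> grass_pt ` echelon_pts q k" using semistable_grass_pt by blast
next
  fix x assume "x \<in> grass_pt ` echelon_pts q k"
  then obtain z where z: "z \<in> echelon_pts q k" "x = grass_pt z" by blast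
  obtain f where f: "is_chart q k f" "z \<in> chart_dom q k f" using chart_exists[OF z(1)] .
  define s where "s = (\<lambda>v :: nat set \<Rightarrow> complex. (\<Prod>a<k. v (exchange_set f a)) * v (exchange_set f k) ^ (n - k))"
  have s: "s \<in> sections S X (n * 1)" "\<And>h v. h \<in> H \<Longrightarrow> s (h v) = s v"
    using chart_section[OF f(1)] unfolding s_def by blast+
  have "s v \<noteq> 0" if v: "v \<in> x" for v
  proof -
    obtain c where "c \<noteq> 0" "v = (\<lambda>I. c * plucker k n (echelon_matrix q z) I)"
      using v unfolding z(2) grass_pt_def mem_pt_class by blast
    then show ?thesis unfolding s_def using exchange_plucker[OF f] by simp
  qed
  moreover have "x \<in> X" using echelon_matrix_cell[of z] z cell_subset_schubert unfolding echelon_pts_iff by blast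
  ultimately show "x \<in> semistable S X H n" unfolding semistable_def using s by blast
qed

section \<open>The quotient\<close>

lemma grass_pt_coord:
  assumes "z \<in> cell_pts q k" "v \<in> grass_pt z"
  shows "v pivots \<noteq> 0" "v = (\<lambda>I. v pivots * plucker k n (echelon_matrix q z) I)"
proof -
  obtain c where c: "c \<noteq> 0" "v = (\<lambda>I. c * plucker k n (echelon_matrix q z) I)"
    using assms(2) unfolding grass_pt_def mem_pt_class by blast
  have vp: "v pivots = c" unfolding c(2) plucker_echelon_pivots[OF assms(1)] by simp
  show "v pivots \<noteq> 0" unfolding vp by (rule c(1))
  show "v = (\<lambda>I. v pivots * plucker k n (echelon_matrix q z) I)" unfolding vp by (rule c(2))
qed

text \<open>Exchanging the pivot of row \<open>j\<close> for column \<open>p\<close> gives a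
  Pluecker coordinate equal to the entry up to a fixed sign, in the representative whose coordinate
  at \<open>pivots\<close> is 1.\<close>

lemma entry_form:
  obtains F where "F \<in> hom_polys S 1" "\<And>z. z \<in> cell_pts q k \<Longrightarrow> F (plucker k n (echelon_matrix q z)) = z j p"
proof (cases "j \<in> {1..k} \<and> p \<in> free_cols q j")
  case True
  define i where "i = j - 1"
  have i: "j = Suc i" "i < k" using True unfolding i_def by auto
  let ?t = "(\<lambda>l. Suc l * q)(i := p)"
  have pl: "p \<noteq> Suc l * q" for l using True pivot_not_free by blast
  have inj: "inj_on ?t {..<k}"
    by (rule inj_onI) (use pl pl[symmetric] q in \<open>auto simp del: mult_Suc split: if_splits\<close>)
  have "p < Suc i * q" using True unfolding i free_cols_def by blast
  then have less: "?t l < n" if "l < k" for l using pivot_less[OF that] pivot_less[OF i(2)] by (simp del: mult_Suc)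
  obtain s :: complex where s: "s \<in> {1, -1}" "\<And>M. minor k M ?t = s * plucker k n M (?t ` {..<k})"
    using plucker_image[OF inj less] by blast
  show thesis
  proof (rule that)
    show "(\<lambda>v. s * v (?t ` {..<k})) \<in> hom_polys S 1"
      using hom_polys_mult[OF hom_polys_const hom_polys_coord[OF finite_ksubsets ksubsets_image[OF inj less]]] by simp
    fix z assume z: "z \<in> cell_pts q k"
    have "s * plucker k n (echelon_matrix q z) (?t ` {..<k}) = echelon_matrix q z p i"
      unfolding s(2)[symmetric] by (rule minor_exchange[where \<tau> = "\<lambda>l. Suc l * q" and M = "echelon_matrix q z", OF echelon_matrix_pivot[OF z] i(2)])
    also have "\<dots> = z j p" using pl[of i] by (simp add: echelon_matrix_def i)
    finally show "s * plucker k n (echelon_matrix q z) (?t ` {..<k}) = z j p" .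
  qed
next
  case False
  then show thesis using that[of "\<lambda>_. 0"] hom_polys_zero unfolding cell_pts_def by fastforce
qed

lemma grass_pt_inj: "inj_on grass_pt (cell_pts q k)"
proof (rule inj_onI)
  fix z z' assume z: "z \<in> cell_pts q k" "z' \<in> cell_pts q k" "grass_pt z = grass_pt z'"
  have "plucker k n (echelon_matrix q z) \<in> grass_pt z'" using pt_class_self z(3) unfolding grass_pt_def by metis
  from grass_pt_coord(2)[OF z(2) this]
  have eq: "plucker k n (echelon_matrix q z) = plucker k n (echelon_matrix q z')"
    unfolding plucker_echelon_pivots[OF z(1)] by simp
  show "z = z'"
  proof (intro ext)
    fix j p
    obtain F where "\<And>z. z \<in> cell_pts q k \<Longrightarrow> F (plucker k n (echelon_matrix q z)) = z j p" using entry_form by metis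
    then show "z j p = z' j p" using z eq by metis
  qed
qed

lemma hom_polys_pivot_power: "(\<lambda>v. v pivots ^ d) \<in> hom_polys S d"
  using hom_polys_power[OF hom_polys_coord[OF finite_ksubsets pivots_S], of d] by simp

text \<open>Powers of the coordinate at \<open>pivots\<close>, which is 1 on echelon matrices,
  equalise the degrees of summands: the usual homogenisation on an affine chart.\<close>

lemma funalg_homogenize:
  assumes "h \<in> funalg entries"
  shows "\<exists>d. \<exists>F\<in>hom_polys S d. \<forall>z\<in>cell_pts q k. F (plucker k n (echelon_matrix q z)) = h z"
  using assms
proof induction
  case (gen h)
  then obtain j p where "h = (\<lambda>z. z j p)" unfolding entries_def by blast
  then show ?case using entry_form[of j p] by metis
next
  case (const c)
  show ?case by (intro exI[of _ 0] bexI[of _ "\<lambda>_. c"]) (auto simp: hom_polys_const)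
next
  case (add g h)
  then obtain d e F G where *: "F \<in> hom_polys S d" "G \<in> hom_polys S e"
    "\<forall>z\<in>cell_pts q k. F (plucker k n (echelon_matrix q z)) = g z"
    "\<forall>z\<in>cell_pts q k. G (plucker k n (echelon_matrix q z)) = h z" by blast
  have "(\<lambda>v. F v * v pivots ^ e + v pivots ^ d * G v) \<in> hom_polys S (d + e)"
    by (intro hom_polys_add hom_polys_mult * hom_polys_pivot_power)
  then show ?case using * plucker_echelon_pivots
    by (intro exI[of _ "d + e"] bexI[of _ "\<lambda>v. F v * v pivots ^ e + v pivots ^ d * G v"]) auto
next
  case (mult g h)
  then obtain d e F G where *: "F \<in> hom_polys S d" "G \<in> hom_polys S e"
    "\<forall>z\<in>cell_pts q k. F (plucker k n (echelon_matrix q z)) = g z"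
    "\<forall>z\<in>cell_pts q k. G (plucker k n (echelon_matrix q z)) = h z" by blast
  then show ?case using hom_polys_mult[OF *(1,2)]
    by (intro exI[of _ "d + e"] bexI[of _ "\<lambda>v. F v * G v"]) auto
qed

lemma hom_polys_funalg:
  assumes "F \<in> hom_polys S d"
  shows "(\<lambda>z. F (plucker k n (echelon_matrix q z))) \<in> funalg entries"
proof -
  obtain M c where 1: "F = (\<lambda>v. \<Sum>\<alpha>\<in>M. c \<alpha> * (\<Prod>b\<in>S. v b ^ \<alpha> b))"
    using assms unfolding hom_polys_def by blast
  have entry: "(\<lambda>z. echelon_matrix q z i j) \<in> funalg entries" for i j
    unfolding echelon_matrix_def by (cases "i = Suc j * q") (auto simp: entries_def intro: funalg.intros)
  have "(\<lambda>z. plucker k n (echelon_matrix q z) I) \<in> funalg entries" for I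
  proof (cases "I \<in> S")
    case True
    then show ?thesis unfolding plucker_def minor_def'
      by simp (intro funalg_sum funalg.mult funalg.const funalg_prod entry)
  qed (auto simp: plucker_def intro: funalg.const)
  then show ?thesis unfolding 1 by (intro funalg_sum funalg.mult funalg.const funalg_prod funalg_power)
qed

lemma grass_pt_proj: "z \<in> cell_pts q k \<Longrightarrow> grass_pt z \<in> proj_pts S"
  unfolding grass_pt_def
  by (rule grassmannian_nonzero(2)[of _ pivots]) (simp add: plucker_echelon_pivots)

lemma grass_pt_nonzero_iff:
  assumes "F \<in> hom_polys S d"
  shows "(\<forall>v\<in>grass_pt z. F v \<noteq> 0) \<longleftrightarrow> F (plucker k n (echelon_matrix q z)) \<noteq> 0"
  unfolding grass_pt_def by (rule hom_polys_ball_iff[OF assms])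

abbreviation "ss \<equiv> semistable_fspace S X H n"

lemma pts_ss: "pts ss = grass_pt ` echelon_pts q k"
  unfolding semistable_fspace_def semistable_eq using grass_pt_proj echelon_pts_iff by auto

lemma openin_ss: "openin (ftop ss) W \<longleftrightarrow> (\<exists>U. openin (ftop (proj_space S)) U \<and> W = U \<inter> grass_pt ` echelon_pts q k)"
  unfolding semistable_fspace_def semistable_eq sub_fspace_def by (simp add: openin_subtopology)

text \<open>As \<open>grass_pt\<close> is injective on echelon bases, this identifies them with the
  semistable locus; the form of a quotient allows composition with the next quotient map.
  Restricting forms and homogenising polynomials match the open sets and the fractions on the two
  sides.\<close>

lemma is_quotient_grass_pt: "is_quotient (echelon_space q k) ss grass_pt"
proof -
  let ?E = "echelon_pts q k"
  have E: "z \<in> cell_pts q k" if "z \<in> ?E" for z using that echelon_pts_iff by blast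
  have open_iff: "openin (ftop ss) W \<longleftrightarrow> openin (ftop (echelon_space q k)) {z \<in> ?E. grass_pt z \<in> W}"
    if W: "W \<subseteq> grass_pt ` ?E" for W
  proof
    assume "openin (ftop ss) W"
    then obtain U where U: "openin (ftop (proj_space S)) U" "W = U \<inter> grass_pt ` ?E" unfolding openin_ss by blast
    show "openin (ftop (echelon_space q k)) {z \<in> ?E. grass_pt z \<in> W}" unfolding openin_echelon_space
    proof
      fix z assume z: "z \<in> {z \<in> ?E. grass_pt z \<in> W}"
      then have zU: "grass_pt z \<in> U" using U by blast
      obtain d F where F: "F \<in> hom_polys S d" "\<forall>v\<in>grass_pt z. F v \<noteq> 0" "{x \<in> proj_pts S. \<forall>v\<in>x. F v \<noteq> 0} \<subseteq> U"
        using openin_proj_space_point[OF U(1) zU] .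
      show "\<exists>h\<in>funalg entries. z \<in> ?E \<and> h z \<noteq> 0 \<and> {x \<in> ?E. h x \<noteq> 0} \<subseteq> {z \<in> ?E. grass_pt z \<in> W}"
      proof (rule bexI[OF _ hom_polys_funalg[OF F(1)]], intro conjI subsetI)
        show "z \<in> ?E" "F (plucker k n (echelon_matrix q z)) \<noteq> 0" using z F(2) grass_pt_nonzero_iff[OF F(1)] by auto
        fix y assume y: "y \<in> {x \<in> ?E. F (plucker k n (echelon_matrix q x)) \<noteq> 0}"
        then have "grass_pt y \<in> U" using F(3) grass_pt_proj[OF E] grass_pt_nonzero_iff[OF F(1)] by blast
        then show "y \<in> {z \<in> ?E. grass_pt z \<in> W}" using y U(2) by blast
      qed
    qed
  next
    assume op: "openin (ftop (echelon_space q k)) {z \<in> ?E. grass_pt z \<in> W}"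
    show "openin (ftop ss) W"
    proof (rule openin_subopen[THEN iffD2], rule ballI)
      fix x assume "x \<in> W"
      then obtain z where z: "z \<in> ?E" "x = grass_pt z" "z \<in> {z \<in> ?E. grass_pt z \<in> W}" using W by blast
      obtain h where h: "h \<in> funalg entries" "h z \<noteq> 0" "{x \<in> ?E. h x \<noteq> 0} \<subseteq> {z \<in> ?E. grass_pt z \<in> W}"
        using op[unfolded openin_echelon_space] z(3) by blast
      obtain d F where F: "F \<in> hom_polys S d" "\<forall>z\<in>cell_pts q k. F (plucker k n (echelon_matrix q z)) = h z"
        using funalg_homogenize[OF h(1)] by blast
      let ?V = "{x \<in> proj_pts S. \<forall>v\<in>x. F v \<noteq> 0} \<inter> grass_pt ` ?E"
      have "openin (ftop ss) ?V" unfolding openin_ss using openin_proj_basic[OF F(1)] by blast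
      moreover have "x \<in> ?V" using z(1,2) grass_pt_proj[OF E[OF z(1)]] grass_pt_nonzero_iff[OF F(1), of z] F(2) E[OF z(1)] h(2)
        by simp
      moreover have "?V \<subseteq> W"
      proof
        fix y assume "y \<in> ?V"
        then obtain z' where z': "z' \<in> ?E" "y = grass_pt z'" "\<forall>v\<in>y. F v \<noteq> 0" by blast
        then have "h z' \<noteq> 0" using grass_pt_nonzero_iff[OF F(1), of z'] F(2) E[OF z'(1)] by simp
        then show "y \<in> W" using h(3) z' by blast
      qed
      ultimately show "\<exists>T. openin (ftop ss) T \<and> x \<in> T \<and> T \<subseteq> W" by blast
    qed
  qed
  have reg_iff: "f \<in> regf ss W \<longleftrightarrow> f \<circ> grass_pt \<in> regf (echelon_space q k) {z \<in> ?E. grass_pt z \<in> W}"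
    if W: "openin (ftop ss) W" for W f
  proof
    have W': "W \<subseteq> grass_pt ` ?E" using W unfolding openin_ss by blast
    assume f: "f \<in> regf ss W"
    show "f \<circ> grass_pt \<in> regf (echelon_space q k) {z \<in> ?E. grass_pt z \<in> W}"
    proof (rule function_sheaf.regf_local[OF function_sheaf_echelon_space])
      show op: "openin (ftop (echelon_space q k)) {z \<in> ?E. grass_pt z \<in> W}" using open_iff[OF W'] W by blast
      fix z assume z: "z \<in> {z \<in> ?E. grass_pt z \<in> W}"
      then obtain U g where U: "openin (ftop (proj_space S)) U" "grass_pt z \<in> U" "g \<in> regf (proj_space S) U"
        "\<forall>y\<in>U \<inter> W. f y = g y"
        using f[unfolded semistable_fspace_def mem_regf_sub_fspace] by blast
      obtain d F G where FG: "F \<in> hom_polys S d" "G \<in> hom_polys S d" "\<forall>v\<in>grass_pt z. G v \<noteq> 0"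
        "\<forall>y\<in>U. \<forall>v\<in>y. G v \<noteq> 0 \<longrightarrow> g y = F v / G v"
        using bspec[OF U(3)[unfolded mem_regf_proj_space] U(2)] by (elim exE bexE conjE)
      let ?F = "\<lambda>z. F (plucker k n (echelon_matrix q z))" and ?G = "\<lambda>z. G (plucker k n (echelon_matrix q z))"
      let ?V = "{z \<in> ?E. grass_pt z \<in> U \<inter> grass_pt ` ?E} \<inter> {z \<in> ?E. ?G z \<noteq> 0}"
      interpret function_sheaf "echelon_space q k" by (rule function_sheaf_echelon_space)
      have "openin (ftop ss) (U \<inter> grass_pt ` ?E)" unfolding openin_ss using U(1) by blast
      then have 1: "openin (ftop (echelon_space q k)) {z \<in> ?E. grass_pt z \<in> U \<inter> grass_pt ` ?E}"
        using open_iff[of "U \<inter> grass_pt ` ?E"] by blast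
      have 2: "openin (ftop (echelon_space q k)) {z \<in> ?E. ?G z \<noteq> 0}"
        using open_nonzero[OF openin_topspace funalg_regf[OF openin_topspace hom_polys_funalg[OF FG(2)]]] by simp
      have V: "openin (ftop (echelon_space q k)) ?V" by (rule openin_Int[OF 1 2])
      have "(\<lambda>z. ?F z / ?G z) \<in> regf (echelon_space q k) ?V"
        by (rule regf_divide[OF V funalg_regf[OF V hom_polys_funalg[OF FG(1)]] funalg_regf[OF V hom_polys_funalg[OF FG(2)]]]) auto
      moreover have "z \<in> ?V" using z U(2) FG(3) grass_pt_nonzero_iff[OF FG(2)] by auto
      moreover have "(f \<circ> grass_pt) y = ?F y / ?G y" if y: "y \<in> ?V \<inter> {z \<in> ?E. grass_pt z \<in> W}" for y
      proof -
        have "plucker k n (echelon_matrix q y) \<in> grass_pt y" unfolding grass_pt_def by (rule pt_class_self)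
        then have "g (grass_pt y) = ?F y / ?G y" using FG(4) y by blast
        then show ?thesis using U(4) y by simp
      qed
      ultimately show "\<exists>V g. openin (ftop (echelon_space q k)) V \<and> z \<in> V \<and> g \<in> regf (echelon_space q k) V \<and>
          (\<forall>y\<in>V \<inter> {z \<in> ?E. grass_pt z \<in> W}. (f \<circ> grass_pt) y = g y)" using V by blast
    qed
  next
    assume f: "f \<circ> grass_pt \<in> regf (echelon_space q k) {z \<in> ?E. grass_pt z \<in> W}"
    have W': "W \<subseteq> grass_pt ` ?E" using W unfolding openin_ss by blast
    show "f \<in> regf ss W" unfolding semistable_fspace_def mem_regf_sub_fspace
    proof
      fix x assume "x \<in> W"
      then obtain z where z: "z \<in> ?E" "x = grass_pt z" "z \<in> {z \<in> ?E. grass_pt z \<in> W}" using W' by blast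
      obtain g h where gh: "g \<in> funalg entries" "h \<in> funalg entries" "h z \<noteq> 0"
        "\<forall>y\<in>{z \<in> ?E. grass_pt z \<in> W} \<inter> ?E. h y \<noteq> 0 \<longrightarrow> (f \<circ> grass_pt) y = g y / h y"
        using bspec[OF f[unfolded mem_regf_echelon_space] z(3)] by (elim exE bexE conjE)
      obtain d F where F: "F \<in> hom_polys S d" "\<forall>z\<in>cell_pts q k. F (plucker k n (echelon_matrix q z)) = g z"
        using funalg_homogenize[OF gh(1)] by blast
      obtain e G where G: "G \<in> hom_polys S e" "\<forall>z\<in>cell_pts q k. G (plucker k n (echelon_matrix q z)) = h z"
        using funalg_homogenize[OF gh(2)] by blast
      \<comment> \<open>Numerator and denominator come with unrelated degrees; powers of the
        coordinate at \<open>pivots\<close> bring both to \<open>d + e\<close> without changing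
        their values on echelon matrices.\<close>
      let ?F = "\<lambda>v. F v * v pivots ^ e" and ?G = "\<lambda>v. v pivots ^ d * G v"
      have F': "?F \<in> hom_polys S (d + e)" and G': "?G \<in> hom_polys S (d + e)"
        using hom_polys_mult[OF F(1) hom_polys_pivot_power] hom_polys_mult[OF hom_polys_pivot_power G(1)] by auto
      have eqs: "?F (plucker k n (echelon_matrix q y)) = g y" "?G (plucker k n (echelon_matrix q y)) = h y" if "y \<in> ?E" for y
        using F(2) G(2) E[OF that] plucker_echelon_pivots[OF E[OF that]] by auto
      let ?U = "{x \<in> proj_pts S. \<forall>v\<in>x. ?G v \<noteq> 0}"
      have U: "openin (ftop (proj_space S)) ?U" by (rule openin_proj_basic[OF G'])
      let ?r = "\<lambda>x. ?F (rep x) / ?G (rep x)"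
      have "?r \<in> regf (proj_space S) ?U" unfolding mem_regf_proj_space
      proof (rule ballI, rule exI[of _ "d + e"], rule bexI[OF _ F'], rule bexI[OF _ G'], intro conjI ballI impI)
        fix y v assume y: "y \<in> ?U" "v \<in> y" "?G v \<noteq> 0"
        then obtain u where "y = pt_class u" by (auto elim!: proj_ptsE)
        then have "y = pt_class v" using mem_pt_class_eq y(2) by blast
        then show "?r y = ?F v / ?G v" using hom_polys_ratio[OF F' G' rep_pt_class] by simp
      qed auto
      moreover have "\<forall>v\<in>grass_pt z. ?G v \<noteq> 0"
        using gh(3) unfolding grass_pt_nonzero_iff[OF G'] eqs(2)[OF z(1)] .
      then have "x \<in> ?U" unfolding z(2) using grass_pt_proj[OF E[OF z(1)]] by blast
      moreover have "f y = ?r y" if y: "y \<in> ?U \<inter> W" for y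
      proof -
        obtain z' where z': "z' \<in> ?E" "y = grass_pt z'" using y W' by blast
        have "\<forall>v\<in>grass_pt z'. ?G v \<noteq> 0" using y unfolding z'(2) by blast
        then have "h z' \<noteq> 0" unfolding grass_pt_nonzero_iff[OF G'] eqs(2)[OF z'(1)] .
        moreover have "z' \<in> {z \<in> ?E. grass_pt z \<in> W} \<inter> ?E" using z' y by blast
        ultimately have "f y = g z' / h z'" using bspec[OF gh(4), of z'] z'(2) by simp
        also have "\<dots> = ?F (plucker k n (echelon_matrix q z')) / ?G (plucker k n (echelon_matrix q z'))"
          using eqs[OF z'(1)] by simp
        also have "\<dots> = ?r y"
          unfolding z'(2) grass_pt_def by (rule hom_polys_ratio[OF F' G' rep_pt_class, symmetric])
        finally show ?thesis .
      qed
      ultimately show "\<exists>U g. openin (ftop (proj_space S)) U \<and> x \<in> U \<and> g \<in> regf (proj_space S) U \<and> (\<forall>y\<in>U \<inter> W. f y = g y)"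
        using U by blast
    qed
  qed
  show ?thesis unfolding is_quotient_def
  proof (intro conjI allI impI)
    show "grass_pt ` pts (echelon_space q k) = pts ss" unfolding pts_ss by simp
    fix W
    show "openin (ftop ss) W = (W \<subseteq> pts ss \<and> openin (ftop (echelon_space q k)) {z \<in> pts (echelon_space q k). grass_pt z \<in> W})"
      using open_iff[of W] openin_subset[of "ftop ss" W] unfolding pts_ss by auto
    fix f assume "openin (ftop ss) W"
    then show "(f \<in> regf ss W) = (f \<circ> grass_pt \<in> regf (echelon_space q k) {z \<in> pts (echelon_space q k). grass_pt z \<in> W})"
      using reg_iff by simp
  qed
qed

section \<open>Torus orbits and the points of the quotient\<close>

lemma diag_act_grass_pt:
  assumes "\<And>b. a b \<noteq> 0"
  shows "diag_act k n (\<lambda>i. a (i div q)) ` grass_pt z = grass_pt (torus_act q a z)"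
proof -
  \<comment> \<open>The factor of column \<open>j\<close> is the scalar at its pivot, which
    \<open>torus_act\<close> divides out; on Pluecker coordinates these factors amount to one common
    scalar.\<close>
  have "a (i div q) * echelon_matrix q z i j = echelon_matrix q (torus_act q a z) i j * a (Suc j)" for i j
    using assms q by (simp add: echelon_matrix_def torus_act_def del: mult_Suc)
  then have "plucker k n (\<lambda>i j. a (i div q) * echelon_matrix q z i j) =
      plucker k n (\<lambda>i j. echelon_matrix q (torus_act q a z) i j * a (Suc j))" by simp
  also have "\<dots> = (\<lambda>I. (\<Prod>j<k. a (Suc j)) * plucker k n (echelon_matrix q (torus_act q a z)) I)"
    by (rule plucker_scale) (rule minor_scale_cols)
  finally show ?thesis unfolding grass_pt_def image_diag_act diag_act_plucker
    using assms by (intro pt_class_scale[of "\<Prod>j<k. a (Suc j)"]) auto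
qed

definition torus_orbit :: "(nat \<Rightarrow> nat \<Rightarrow> complex) \<Rightarrow> (nat \<Rightarrow> nat \<Rightarrow> complex) set" where
  "torus_orbit z = {torus_act q a z | a. \<forall>b. a b \<noteq> 0}"

text \<open>Any nonzero tuple can be multiplied by an \<open>n\<close>-th root of its inverse
  determinant to land in \<open>block_torus\<close>, and a common factor does not affect
  \<open>torus_act\<close>.\<close>

lemma orbit_grass_pt: "{h ` grass_pt z | h. h \<in> H} = grass_pt ` torus_orbit z"
proof (intro subset_antisym subsetI)
  fix x assume "x \<in> {h ` grass_pt z | h. h \<in> H}"
  then obtain a where "a \<in> block_torus q n" "x = diag_act k n (\<lambda>i. a (i div q)) ` grass_pt z" unfolding H_eq by blast
  then have "x = grass_pt (torus_act q a z)" "\<forall>b. a b \<noteq> 0" using diag_act_grass_pt by (auto simp: block_torus_def)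
  then show "x \<in> grass_pt ` torus_orbit z" unfolding torus_orbit_def by blast
next
  fix x assume "x \<in> grass_pt ` torus_orbit z"
  then obtain a where a: "x = grass_pt (torus_act q a z)" "\<And>b. a b \<noteq> 0" unfolding torus_orbit_def by blast
  obtain c where c: "c \<noteq> 0" "c ^ n = inverse (\<Prod>i<n. a (i div q))"
    using complex_root_exists[OF n(2), of "inverse (\<Prod>i<n. a (i div q))"] a(2) by auto
  let ?a = "\<lambda>b. c * a b"
  have "?a \<in> block_torus q n" unfolding block_torus_def using c a(2) by (simp add: prod.distrib)
  moreover have "torus_act q ?a z = torus_act q a z" unfolding torus_act_def using c(1) by (simp add: fun_eq_iff)
  then have "x = diag_act k n (\<lambda>i. ?a (i div q)) ` grass_pt z" unfolding a(1) using diag_act_grass_pt[of ?a z] a(2) c(1) by simp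
  moreover have "diag_act k n (\<lambda>i. ?a (i div q)) \<in> H" unfolding H_eq
    by (intro CollectI exI[of _ ?a] conjI refl calculation(1))
  ultimately show "x \<in> {h ` grass_pt z | h. h \<in> H}"
    by (intro CollectI exI[of _ "diag_act k n (\<lambda>i. ?a (i div q))"] conjI)
qed

lemma torus_orbit_echelon: "z \<in> echelon_pts q k \<Longrightarrow> torus_orbit z \<subseteq> echelon_pts q k"
  unfolding torus_orbit_def using torus_act_echelon_pts by blast

lemma torus_orbit_self: "z \<in> torus_orbit z"
  unfolding torus_orbit_def using torus_act_one[of q z] by (intro CollectI exI[of _ "\<lambda>_. 1"]) simp

lemma torus_orbit_eq:
  assumes "w \<in> torus_orbit z"
  shows "torus_orbit w = torus_orbit z"
proof -
  obtain a where a: "w = torus_act q a z" "\<And>b. a b \<noteq> 0" using assms unfolding torus_orbit_def by blast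
  show ?thesis
  proof (intro subset_antisym subsetI)
    fix y assume "y \<in> torus_orbit w"
    then obtain b where "y = torus_act q b w" "\<And>i. b i \<noteq> 0" unfolding torus_orbit_def by blast
    then show "y \<in> torus_orbit z" unfolding torus_orbit_def a(1) torus_act_torus_act using a(2)
      by (intro CollectI exI[of _ "\<lambda>i. b i * a i"]) auto
  next
    fix y assume "y \<in> torus_orbit z"
    then obtain b where b: "y = torus_act q b z" "\<And>i. b i \<noteq> 0" unfolding torus_orbit_def by blast
    have "y = torus_act q (\<lambda>i. b i / a i) w" unfolding a(1) torus_act_torus_act b(1) using a(2) by simp
    then show "y \<in> torus_orbit w" unfolding torus_orbit_def using a(2) b(2)
      by (intro CollectI exI[of _ "\<lambda>i. b i / a i"]) auto
  qed
qed

text \<open>The normal forms are invariant regular functions on the charts that separate orbits.\<close>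

lemma openin_orbit_complement:
  assumes "z \<in> echelon_pts q k"
  shows "openin (ftop (echelon_space q k)) (echelon_pts q k - torus_orbit z)"
proof (rule openin_subopen[THEN iffD2], rule ballI)
  interpret function_sheaf "echelon_space q k" by (rule function_sheaf_echelon_space)
  fix y assume y: "y \<in> echelon_pts q k - torus_orbit z"
  obtain f where f: "is_chart q k f" "y \<in> chart_dom q k f" using chart_exists y by blast
  \<comment> \<open>Charts are unions of orbits. If the chart around \<open>y\<close> misses
    \<open>z\<close>, it misses the orbit of \<open>z\<close>; otherwise some entry of the normal
    form takes different values at \<open>y\<close> and \<open>z\<close>.\<close>
  show "\<exists>T. openin (ftop (echelon_space q k)) T \<and> y \<in> T \<and> T \<subseteq> echelon_pts q k - torus_orbit z"
  proof (cases "z \<in> chart_dom q k f")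
    case False
    have "chart_dom q k f \<inter> torus_orbit z = {}"
    proof (rule ccontr)
      assume "chart_dom q k f \<inter> torus_orbit z \<noteq> {}"
      then obtain w where w: "w \<in> chart_dom q k f" "w \<in> torus_orbit z" by blast
      then have "z \<in> torus_orbit w" using torus_orbit_eq[OF w(2)] torus_orbit_self by simp
      then show False using False chart_dom_torus_act[OF w(1)] unfolding torus_orbit_def by blast
    qed
    then show ?thesis using openin_chart_dom[of q k f] f(2) unfolding chart_dom_def
      by (intro exI[of _ "chart_dom q k f"]) (auto simp: chart_dom_def)
  next
    case True
    have nf_orbit: "normal_form q f w \<in> torus_orbit w" if w: "w \<in> chart_dom q k f" for w
    proof -
      have "\<forall>b. (if b \<le> k then inverse (weight q f w b) else 1) \<noteq> 0" using weight_nonzero[OF f(1) w] by simp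
      then show ?thesis unfolding normal_form_eq_torus_act[OF f(1) w] torus_orbit_def by blast
    qed
    have "normal_form q f y \<noteq> normal_form q f z"
    proof
      assume eq: "normal_form q f y = normal_form q f z"
      have "torus_orbit y = torus_orbit z"
        using torus_orbit_eq[OF nf_orbit[OF f(2)]] torus_orbit_eq[OF nf_orbit[OF True]] eq by simp
      then show False using torus_orbit_self[of y] y by simp
    qed
    then obtain j p where jp: "normal_form q f y j p \<noteq> normal_form q f z j p" by (auto simp: fun_eq_iff)
    let ?g = "\<lambda>w. normal_form q f w j p + (- normal_form q f z j p)"
    let ?T = "{w \<in> chart_dom q k f. ?g w \<noteq> 0}"
    have T: "openin (ftop (echelon_space q k)) ?T"
      by (intro open_nonzero regf_add regf_const normal_form_regf f(1) openin_chart_dom)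
    have "w \<notin> torus_orbit z" if w: "w \<in> ?T" for w
    proof
      assume "w \<in> torus_orbit z"
      then obtain a where "\<And>b. a b \<noteq> 0" "w = torus_act q a z" unfolding torus_orbit_def by blast
      then show False using w normal_form_torus_act[OF f(1) assms] by simp
    qed
    then have "?T \<subseteq> echelon_pts q k - torus_orbit z" unfolding chart_dom_def by blast
    then show ?thesis using T f(2) jp by (intro exI[of _ ?T]) auto
  qed
qed

text \<open>All orbits are closed in the semistable locus, so the closures of two orbits meet only
  if the orbits coincide.\<close>

lemma git_class_grass_pt:
  assumes z: "z \<in> echelon_pts q k"
  shows "git_class S X H n (grass_pt z) = grass_pt ` torus_orbit z"
proof -
  let ?E = "echelon_pts q k"
  have inj: "inj_on grass_pt ?E" using grass_pt_inj by (rule inj_on_subset) (use echelon_pts_iff in auto)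
  have closed: "ftop ss closure_of (grass_pt ` torus_orbit w) = grass_pt ` torus_orbit w" if w: "w \<in> ?E" for w
  proof (rule closure_of_closedin)
    have sub: "grass_pt ` torus_orbit w \<subseteq> pts ss" unfolding pts_ss using torus_orbit_echelon[OF w] by blast
    let ?W = "pts ss - grass_pt ` torus_orbit w"
    have "{y \<in> pts (echelon_space q k). grass_pt y \<in> ?W} = ?E - torus_orbit w"
      unfolding pts_ss using torus_orbit_echelon[OF w] inj by (auto simp: inj_on_def)
    then have "openin (ftop ss) ?W"
      unfolding is_quotient_openin[OF is_quotient_grass_pt, of ?W] using openin_orbit_complement[OF w] by auto
    then show "closedin (ftop ss) (grass_pt ` torus_orbit w)" unfolding closedin_def using sub by blast
  qed
  show ?thesis
  proof (intro subset_antisym subsetI)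
    fix y assume y: "y \<in> git_class S X H n (grass_pt z)"
    then obtain w where w: "w \<in> ?E" "y = grass_pt w" unfolding git_class_def semistable_eq by blast
    have "grass_pt ` torus_orbit z \<inter> grass_pt ` torus_orbit w \<noteq> {}"
    proof -
      have "ftop ss closure_of {h ` grass_pt z | h. h \<in> H} \<inter> ftop ss closure_of {h ` y | h. h \<in> H} \<noteq> {}"
        using y unfolding git_class_def mem_Collect_eq by (rule conjunct2)
      then show ?thesis unfolding w(2) orbit_grass_pt closed[OF z] closed[OF w(1)] .
    qed
    then obtain u u' where u: "u \<in> torus_orbit z" "u' \<in> torus_orbit w" "grass_pt u = grass_pt u'" by blast
    have "u = u'" using inj u torus_orbit_echelon[OF z] torus_orbit_echelon[OF w(1)] unfolding inj_on_def by blast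
    then have "torus_orbit w = torus_orbit z" using torus_orbit_eq u by metis
    then show "y \<in> grass_pt ` torus_orbit z" unfolding w(2) using torus_orbit_self[of w] by blast
  next
    fix y assume "y \<in> grass_pt ` torus_orbit z"
    then obtain w where w: "w \<in> torus_orbit z" "y = grass_pt w" by blast
    have wE: "w \<in> ?E" using w torus_orbit_echelon[OF z] by blast
    have ne: "grass_pt ` torus_orbit z \<noteq> {}" using torus_orbit_self by blast
    show "y \<in> git_class S X H n (grass_pt z)"
      unfolding git_class_def semistable_eq w(2)
    proof (intro CollectI conjI imageI wE)
      show "ftop ss closure_of {h ` grass_pt z | h. h \<in> H} \<inter> ftop ss closure_of {h ` grass_pt w | h. h \<in> H} \<noteq> {}"
        unfolding orbit_grass_pt closed[OF z] closed[OF wE] torus_orbit_eq[OF w(1)] Int_absorb by (rule ne)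
    qed
  qed
qed

lemma torus_quotient_Y: "torus_quotient q k (Y q k) (git_class S X H n \<circ> grass_pt)"
  unfolding torus_quotient_def
proof (intro conjI ballI)
  have Y: "Y q k = quotient_fspace ss (git_class S X H n)"
    using k unfolding Y_def git_quotient_def H_def by simp
  show "is_quotient (echelon_space q k) (Y q k) (git_class S X H n \<circ> grass_pt)"
    unfolding Y by (rule is_quotient_comp[OF is_quotient_grass_pt is_quotient_quotient_fspace])
  fix z z' assume z: "z \<in> echelon_pts q k" "z' \<in> echelon_pts q k"
  have inj: "inj_on grass_pt (echelon_pts q k)" using grass_pt_inj by (rule inj_on_subset) (use echelon_pts_iff in auto)
  have "(git_class S X H n \<circ> grass_pt) z = (git_class S X H n \<circ> grass_pt) z' \<longleftrightarrow> grass_pt ` torus_orbit z = grass_pt ` torus_orbit z'"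
    using git_class_grass_pt z by simp
  also have "\<dots> \<longleftrightarrow> torus_orbit z = torus_orbit z'"
    using inj_on_image_eq_iff[OF inj torus_orbit_echelon[OF z(1)] torus_orbit_echelon[OF z(2)]] .
  also have "\<dots> \<longleftrightarrow> z' \<in> torus_orbit z" using torus_orbit_eq torus_orbit_self by blast
  also have "\<dots> \<longleftrightarrow> (\<exists>a. (\<forall>b. a b \<noteq> 0) \<and> z' = torus_act q a z)" unfolding torus_orbit_def by blast
  finally show "(git_class S X H n \<circ> grass_pt) z = (git_class S X H n \<circ> grass_pt) z' \<longleftrightarrow>
    (\<exists>a. (\<forall>b. a b \<noteq> 0) \<and> z' = torus_act q a z)" .
qed

end

text \<open>Without rows the echelon space is a single point, so the base of the tower satisfies the
  same interface as the other stages.\<close>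

lemma torus_quotient_Y0: "torus_quotient q 0 (Y q 0) (\<lambda>_. {})"
proof -
  let ?Z = "echelon_space q 0"
  interpret function_sheaf ?Z by (rule function_sheaf_echelon_space)
  have E: "echelon_pts q 0 = {\<lambda>_ _. 0}" unfolding echelon_pts_def by (auto simp: fun_eq_iff)
  have Y: "Y q 0 = point_fspace {}" unfolding Y_def by simp
  have op: "openin (ftop ?Z) {z \<in> pts ?Z. {} \<in> W}" for W :: "'a set set"
    by (cases "{} \<in> W") (use openin_topspace[of "ftop ?Z"] in auto)
  have reg: "(\<lambda>z. c) \<in> regf ?Z {z \<in> pts ?Z. {} \<in> W}" for c and W :: "'a set set" by (rule regf_const[OF op])
  have act: "torus_act q (\<lambda>_. 1) z = z" for z by (rule torus_act_one)
  show ?thesis unfolding torus_quotient_def is_quotient_def Y point_fspace_def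
    using op reg act E by (auto simp: comp_def intro!: exI[of _ "\<lambda>_. 1"])
qed

theorem theorem1p3:
  fixes r q :: nat
  assumes "r \<ge> 2" and "q \<ge> 2"
  shows "\<exists>\<phi>. (\<forall>k\<in>{1..r}. fmorphism (Y q k) (Y q (k - 1)) (\<phi> k)) \<and>
             generalized_bott_tower r (Y q) \<phi>"
proof -
  have quot: "\<exists>\<pi>. torus_quotient q k (Y q k) \<pi>" for k
  proof (cases "k = 0")
    case True
    then show ?thesis using torus_quotient_Y0 by blast
  next
    case False
    then interpret tower_params q k using assms(2) by unfold_locales auto
    show ?thesis using torus_quotient_Y by blast
  qed
  let ?stage = "\<lambda>k \<phi>. fmorphism (Y q k) (Y q (k - 1)) \<phi> \<and>
     (\<exists>n\<ge>1. \<exists>L :: nat \<Rightarrow> ((nat set \<Rightarrow> complex) set set set, (nat set \<Rightarrow> complex) set set) bundle_data.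
        (\<forall>a\<le>n. line_bundle (Y q (k - 1)) (L a)) \<and> trivial_line_bundle (Y q (k - 1)) (L 0) \<and>
        isomorphic_over \<phi> pbundle_proj (Y q k) (pbundle (Y q (k - 1)) (Suc n) (line_bundle_sum n L)))"
  have "\<exists>\<phi>. ?stage k \<phi>" if k: "k \<in> {1..r}" for k
  proof -
    obtain m where m: "k = Suc m" using k by (cases k) auto
    obtain \<pi> \<pi>' where "torus_quotient q m (Y q m) \<pi>" "torus_quotient q (Suc m) (Y q (Suc m)) \<pi>'"
      using quot by blast
    from torus_quotient_tower[OF assms(2) this] show ?thesis unfolding m diff_Suc_1 .
  qed
  then obtain \<phi> where \<phi>: "\<forall>k\<in>{1..r}. ?stage k (\<phi> k)" by metis
  moreover have "Y q 0 = point_fspace {}" by (simp add: Y_def)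
  ultimately have "generalized_bott_tower r (Y q) \<phi>"
    unfolding generalized_bott_tower_def by blast
  then show ?thesis using \<phi> by blast
qed

end
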